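(* Let $G$ be a countable group and let $\Theta:G\to\mathcal{E}^\omega$ be a diffuse sofic representation. Then $[\Theta]_{\mathcal{E}}$ is an extreme point in $Sof(G,\mathcal{E}^\omega)$ if and only if the action $\gamma(\Theta)$ of $\Theta'\cap\mathcal{E}^\omega$ on $\Theta'\cap A^\omega$ is ergodic.
   Context: $\omega$ is a free ultrafilter on $\mathbb{N}$. $M_n=M_n(\mathbb{C})$ has normalised trace $Tr$, $D_n\subset M_n$ is the subalgebra of diagonal matrices, $P_n\subset M_n$ the group of permutation matrices; rows and columns are indexed by $\{0,\dots,n-1\}$, and $(x\otimes 1_r)(ir+s,jr+t)=x(i,j)\delta_{s,t}$. $\Pi_{k\to\omega}M_{n_k}$ is the tracial ultraproduct (bounded sequences modulo $\lim_{k\to\omega}\|x_k\|_2=0$); $\Pi_{k\to\omega}P_{n_k}$ and $\Pi_{k\to\omega}D_{n_k}$ are its subsets of elements represented by sequences from $P_{n_k}$, $D_{n_k}$. Let $\mu$ be Lebesgue measure on $[0,1]$ and $E=\{(x,y)\in[0,1]^2:x-y\in\mathbb{Q}\}$. $M(E)$ is the Feldman–Moore von Neumann algebra of $E$ (isomorphic to the hyperfinite $II_1$ factor), whose elements are functions $f:E\to\mathbb{C}$ (multipliers) with $f\cdot g(x,z)=\sum_{yEx}f(x,y)g(y,z)$, $f^*(x,y)=\overline{f(y,x)}$, $Tr(f)=\int f(x,x)\,d\mu(x)$. $A\subset M(E)$ is the Cartan subalgebra of functions supported on the diagonal ($A\simeq L^\infty([0,1],\mu)$). $\mathcal{E}\subset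 M(E)$ is the group of $\{0,1\}$-valued functions with exactly one entry $1$ on each row and column (a.e.), i.e. the image of the full group $[E]$ under $u\mapsto\chi_{graph(u^{-1})}$. $A^\omega$ and $\mathcal{E}^\omega$ denote the subsets of the tracial ultrapower $M(E)^\omega$ of elements represented by sequences from $A$, resp. $\mathcal{E}$. Define $\Psi_n:M_n\to M(E)$ by $\Psi_n(x)(s,t)=x([ns],[nt])$ if $\{ns\}=\{nt\}$ and $0$ otherwise (integer and fractional parts), a trace preserving embedding; $\Psi:\Pi_{k\to\omega}M_{n_k}\to M(E)^\omega$ is $\Psi(\Pi_{k\to\omega}x_k)=\Pi_{k\to\omega}\Psi_{n_k}(x_k)$. A diffuse sofic representation of $G$ is a group homomorphism $\Theta:G\to\mathcal{E}^\omega$ with $Tr(\Theta(g))=0$ for $g\neq e$. $Sof(G,\mathcal{E}^\omega)$ is the set of diffuse sofic representations modulo conjugation by elements of $\mathcal{E}^\omega$; $[\Theta]_{\mathcal{E}}$ is the class of $\Theta$. For each $\lambda\in[0,1]$ fix sequences $(r_k),(s_k)$ of positive integers with $\lim_{k\to\omega}r_k/(r_k+s_k)=\lambda$. For $u,v\in\mathcal{E}^\omega$ choose (this is always possible) a sequence $(n_k)$ and $u_1,v_1\in\Pi_{k\to\omega}P_{n_k}$ with $\Psi(u_1)=u$, $\Psi(v_1)=v$, and set $\Phi_\lambda(u\oplus v)=\Psi[(u_1\otimes 1_{r_k})\oplus(v_1\otimes 1_{s_k})]$ (block-diagonal sum, in $\Pi_{k\to\omega}P_{(r_k+s_k)n_k}$).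 This is a homomorphism $\Phi_\lambda:\mathcal{E}^\omega\oplus\mathcal{E}^\omega\to\mathcal{E}^\omega$. Convex combinations in $Sof(G,\mathcal{E}^\omega)$ are defined by $\lambda[\Theta_1]_{\mathcal{E}}+(1-\lambda)[\Theta_2]_{\mathcal{E}}=[\Phi_\lambda(\Theta_1\oplus\Theta_2)]_{\mathcal{E}}$; this does not depend on the choices. $[\Theta]_{\mathcal{E}}$ is an extreme point if $[\Theta]_{\mathcal{E}}=\lambda[\Theta_1]_{\mathcal{E}}+(1-\lambda)[\Theta_2]_{\mathcal{E}}$ with $\lambda\in(0,1)$ implies $[\Theta_1]_{\mathcal{E}}=[\Theta_2]_{\mathcal{E}}=[\Theta]_{\mathcal{E}}$. $\Theta'\cap A^\omega$ and $\Theta'\cap\mathcal{E}^\omega$ are the sets of elements of $A^\omega$, resp. $\mathcal{E}^\omega$, commuting with all $\Theta(g)$, $g\in G$. $\gamma(\Theta)$ is the action $\gamma(u)(a)=uau^*$ of the group $\Theta'\cap\mathcal{E}^\omega$ on the von Neumann algebra $\Theta'\cap A^\omega$; it is ergodic if its only fixed elements are the scalars. *)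

theory Defs
  imports "HOL-Analysis.Analysis" "HOL-Algebra.Group" "Jordan_Normal_Form.Matrix"
begin

hide_const (open) Finite_Cartesian_Product.vec Finite_Cartesian_Product.mat

section \<open>The algebra of the equivalence relation\<close>

definition free_ultrafilter :: "nat filter \<Rightarrow> bool" where
  "free_ultrafilter \<omega> \<longleftrightarrow>
     \<omega> \<noteq> bot \<and>
     (\<forall>P. eventually P \<omega> \<or> eventually (\<lambda>k. \<not> P k) \<omega>) \<and>
     (\<forall>m. eventually (\<lambda>k. k \<noteq> m) \<omega>)"

definition relE :: "(real \<times> real) set" where
  "relE = {(x, y). x \<in> {0..1} \<and> y \<in> {0..1} \<and> x - y \<in> \<rat>}"

definition orbit :: "real \<Rightarrow> real set" where
  "orbit x = relE `` {x}"

text \<open>Functions on \<open>relE\<close> are functions on the plane that vanish off \<open>relE\<close>.\<close>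

type_synonym kernel = "real \<times> real \<Rightarrow> complex"

definition kmult :: "kernel \<Rightarrow> kernel \<Rightarrow> kernel" where
  "kmult f g = (\<lambda>(x, z). \<Sum>\<^sub>\<infinity>y\<in>orbit x. f (x, y) * g (y, z))"

definition kstar :: "kernel \<Rightarrow> kernel" where
  "kstar f = (\<lambda>(x, y). cnj (f (y, x)))"

definition kone :: kernel where
  "kone = (\<lambda>(x, y). if x = y \<and> x \<in> {0..1} then 1 else 0)"

definition kTr :: "kernel \<Rightarrow> complex" where
  "kTr f = integral\<^sup>L (lebesgue_on {0..1}) (\<lambda>x. f (x, x))"

definition knorm2 :: "kernel \<Rightarrow> real" where
  "knorm2 f = sqrt (Re (kTr (kmult (kstar f) f)))"

text \<open>The squared norm of \<open>L\<^sup>2(relE, \<nu>)\<close>, where \<open>\<nu>\<close> is the measure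
  \<open>C \<mapsto> \<integral> card {y. (x, y) \<in> C} d\<mu>(x)\<close>. The set \<open>relE\<close> is a Lebesgue null set of the
  plane, so measurability of kernels always refers to the Borel sets of the plane.\<close>

definition L2sq :: "kernel \<Rightarrow> ennreal" where
  "L2sq f = (\<integral>\<^sup>+x. (\<integral>\<^sup>+y. ennreal ((cmod (f (x, y)))\<^sup>2) \<partial>count_space (orbit x))
               \<partial>lebesgue_on {0..1})"

definition L2E :: "kernel set" where
  "L2E = {f. f \<in> borel_measurable borel \<and> (\<forall>p. p \<notin> relE \<longrightarrow> f p = 0) \<and> L2sq f < \<infinity>}"

definition opnorm_le :: "kernel \<Rightarrow> real \<Rightarrow> bool" where
  "opnorm_le f C \<longleftrightarrow> 0 \<le> C \<and> (\<forall>g\<in>L2E. L2sq (kmult f g) \<le> ennreal (C\<^sup>2) * L2sq g)"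

text \<open>The Feldman--Moore algebra consists of the square integrable kernels whose left
  convolution operator on \<open>L\<^sup>2(relE, \<nu>)\<close> is bounded; an operator \<open>T\<close> corresponds to the kernel
  \<open>T kone\<close>. Kernels are not identified when they agree almost everywhere; this identification
  is part of the ultrapower relation below.\<close>

definition ME :: "kernel set" where
  "ME = {f \<in> L2E. \<exists>C. opnorm_le f C}"

definition cartanA :: "kernel set" where
  "cartanA = {f \<in> ME. \<forall>x y. x \<noteq> y \<longrightarrow> f (x, y) = 0}"

definition fullE :: "kernel set" where
  "fullE = {f \<in> ME. range f \<subseteq> {0, 1} \<and>
     (AE x in lebesgue_on {0..1}. \<exists>!y. f (x, y) = 1) \<and>
     (AE y in lebesgue_on {0..1}. \<exists>!x. f (x, y) = 1)}"

section \<open>The tracial ultrapower\<close>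

definition bdd_seqs :: "(nat \<Rightarrow> kernel) set" where
  "bdd_seqs = {x. (\<forall>k. x k \<in> ME) \<and> (\<exists>C. \<forall>k. opnorm_le (x k) C)}"

definition urel :: "nat filter \<Rightarrow> ((nat \<Rightarrow> kernel) \<times> (nat \<Rightarrow> kernel)) set" where
  "urel \<omega> = {(x, y). x \<in> bdd_seqs \<and> y \<in> bdd_seqs \<and>
     ((\<lambda>k. knorm2 (\<lambda>p. x k p - y k p)) \<longlongrightarrow> 0) \<omega>}"

type_synonym uelem = "(nat \<Rightarrow> kernel) set"

definition uclass :: "nat filter \<Rightarrow> (nat \<Rightarrow> kernel) \<Rightarrow> uelem" where
  "uclass \<omega> x = urel \<omega> `` {x}"

text \<open>The multiplicative structure of \<open>M(E)\<^sup>\<omega>\<close>.\<close>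

definition MEu :: "nat filter \<Rightarrow> uelem monoid" where
  "MEu \<omega> = \<lparr>carrier = bdd_seqs // urel \<omega>,
            monoid.mult = (\<lambda>X Y. \<Union>x\<in>X. \<Union>y\<in>Y. uclass \<omega> (\<lambda>k. kmult (x k) (y k))),
            one = uclass \<omega> (\<lambda>k. kone)\<rparr>"

definition ustar :: "nat filter \<Rightarrow> uelem \<Rightarrow> uelem" where
  "ustar \<omega> X = (\<Union>x\<in>X. uclass \<omega> (\<lambda>k. kstar (x k)))"

definition uTr :: "nat filter \<Rightarrow> uelem \<Rightarrow> complex" where
  "uTr \<omega> X = (THE t. \<exists>x\<in>X. ((\<lambda>k. kTr (x k)) \<longlongrightarrow> t) \<omega>)"

definition uscalar :: "nat filter \<Rightarrow> complex \<Rightarrow> uelem" where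
  "uscalar \<omega> c = uclass \<omega> (\<lambda>k p. c * kone p)"

definition repr_by :: "nat filter \<Rightarrow> kernel set \<Rightarrow> uelem set" where
  "repr_by \<omega> S = {uclass \<omega> x |x. x \<in> bdd_seqs \<and> (\<forall>k. x k \<in> S)}"

definition Au :: "nat filter \<Rightarrow> uelem set" where
  "Au \<omega> = repr_by \<omega> cartanA"

definition Eu :: "nat filter \<Rightarrow> uelem monoid" where
  "Eu \<omega> = (MEu \<omega>)\<lparr>carrier := repr_by \<omega> fullE\<rparr>"

section \<open>Matrices\<close>

definition perm_matrices :: "nat \<Rightarrow> complex mat set" where
  "perm_matrices n =
     {mat n n (\<lambda>(i, j). if i = \<pi> j then 1 else 0) |\<pi>. bij_betw \<pi> {..<n} {..<n}}"

definition tensor_one :: "complex mat \<Rightarrow> nat \<Rightarrow> complex mat" where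
  "tensor_one x r = mat (dim_row x * r) (dim_col x * r)
     (\<lambda>(i, j). if i mod r = j mod r then x $$ (i div r, j div r) else 0)"

definition block_sum :: "complex mat \<Rightarrow> complex mat \<Rightarrow> complex mat" where
  "block_sum x y =
     four_block_mat x (0\<^sub>m (dim_row x) (dim_col y)) (0\<^sub>m (dim_row y) (dim_col x)) y"

text \<open>The endpoint 1 would give the index \<open>n\<close>, which is out of range; the kernel is set to 0
  there, which only concerns a null set.\<close>

definition Psi_n :: "nat \<Rightarrow> complex mat \<Rightarrow> kernel" where
  "Psi_n n x = (\<lambda>(s, t).
     if s \<in> {0..<1} \<and> t \<in> {0..<1} \<and> frac (real n * s) = frac (real n * t)
     then x $$ (nat \<lfloor>real n * s\<rfloor>, nat \<lfloor>real n * t\<rfloor>) else 0)"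

text \<open>\<open>\<Psi>\<close> is given on sequences of matrices that represent elements of the matrix ultraproduct.\<close>

definition Psi :: "nat filter \<Rightarrow> (nat \<Rightarrow> nat) \<Rightarrow> (nat \<Rightarrow> complex mat) \<Rightarrow> uelem" where
  "Psi \<omega> n x = uclass \<omega> (\<lambda>k. Psi_n (n k) (x k))"

section \<open>Diffuse sofic representations and their convex structure\<close>

definition diffuse_sofic :: "nat filter \<Rightarrow> ('g, 'b) monoid_scheme \<Rightarrow> ('g \<Rightarrow> uelem) set" where
  "diffuse_sofic \<omega> G = {\<Theta> \<in> hom G (Eu \<omega>).
     \<forall>g\<in>carrier G. g \<noteq> \<one>\<^bsub>G\<^esub> \<longrightarrow> uTr \<omega> (\<Theta> g) = 0}"

definition ad :: "nat filter \<Rightarrow> uelem \<Rightarrow> uelem \<Rightarrow> uelem" where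
  "ad \<omega> u a = u \<otimes>\<^bsub>MEu \<omega>\<^esub> a \<otimes>\<^bsub>MEu \<omega>\<^esub> ustar \<omega> u"

definition conj_rel ::
  "nat filter \<Rightarrow> ('g, 'b) monoid_scheme \<Rightarrow> (('g \<Rightarrow> uelem) \<times> ('g \<Rightarrow> uelem)) set" where
  "conj_rel \<omega> G = {(\<Theta>, \<Theta>'). \<Theta> \<in> diffuse_sofic \<omega> G \<and> \<Theta>' \<in> diffuse_sofic \<omega> G \<and>
     (\<exists>u\<in>carrier (Eu \<omega>). \<forall>g\<in>carrier G. \<Theta>' g = ad \<omega> u (\<Theta> g))}"

definition Sof :: "nat filter \<Rightarrow> ('g, 'b) monoid_scheme \<Rightarrow> ('g \<Rightarrow> uelem) set set" where
  "Sof \<omega> G = diffuse_sofic \<omega> G // conj_rel \<omega> G"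

definition sof_class ::
  "nat filter \<Rightarrow> ('g, 'b) monoid_scheme \<Rightarrow> ('g \<Rightarrow> uelem) \<Rightarrow> ('g \<Rightarrow> uelem) set" where
  "sof_class \<omega> G \<Theta> = conj_rel \<omega> G `` {\<Theta>}"

text \<open>Sequences \<open>r l\<close>, \<open>s l\<close> of positive integers, fixed for each weight \<open>l\<close>.\<close>

definition weight_seqs ::
  "nat filter \<Rightarrow> (real \<Rightarrow> nat \<Rightarrow> nat) \<Rightarrow> (real \<Rightarrow> nat \<Rightarrow> nat) \<Rightarrow> bool" where
  "weight_seqs \<omega> r s \<longleftrightarrow> (\<forall>l\<in>{0..1}. (\<forall>k. 0 < r l k \<and> 0 < s l k) \<and>
     ((\<lambda>k. real (r l k) / real (r l k + s l k)) \<longlongrightarrow> l) \<omega>)"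

text \<open>The choice of the dimensions \<open>n\<close> and of the lifts \<open>x\<close>, \<open>y\<close> of \<open>u\<close>, \<open>v\<close> to products of
  permutation matrices is made by the choice operator.\<close>

definition Phi ::
  "nat filter \<Rightarrow> (real \<Rightarrow> nat \<Rightarrow> nat) \<Rightarrow> (real \<Rightarrow> nat \<Rightarrow> nat) \<Rightarrow> real \<Rightarrow> uelem \<Rightarrow> uelem \<Rightarrow> uelem"
  where
  "Phi \<omega> r s l u v = (SOME w. \<exists>n x y.
     (\<forall>k. 0 < n k \<and> x k \<in> perm_matrices (n k) \<and> y k \<in> perm_matrices (n k)) \<and>
     Psi \<omega> n x = u \<and> Psi \<omega> n y = v \<and>
     w = Psi \<omega> (\<lambda>k. (r l k + s l k) * n k)
               (\<lambda>k. block_sum (tensor_one (x k) (r l k)) (tensor_one (y k) (s l k))))"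

definition convex_comb ::
  "nat filter \<Rightarrow> ('g, 'b) monoid_scheme \<Rightarrow> (real \<Rightarrow> nat \<Rightarrow> nat) \<Rightarrow> (real \<Rightarrow> nat \<Rightarrow> nat) \<Rightarrow> real \<Rightarrow>
     ('g \<Rightarrow> uelem) set \<Rightarrow> ('g \<Rightarrow> uelem) set \<Rightarrow> ('g \<Rightarrow> uelem) set" where
  "convex_comb \<omega> G r s l C1 C2 =
     (\<Union>\<Theta>1\<in>C1. \<Union>\<Theta>2\<in>C2. sof_class \<omega> G (\<lambda>g. Phi \<omega> r s l (\<Theta>1 g) (\<Theta>2 g)))"

definition extreme_pt ::
  "nat filter \<Rightarrow> ('g, 'b) monoid_scheme \<Rightarrow> (real \<Rightarrow> nat \<Rightarrow> nat) \<Rightarrow> (real \<Rightarrow> nat \<Rightarrow> nat) \<Rightarrow>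
     ('g \<Rightarrow> uelem) set \<Rightarrow> bool" where
  "extreme_pt \<omega> G r s C \<longleftrightarrow> C \<in> Sof \<omega> G \<and>
     (\<forall>l\<in>{0<..<1}. \<forall>C1\<in>Sof \<omega> G. \<forall>C2\<in>Sof \<omega> G.
        C = convex_comb \<omega> G r s l C1 C2 \<longrightarrow> C1 = C \<and> C2 = C)"

section \<open>The commutant action\<close>

definition commutant_in ::
  "nat filter \<Rightarrow> ('g, 'b) monoid_scheme \<Rightarrow> ('g \<Rightarrow> uelem) \<Rightarrow> uelem set \<Rightarrow> uelem set" where
  "commutant_in \<omega> G \<Theta> S =
     {a \<in> S. \<forall>g\<in>carrier G. a \<otimes>\<^bsub>MEu \<omega>\<^esub> \<Theta> g = \<Theta> g \<otimes>\<^bsub>MEu \<omega>\<^esub> a}"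

definition ergodic_action ::
  "nat filter \<Rightarrow> uelem set \<Rightarrow> uelem set \<Rightarrow> (uelem \<Rightarrow> uelem \<Rightarrow> uelem) \<Rightarrow> bool" where
  "ergodic_action \<omega> U N act \<longleftrightarrow>
     (\<forall>a\<in>N. (\<forall>u\<in>U. act u a = a) \<longrightarrow> (\<exists>c. a = uscalar \<omega> c))"

definition gamma_ergodic ::
  "nat filter \<Rightarrow> ('g, 'b) monoid_scheme \<Rightarrow> ('g \<Rightarrow> uelem) \<Rightarrow> bool" where
  "gamma_ergodic \<omega> G \<Theta> \<longleftrightarrow>
     ergodic_action \<omega> (commutant_in \<omega> G \<Theta> (carrier (Eu \<omega>))) (commutant_in \<omega> G \<Theta> (Au \<omega>)) (ad \<omega>)"

end

theory Submission
  imports Defs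
begin

text \<open>The theorem is reduced to a statement about the full group itself. An element of \<open>\<E>\<^sup>\<omega>\<close> is given
  by a sequence of measure preserving bijections of \<open>[0,1)\<close> that move points by rational numbers,
  and an element of \<open>A\<^sup>\<omega>\<close> by a uniformly bounded sequence of Borel functions. All relations between them
  that matter here (equality, multiplicativity, trace zero, commutation, being fixed or scalar) say
  that a sequence of exceptional sets has measure tending to 0 along \<open>\<omega>\<close>; this is the predicate
  \<open>alm\<close>. The dictionary is provided by kernels with at most one entry in every row and column,
  see \<open>mclass_mult\<close>, \<open>mclass_eq_iff\<close>, \<open>kclass_eq_iff\<close>, \<open>fullE_representation\<close>,
  \<open>cartanA_representation\<close> and \<open>Phi_kclass\<close>. In it the convex combination with weight \<open>\<lambda>\<close>
  becomes the direct sum \<open>glue_rep\<close>: at stage \<open>k\<close> the first representation acts on \<open>[0,c\<^sub>k)\<close> and the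
  second one on \<open>[c\<^sub>k,1)\<close>, both rescaled, where \<open>c\<^sub>k\<close> is rational and tends to \<open>\<lambda>\<close>.

  Block permutations, which permute the intervals \<open>[i/N,(i+1)/N)\<close>, are dense in the full group
  (\<open>full_group_block_approx\<close>), so countably many elements of \<open>\<E>\<^sup>\<omega>\<close> are simultaneously represented by
  block permutations (\<open>common_block_representation\<close>). For block permutations the interior of the
  blocks is free room. Collecting the initial parts of all blocks shows that every \<open>\<theta>\<close> is conjugate
  to its own direct sum \<open>\<theta> \<oplus> \<theta>\<close> with any weight (\<open>collect_intertwines\<close>), and applying one
  transformation inside all blocks gives elements that commute with \<open>\<theta>\<close>
  (\<open>inside_blocks_commutes\<close>).

  Ergodic implies extreme (\<open>ergodic_imp_conj_summands\<close>). If \<open>\<theta>\<close> is conjugate to \<open>\<theta>1 \<oplus> \<theta>2\<close>, then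
  the projection onto the first summand and the corresponding projection of \<open>\<theta> \<oplus> \<theta>\<close>
  give two projections of the same trace in the commutant of \<open>\<theta>\<close>. An ergodic action is transitive
  on projections of equal trace (\<open>ergodic_seq_transitive\<close>), which is a saturated version of the
  exhaustion argument for ergodic groups. Hence some element conjugates \<open>\<theta> \<oplus> \<theta>\<close> to \<open>\<theta>1 \<oplus> \<theta>2\<close>
  and respects the summands, so it conjugates \<open>\<theta>\<close> to \<open>\<theta>1\<close> and to \<open>\<theta>2\<close>.

  Extreme implies ergodic (\<open>extreme_imp_ergodic_seq\<close>). An invariant function that is not scalar has an
  invariant level set of trace strictly between 0 and 1. Such a projection splits \<open>\<theta>\<close> as
  \<open>\<theta>1 \<oplus> \<theta>2\<close>. If both summands were conjugate to \<open>\<theta>\<close>, the projection would be carried by a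
  commuting element to the one that cuts every block at the same proportion, and a half turn inside
  all blocks commutes with \<open>\<theta>\<close> and moves the latter (\<open>extreme_zero_one\<close>).\<close>

section \<open>Limits along an ultrafilter\<close>

lemma free_ultrafilter_nontrivial:
  "free_ultrafilter \<omega> \<Longrightarrow> \<omega> \<noteq> bot"
  by (simp add: free_ultrafilter_def)

lemma ultrafilter_cases:
  "free_ultrafilter \<omega> \<Longrightarrow> eventually P \<omega> \<or> eventually (\<lambda>k. \<not> P k) \<omega>"
  by (simp add: free_ultrafilter_def)

lemma free_ultrafilter_le_sequentially:
  assumes "free_ultrafilter \<omega>"
  shows "\<omega> \<le> sequentially"
proof -
  have "eventually (\<lambda>k. k \<ge> m) \<omega>" for m
  proof (induction m)
    case (Suc m)
    moreover have "eventually (\<lambda>k. k \<noteq> m) \<omega>"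
      using assms by (simp add: free_ultrafilter_def)
    ultimately show ?case
      by eventually_elim auto
  qed simp
  then show ?thesis
    by (force simp: le_filter_def eventually_sequentially elim: eventually_mono)
qed

lemma free_ultrafilter_ge:
  "free_ultrafilter \<omega> \<Longrightarrow> eventually (\<lambda>k. m \<le> k) \<omega>"
  using free_ultrafilter_le_sequentially eventually_ge_at_top
  by (auto simp: le_filter_def)

lemma LIMSEQ_imp_ultralimit:
  "free_ultrafilter \<omega> \<Longrightarrow> f \<longlonglongrightarrow> l \<Longrightarrow> (f \<longlongrightarrow> l) \<omega>"
  using free_ultrafilter_le_sequentially tendsto_mono by blast

lemma bounded_has_ultralimit:
  fixes f :: "nat \<Rightarrow> real"
  assumes \<omega>: "free_ultrafilter \<omega>" and f: "\<And>k. \<bar>f k\<bar> \<le> C"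
  obtains l where "(f \<longlongrightarrow> l) \<omega>"
proof -
  have "eventually (\<lambda>x. x \<in> cball 0 C) (filtermap f \<omega>)"
    using f by (simp add: eventually_filtermap)
  moreover have "filtermap f \<omega> \<noteq> bot"
    using \<omega> by (simp add: filtermap_bot_iff free_ultrafilter_def)
  ultimately obtain l where l: "inf (nhds l) (filtermap f \<omega>) \<noteq> bot"
    using compact_cball[of "0::real" C] unfolding compact_filter by blast
  have "filtermap f \<omega> \<le> nhds l"
  proof (rule filter_leI)
    fix P assume P: "eventually P (nhds l)"
    show "eventually P (filtermap f \<omega>)"
    proof (rule ccontr)
      assume "\<not> eventually P (filtermap f \<omega>)"
      then have "eventually (\<lambda>x. \<not> P x) (filtermap f \<omega>)"
        using ultrafilter_cases[OF \<omega>, of "\<lambda>k. P (f k)"] by (simp add: eventually_filtermap)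
      with P have "eventually (\<lambda>x. False) (inf (nhds l) (filtermap f \<omega>))"
        unfolding eventually_inf by (metis (no_types, lifting))
      then show False
        using l by (simp add: eventually_False)
    qed
  qed
  then show ?thesis
    using that by (simp add: filterlim_def)
qed

text \<open>Countable saturation: the point at stage \<open>k\<close> satisfies as many of the first \<open>k\<close>
  conditions as can be satisfied together.\<close>

lemma ultraproduct_saturation:
  assumes \<omega>: "free_ultrafilter \<omega>"
    and sat: "\<And>m. eventually (\<lambda>k. \<exists>y\<in>S. \<forall>j<m. P j k y) \<omega>"
  obtains x where "\<And>k. x k \<in> S" and "\<And>j::nat. eventually (\<lambda>k. P j k (x k)) \<omega>"
proof -
  define good where "good k m \<longleftrightarrow> m \<le> k \<and> (\<exists>y\<in>S. \<forall>j<m. P j k y)" for k m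
  have "\<exists>y. y \<in> S"
    using eventually_happens'[OF free_ultrafilter_nontrivial[OF \<omega>] sat[of 0]] by auto
  then have good0: "good k 0" for k
    by (auto simp: good_def)
  define i where "i k = (GREATEST m. good k m)" for k
  have i: "good k (i k)" for k
    unfolding i_def by (rule GreatestI_nat[where P = "good k" and b = k and k = 0]) (use good0 in \<open>auto simp: good_def\<close>)
  then have "\<exists>y\<in>S. \<forall>j<i k. P j k y" for k
    by (auto simp: good_def)
  then obtain x where x: "\<And>k. x k \<in> S" "\<And>k j. j < i k \<Longrightarrow> P j k (x k)"
    by metis
  have "eventually (\<lambda>k. P j k (x k)) \<omega>" for j
    using sat[of "Suc j"] free_ultrafilter_ge[OF \<omega>, of "Suc j"]
  proof eventually_elim
    case (elim k)
    then have "good k (Suc j)"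
      by (auto simp: good_def)
    then have "Suc j \<le> i k"
      unfolding i_def by (rule Greatest_le_nat[where P = "good k" and b = k]) (auto simp: good_def)
    then show ?case
      by (intro x) auto
  qed
  with x(1) show ?thesis
    by (rule that)
qed

lemma tendsto_squeeze_0:
  fixes f g :: "'a \<Rightarrow> real"
  assumes "(g \<longlongrightarrow> 0) F" "\<And>k. 0 \<le> f k" "\<And>k. f k \<le> g k"
  shows "(f \<longlongrightarrow> 0) F"
  by (rule tendsto_sandwich[OF _ _ tendsto_const assms(1)]) (use assms in auto)

section \<open>Lebesgue measure on the unit interval\<close>

text \<open>Probability measure on all of \<open>\<real>\<close> that lives on \<open>[0,1)\<close>. With it, transformations and Borel sets
  need no restriction to the interval; the endpoint 1 is omitted because it belongs to no block.\<close>

definition leb :: "real measure" where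
  "leb = density lborel (indicator {0..<1})"

lemma sets_leb [measurable_cong, simp]: "sets leb = sets borel"
  by (simp add: leb_def)

lemma space_leb [simp]: "space leb = UNIV"
  by (simp add: leb_def)

lemma emeasure_leb: "A \<in> sets borel \<Longrightarrow> emeasure leb A = emeasure lborel (A \<inter> {0..<1})"
  unfolding leb_def by (subst emeasure_density) (simp_all add: nn_integral_indicator[symmetric] indicator_inter_arith mult.commute)

interpretation leb: finite_measure leb
  by (rule finite_measureI) (simp add: emeasure_leb)

lemma measure_leb_UNIV [simp]: "measure leb UNIV = 1"
  by (simp add: measure_def emeasure_leb)

lemma measure_leb_le_1: "measure leb A \<le> 1"
  by (metis leb.bounded_measure measure_leb_UNIV space_leb)

lemma measure_leb_interval:
  assumes "0 \<le> a" "a \<le> b" "b \<le> 1"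
  shows "measure leb {a..<b} = b - a"
proof -
  have "{a..<b} \<inter> {0..<1} = {a..<b}"
    using assms by auto
  then show ?thesis
    using assms by (simp add: measure_def emeasure_leb)
qed

lemma measure_leb_outside [simp]: "A \<inter> {0..<1} = {} \<Longrightarrow> A \<in> sets borel \<Longrightarrow> measure leb A = 0"
  by (simp add: measure_def emeasure_leb)

section \<open>The full group of the rational translation relation\<close>

text \<open>Total functions that are the identity off \<open>[0,1)\<close>, with equality everywhere rather than almost
  everywhere, so that composition and inversion are literal group operations.\<close>

definition full_group :: "(real \<Rightarrow> real) set" where
  "full_group = {T. T \<in> borel_measurable borel \<and> bij T \<and> (\<forall>x. T x - x \<in> \<rat>) \<and>
     (\<forall>x. x \<notin> {0..<1} \<longrightarrow> T x = x)}"

lemma full_group_borel [measurable_dest]: "T \<in> full_group \<Longrightarrow> T \<in> borel_measurable borel"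
  by (simp add: full_group_def)

lemma full_group_bij: "T \<in> full_group \<Longrightarrow> bij T"
  by (simp add: full_group_def)

lemma full_group_inj: "T \<in> full_group \<Longrightarrow> T x = T y \<longleftrightarrow> x = y"
  using full_group_bij bij_is_inj inj_eq by metis

lemma full_group_rat: "T \<in> full_group \<Longrightarrow> T x - x \<in> \<rat>"
  by (simp add: full_group_def)

lemma full_group_outside: "T \<in> full_group \<Longrightarrow> x \<notin> {0..<1} \<Longrightarrow> T x = x"
  by (simp add: full_group_def)

lemma full_group_unit_iff: "T \<in> full_group \<Longrightarrow> T x \<in> {0..<1} \<longleftrightarrow> x \<in> {0..<1}"
  by (metis full_group_inj full_group_outside)

lemma full_groupI:
  assumes "T \<in> borel_measurable borel" "\<And>x. S (T x) = x" "\<And>x. T (S x) = x"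
    "\<And>x. x \<in> {0..<1} \<Longrightarrow> T x - x \<in> \<rat>" "\<And>x. x \<notin> {0..<1} \<Longrightarrow> T x = x"
  shows "T \<in> full_group"
proof -
  have "bij T"
    by (rule o_bij[of S]) (use assms in auto)
  moreover have "T x - x \<in> \<rat>" for x
    using assms(4,5) by (cases "x \<in> {0..<1}") auto
  ultimately show ?thesis
    using assms by (auto simp: full_group_def)
qed

lemma full_group_id [simp]: "id \<in> full_group" "(\<lambda>x. x) \<in> full_group"
  by (rule full_groupI[where S = id]; simp)+

abbreviation finv :: "(real \<Rightarrow> real) \<Rightarrow> real \<Rightarrow> real" where
  "finv T \<equiv> inv_into UNIV T"

lemma full_group_inv_apply [simp]:
  "T \<in> full_group \<Longrightarrow> finv T (T x) = x" "T \<in> full_group \<Longrightarrow> T (finv T x) = x"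
  by (simp_all add: full_group_bij bij_is_inj bij_is_surj surj_f_inv_f)

lemma full_group_comp: "T \<in> full_group \<Longrightarrow> S \<in> full_group \<Longrightarrow> (\<lambda>x. T (S x)) \<in> full_group"
proof (rule full_groupI[where S = "\<lambda>x. finv S (finv T x)"])
  fix x assume "T \<in> full_group" "S \<in> full_group"
  then have "(T (S x) - S x) + (S x - x) \<in> \<rat>"
    by (intro Rats_add full_group_rat)
  then show "T (S x) - x \<in> \<rat>"
    by simp
qed (auto simp: full_group_outside intro: measurable_compose[OF full_group_borel full_group_borel])

lemma image_full_group_borel:
  assumes T: "T \<in> full_group" and A: "A \<in> sets borel"
  shows "T ` A \<in> sets borel"
proof -
  note [measurable] = full_group_borel[OF T] A
  have "T ` A = (\<Union>q\<in>\<rat>. {y. y - q \<in> A \<and> T (y - q) = y})"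
  proof (rule Set.set_eqI, rule iffI)
    fix y assume "y \<in> T ` A"
    then obtain x where "x \<in> A" "y = T x" by blast
    then show "y \<in> (\<Union>q\<in>\<rat>. {y. y - q \<in> A \<and> T (y - q) = y})"
      using full_group_rat[OF T, of x] by (intro UN_I[of "T x - x"]) auto
  qed force
  moreover have "{y. y - q \<in> A \<and> T (y - q) = y} \<in> sets borel" for q
  proof -
    have "{y \<in> space borel. y - q \<in> A \<and> T (y - q) = y} \<in> sets borel"
      by measurable
    then show ?thesis by simp
  qed
  ultimately show ?thesis
    using countable_rat by auto
qed

lemma full_group_inv:
  assumes T: "T \<in> full_group" shows "finv T \<in> full_group"
proof (rule full_groupI[where S = T])
  show "finv T \<in> borel_measurable borel"
  proof (rule measurableI)
    fix A :: "real set" assume "A \<in> sets borel"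
    then show "finv T -` A \<inter> space borel \<in> sets borel"
      using image_full_group_borel[OF T] bij_vimage_eq_inv_image[OF bij_imp_bij_inv[OF full_group_bij[OF T]]]
      by (simp add: inv_inv_eq full_group_bij T)
  qed simp
  fix x
  have "- (T (finv T x) - finv T x) \<in> \<rat>"
    using full_group_rat[OF T, of "finv T x"] by (rule Rats_minus_iff[THEN iffD2])
  then show "finv T x - x \<in> \<rat>"
    using T by simp
  show "x \<notin> {0..<1} \<Longrightarrow> finv T x = x"
    using T by (metis full_group_inv_apply(1) full_group_outside)
qed (use T in auto)

lemma inv_full_group_eq: "T \<in> full_group \<Longrightarrow> finv T x = y \<longleftrightarrow> x = T y"
  by auto

text \<open>An element of the full group is, piece by piece, a translation, and there are countably
  many pieces.\<close>

lemma emeasure_lborel_translate: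
  assumes [measurable]: "A \<in> sets borel"
  shows "emeasure lborel {y. y - (q::real) \<in> A} = emeasure lborel A"
proof -
  have "emeasure lborel A = emeasure (distr lborel borel ((+) (-q))) A"
    by (simp add: lborel_distr_plus)
  also have "\<dots> = emeasure lborel {y. y - q \<in> A}"
    by (subst emeasure_distr) (auto intro!: arg_cong[where f = "emeasure lborel"])
  finally show ?thesis by simp
qed

lemma emeasure_lborel_image_full_group:
  assumes T: "T \<in> full_group" and A: "A \<in> sets borel"
  shows "emeasure lborel (T ` A) = emeasure lborel A"
proof -
  note [measurable] = full_group_borel[OF T] A
  define B where "B q = {x \<in> space borel. x \<in> A \<and> T x - x = q}" for q
  have B: "B q \<in> sets borel" for q
    unfolding B_def by measurable
  have TB: "T ` B q = {y. y - q \<in> B q}" for q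
    by (auto simp: B_def image_iff algebra_simps) (metis add_diff_cancel_left' diff_add_cancel)
  have A_eq: "A = (\<Union>q\<in>\<rat>. B q)"
    using full_group_rat[OF T] by (auto simp: B_def)
  then have TA_eq: "T ` A = (\<Union>q\<in>\<rat>. T ` B q)"
    by blast
  have disj: "disjoint_family_on B \<rat>" "disjoint_family_on (\<lambda>q. T ` B q) \<rat>"
    by (auto simp: disjoint_family_on_def B_def full_group_inj[OF T])
  have TB_sets: "T ` B q \<in> sets borel" for q
    using image_full_group_borel[OF T B] .
  have "emeasure lborel (T ` A) = (\<integral>\<^sup>+q. emeasure lborel (T ` B q) \<partial>count_space \<rat>)"
    unfolding TA_eq by (rule emeasure_UN_countable) (use TB_sets disj countable_rat in auto)
  also have "\<dots> = (\<integral>\<^sup>+q. emeasure lborel (B q) \<partial>count_space \<rat>)"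
    unfolding TB by (simp add: emeasure_lborel_translate B)
  also have "\<dots> = emeasure lborel A"
    by (subst A_eq, rule emeasure_UN_countable[symmetric]) (use B disj countable_rat in auto)
  finally show ?thesis .
qed

lemma image_full_group_unit: "T \<in> full_group \<Longrightarrow> T ` A \<inter> {0..<1} = T ` (A \<inter> {0..<1})"
  using full_group_unit_iff by blast

lemma emeasure_leb_image:
  assumes "T \<in> full_group" "A \<in> sets borel"
  shows "emeasure leb (T ` A) = emeasure leb A"
  using assms by (simp add: emeasure_leb image_full_group_borel image_full_group_unit
    emeasure_lborel_image_full_group)

lemma emeasure_leb_vimage:
  assumes "T \<in> full_group" "A \<in> sets borel"
  shows "emeasure leb {x. T x \<in> A} = emeasure leb A"
proof -
  have "{x. T x \<in> A} = finv T ` A"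
    using assms(1) by (auto simp: image_iff intro!: bexI[of _ "T _"])
  then show ?thesis
    using emeasure_leb_image[OF full_group_inv[OF assms(1)] assms(2)] by simp
qed

lemma measure_leb_vimage:
  "T \<in> full_group \<Longrightarrow> A \<in> sets borel \<Longrightarrow> measure leb {x. T x \<in> A} = measure leb A"
  by (simp add: measure_def emeasure_leb_vimage)

lemma borel_vimage_full_group: "T \<in> full_group \<Longrightarrow> A \<in> sets borel \<Longrightarrow> {x. T x \<in> A} \<in> sets borel"
  using measurable_sets_borel[of T borel A] by (simp add: full_group_borel vimage_def)

lemma full_group_distr: "T \<in> full_group \<Longrightarrow> distr leb leb T = leb"
  by (rule measure_eqI) (auto simp: emeasure_distr full_group_borel emeasure_leb_vimage vimage_def)

section \<open>Asymptotically almost everywhere\<close>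

text \<open>Equality in the ultrapower, commutation, and invariance of projections all say that a
  sequence of exceptional sets has measure tending to 0 along the ultrafilter. The exceptional sets
  are only required to lie in small Borel sets, which makes the notion monotone without side
  conditions on measurability.\<close>

definition alm :: "nat filter \<Rightarrow> (nat \<Rightarrow> real \<Rightarrow> bool) \<Rightarrow> bool" where
  "alm \<omega> P \<longleftrightarrow> (\<exists>B. (\<forall>k. B k \<in> sets borel \<and> {x. \<not> P k x} \<subseteq> B k) \<and>
     ((\<lambda>k. measure leb (B k)) \<longlongrightarrow> 0) \<omega>)"

lemma almI:
  "(\<And>k. {x. \<not> P k x} \<in> sets borel) \<Longrightarrow> ((\<lambda>k. measure leb {x. \<not> P k x}) \<longlongrightarrow> 0) \<omega> \<Longrightarrow> alm \<omega> P"
  unfolding alm_def by (rule exI[of _ "\<lambda>k. {x. \<not> P k x}"]) auto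

lemma almD:
  assumes "alm \<omega> P" "\<And>k. {x. \<not> P k x} \<in> sets borel"
  shows "((\<lambda>k. measure leb {x. \<not> P k x}) \<longlongrightarrow> 0) \<omega>"
proof -
  obtain B where B: "\<And>k. B k \<in> sets borel" "\<And>k. {x. \<not> P k x} \<subseteq> B k"
    "((\<lambda>k. measure leb (B k)) \<longlongrightarrow> 0) \<omega>"
    using assms(1) unfolding alm_def by auto
  show ?thesis
    by (rule tendsto_squeeze_0[OF B(3)]) (use B in \<open>auto intro!: leb.finite_measure_mono\<close>)
qed

lemma alm_iff:
  "(\<And>k. {x. \<not> P k x} \<in> sets borel) \<Longrightarrow> alm \<omega> P \<longleftrightarrow> ((\<lambda>k. measure leb {x. \<not> P k x}) \<longlongrightarrow> 0) \<omega>"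
  using almI almD by blast

lemma alm_mono: "alm \<omega> P \<Longrightarrow> (\<And>k x. P k x \<Longrightarrow> Q k x) \<Longrightarrow> alm \<omega> Q"
  unfolding alm_def by (elim exE, rule_tac x = B in exI) blast

lemma alm_conj:
  assumes "alm \<omega> P" "alm \<omega> Q" shows "alm \<omega> (\<lambda>k x. P k x \<and> Q k x)"
proof -
  obtain B C where B: "\<And>k. B k \<in> sets borel" "\<And>k. {x. \<not> P k x} \<subseteq> B k"
    "((\<lambda>k. measure leb (B k)) \<longlongrightarrow> 0) \<omega>"
    and C: "\<And>k. C k \<in> sets borel" "\<And>k. {x. \<not> Q k x} \<subseteq> C k"
    "((\<lambda>k. measure leb (C k)) \<longlongrightarrow> 0) \<omega>"
    using assms unfolding alm_def by metis
  have "((\<lambda>k. measure leb (B k \<union> C k)) \<longlongrightarrow> 0) \<omega>"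
    by (rule tendsto_squeeze_0[OF tendsto_add_zero[OF B(3) C(3)]])
      (use B C in \<open>auto intro!: measure_Un_le\<close>)
  then show ?thesis
    unfolding alm_def by (intro exI[of _ "\<lambda>k. B k \<union> C k"]) (use B C in blast)
qed

lemma alm_mono2:
  "alm \<omega> P \<Longrightarrow> alm \<omega> Q \<Longrightarrow> (\<And>k x. P k x \<Longrightarrow> Q k x \<Longrightarrow> R k x) \<Longrightarrow> alm \<omega> R"
  using alm_mono[OF alm_conj] by blast

lemma alm_mono3:
  "alm \<omega> P \<Longrightarrow> alm \<omega> Q \<Longrightarrow> alm \<omega> R \<Longrightarrow>
    (\<And>k x. P k x \<Longrightarrow> Q k x \<Longrightarrow> R k x \<Longrightarrow> S k x) \<Longrightarrow> alm \<omega> S"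
  using alm_mono2[OF alm_conj] by blast

lemma alm_mono4:
  "alm \<omega> P \<Longrightarrow> alm \<omega> Q \<Longrightarrow> alm \<omega> R \<Longrightarrow> alm \<omega> S \<Longrightarrow>
    (\<And>k x. P k x \<Longrightarrow> Q k x \<Longrightarrow> R k x \<Longrightarrow> S k x \<Longrightarrow> U k x) \<Longrightarrow> alm \<omega> U"
  using alm_mono2[OF alm_conj alm_conj] by blast

lemma alm_all: "(\<And>k x. x \<in> {0..<1} \<Longrightarrow> P k x) \<Longrightarrow> alm \<omega> P"
  unfolding alm_def by (rule exI[of _ "\<lambda>k. - {0..<1}"]) auto

lemma alm_unit: "alm \<omega> (\<lambda>k x. x \<in> {0..<1})"
  by (rule alm_all)

lemma alm_vimage:
  assumes "alm \<omega> P" "\<And>k. T k \<in> full_group"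
  shows "alm \<omega> (\<lambda>k x. P k (T k x))"
proof -
  obtain B where B: "\<And>k. B k \<in> sets borel" "\<And>k. {x. \<not> P k x} \<subseteq> B k"
    "((\<lambda>k. measure leb (B k)) \<longlongrightarrow> 0) \<omega>"
    using assms unfolding alm_def by metis
  then show ?thesis
    unfolding alm_def
    by (intro exI[of _ "\<lambda>k. {x. T k x \<in> B k}"])
      (use assms in \<open>auto simp: measure_leb_vimage borel_vimage_full_group\<close>)
qed

text \<open>A uniform estimate at every stage gives an asymptotic statement.\<close>

lemma alm_of_bound:
  assumes "\<And>k. \<exists>B\<in>sets borel. {x. \<not> P k x} \<subseteq> B \<and> measure leb B \<le> f k" "(f \<longlongrightarrow> 0) \<omega>"
  shows "alm \<omega> P"
proof -
  obtain B where B: "\<And>k. B k \<in> sets borel" "\<And>k. {x. \<not> P k x} \<subseteq> B k" "\<And>k. measure leb (B k) \<le> f k"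
    using assms(1) by metis
  have "((\<lambda>k. measure leb (B k)) \<longlongrightarrow> 0) \<omega>"
    by (rule tendsto_squeeze_0[OF assms(2)]) (use B in auto)
  then show ?thesis
    using B unfolding alm_def by blast
qed

text \<open>The trace of a projection, computed along any sequence of representatives.\<close>

lemma tendsto_measure_alm_eq:
  assumes P: "\<And>k. P k \<in> sets borel" and Q: "\<And>k. Q k \<in> sets borel"
    and l: "((\<lambda>k. measure leb (P k)) \<longlongrightarrow> l) \<omega>"
    and eq: "alm \<omega> (\<lambda>k x. x \<in> P k \<longleftrightarrow> x \<in> Q k)"
  shows "((\<lambda>k. measure leb (Q k)) \<longlongrightarrow> l) \<omega>"
proof -
  have s: "{x. \<not> (x \<in> P k \<longleftrightarrow> x \<in> Q k)} = (P k - Q k) \<union> (Q k - P k)" for k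
    by auto
  have *: "((\<lambda>k. measure leb ((P k - Q k) \<union> (Q k - P k))) \<longlongrightarrow> 0) \<omega>"
    using almD[OF eq] P Q unfolding s by auto
  have "((\<lambda>k. measure leb (Q k) - measure leb (P k)) \<longlongrightarrow> 0) \<omega>"
  proof (rule tendsto_rabs_zero_cancel, rule tendsto_squeeze_0[OF *])
    fix k
    have "measure leb (Q k) \<le> measure leb (P k \<union> ((P k - Q k) \<union> (Q k - P k)))"
      "measure leb (P k) \<le> measure leb (Q k \<union> ((P k - Q k) \<union> (Q k - P k)))"
      using P Q by (auto intro!: leb.finite_measure_mono)
    moreover have "measure leb (P k \<union> ((P k - Q k) \<union> (Q k - P k))) \<le> measure leb (P k) + measure leb ((P k - Q k) \<union> (Q k - P k))"
      "measure leb (Q k \<union> ((P k - Q k) \<union> (Q k - P k))) \<le> measure leb (Q k) + measure leb ((P k - Q k) \<union> (Q k - P k))"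
      using P Q by (auto intro!: measure_Un_le)
    ultimately show "\<bar>measure leb (Q k) - measure leb (P k)\<bar> \<le> measure leb ((P k - Q k) \<union> (Q k - P k))"
      by linarith
  qed simp
  from tendsto_add[OF this l] show ?thesis by simp
qed

lemma alm_notin_iff:
  "(\<And>k. P k \<in> sets borel) \<Longrightarrow> alm \<omega> (\<lambda>k x. x \<notin> P k) \<longleftrightarrow> ((\<lambda>k. measure leb (P k)) \<longlongrightarrow> 0) \<omega>"
  by (subst alm_iff) auto

section \<open>Block permutations of the unit interval\<close>

definition block_index :: "nat \<Rightarrow> real \<Rightarrow> nat" where
  "block_index N x = nat \<lfloor>real N * x\<rfloor>"

definition block_set :: "nat \<Rightarrow> nat set \<Rightarrow> real set" where
  "block_set N J = {x \<in> {0..<1}. block_index N x \<in> J}"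

text \<open>The permutation matrix of \<open>\<sigma>\<close> acting on the interval: block \<open>i\<close> is translated onto block \<open>\<sigma> i\<close>.\<close>

definition block_perm :: "nat \<Rightarrow> (nat \<Rightarrow> nat) \<Rightarrow> real \<Rightarrow> real" where
  "block_perm N \<sigma> x =
     (if x \<in> {0..<1} then (real (\<sigma> (block_index N x)) + frac (real N * x)) / real N else x)"

lemma block_point:
  assumes "i < N" "0 \<le> t" "t < 1"
  shows "(real i + t) / real N \<in> {0..<1}" "block_index N ((real i + t) / real N) = i"
    "frac (real N * ((real i + t) / real N)) = t"
proof -
  have "real i + 1 \<le> real N"
    using assms(1) by linarith
  with assms show "(real i + t) / real N \<in> {0..<1}"
    by (auto simp: field_simps)
  have "real N * ((real i + t) / real N) = real_of_int (int i) + t"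
    using assms by simp
  then show "block_index N ((real i + t) / real N) = i"
    "frac (real N * ((real i + t) / real N)) = t"
    using assms by (auto simp: block_index_def frac_def floor_unique nat_eq_iff)
qed

lemma block_index_less:
  assumes "0 < N" "x \<in> {0..<1}"
  shows "block_index N x < N"
proof -
  have "real N * x < real N" "0 \<le> real N * x"
    using assms by auto
  then show ?thesis
    unfolding block_index_def by (simp add: nat_less_iff floor_less_iff)
qed

lemma block_index_frac:
  assumes "0 < N" "x \<in> {0..<1}"
  shows "real N * x = real (block_index N x) + frac (real N * x)"
  using assms by (simp add: block_index_def frac_def)

lemma block_decomp:
  assumes "0 < N" "x \<in> {0..<1}"
  shows "x = (real (block_index N x) + frac (real N * x)) / real N"
  using block_index_frac[OF assms] assms(1) by (simp add: field_simps)

lemma unit_blockE: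
  assumes "0 < N" "x \<in> {0..<1}"
  obtains i t where "i < N" "0 \<le> t" "t < 1" "x = (real i + t) / real N"
  using block_decomp[OF assms] block_index_less[OF assms] frac_ge_0 frac_lt_1 by metis

lemma block_perm_point:
  assumes "i < N" "0 \<le> t" "t < 1"
  shows "block_perm N \<sigma> ((real i + t) / real N) = (real (\<sigma> i) + t) / real N"
  using block_point[OF assms] by (simp add: block_perm_def)

lemma block_index_measurable [measurable]: "block_index N \<in> borel \<rightarrow>\<^sub>M count_space UNIV"
  unfolding block_index_def by measurable

lemma block_set_borel [measurable, simp]: "block_set N J \<in> sets borel"
proof -
  have "{x \<in> space borel. x \<in> {0..<1} \<and> block_index N x \<in> J} \<in> sets borel"
    by measurable
  then show ?thesis
    by (simp add: block_set_def)
qed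

lemma block_perm_measurable [measurable]: "block_perm N \<sigma> \<in> borel_measurable borel"
  unfolding block_perm_def frac_def by measurable

lemma block_perm_full_group:
  assumes N: "0 < N" and \<sigma>: "bij_betw \<sigma> {..<N} {..<N}"
  shows "block_perm N \<sigma> \<in> full_group"
proof (rule full_groupI[where S = "block_perm N (inv_into {..<N} \<sigma>)"])
  let ?\<tau> = "inv_into {..<N} \<sigma>"
  have inv: "i < N \<Longrightarrow> ?\<tau> (\<sigma> i) = i" "i < N \<Longrightarrow> \<sigma> (?\<tau> i) = i"
    "i < N \<Longrightarrow> \<sigma> i < N" "i < N \<Longrightarrow> ?\<tau> i < N" for i
    using \<sigma> bij_betw_inv_into_left[OF \<sigma>] bij_betw_inv_into_right[OF \<sigma>]
      bij_betw_apply[OF \<sigma>] bij_betw_apply[OF bij_betw_inv_into[OF \<sigma>]] by auto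
  show "block_perm N ?\<tau> (block_perm N \<sigma> x) = x" "block_perm N \<sigma> (block_perm N ?\<tau> x) = x" for x
  proof -
    have "block_perm N ?\<tau> (block_perm N \<sigma> x) = x \<and> block_perm N \<sigma> (block_perm N ?\<tau> x) = x"
    proof (cases "x \<in> {0..<1}")
      case True
      then obtain i t where "i < N" "0 \<le> t" "t < 1" "x = (real i + t) / real N"
        using unit_blockE[OF N] by metis
      then show ?thesis
        by (simp add: block_perm_point inv)
    next
      case False
      then have "block_perm N \<tau> x = x" for \<tau>
        unfolding block_perm_def by meson
      then show ?thesis by simp
    qed
    then show "block_perm N ?\<tau> (block_perm N \<sigma> x) = x" "block_perm N \<sigma> (block_perm N ?\<tau> x) = x"
      by auto
  qed
  fix x :: real assume "x \<in> {0..<1}"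
  then obtain i t where "i < N" "0 \<le> t" "t < 1" "x = (real i + t) / real N"
    using unit_blockE[OF N] by metis
  then have "block_perm N \<sigma> x - x = (real (\<sigma> i) - real i) / real N"
    by (simp add: block_perm_point flip: diff_divide_distrib)
  then show "block_perm N \<sigma> x - x \<in> \<rat>"
    by simp
next
  show "x \<notin> {0..<1} \<Longrightarrow> block_perm N \<sigma> x = x" for x
    unfolding block_perm_def by meson
qed measurable

lemma block_set_single:
  assumes "i < N"
  shows "block_set N {i} = {real i / real N..<(real i + 1) / real N}"
proof -
  have N: "0 < N" using assms by simp
  show ?thesis
  proof (rule Set.set_eqI, rule iffI)
    fix x assume "x \<in> block_set N {i}"
    then have "x \<in> {0..<1}" "block_index N x = i"
      by (auto simp: block_set_def)
    then have "real i \<le> real N * x" "real N * x < real i + 1"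
      using block_index_frac[OF N, of x] frac_ge_0[of "real N * x"] frac_lt_1[of "real N * x"]
      by linarith+
    then show "x \<in> {real i / real N..<(real i + 1) / real N}"
      using N by (simp add: pos_divide_le_eq pos_less_divide_eq mult.commute[of x])
  next
    fix x assume x: "x \<in> {real i / real N..<(real i + 1) / real N}"
    have "x = (real i + (real N * x - real i)) / real N"
      using N by simp
    moreover have "0 \<le> real N * x - real i" "real N * x - real i < 1"
      using x N by (auto simp: field_simps)
    ultimately show "x \<in> block_set N {i}"
      using block_point[OF assms] unfolding block_set_def by (metis (mono_tags, lifting) insertI1 mem_Collect_eq)
  qed
qed

lemma measure_block_set_single: "i < N \<Longrightarrow> measure leb (block_set N {i}) = 1 / real N"
  by (simp add: block_set_single, subst measure_leb_interval) (auto simp: field_simps)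

lemma measure_block_set:
  assumes "J \<subseteq> {..<N}"
  shows "measure leb (block_set N J) = real (card J) / real N"
proof -
  have fin: "finite J"
    using assms finite_subset by blast
  have "block_set N J = (\<Union>i\<in>J. block_set N {i})"
    by (auto simp: block_set_def)
  also have "measure leb \<dots> = (\<Sum>i\<in>J. measure leb (block_set N {i}))"
    by (rule leb.finite_measure_finite_Union[OF fin])
      (auto simp: disjoint_family_on_def block_set_def)
  also have "\<dots> = (\<Sum>i\<in>J. 1 / real N)"
    using assms by (intro sum.cong) (auto simp: measure_block_set_single)
  finally show ?thesis
    by simp
qed

lemma measure_block_set_single_le: "0 < N \<Longrightarrow> measure leb (block_set N {i}) \<le> 1 / real N"
proof (cases "i < N")
  case False
  moreover assume "0 < N"
  ultimately have "block_set N {i} = {}"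
    using block_index_less by (auto simp: block_set_def)
  then show ?thesis
    by simp
qed (simp add: measure_block_set_single)

section \<open>Approximation of Borel sets by unions of blocks\<close>

lemma measure_leb_unit_part:
  assumes "A \<in> sets borel"
  shows "measure leb {x \<in> {0..<1}. x \<in> A} = measure leb A"
proof -
  have "{x \<in> {0..<1}. x \<in> A} = A \<inter> {0..<1}" by auto
  then show ?thesis
    using assms by (simp add: measure_def emeasure_leb Int_assoc)
qed

definition block_mismatch :: "real set \<Rightarrow> nat \<Rightarrow> nat set \<Rightarrow> real set" where
  "block_mismatch M N J = {x \<in> {0..<1}. (x \<in> M) \<noteq> (x \<in> block_set N J)}"

lemma block_mismatch_eq:
  "block_mismatch M N J = ((M - block_set N J) \<union> (block_set N J - M)) \<inter> {0..<1}"
  by (auto simp: block_mismatch_def)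

lemma block_mismatch_borel [measurable, simp]: "M \<in> sets borel \<Longrightarrow> block_mismatch M N J \<in> sets borel"
  by (simp add: block_mismatch_eq)

text \<open>The sets that are approximable for all multiples of some number form a \<open>\<sigma>\<close>-algebra: passing to
  common multiples handles finite unions, and half-lines are approximable by inspection. The
  quantifier over all multiples is what allows several sets to be approximated with the same
  blocks.\<close>

lemma borel_block_approx:
  assumes "M \<in> sets borel" "0 < \<epsilon>"
  shows "\<exists>N0>0. \<forall>N>0. N0 dvd N \<longrightarrow> (\<exists>J\<subseteq>{..<N}. measure leb (block_mismatch M N J) < \<epsilon>)"
proof -
  have "M \<in> sigma_sets UNIV (range lessThan)"
    using assms(1) by (simp add: borel_Iio)
  then show ?thesis
    using assms(2)
  proof (induction arbitrary: \<epsilon> rule: sigma_sets.induct)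
    case (Basic A)
    then obtain a where A: "A = {..<a}" by auto
    obtain N0 :: nat where N0: "0 < N0" "1 / \<epsilon> < real N0"
      by (metis gr0I less_trans of_nat_0 of_nat_0_less_iff reals_Archimedean2 zero_less_divide_1_iff Basic(2))
    have "\<exists>J\<subseteq>{..<N}. measure leb (block_mismatch A N J) < \<epsilon>" if N: "0 < N" "N0 dvd N" for N
    proof -
      define J where "J = {i. i < N \<and> real i / real N < a}"
      \<comment> \<open>A half-line is wrong only on the one block that contains its endpoint.\<close>
      have "block_mismatch A N J \<subseteq> block_set N {nat \<lfloor>real N * a\<rfloor>}"
      proof
        fix x assume x: "x \<in> block_mismatch A N J"
        then have x01: "x \<in> {0..<1}" by (simp add: block_mismatch_def)
        let ?i = "block_index N x"
        have i: "?i < N" using block_index_less[OF N(1) x01] .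
        note d = block_index_frac[OF N(1) x01] frac_ge_0[of "real N * x"] frac_lt_1[of "real N * x"]
        from x x01 i have "(x < a) \<noteq> (real ?i / real N < a)"
          by (auto simp: block_mismatch_def A J_def block_set_def)
        moreover have "real ?i \<le> real N * x"
          using d by linarith
        then have "real ?i / real N \<le> x"
          using N(1) by (simp add: pos_divide_le_eq mult.commute[of x])
        ultimately have "a \<le> x" "real ?i / real N < a"
          by linarith+
        then have "real N * a \<le> real N * x" "real ?i < real N * a"
          using N(1) by (auto simp: field_simps)
        then have "\<lfloor>real N * a\<rfloor> = int ?i"
          using d by (intro floor_unique) auto
        then show "x \<in> block_set N {nat \<lfloor>real N * a\<rfloor>}"
          using x01 by (simp add: block_set_def)
      qed
      then have "measure leb (block_mismatch A N J) \<le> 1 / real N"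
        by (rule order_trans[OF leb.finite_measure_mono measure_block_set_single_le[OF N(1)]]) simp
      also have "\<dots> \<le> 1 / real N0"
        using N N0 dvd_imp_le[OF N(2)] by (simp add: frac_le)
      also have "\<dots> < \<epsilon>"
        using N0 Basic(2) by (simp add: field_simps)
      finally show ?thesis
        by (intro exI[of _ J]) (auto simp: J_def)
    qed
    with N0(1) show ?case by blast
  next
    case Empty
    have "block_mismatch {} N {} = {}" for N
      by (auto simp: block_mismatch_def block_set_def)
    then show ?case
      using Empty by (intro exI[of _ 1]) (auto intro!: exI[of _ "{}"])
  next
    case (Compl A)
    then obtain N0 where N0: "N0 > 0"
      "\<And>N. N > 0 \<Longrightarrow> N0 dvd N \<Longrightarrow> \<exists>J\<subseteq>{..<N}. measure leb (block_mismatch A N J) < \<epsilon>"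
      by meson
    have "\<exists>J\<subseteq>{..<N}. measure leb (block_mismatch (UNIV - A) N J) < \<epsilon>" if N: "0 < N" "N0 dvd N" for N
    proof -
      obtain J where J: "J \<subseteq> {..<N}" "measure leb (block_mismatch A N J) < \<epsilon>"
        using N0 N by blast
      have "block_mismatch (UNIV - A) N ({..<N} - J) = block_mismatch A N J"
        using block_index_less[OF N(1)] by (auto simp: block_mismatch_def block_set_def)
      with J show ?thesis
        by (intro exI[of _ "{..<N} - J"]) auto
    qed
    with N0(1) show ?case by blast
  next
    case (Union A)
    have A [measurable]: "A i \<in> sets borel" for i
      using Union(1)[of i] by (simp add: borel_Iio)
    \<comment> \<open>Up to half of the error finitely many members of the union suffice; each of them is then
      approximated within an equal share of the other half.\<close>
    define U where "U m = (\<Union>i<m. A i)" for m :: nat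
    have U [measurable]: "U m \<in> sets borel" for m
      unfolding U_def by auto
    have "(\<lambda>m. measure leb (U m)) \<longlonglongrightarrow> measure leb (\<Union>m. U m)"
      by (rule leb.finite_Lim_measure_incseq) (auto simp: U_def incseq_def intro: less_le_trans)
    moreover have "(\<Union>m. U m) = (\<Union>i. A i)"
      by (auto simp: U_def)
    ultimately have "(\<lambda>m. measure leb (U m)) \<longlonglongrightarrow> measure leb (\<Union>i. A i)"
      by simp
    from tendstoD[OF this half_gt_zero[OF Union(3)]]
    obtain m where "dist (measure leb (U m)) (measure leb (\<Union>i. A i)) < \<epsilon> / 2"
      unfolding eventually_sequentially by blast
    moreover have "measure leb ((\<Union>i. A i) - U m) = measure leb (\<Union>i. A i) - measure leb (U m)"
      by (rule leb.finite_measure_Diff) (auto simp: U_def)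
    ultimately have m: "measure leb ((\<Union>i. A i) - U m) < \<epsilon> / 2"
      unfolding dist_real_def by linarith
    define \<delta> where "\<delta> = \<epsilon> / (2 * (real m + 1))"
    have \<delta>: "\<delta> > 0" "real m * \<delta> < \<epsilon> / 2"
      using Union(3) by (auto simp: \<delta>_def field_simps)
    have "\<exists>N0>0. \<forall>N>0. N0 dvd N \<longrightarrow> (\<exists>J\<subseteq>{..<N}. measure leb (block_mismatch (A i) N J) < \<delta>)" for i
      using Union(2) \<delta>(1) by blast
    then obtain n where n: "\<And>i. n i > 0" "\<And>i N. N > 0 \<Longrightarrow> n i dvd N \<Longrightarrow>
        \<exists>J\<subseteq>{..<N}. measure leb (block_mismatch (A i) N J) < \<delta>"
      by metis
    have "\<exists>J\<subseteq>{..<N}. measure leb (block_mismatch (\<Union>i. A i) N J) < \<epsilon>"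
      if N: "0 < N" "(\<Prod>i<m. n i) dvd N" for N
    proof -
      have "n i dvd N" if "i < m" for i
        using that N(2) by (meson dvd_prodI dvd_trans finite_lessThan lessThan_iff)
      then have "\<forall>i. \<exists>J. i < m \<longrightarrow> J \<subseteq> {..<N} \<and> measure leb (block_mismatch (A i) N J) < \<delta>"
        using n(2) N(1) by blast
      then obtain J where J: "\<And>i. i < m \<Longrightarrow> J i \<subseteq> {..<N}"
        "\<And>i. i < m \<Longrightarrow> measure leb (block_mismatch (A i) N (J i)) < \<delta>"
        by metis
      have "block_mismatch (\<Union>i. A i) N (\<Union>i<m. J i) \<subseteq>
          ((\<Union>i. A i) - U m) \<union> (\<Union>i<m. block_mismatch (A i) N (J i))"
        by (auto simp: block_mismatch_def block_set_def U_def)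
      then have "measure leb (block_mismatch (\<Union>i. A i) N (\<Union>i<m. J i)) \<le>
          measure leb (((\<Union>i. A i) - U m) \<union> (\<Union>i<m. block_mismatch (A i) N (J i)))"
        by (intro leb.finite_measure_mono) auto
      also have "\<dots> \<le> measure leb ((\<Union>i. A i) - U m) + measure leb (\<Union>i<m. block_mismatch (A i) N (J i))"
        by (rule measure_Un_le) auto
      also have "measure leb (\<Union>i<m. block_mismatch (A i) N (J i)) \<le> (\<Sum>i<m. measure leb (block_mismatch (A i) N (J i)))"
        by (rule measure_UNION_le) auto
      also have "\<dots> \<le> (\<Sum>i<m. \<delta>)"
        using J(2) by (intro sum_mono) (auto intro: less_imp_le)
      also have "\<dots> = real m * \<delta>"
        by simp
      finally have "measure leb (block_mismatch (\<Union>i. A i) N (\<Union>i<m. J i)) < \<epsilon>"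
        using m \<delta>(2) by linarith
      then show ?thesis
        using J(1) by (intro exI[of _ "\<Union>i<m. J i"]) auto
    qed
    moreover have "(\<Prod>i<m. n i) > 0"
      using n(1) by (simp add: prod_pos)
    ultimately show ?case by blast
  qed
qed

section \<open>Density of the block permutations in the full group\<close>

lemma extend_inj_to_bij:
  assumes B: "finite B" and A: "A \<subseteq> B" "inj_on f A" "f ` A \<subseteq> B"
  obtains g where "bij_betw g B B" "\<And>x. x \<in> A \<Longrightarrow> g x = f x"
proof -
  have "card (B - A) = card (B - f ` A)"
    using A B by (simp add: card_Diff_subset finite_subset card_image)
  then obtain h where h: "bij_betw h (B - A) (B - f ` A)"
    using B finite_same_card_bij by (metis finite_Diff)
  define g where "g x = (if x \<in> A then f x else h x)" for x
  have "bij_betw g A (f ` A)"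
    using A(2) by (auto simp: bij_betw_def g_def inj_on_def)
  moreover have "bij_betw g (B - A) (B - f ` A)"
    using h by (subst bij_betw_cong[of _ _ h]) (auto simp: g_def)
  ultimately have "bij_betw g (A \<union> (B - A)) (f ` A \<union> (B - f ` A))"
    by (rule bij_betw_combine) auto
  then have "bij_betw g B B"
    using A by (simp add: Un_absorb1)
  then show ?thesis
    using that by (simp add: g_def)
qed

lemma finite_rats_common_denominator:
  assumes "finite Q" "Q \<subseteq> \<rat>"
  shows "\<exists>N>0. \<forall>q\<in>Q. real N * q \<in> \<int>"
  using assms
proof (induction Q rule: finite_induct)
  case (insert q Q)
  then obtain N where N: "N > 0" "\<And>q. q \<in> Q \<Longrightarrow> real N * q \<in> \<int>"
    by auto
  obtain a b :: int where q: "b > 0" "q = of_int a / of_int b"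
    using insert.prems by (auto elim!: Rats_cases')
  have "real (N * nat b) * p \<in> \<int>" if "p \<in> insert q Q" for p
  proof (cases "p = q")
    case True
    then have "real (N * nat b) * p = of_int (int N * a)"
      using q by simp
    then show ?thesis
      using Ints_of_int by metis
  next
    case False
    have "of_int b * (real N * p) \<in> \<int>"
      by (rule Ints_mult[OF Ints_of_int N(2)]) (use that False in simp)
    also have "of_int b * (real N * p) = real (N * nat b) * p"
      using q(1) by simp
    finally show ?thesis .
  qed
  then show ?case
    using N(1) q(1) by (intro exI[of _ "N * nat b"]) auto
qed auto

text \<open>An element of the full group translates each block that lies mostly in one of its pieces
  onto another block. Two such blocks cannot have the same image, since the images of their
  major parts are disjoint and each fills more than half of a block.\<close>

lemma full_group_block_approx:
  assumes T: "T \<in> full_group" and \<epsilon>: "0 < \<epsilon>"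
  shows "\<exists>N0>0. \<forall>N>0. N0 dvd N \<longrightarrow> (\<exists>\<sigma>. bij_betw \<sigma> {..<N} {..<N} \<and>
    measure leb {x. T x \<noteq> block_perm N \<sigma> x} < \<epsilon>)"
proof -
  note [measurable] = full_group_borel[OF T]
  define M where "M q = {x \<in> space borel. T x = x + q}" for q
  have M [measurable]: "M q \<in> sets borel" for q
    unfolding M_def by measurable
  define e :: "nat \<Rightarrow> real" where "e j = real_of_rat (from_nat j)" for j
  have e_surj: "\<exists>j. q = e j" if "q \<in> \<rat>" for q
    using that by (auto simp: e_def elim!: Rats_cases) (metis surj_from_nat surj_def)
  \<comment> \<open>Finitely many pieces fill the interval up to half of the allowed error.\<close>
  define U where "U m = (\<Union>j<m. M (e j))" for m :: nat
  have U [measurable]: "U m \<in> sets borel" for m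
    unfolding U_def by auto
  have "(\<Union>m. U m) = UNIV"
  proof (rule Set.set_eqI)
    fix x
    obtain j where "T x - x = e j"
      using e_surj full_group_rat[OF T] by metis
    then have "x \<in> U (Suc j)"
      by (auto simp: U_def M_def intro!: bexI[of _ j])
    then show "x \<in> (\<Union>m. U m) \<longleftrightarrow> x \<in> UNIV" by auto
  qed
  moreover have "(\<lambda>m. measure leb (U m)) \<longlonglongrightarrow> measure leb (\<Union>m. U m)"
    by (rule leb.finite_Lim_measure_incseq) (auto simp: U_def incseq_def intro: less_le_trans)
  ultimately have "(\<lambda>m. measure leb (U m)) \<longlonglongrightarrow> 1"
    by simp
  from tendstoD[OF this half_gt_zero[OF \<epsilon>]]
  obtain m where "dist (measure leb (U m)) 1 < \<epsilon> / 2"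
    unfolding eventually_sequentially by blast
  moreover have "measure leb (- U m) = 1 - measure leb (U m)"
    using leb.finite_measure_compl[of "U m"] by (simp add: Compl_eq_Diff_UNIV)
  ultimately have m: "measure leb (- U m) < \<epsilon> / 2"
    unfolding dist_real_def by linarith
  define Q where "Q = e ` {..<m}"
  have Q: "finite Q" "Q \<subseteq> \<rat>"
    by (auto simp: Q_def e_def)
  have U_Q: "U m = (\<Union>q\<in>Q. M q)"
    by (auto simp: U_def Q_def)
  obtain D where D: "D > 0" "\<And>q. q \<in> Q \<Longrightarrow> real D * q \<in> \<int>"
    using finite_rats_common_denominator[OF Q] by blast
  define \<delta> where "\<delta> = \<epsilon> / (4 * (real (card Q) + 1))"
  have \<delta>: "\<delta> > 0" "real (card Q) * (2 * \<delta>) < \<epsilon> / 2"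
    using \<epsilon> by (auto simp: \<delta>_def field_simps)
  have "\<exists>N0>0. \<forall>N>0. N0 dvd N \<longrightarrow> (\<exists>J\<subseteq>{..<N}. measure leb (block_mismatch (M q) N J) < \<delta>)" for q
    using borel_block_approx[OF M \<delta>(1)] .
  then obtain n where n: "\<And>q. n q > 0" "\<And>q N. N > 0 \<Longrightarrow> n q dvd N \<Longrightarrow>
      \<exists>J\<subseteq>{..<N}. measure leb (block_mismatch (M q) N J) < \<delta>"
    by metis
  have "\<exists>\<sigma>. bij_betw \<sigma> {..<N} {..<N} \<and> measure leb {x. T x \<noteq> block_perm N \<sigma> x} < \<epsilon>"
    if N: "0 < N" "D * (\<Prod>q\<in>Q. n q) dvd N" for N
  proof -
    have "n q dvd N" if "q \<in> Q" for q
      using that N(2) by (meson dvd_prodI dvd_trans Q(1) dvd_mult_right)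
    then have "\<forall>q. \<exists>J. q \<in> Q \<longrightarrow> J \<subseteq> {..<N} \<and> measure leb (block_mismatch (M q) N J) < \<delta>"
      using n(2) N(1) by blast
    then obtain J where J: "\<And>q. q \<in> Q \<Longrightarrow> J q \<subseteq> {..<N}"
      "\<And>q. q \<in> Q \<Longrightarrow> measure leb (block_mismatch (M q) N (J q)) < \<delta>"
      by metis
    have "\<exists>z. real N * q = of_int z" if "q \<in> Q" for q
    proof -
      obtain c where "N = D * c"
        using N(2) by (meson dvd_def dvd_mult_left)
      then have "real N * q = real c * (real D * q)"
        by simp
      also have "\<dots> \<in> \<int>"
        by (rule Ints_mult[OF _ D(2)[OF that]]) simp
      finally show ?thesis
        by (rule Ints_cases) blast
    qed
    then obtain z where z: "\<And>q. q \<in> Q \<Longrightarrow> real N * q = of_int (z q)"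
      by metis
    define blk where "blk i = block_set N {i}" for i
    have blk [measurable]: "blk i \<in> sets borel" for i
      unfolding blk_def by simp
    define major where "major i q \<longleftrightarrow> i < N \<and> q \<in> Q \<and> 1 / (2 * real N) < measure leb (M q \<inter> blk i)" for i q
    have blk_measure: "i < N \<Longrightarrow> measure leb (blk i) = 1 / real N" for i
      by (simp add: blk_def measure_block_set_single)
    have two_majors: False if "major i q" "major i' q'" and A: "measure leb A \<le> 1 / real N" "A \<in> sets borel"
      and disj: "T ` (M q \<inter> blk i) \<inter> T ` (M q' \<inter> blk i') = {}"
      and sub: "T ` (M q \<inter> blk i) \<subseteq> A" "T ` (M q' \<inter> blk i') \<subseteq> A" for i q i' q' A
    proof -
      have meas: "measure leb (T ` (M p \<inter> blk j)) = measure leb (M p \<inter> blk j)"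
        "T ` (M p \<inter> blk j) \<in> sets borel" for p j
        using T by (simp_all add: measure_def emeasure_leb_image image_full_group_borel)
      have "1 / real N < measure leb (T ` (M q \<inter> blk i)) + measure leb (T ` (M q' \<inter> blk i'))"
        using that(1,2) unfolding meas major_def by (simp add: field_simps)
      also have "\<dots> = measure leb (T ` (M q \<inter> blk i) \<union> T ` (M q' \<inter> blk i'))"
        using disj meas(2) by (intro leb.finite_measure_Union[symmetric]) auto
      also have "\<dots> \<le> measure leb A"
        using sub A by (intro leb.finite_measure_mono) auto
      finally show False using A by simp
    qed
    have major_unique: "q = q'" if "major i q" "major i q'" for i q q'
    proof (rule ccontr)
      assume "q \<noteq> q'"
      then have "T ` (M q \<inter> blk i) \<inter> T ` (M q' \<inter> blk i) = {}"
        by (auto simp del: Int_iff simp: image_iff full_group_inj[OF T]) (simp add: M_def)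
      moreover have "measure leb (T ` blk i) \<le> 1 / real N" "T ` blk i \<in> sets borel"
        using that blk_measure[of i] by (simp_all add: major_def measure_def
          emeasure_leb_image[OF T blk] image_full_group_borel[OF T])
      ultimately show False
        using two_majors[OF that, of "T ` blk i"] by blast
    qed
    \<comment> \<open>On its major part the transformation moves block \<open>i\<close> into block \<open>i + N q\<close>.\<close>
    have T_blk: "0 \<le> int i + z q \<and> int i + z q < int N \<and> T x \<in> blk (nat (int i + z q)) \<and>
        T x = (real_of_int (int i + z q) + frac (real N * x)) / real N"
      if x: "x \<in> M q \<inter> blk i" and q: "q \<in> Q" for x i q
    proof -
      have x01: "x \<in> {0..<1}" and i: "block_index N x = i"
        using x by (auto simp: blk_def block_set_def)
      have Tx: "T x \<in> {0..<1}"
        using full_group_unit_iff[OF T] x01 by simp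
      have NT: "real N * T x = real_of_int (int i + z q) + frac (real N * x)"
        using x block_index_frac[OF N(1) x01] z[OF q] by (simp add: M_def i algebra_simps)
      have fl: "\<lfloor>real N * T x\<rfloor> = int i + z q"
        unfolding NT using frac_ge_0[of "real N * x"] frac_lt_1[of "real N * x"] by (intro floor_unique) auto
      have "0 \<le> real N * T x" "real N * T x < real N"
        using Tx N(1) by auto
      then have "0 \<le> int i + z q" "int i + z q < int N"
        unfolding fl[symmetric] by (auto simp: floor_less_iff)
      moreover have "T x \<in> blk (nat (int i + z q))"
        using Tx fl by (simp add: blk_def block_set_def block_index_def)
      moreover have "T x = (real_of_int (int i + z q) + frac (real N * x)) / real N"
        using NT N(1) by (simp add: field_simps)
      ultimately show ?thesis by blast
    qed
    have major_ne: "\<exists>x. x \<in> M q \<inter> blk i" if "major i q" for i q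
    proof (rule ccontr)
      assume "\<nexists>x. x \<in> M q \<inter> blk i"
      then have "M q \<inter> blk i = {}" by blast
      with that show False by (simp add: major_def)
    qed
    define A where "A = {i. \<exists>q. major i q}"
    define p where "p i = (SOME q. major i q)" for i
    have p: "major i (p i)" if "i \<in> A" for i
      using that unfolding A_def p_def by (metis (mono_tags, lifting) mem_Collect_eq someI)
    define f where "f i = nat (int i + z (p i))" for i
    have pQ: "p i \<in> Q" "i < N" if "i \<in> A" for i
      using p[OF that] by (auto simp: major_def)
    have f_range: "f i < N" "0 \<le> int i + z (p i)" if i: "i \<in> A" for i
    proof -
      obtain x where "x \<in> M (p i) \<inter> blk i"
        using major_ne[OF p[OF i]] by blast
      from T_blk[OF this pQ(1)[OF i]] show "f i < N" "0 \<le> int i + z (p i)"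
        by (auto simp: f_def)
    qed
    have "inj_on f A"
    proof (rule inj_onI, rule ccontr)
      fix i i' assume i: "i \<in> A" "i' \<in> A" "f i = f i'" "i \<noteq> i'"
      have "T ` (M (p i) \<inter> blk i) \<inter> T ` (M (p i') \<inter> blk i') = {}"
        using i by (auto simp: blk_def block_set_def full_group_inj[OF T])
      moreover have "T ` (M (p j) \<inter> blk j) \<subseteq> blk (f j)" if "j \<in> A" for j
        using T_blk pQ(1)[OF that] unfolding f_def by blast
      moreover have "measure leb (blk (f i)) \<le> 1 / real N"
        by (simp add: blk_measure f_range i)
      ultimately show False
        using two_majors[OF p p, of i i' "blk (f i)"] i blk by metis
    qed
    moreover have "A \<subseteq> {..<N}" "f ` A \<subseteq> {..<N}"
      using f_range pQ by auto
    ultimately obtain \<sigma> where \<sigma>: "bij_betw \<sigma> {..<N} {..<N}" "\<And>i. i \<in> A \<Longrightarrow> \<sigma> i = f i"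
      using extend_inj_to_bij[of "{..<N}" A f] by auto
    define minor where "minor q = {x \<in> M q \<inter> {0..<1}. \<not> major (block_index N x) q}" for q
    have minor_eq: "minor q = M q \<inter> block_set N {i. i < N \<and> \<not> major i q}" for q
      using block_index_less[OF N(1)] by (auto simp: minor_def block_set_def)
    have minor [measurable]: "minor q \<in> sets borel" for q
      unfolding minor_eq by simp
    have wrong: "x \<in> - U m \<union> (\<Union>q\<in>Q. minor q)" if x: "T x \<noteq> block_perm N \<sigma> x" for x
    proof (rule ccontr)
      assume *: "x \<notin> - U m \<union> (\<Union>q\<in>Q. minor q)"
      have x01: "x \<in> {0..<1}"
        using x full_group_outside[OF T] unfolding block_perm_def by metis
      obtain q where q: "q \<in> Q" "x \<in> M q" "x \<notin> minor q"
        using * by (auto simp: U_Q)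
      let ?i = "block_index N x"
      have mj: "major ?i q"
        using q x01 by (auto simp: minor_def)
      then have iA: "?i \<in> A" by (auto simp: A_def)
      have "p ?i = q"
        using major_unique[OF p[OF iA] mj] .
      then have "\<sigma> ?i = nat (int ?i + z q)" "0 \<le> int ?i + z q"
        using \<sigma>(2)[OF iA] f_range(2)[OF iA] by (auto simp: f_def)
      moreover have "x \<in> blk ?i"
        using x01 by (simp add: blk_def block_set_def)
      ultimately have "T x = block_perm N \<sigma> x"
        using T_blk[of x q ?i] q x01 by (simp add: block_perm_def)
      with x show False by simp
    qed
    have minor_small: "measure leb (minor q) \<le> 2 * \<delta>" if q: "q \<in> Q" for q
    proof -
      define I where "I = {i \<in> J q. \<not> major i q}"
      have I: "finite I" "I \<subseteq> {..<N}"
        using J(1)[OF q] finite_subset[OF _ finite_lessThan[of N]] by (auto simp: I_def)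
      \<comment> \<open>A block of \<open>J q\<close> on which piece \<open>q\<close> is not in the majority contributes at least as much to the
        mismatch of \<open>J q\<close> as to the minority part.\<close>
      have "measure leb (M q \<inter> block_set N I) \<le> measure leb (block_set N I - M q)"
      proof -
        have "measure leb (M q \<inter> block_set N I) = measure leb (\<Union>i\<in>I. M q \<inter> blk i)"
          by (rule arg_cong[where f = "measure leb"]) (auto simp: blk_def block_set_def)
        also have "\<dots> \<le> (\<Sum>i\<in>I. measure leb (M q \<inter> blk i))"
          using I by (intro measure_UNION_le) auto
        also have "\<dots> \<le> (\<Sum>i\<in>I. measure leb (blk i - M q))"
        proof (rule sum_mono)
          fix i assume "i \<in> I"
          then have i: "i < N" "\<not> major i q" using I by (auto simp: I_def)
          have "measure leb (blk i - M q) = measure leb (blk i) - measure leb (M q \<inter> blk i)"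
            by (subst leb.finite_measure_Diff') (auto simp: Int_commute)
          moreover have "measure leb (M q \<inter> blk i) \<le> 1 / (2 * real N)"
            using i q by (auto simp: major_def)
          moreover have "1 / real N = 1 / (2 * real N) + 1 / (2 * real N)"
            using N(1) by (simp add: field_simps)
          ultimately show "measure leb (M q \<inter> blk i) \<le> measure leb (blk i - M q)"
            using blk_measure[OF i(1)] by linarith
        qed
        also have "\<dots> = measure leb (\<Union>i\<in>I. blk i - M q)"
          using I by (intro leb.finite_measure_finite_Union[symmetric])
            (auto simp: disjoint_family_on_def blk_def block_set_def)
        also have "(\<Union>i\<in>I. blk i - M q) = block_set N I - M q"
          by (auto simp: blk_def block_set_def)
        finally show ?thesis .
      qed
      also have "\<dots> \<le> measure leb (block_mismatch (M q) N (J q))"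
        by (rule leb.finite_measure_mono) (auto simp: block_mismatch_def block_set_def I_def)
      finally have 1: "measure leb (M q \<inter> block_set N I) \<le> \<delta>"
        using J(2)[OF q] by simp
      have "minor q \<subseteq> block_mismatch (M q) N (J q) \<union> (M q \<inter> block_set N I)"
        by (auto simp: minor_def block_mismatch_def block_set_def I_def)
      then have "measure leb (minor q) \<le> measure leb (block_mismatch (M q) N (J q) \<union> (M q \<inter> block_set N I))"
        by (intro leb.finite_measure_mono) auto
      also have "\<dots> \<le> measure leb (block_mismatch (M q) N (J q)) + measure leb (M q \<inter> block_set N I)"
        by (rule measure_Un_le) auto
      finally show ?thesis
        using 1 J(2)[OF q] by linarith
    qed
    have "measure leb {x. T x \<noteq> block_perm N \<sigma> x} \<le> measure leb (- U m \<union> (\<Union>q\<in>Q. minor q))"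
      using wrong Q(1) by (intro leb.finite_measure_mono sets.Un sets.finite_UN)
        (auto simp: Compl_eq_Diff_UNIV)
    also have "\<dots> \<le> measure leb (- U m) + measure leb (\<Union>q\<in>Q. minor q)"
      using Q(1) by (intro measure_Un_le) auto
    also have "measure leb (\<Union>q\<in>Q. minor q) \<le> (\<Sum>q\<in>Q. measure leb (minor q))"
      using Q(1) by (intro measure_UNION_le) auto
    also have "\<dots> \<le> (\<Sum>q\<in>Q. 2 * \<delta>)"
      by (intro sum_mono minor_small)
    also have "\<dots> = real (card Q) * (2 * \<delta>)"
      by simp
    finally have "measure leb {x. T x \<noteq> block_perm N \<sigma> x} < \<epsilon>"
      using m \<delta>(2) by linarith
    with \<sigma>(1) show ?thesis by blast
  qed
  moreover have "D * (\<Prod>q\<in>Q. n q) > 0"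
    using D(1) n(1) by (simp add: prod_pos)
  ultimately show ?thesis by blast
qed

section \<open>Scaled copies of the unit interval\<close>

lemma measure_leb_affine:
  assumes c: "0 < c" "0 \<le> a" "a + c \<le> 1" and B [measurable]: "B \<in> sets borel"
  shows "measure leb (B \<inter> {a..<a + c}) = c * measure leb {t. a + c * t \<in> B}"
proof -
  have pre [measurable]: "{t. a + c * t \<in> A} \<in> sets borel" if [measurable]: "A \<in> sets borel" for A
  proof -
    have "{t \<in> space borel. a + c * t \<in> A} \<in> sets borel" by measurable
    then show ?thesis by simp
  qed
  have "emeasure leb (B \<inter> {a..<a + c}) = emeasure lborel (B \<inter> {a..<a + c})"
    using c by (subst emeasure_leb) (auto intro!: arg_cong[where f = "emeasure lborel"])
  also have "\<dots> = emeasure (density (distr lborel borel (\<lambda>x. a + c * x)) (\<lambda>_. ennreal \<bar>c\<bar>)) (B \<inter> {a..<a + c})"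
    by (subst lborel_real_affine[of c a]) (use c in auto)
  also have "\<dots> = ennreal c * emeasure lborel {t. a + c * t \<in> B \<inter> {a..<a + c}}"
    using c by (subst emeasure_density) (auto simp: nn_integral_cmult emeasure_distr vimage_def)
  also have "{t. a + c * t \<in> B \<inter> {a..<a + c}} = {t. a + c * t \<in> B} \<inter> {0..<1}"
    using c by (auto simp: zero_le_mult_iff)
  also have "emeasure lborel \<dots> = emeasure leb {t. a + c * t \<in> B}"
    using pre[OF B] by (simp add: emeasure_leb)
  finally show ?thesis
    using c by (simp add: measure_def enn2real_mult)
qed

lemma alm_zoom:
  assumes R: "alm \<omega> R" and c: "\<And>k. 0 < c k" "\<And>k. 0 \<le> a k" "\<And>k. a k + c k \<le> 1"
    and lim: "(c \<longlongrightarrow> l) \<omega>" "0 < l"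
  shows "alm \<omega> (\<lambda>k t. R k (a k + c k * t))"
proof -
  obtain B where B: "\<And>k. B k \<in> sets borel" "\<And>k. {x. \<not> R k x} \<subseteq> B k"
    "((\<lambda>k. measure leb (B k)) \<longlongrightarrow> 0) \<omega>"
    using R unfolding alm_def by metis
  show ?thesis
  proof (rule alm_of_bound)
    show "((\<lambda>k. measure leb (B k) / c k) \<longlongrightarrow> 0) \<omega>"
      using tendsto_divide[OF B(3) lim(1)] lim(2) by simp
    fix k
    have "(\<lambda>t. a k + c k * t) \<in> borel_measurable borel" by measurable
    from measurable_sets_borel[OF this B(1)] have "{t. a k + c k * t \<in> B k} \<in> sets borel"
      by (simp add: vimage_def)
    moreover have "c k * measure leb {t. a k + c k * t \<in> B k} \<le> measure leb (B k)"
      unfolding measure_leb_affine[OF c B(1), symmetric] by (intro leb.finite_measure_mono) (use B in auto)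
    ultimately show "\<exists>C\<in>sets borel. {t. \<not> R k (a k + c k * t)} \<subseteq> C \<and> measure leb C \<le> measure leb (B k) / c k"
      using B(2) c(1)[of k] by (intro bexI[of _ "{t. a k + c k * t \<in> B k}"]) (auto simp: field_simps)
  qed
qed

lemma alm_unzoom:
  assumes P: "alm \<omega> P" and c: "\<And>k. 0 < c k" "\<And>k. 0 \<le> a k" "\<And>k. a k + c k \<le> 1"
  shows "alm \<omega> (\<lambda>k x. x \<in> {a k..<a k + c k} \<longrightarrow> P k ((x - a k) / c k))"
proof -
  obtain B where B: "\<And>k. B k \<in> sets borel" "\<And>k. {x. \<not> P k x} \<subseteq> B k"
    "((\<lambda>k. measure leb (B k)) \<longlongrightarrow> 0) \<omega>"
    using P unfolding alm_def by metis
  show ?thesis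
  proof (rule alm_of_bound[OF _ B(3)])
    fix k
    define C where "C = {x. (x - a k) / c k \<in> B k}"
    have "(\<lambda>x. (x - a k) / c k) \<in> borel_measurable borel" by measurable
    from measurable_sets_borel[OF this B(1)] have C: "C \<in> sets borel"
      by (simp add: vimage_def C_def)
    have "{t. a k + c k * t \<in> C} = B k"
      using c(1)[of k] by (simp add: C_def)
    then have "measure leb (C \<inter> {a k..<a k + c k}) = c k * measure leb (B k)"
      using measure_leb_affine[OF c C] by simp
    also have "\<dots> \<le> 1 * measure leb (B k)"
      using c[of k] by (intro mult_right_mono) auto
    finally show "\<exists>C\<in>sets borel. {x. \<not> (x \<in> {a k..<a k + c k} \<longrightarrow> P k ((x - a k) / c k))} \<subseteq> C \<and>
        measure leb C \<le> measure leb (B k)"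
      using C B(2)[of k] by (intro bexI[of _ "C \<inter> {a k..<a k + c k}"]) (auto simp: C_def)
  qed
qed

section \<open>Direct sums inside the full group\<close>

lemma unit_scale_bounds:
  fixes d t :: real
  assumes "0 < d" "0 \<le> t" "t < 1"
  shows "0 \<le> d * t" "d * t < d"
  using assms mult_strict_left_mono[of t 1 d] by auto

text \<open>The direct sum of the two transformations with weights \<open>c\<close> and \<open>1 - c\<close>.\<close>

definition glue :: "real \<Rightarrow> (real \<Rightarrow> real) \<Rightarrow> (real \<Rightarrow> real) \<Rightarrow> real \<Rightarrow> real" where
  "glue c T S x =
     (if x \<in> {0..<c} then c * T (x / c)
      else if x \<in> {c..<1} then c + (1 - c) * S ((x - c) / (1 - c)) else x)"

lemma glue_low: "0 < c \<Longrightarrow> t \<in> {0..<1} \<Longrightarrow> glue c T S (c * t) = c * T t"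
  by (simp add: glue_def)

lemma glue_high:
  assumes "c < 1" "t \<in> {0..<1}"
  shows "glue c T S (c + (1 - c) * t) = c + (1 - c) * S t"
proof -
  have "0 \<le> (1 - c) * t" "(1 - c) * t < 1 - c"
    using assms by (intro unit_scale_bounds; simp)+
  then have "c + (1 - c) * t \<notin> {0..<c}" "c + (1 - c) * t \<in> {c..<1}"
    by (simp_all only: atLeastLessThan_iff) linarith+
  then show ?thesis
    using assms unfolding glue_def by simp
qed

lemma glue_outside: "0 < c \<Longrightarrow> c < 1 \<Longrightarrow> x \<notin> {0..<1} \<Longrightarrow> glue c T S x = x"
  by (auto simp: glue_def)

lemma scale_low_iff: "0 < c \<Longrightarrow> c * t \<in> {0..<c} \<longleftrightarrow> t \<in> {0..<(1::real)}"
  by (auto simp: zero_le_mult_iff)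

lemma scale_high_less:
  assumes "c < 1" "t \<in> {0..<1}"
  shows "c + (1 - c) * t \<in> {c..<(1::real)}"
proof -
  have "0 \<le> (1 - c) * t" "(1 - c) * t < 1 - c"
    using assms by (intro unit_scale_bounds; simp)+
  then show ?thesis
    by (simp only: atLeastLessThan_iff) linarith
qed

lemma unit_glue_cases:
  assumes "0 < c" "c < 1" "x \<in> {0..<(1::real)}"
  obtains (low) t where "t \<in> {0..<1}" "x = c * t" | (high) t where "t \<in> {0..<1}" "x = c + (1 - c) * t"
proof (cases "x < c")
  case True
  then show ?thesis
    using assms by (intro low[of "x / c"]) auto
next
  case False
  then show ?thesis
    using assms by (intro high[of "(x - c) / (1 - c)"]) (auto simp: field_simps)
qed

lemma glue_less_iff:
  assumes "0 < c" "c < 1" "T \<in> full_group" "S \<in> full_group" "x \<in> {0..<1}"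
  shows "glue c T S x < c \<longleftrightarrow> x < c"
  using assms(1,2,5)
proof (cases rule: unit_glue_cases)
  case (low t)
  then show ?thesis
    using assms full_group_unit_iff[of T t] by (simp add: glue_low)
next
  case (high t)
  then show ?thesis
    using assms full_group_unit_iff[of S t] scale_high_less[OF assms(2), of t]
      scale_high_less[OF assms(2), of "S t"] by (metis atLeastLessThan_iff glue_high not_less)
qed

lemma glue_comp:
  assumes c: "0 < c" "c < 1" and "T' \<in> full_group" "S' \<in> full_group"
  shows "glue c T S (glue c T' S' x) = glue c (\<lambda>x. T (T' x)) (\<lambda>x. S (S' x)) x"
proof (cases "x \<in> {0..<1}")
  case True
  with c show ?thesis
  proof (cases rule: unit_glue_cases)
    case (low t)
    then show ?thesis
      using assms full_group_unit_iff[of T' t] by (simp add: glue_low)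
  next
    case (high t)
    then show ?thesis
      using assms full_group_unit_iff[of S' t] by (simp add: glue_high)
  qed
qed (use c in \<open>simp add: glue_outside\<close>)

lemma glue_id: "0 < c \<Longrightarrow> c < 1 \<Longrightarrow> glue c (\<lambda>x. x) (\<lambda>x. x) x = x"
  by (simp add: glue_def)

lemma glue_full_group:
  assumes c: "0 < c" "c < 1" "c \<in> \<rat>" and T: "T \<in> full_group" and S: "S \<in> full_group"
  shows "glue c T S \<in> full_group"
proof (rule full_groupI[where S = "glue c (finv T) (finv S)"])
  note [measurable] = full_group_borel[OF T] full_group_borel[OF S]
  show "glue c T S \<in> borel_measurable borel"
    unfolding glue_def by measurable
  show "glue c (finv T) (finv S) (glue c T S x) = x" "glue c T S (glue c (finv T) (finv S) x) = x" for x
    using c T S by (simp_all add: glue_comp full_group_inv glue_id)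
  show "x \<notin> {0..<1} \<Longrightarrow> glue c T S x = x" for x
    using c by (simp add: glue_outside)
  show "glue c T S x - x \<in> \<rat>" if "x \<in> {0..<1}" for x
    using c(1,2) that
  proof (cases rule: unit_glue_cases)
    case (low t)
    then have "glue c T S x - x = c * (T t - t)"
      using c by (simp add: glue_low algebra_simps)
    then show ?thesis
      using c full_group_rat[OF T] by simp
  next
    case (high t)
    then have "glue c T S x - x = (1 - c) * (S t - t)"
      using c by (simp only: glue_high) (simp add: algebra_simps)
    then show ?thesis
      using c full_group_rat[OF S] by simp
  qed
qed

lemma alm_glueI:
  assumes c: "\<And>k. 0 < c k" "\<And>k. c k < 1"
    and T: "alm \<omega> (\<lambda>k x. T k x = T' k x)" and S: "alm \<omega> (\<lambda>k x. S k x = S' k x)"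
  shows "alm \<omega> (\<lambda>k x. glue (c k) (T k) (S k) x = glue (c k) (T' k) (S' k) x)"
proof (rule alm_mono2)
  show "alm \<omega> (\<lambda>k x. x \<in> {0..<0 + c k} \<longrightarrow> T k ((x - 0) / c k) = T' k ((x - 0) / c k))"
    using alm_unzoom[OF T, of c "\<lambda>_. 0"] c less_imp_le by auto
  show "alm \<omega> (\<lambda>k x. x \<in> {c k..<c k + (1 - c k)} \<longrightarrow> S k ((x - c k) / (1 - c k)) = S' k ((x - c k) / (1 - c k)))"
    using alm_unzoom[OF S, of "\<lambda>k. 1 - c k" c] c less_imp_le by auto
qed (auto simp: glue_def)

lemma alm_glueD:
  assumes c: "\<And>k. 0 < c k" "\<And>k. c k < 1" and l: "(c \<longlongrightarrow> l) \<omega>" "0 < l" "l < 1"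
    and eq: "alm \<omega> (\<lambda>k x. glue (c k) (T k) (S k) x = glue (c k) (T' k) (S' k) x)"
  shows "alm \<omega> (\<lambda>k x. T k x = T' k x)" "alm \<omega> (\<lambda>k x. S k x = S' k x)"
proof -
  have "alm \<omega> (\<lambda>k t. glue (c k) (T k) (S k) (0 + c k * t) = glue (c k) (T' k) (S' k) (0 + c k * t))"
    by (rule alm_zoom[OF eq _ _ _ l(1,2)]) (use c less_imp_le in auto)
  then show "alm \<omega> (\<lambda>k x. T k x = T' k x)"
    by (rule alm_mono2[OF _ alm_unit]) (use c in \<open>simp add: glue_low less_imp_neq[THEN not_sym]\<close>)
  have "alm \<omega> (\<lambda>k t. glue (c k) (T k) (S k) (c k + (1 - c k) * t) = glue (c k) (T' k) (S' k) (c k + (1 - c k) * t))"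
    by (rule alm_zoom[OF eq _ _ _ tendsto_diff[OF tendsto_const l(1)]]) (use c l less_imp_le in auto)
  then show "alm \<omega> (\<lambda>k x. S k x = S' k x)"
    by (rule alm_mono2[OF _ alm_unit]) (use c in \<open>simp add: glue_high less_imp_neq\<close>)
qed

text \<open>A transformation that preserves the cut at \<open>c\<close> restricts to both sides; rescaling the two
  restrictions keeps translations rational because \<open>c\<close> is rational.\<close>

lemma unglue:
  assumes c: "0 < c" "c < 1" "c \<in> \<rat>" and T: "T \<in> full_group"
    and pres: "\<And>x. x \<in> {0..<1} \<Longrightarrow> T x < c \<longleftrightarrow> x < c"
  obtains T1 T2 where "T1 \<in> full_group" "T2 \<in> full_group" "T = glue c T1 T2"
proof -
  note Ti = full_group_inv[OF T]
  define lo where "lo U t = (if t \<in> {0..<1} then U (c * t) / c else t)" for U :: "real \<Rightarrow> real" and t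
  define hi where "hi U t = (if t \<in> {0..<1} then (U (c + (1 - c) * t) - c) / (1 - c) else t)"
    for U :: "real \<Rightarrow> real" and t
  have pres_inv: "finv T x < c \<longleftrightarrow> x < c" if "x \<in> {0..<1}" for x
    using pres[of "finv T x"] that full_group_unit_iff[OF Ti] T by simp
  have c1: "c * t < 1" if "t < 1" for t
    using mult_strict_left_mono[OF that c(1)] c(2) by simp
  have c2: "c + (1 - c) * t < 1" "0 \<le> c + (1 - c) * t" "\<not> c + (1 - c) * t < c" if "0 \<le> t" "t < 1" for t
    using unit_scale_bounds[OF _ that, of "1 - c"] c by linarith+
  have lo_unit: "lo U t \<in> {0..<1}" if "U \<in> full_group" "t \<in> {0..<1}" "\<And>x. x \<in> {0..<1} \<Longrightarrow> U x < c \<longleftrightarrow> x < c" for U t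
    using full_group_unit_iff[OF that(1), of "c * t"] that(2) that(3)[of "c * t"] c c1[of t] by (simp add: lo_def)
  have hi_unit: "hi U t \<in> {0..<1}" if "U \<in> full_group" "t \<in> {0..<1}" "\<And>x. x \<in> {0..<1} \<Longrightarrow> U x < c \<longleftrightarrow> x < c" for U t
    using full_group_unit_iff[OF that(1), of "c + (1 - c) * t"] that(2) that(3)[of "c + (1 - c) * t"] c c2[of t]
    by (auto simp: hi_def field_simps)
  have lo_inv: "lo U (lo V t) = t" if "V \<in> full_group" "\<And>x. x \<in> {0..<1} \<Longrightarrow> V x < c \<longleftrightarrow> x < c" "\<And>x. U (V x) = x" for U V t
    using lo_unit[OF that(1) _ that(2), of t] that(3) c by (auto simp: lo_def)
  have hi_inv: "hi U (hi V t) = t" if "V \<in> full_group" "\<And>x. x \<in> {0..<1} \<Longrightarrow> V x < c \<longleftrightarrow> x < c" "\<And>x. U (V x) = x" for U V t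
    using hi_unit[OF that(1) _ that(2), of t] that(3) c by (auto simp: hi_def)
  note [measurable] = full_group_borel[OF T]
  have "lo T \<in> full_group"
  proof (rule full_groupI[where S = "lo (finv T)"])
    show "lo T \<in> borel_measurable borel"
      unfolding lo_def by measurable
    show "lo T x - x \<in> \<rat>" if "x \<in> {0..<1}" for x
    proof -
      have "lo T x - x = (T (c * x) - c * x) / c"
        using that c by (simp add: lo_def field_simps)
      then show ?thesis
        using full_group_rat[OF T, of "c * x"] c by simp
    qed
  qed (use lo_inv T Ti pres pres_inv in \<open>auto simp: lo_def\<close>)
  moreover have "hi T \<in> full_group"
  proof (rule full_groupI[where S = "hi (finv T)"])
    show "hi T \<in> borel_measurable borel"
      unfolding hi_def by measurable
    show "hi T x - x \<in> \<rat>" if "x \<in> {0..<1}" for x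
    proof -
      have "hi T x - x = (T (c + (1 - c) * x) - (c + (1 - c) * x)) / (1 - c)"
        using that c by (simp add: hi_def field_simps)
      then show ?thesis
        using full_group_rat[OF T, of "c + (1 - c) * x"] c by simp
    qed
  qed (use hi_inv T Ti pres pres_inv in \<open>auto simp: hi_def\<close>)
  moreover have "T = glue c (lo T) (hi T)"
  proof
    fix x
    show "T x = glue c (lo T) (hi T) x"
    proof (cases "x \<in> {0..<1}")
      case True
      with c(1,2) show ?thesis
        by (cases rule: unit_glue_cases) (use c in \<open>auto simp: glue_low glue_high lo_def hi_def\<close>)
    qed (use c in \<open>simp add: glue_outside full_group_outside[OF T]\<close>)
  qed
  ultimately show ?thesis
    using that by blast
qed

section \<open>Two transformations attached to a block structure\<close>

text \<open>The first collects the initial parts of all blocks into one interval. It conjugates a block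
  permutation into the direct sum of two scaled copies of itself.\<close>

definition collect :: "nat \<Rightarrow> real \<Rightarrow> real \<Rightarrow> real" where
  "collect N c x =
     (if x \<notin> {0..<1} then x
      else if frac (real N * x) < c then (c * real (block_index N x) + frac (real N * x)) / real N
      else c + ((1 - c) * real (block_index N x) + (frac (real N * x) - c)) / real N)"

definition collect_inv :: "nat \<Rightarrow> real \<Rightarrow> real \<Rightarrow> real" where
  "collect_inv N c y =
     (if y \<notin> {0..<1} then y
      else if y < c then (real (block_index N (y / c)) + c * frac (real N * (y / c))) / real N
      else (real (block_index N ((y - c) / (1 - c))) + (c + (1 - c) * frac (real N * ((y - c) / (1 - c))))) / real N)"

lemma collect_low:
  assumes "0 < c" "c < 1" "i < N" "0 \<le> t" "t < 1"
  shows "collect N c ((real i + c * t) / real N) = c * ((real i + t) / real N)"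
proof -
  have b: "0 \<le> c * t" "c * t < 1" "c * t < c"
    using unit_scale_bounds[OF assms(1,4,5)] assms(2) by linarith+
  show ?thesis
    using block_point[OF assms(3) b(1,2)] b by (simp add: collect_def algebra_simps)
qed

lemma collect_high:
  assumes "0 < c" "c < 1" "i < N" "0 \<le> t" "t < 1"
  shows "collect N c ((real i + (c + (1 - c) * t)) / real N) = c + (1 - c) * ((real i + t) / real N)"
proof -
  have b: "0 \<le> c + (1 - c) * t" "c + (1 - c) * t < 1" "\<not> c + (1 - c) * t < c"
    using unit_scale_bounds[OF _ assms(4,5), of "1 - c"] assms(1,2) by linarith+
  show ?thesis
    unfolding collect_def block_point(2,3)[OF assms(3) b(1,2)]
    using block_point(1)[OF assms(3) b(1,2)] b(3) by (simp add: distrib_left)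
qed

lemma collect_cases:
  assumes N: "0 < N" and c: "0 < c" "c < 1" and x: "x \<in> {0..<(1::real)}"
  obtains (low) i t where "i < N" "0 \<le> t" "t < 1" "x = (real i + c * t) / real N"
  | (high) i t where "i < N" "0 \<le> t" "t < 1" "x = (real i + (c + (1 - c) * t)) / real N"
proof -
  obtain i u where iu: "i < N" "0 \<le> u" "u < 1" "x = (real i + u) / real N"
    using unit_blockE[OF N x] .
  then have "u \<in> {0..<1}" by simp
  with c show ?thesis
    by (cases rule: unit_glue_cases) (use iu low high in auto)
qed

lemma collect_inv_low:
  assumes "0 < c" "c < 1" "i < N" "0 \<le> t" "t < 1"
  shows "collect_inv N c (c * ((real i + t) / real N)) = (real i + c * t) / real N"
proof -
  let ?y = "(real i + t) / real N"
  have y: "?y \<in> {0..<1}" "block_index N ?y = i" "frac (real N * ?y) = t"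
    by (rule block_point[OF assms(3-5)])+
  have "c * ?y \<in> {0..<c}"
    using scale_low_iff[OF assms(1)] y(1) by blast
  moreover have "c * ?y / c = ?y"
    using assms(1) by simp
  ultimately show ?thesis
    using y(2,3) assms(2) unfolding collect_inv_def by simp
qed

lemma collect_inv_high:
  assumes "0 < c" "c < 1" "i < N" "0 \<le> t" "t < 1"
  shows "collect_inv N c (c + (1 - c) * ((real i + t) / real N)) = (real i + (c + (1 - c) * t)) / real N"
proof -
  let ?y = "(real i + t) / real N"
  have y: "?y \<in> {0..<1}" "block_index N ?y = i" "frac (real N * ?y) = t"
    by (rule block_point[OF assms(3-5)])+
  have "c + (1 - c) * ?y \<in> {c..<1}"
    using scale_high_less[OF assms(2) y(1)] .
  moreover have "(c + (1 - c) * ?y - c) / (1 - c) = ?y"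
    using assms(2) by simp
  ultimately show ?thesis
    using y(2,3) assms(1) unfolding collect_inv_def by simp
qed

lemma collect_full_group:
  assumes N: "0 < N" and c: "0 < c" "c < 1" "c \<in> \<rat>"
  shows "collect N c \<in> full_group"
proof (rule full_groupI[where S = "collect_inv N c"])
  show "collect N c \<in> borel_measurable borel"
    unfolding collect_def frac_def by measurable
  show "collect N c x = x" if "x \<notin> {0..<1}" for x
    using that unfolding collect_def by meson
  show "collect_inv N c (collect N c x) = x" for x
  proof (cases "x \<in> {0..<1}")
    case True
    with N c(1,2) show ?thesis
      by (cases rule: collect_cases) (use c in \<open>simp_all only: collect_low collect_high collect_inv_low collect_inv_high\<close>)
  next
    case False
    then show ?thesis unfolding collect_def collect_inv_def by simp
  qed
  show "collect N c (collect_inv N c y) = y" for y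
  proof (cases "y \<in> {0..<1}")
    case True
    with c(1,2) show ?thesis
    proof (cases rule: unit_glue_cases)
      case (low t)
      obtain i u where "i < N" "0 \<le> u" "u < 1" "t = (real i + u) / real N"
        using unit_blockE[OF N low(1)] .
      then show ?thesis
        using c low by (simp only: collect_low collect_high collect_inv_low collect_inv_high)
    next
      case (high t)
      obtain i u where "i < N" "0 \<le> u" "u < 1" "t = (real i + u) / real N"
        using unit_blockE[OF N high(1)] .
      then show ?thesis
        using c high by (simp only: collect_low collect_high collect_inv_low collect_inv_high)
    qed
  next
    case False
    then show ?thesis unfolding collect_def collect_inv_def by simp
  qed
  show "collect N c x - x \<in> \<rat>" if x: "x \<in> {0..<1}" for x
    using N c(1,2) x
  proof (cases rule: collect_cases)
    case (low i t)
    then have "collect N c x - x = (c * real i - real i) / real N"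
      using c by (simp only: collect_low) (simp add: field_simps)
    then show ?thesis
      using c(3) by simp
  next
    case (high i t)
    then have "collect N c x - x = c + ((1 - c) * real i - real i - c) / real N"
      using c by (simp only: collect_high) (simp add: field_simps)
    then show ?thesis
      using c(3) by simp
  qed
qed

lemma collect_less_iff:
  assumes N: "0 < N" and c: "0 < c" "c < 1" and x: "x \<in> {0..<1}"
  shows "collect N c x < c \<longleftrightarrow> frac (real N * x) < c"
proof -
  have "block_index N x < N"
    using block_index_less[OF N x] .
  then have i: "real (block_index N x) + 1 \<le> real N"
    by linarith
  have f: "0 \<le> frac (real N * x)" "frac (real N * x) < 1"
    by (simp_all add: frac_lt_1)
  have "(c * real (block_index N x) + frac (real N * x)) / real N < c" if "frac (real N * x) < c"
  proof -
    have "c * (real (block_index N x) + 1) \<le> c * real N"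
      using i c by (intro mult_left_mono) auto
    then have "c * real (block_index N x) + frac (real N * x) < c * real N"
      using that by (simp add: algebra_simps)
    then show ?thesis
      using N by (simp add: pos_divide_less_eq)
  qed
  moreover have "c \<le> c + ((1 - c) * real (block_index N x) + (frac (real N * x) - c)) / real N"
    if "\<not> frac (real N * x) < c"
    using that c by simp
  ultimately show ?thesis
    using x by (auto simp: collect_def simp del: not_less) 
qed

lemma glue_collect:
  assumes N: "0 < N" and c: "0 < c" "c < 1" and \<sigma>: "bij_betw \<sigma> {..<N} {..<N}"
  shows "glue c (block_perm N \<sigma>) (block_perm N \<sigma>) (collect N c x) = collect N c (block_perm N \<sigma> x)"
proof (cases "x \<in> {0..<1}")
  case True
  have \<sigma>N: "\<sigma> i < N" if "i < N" for i
    using that bij_betw_apply[OF \<sigma>] by auto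
  from N c True show ?thesis
  proof (cases rule: collect_cases)
    case (low i t)
    have b: "0 \<le> c * t" "c * t < 1"
      using unit_scale_bounds[OF c(1) low(2,3)] c(2) by linarith+
    show ?thesis
      unfolding low(4) collect_low[OF c low(1-3)] glue_low[OF c(1) block_point(1)[OF low(1-3)]]
        block_perm_point[OF low(1-3)] block_perm_point[OF low(1) b] collect_low[OF c \<sigma>N[OF low(1)] low(2,3)] ..
  next
    case (high i t)
    have b: "0 \<le> c + (1 - c) * t" "c + (1 - c) * t < 1"
      using unit_scale_bounds[OF _ high(2,3), of "1 - c"] c by linarith+
    show ?thesis
      unfolding high(4) collect_high[OF c high(1-3)] glue_high[OF c(2) block_point(1)[OF high(1-3)]]
        block_perm_point[OF high(1-3)] block_perm_point[OF high(1) b] collect_high[OF c \<sigma>N[OF high(1)] high(2,3)] ..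
  qed
next
  case False
  then have "collect N c x = x" "block_perm N \<sigma> x = x"
    unfolding collect_def block_perm_def by meson+
  then show ?thesis
    using False c by (simp add: glue_outside)
qed

text \<open>The second applies one transformation inside every block. It commutes with all block
  permutations.\<close>

definition inside_blocks :: "nat \<Rightarrow> (real \<Rightarrow> real) \<Rightarrow> real \<Rightarrow> real" where
  "inside_blocks N W x =
     (if x \<in> {0..<1} then (real (block_index N x) + W (frac (real N * x))) / real N else x)"

lemma inside_blocks_point:
  assumes "i < N" "0 \<le> t" "t < 1"
  shows "inside_blocks N W ((real i + t) / real N) = (real i + W t) / real N"
  using block_point[OF assms] by (simp add: inside_blocks_def)

lemma inside_blocks_outside: "x \<notin> {0..<1} \<Longrightarrow> inside_blocks N W x = x"
  unfolding inside_blocks_def by meson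

lemma full_group_unit_bounds:
  "T \<in> full_group \<Longrightarrow> 0 \<le> t \<Longrightarrow> t < 1 \<Longrightarrow> 0 \<le> T t" "T \<in> full_group \<Longrightarrow> 0 \<le> t \<Longrightarrow> t < 1 \<Longrightarrow> T t < 1"
  using full_group_unit_iff[of T t] by auto

lemma inside_blocks_full_group:
  assumes N: "0 < N" and W: "W \<in> full_group"
  shows "inside_blocks N W \<in> full_group"
proof (rule full_groupI[where S = "inside_blocks N (finv W)"])
  note [measurable] = full_group_borel[OF W]
  show "inside_blocks N W \<in> borel_measurable borel"
    unfolding inside_blocks_def frac_def by measurable
  have *: "inside_blocks N U (inside_blocks N V x) = x" if "V \<in> full_group" "\<And>x. U (V x) = x" for U V x
  proof (cases "x \<in> {0..<1}")
    case True
    obtain i t where "i < N" "0 \<le> t" "t < 1" "x = (real i + t) / real N"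
      using unit_blockE[OF N True] .
    then show ?thesis
      using that by (simp add: inside_blocks_point full_group_unit_bounds)
  next
    case False
    then show ?thesis
      by (simp add: inside_blocks_outside)
  qed
  show "inside_blocks N (finv W) (inside_blocks N W x) = x" "inside_blocks N W (inside_blocks N (finv W) x) = x" for x
    using * W full_group_inv[OF W] by auto
  show "inside_blocks N W x - x \<in> \<rat>" if x: "x \<in> {0..<1}" for x
  proof -
    obtain i t where "i < N" "0 \<le> t" "t < 1" "x = (real i + t) / real N"
      using unit_blockE[OF N x] .
    then have "inside_blocks N W x - x = (W t - t) / real N"
      by (simp add: inside_blocks_point flip: diff_divide_distrib)
    then show ?thesis
      using full_group_rat[OF W, of t] by simp
  qed
qed (rule inside_blocks_outside)

lemma frac_inside_blocks:
  assumes N: "0 < N" and W: "W \<in> full_group" and x: "x \<in> {0..<1}"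
  shows "frac (real N * inside_blocks N W x) = W (frac (real N * x))"
proof -
  obtain i t where *: "i < N" "0 \<le> t" "t < 1" "x = (real i + t) / real N"
    using unit_blockE[OF N x] .
  have "frac (real N * x) = t"
    unfolding *(4) by (rule block_point[OF *(1-3)])
  moreover have "frac (real N * inside_blocks N W x) = W t"
    unfolding *(4) inside_blocks_point[OF *(1-3)]
    by (rule block_point) (use * W full_group_unit_bounds in auto)
  ultimately show ?thesis by simp
qed

lemma inside_blocks_commutes:
  assumes N: "0 < N" and W: "W \<in> full_group" and \<sigma>: "bij_betw \<sigma> {..<N} {..<N}"
  shows "inside_blocks N W (block_perm N \<sigma> x) = block_perm N \<sigma> (inside_blocks N W x)"
proof (cases "x \<in> {0..<1}")
  case True
  obtain i t where *: "i < N" "0 \<le> t" "t < 1" "x = (real i + t) / real N"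
    using unit_blockE[OF N True] .
  have "\<sigma> i < N"
    using * bij_betw_apply[OF \<sigma>] by auto
  with * W show ?thesis
    by (simp add: inside_blocks_point block_perm_point full_group_unit_bounds)
next
  case False
  moreover from this have "block_perm N \<sigma> x = x"
    unfolding block_perm_def by meson
  ultimately show ?thesis
    by (simp add: inside_blocks_outside)
qed

definition half_turn :: "real \<Rightarrow> real" where
  "half_turn = block_perm 2 (\<lambda>i. 1 - i)"

lemma half_turn_full_group: "half_turn \<in> full_group"
proof -
  have "bij_betw (\<lambda>i::nat. 1 - i) {..<2} {..<2}"
    by (rule bij_betw_byWitness[where f' = "\<lambda>i. 1 - i"]) auto
  then show ?thesis
    unfolding half_turn_def by (intro block_perm_full_group) auto
qed

lemma half_turn_ge: "0 \<le> t \<Longrightarrow> t < c \<Longrightarrow> c \<le> 1 / 2 \<Longrightarrow> c \<le> half_turn t"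
  using block_perm_point[of 0 2 "2 * t" "\<lambda>i. 1 - i"] by (simp add: half_turn_def)

lemma half_turn_less: "1 / 2 < c \<Longrightarrow> c \<le> t \<Longrightarrow> t < 1 \<Longrightarrow> half_turn t < c"
  using block_perm_point[of 1 2 "2 * t - 1" "\<lambda>i. 1 - i"] by (simp add: half_turn_def)

section \<open>Perturbations\<close>

lemma less_iff_block_index_less:
  assumes N: "0 < N" and c: "real N * c = real m" and x: "x \<in> {0..<1}"
  shows "x < c \<longleftrightarrow> block_index N x < m"
proof -
  note d = block_index_frac[OF N x] frac_ge_0[of "real N * x"] frac_lt_1[of "real N * x"]
  have "x < c \<longleftrightarrow> real N * x < real m"
    using N by (simp flip: c)
  also have "\<dots> \<longleftrightarrow> block_index N x < m"
    using d by linarith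
  finally show ?thesis .
qed

lemma rat_denominator:
  assumes "c \<in> \<rat>" "0 \<le> c"
  obtains D :: nat where "0 < D" "\<And>N. D dvd N \<Longrightarrow> \<exists>m. real N * c = real m"
proof -
  obtain D where D: "D > 0" "real D * c \<in> \<int>"
    using finite_rats_common_denominator[of "{c}"] assms by auto
  then have "real D * c \<in> \<nat>"
    using assms by (auto simp: Nats_altdef2)
  then obtain m where m: "real D * c = real m"
    by (auto elim: Nats_cases)
  show ?thesis
  proof (rule that[OF D(1)])
    fix N assume "D dvd N"
    then obtain a where "N = D * a" by (auto simp: dvd_def)
    then have "real N * c = real (a * m)"
      by (simp flip: m)
    then show "\<exists>m. real N * c = real m" by blast
  qed
qed

text \<open>Approximate \<open>P\<close> by a union of blocks and let a block permutation carry an initial segment of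
  blocks of the same size onto it. The term \<open>\<bar>measure leb P - c\<bar>\<close> is unavoidable, as the full group
  preserves the measure.\<close>

lemma full_group_moves_interval_onto:
  assumes P: "P \<in> sets borel" and c: "c \<in> \<rat>" "0 \<le> c" "c \<le> 1" and \<epsilon>: "0 < \<epsilon>"
  shows "\<exists>S\<in>full_group. \<exists>B\<in>sets borel. {x \<in> {0..<1}. (S x \<in> P) \<noteq> (x < c)} \<subseteq> B \<and>
    measure leb B \<le> \<bar>measure leb P - c\<bar> + \<epsilon>"
proof -
  obtain N0 where N0: "N0 > 0" "\<And>N. N > 0 \<Longrightarrow> N0 dvd N \<Longrightarrow>
      \<exists>J\<subseteq>{..<N}. measure leb (block_mismatch P N J) < \<epsilon> / 2"
    using borel_block_approx[OF P half_gt_zero[OF \<epsilon>]] by blast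
  obtain D where D: "0 < D" "\<And>N. D dvd N \<Longrightarrow> \<exists>m. real N * c = real m"
    using rat_denominator[OF c(1,2)] by blast
  define N where "N = N0 * D"
  have N: "0 < N" "N0 dvd N" "D dvd N"
    using N0 D by (auto simp: N_def)
  obtain J where J: "J \<subseteq> {..<N}" "measure leb (block_mismatch P N J) < \<epsilon> / 2"
    using N0(2) N by blast
  obtain m where m: "real N * c = real m"
    using D(2) N by blast
  have "finite J"
    using J(1) finite_subset by blast
  then obtain h where h: "bij_betw h {..<card J} J"
    using ex_bij_betw_nat_finite atLeast0LessThan by metis
  have cJ: "card J \<le> N"
    using card_mono[OF _ J(1)] by simp
  obtain \<sigma> where \<sigma>: "bij_betw \<sigma> {..<N} {..<N}" "\<And>i. i < card J \<Longrightarrow> \<sigma> i = h i"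
    using extend_inj_to_bij[of "{..<N}" "{..<card J}" h] h J(1) cJ by (auto simp: bij_betw_def)
  have \<sigma>J: "\<sigma> i \<in> J \<longleftrightarrow> i < card J" if "i < N" for i
  proof
    assume "\<sigma> i \<in> J"
    then obtain i' where "i' < card J" "\<sigma> i = \<sigma> i'"
      using h \<sigma>(2) by (metis (no_types, lifting) bij_betw_def imageE lessThan_iff)
    then show "i < card J"
      using inj_onD[of \<sigma> "{..<N}" i i'] \<sigma>(1) that cJ by (auto simp: bij_betw_def)
  qed (use \<sigma>(2) h in \<open>auto simp: bij_betw_def\<close>)
  define S where "S = block_perm N \<sigma>"
  have S: "S \<in> full_group"
    unfolding S_def by (rule block_perm_full_group[OF N(1) \<sigma>(1)])
  have mN: "m \<le> N"
    using m c(3) N(1) by (metis mult.right_neutral mult_left_mono of_nat_0_le_iff of_nat_le_iff)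
  \<comment> \<open>The blocks between the cut \<open>c\<close> and the number of blocks that make up \<open>P\<close>.\<close>
  define I where "I = {min m (card J)..<max m (card J)}"
  define B where "B = {x. S x \<in> block_mismatch P N J} \<union> block_set N I"
  have "block_set N J \<subseteq> {0..<1}" by (auto simp: block_set_def)
  have meas_J: "\<bar>measure leb P - real (card J) / real N\<bar> \<le> measure leb (block_mismatch P N J)"
  proof -
    have "measure leb P = measure leb {x \<in> {0..<1}. x \<in> P}"
      using measure_leb_unit_part[OF P] by simp
    also have "{x \<in> {0..<1}. x \<in> P} = P \<inter> {0..<1}" by auto
    finally have 1: "measure leb P = measure leb (P \<inter> {0..<1})" .
    have "measure leb (P \<inter> {0..<1}) \<le> measure leb (block_set N J \<union> block_mismatch P N J)"
      "measure leb (block_set N J) \<le> measure leb ((P \<inter> {0..<1}) \<union> block_mismatch P N J)"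
      using P by (auto intro!: leb.finite_measure_mono simp: block_mismatch_def block_set_def)
    moreover have "measure leb (block_set N J \<union> block_mismatch P N J) \<le> measure leb (block_set N J) + measure leb (block_mismatch P N J)"
      "measure leb ((P \<inter> {0..<1}) \<union> block_mismatch P N J) \<le> measure leb (P \<inter> {0..<1}) + measure leb (block_mismatch P N J)"
      using P by (auto intro!: measure_Un_le)
    ultimately show ?thesis
      using measure_block_set[OF J(1)] 1 by linarith
  qed
  have "{x \<in> {0..<1}. (S x \<in> P) \<noteq> (x < c)} \<subseteq> B"
  proof
    fix x assume "x \<in> {x \<in> {0..<1}. (S x \<in> P) \<noteq> (x < c)}"
    then have x: "x \<in> {0..<1}" "(S x \<in> P) \<noteq> (x < c)" by auto
    have i: "block_index N x < N"
      using block_index_less[OF N(1) x(1)] .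
    have Sx: "S x \<in> {0..<1}"
      using full_group_unit_iff[OF S] x by simp
    obtain i t where it: "i < N" "0 \<le> t" "t < 1" "x = (real i + t) / real N"
      using unit_blockE[OF N(1) x(1)] .
    have ix: "block_index N x = i"
      unfolding it(4) by (rule block_point[OF it(1-3)])
    have "block_index N (S x) = \<sigma> i"
      unfolding it(4) S_def block_perm_point[OF it(1-3)]
      by (rule block_point) (use it bij_betw_apply[OF \<sigma>(1)] in auto)
    then have 1: "S x \<in> block_set N J \<longleftrightarrow> i < card J"
      using Sx \<sigma>J[OF it(1)] by (simp add: block_set_def)
    have 2: "x < c \<longleftrightarrow> i < m"
      using less_iff_block_index_less[OF N(1) m x(1)] ix by simp
    show "x \<in> B"
    proof (cases "S x \<in> block_mismatch P N J")
      case False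
      with Sx have "S x \<in> P \<longleftrightarrow> S x \<in> block_set N J"
        unfolding block_mismatch_def by blast
      then have "(i < card J) \<noteq> (i < m)"
        using x(2) 1 2 by blast
      then have "block_index N x \<in> I"
        unfolding I_def ix by (auto simp: min_def max_def)
      then show ?thesis
        using x(1) by (simp add: B_def block_set_def)
    qed (simp add: B_def)
  qed
  moreover have B: "B \<in> sets borel"
    using borel_vimage_full_group[OF S] P by (auto simp: B_def)
  moreover have "measure leb B \<le> \<bar>measure leb P - c\<bar> + \<epsilon>"
  proof -
    have "measure leb B \<le> measure leb {x. S x \<in> block_mismatch P N J} + measure leb (block_set N I)"
      unfolding B_def by (rule measure_Un_le) (use borel_vimage_full_group[OF S] P in auto)
    also have "measure leb {x. S x \<in> block_mismatch P N J} = measure leb (block_mismatch P N J)"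
      using measure_leb_vimage[OF S] P by simp
    also have "measure leb (block_set N I) = real (card I) / real N"
      by (rule measure_block_set) (use mN cJ in \<open>auto simp: I_def\<close>)
    also have "real (card I) = \<bar>real m - real (card J)\<bar>"
      by (auto simp: I_def min_def max_def)
    also have "\<bar>real m - real (card J)\<bar> / real N = \<bar>c - real (card J) / real N\<bar>"
      using N(1) by (simp add: field_simps abs_if flip: m)
    finally show ?thesis
      using meas_J J(2) by linarith
  qed
  ultimately show ?thesis
    using S by blast
qed

text \<open>An element that almost preserves the cut at \<open>c\<close> is close to one that preserves it exactly, and
  then splits as a direct sum.\<close>

lemma full_group_almost_preserving:
  assumes T: "T \<in> full_group" and c: "c \<in> \<rat>" "0 \<le> c" "c \<le> 1" and \<epsilon>: "0 < \<epsilon>"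
  shows "\<exists>T'\<in>full_group. (\<forall>x\<in>{0..<1}. T' x < c \<longleftrightarrow> x < c) \<and>
    measure leb {x. T x \<noteq> T' x} \<le> measure leb {x \<in> {0..<1}. (T x < c) \<noteq> (x < c)} + \<epsilon>"
proof -
  note [measurable] = full_group_borel[OF T]
  obtain N0 where N0: "N0 > 0" "\<And>N. N > 0 \<Longrightarrow> N0 dvd N \<Longrightarrow>
      \<exists>\<sigma>. bij_betw \<sigma> {..<N} {..<N} \<and> measure leb {x. T x \<noteq> block_perm N \<sigma> x} < \<epsilon>"
    using full_group_block_approx[OF T \<epsilon>] by blast
  obtain D where D: "0 < D" "\<And>N. D dvd N \<Longrightarrow> \<exists>m. real N * c = real m"
    using rat_denominator[OF c(1,2)] by blast
  define N where "N = N0 * D"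
  have N: "0 < N" "N0 dvd N" "D dvd N"
    using N0 D by (auto simp: N_def)
  obtain m where m: "real N * c = real m"
    using D(2) N by blast
  have mN: "m \<le> N"
    using m c(3) N(1) by (metis mult.right_neutral mult_left_mono of_nat_0_le_iff of_nat_le_iff)
  obtain \<sigma> where \<sigma>: "bij_betw \<sigma> {..<N} {..<N}" "measure leb {x. T x \<noteq> block_perm N \<sigma> x} < \<epsilon>"
    using N0(2) N by blast
  have inj: "inj_on \<sigma> {..<N}" and \<sigma>N: "\<And>i. i < N \<Longrightarrow> \<sigma> i < N"
    using \<sigma>(1) by (auto simp: bij_betw_def)
  \<comment> \<open>Keep the permutation on the blocks that stay on their side of \<open>c\<close>, and complete it
    separately on both sides.\<close>
  obtain \<sigma>1 where \<sigma>1: "bij_betw \<sigma>1 {..<m} {..<m}" "\<And>i. i < m \<Longrightarrow> \<sigma> i < m \<Longrightarrow> \<sigma>1 i = \<sigma> i"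
  proof -
    have "inj_on \<sigma> {i. i < m \<and> \<sigma> i < m}"
      by (rule inj_on_subset[OF inj]) (use mN in auto)
    then show ?thesis
      by (rule extend_inj_to_bij[where B = "{..<m}", rotated 2]) (use that in auto)
  qed
  obtain \<sigma>2 where \<sigma>2: "bij_betw \<sigma>2 {m..<N} {m..<N}"
    "\<And>i. m \<le> i \<Longrightarrow> i < N \<Longrightarrow> m \<le> \<sigma> i \<Longrightarrow> \<sigma>2 i = \<sigma> i"
  proof -
    have "inj_on \<sigma> {i. m \<le> i \<and> i < N \<and> m \<le> \<sigma> i}"
      by (rule inj_on_subset[OF inj]) auto
    moreover have "\<sigma> ` {i. m \<le> i \<and> i < N \<and> m \<le> \<sigma> i} \<subseteq> {m..<N}"
      using \<sigma>N by auto
    ultimately show ?thesis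
      by (rule extend_inj_to_bij[rotated 2]) (use that in auto)
  qed
  define \<tau> where "\<tau> i = (if i < m then \<sigma>1 i else \<sigma>2 i)" for i
  have "bij_betw \<tau> {..<m} {..<m}" "bij_betw \<tau> {m..<N} {m..<N}"
    using bij_betw_cong[of "{..<m}" \<tau> \<sigma>1 "{..<m}"] bij_betw_cong[of "{m..<N}" \<tau> \<sigma>2 "{m..<N}"] \<sigma>1(1) \<sigma>2(1)
    by (auto simp: \<tau>_def)
  then have "bij_betw \<tau> ({..<m} \<union> {m..<N}) ({..<m} \<union> {m..<N})"
    by (rule bij_betw_combine) auto
  then have \<tau>: "bij_betw \<tau> {..<N} {..<N}"
    using mN by (simp add: ivl_disj_un)
  have \<tau>m: "\<tau> i < m \<longleftrightarrow> i < m" if "i < N" for i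
    using that bij_betw_apply[OF \<sigma>1(1), of i] bij_betw_apply[OF \<sigma>2(1), of i] by (auto simp: \<tau>_def)
  define T' where "T' = block_perm N \<tau>"
  have T': "T' \<in> full_group"
    unfolding T'_def by (rule block_perm_full_group[OF N(1) \<tau>])
  have less_iff: "block_perm N \<rho> x < c \<longleftrightarrow> \<rho> (block_index N x) < m"
    if \<rho>: "bij_betw \<rho> {..<N} {..<N}" and x: "x \<in> {0..<1}" for \<rho> x
  proof -
    obtain i t where it: "i < N" "0 \<le> t" "t < 1" "x = (real i + t) / real N"
      using unit_blockE[OF N(1) x] .
    have ix: "block_index N x = i"
      unfolding it(4) by (rule block_point[OF it(1-3)])
    have "\<rho> i < N"
      using bij_betw_apply[OF \<rho>] it(1) by auto
    then have "block_perm N \<rho> x \<in> {0..<1}" "block_index N (block_perm N \<rho> x) = \<rho> i"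
      unfolding it(4) block_perm_point[OF it(1-3)] using block_point it(2,3) by blast+
    then show ?thesis
      using less_iff_block_index_less[OF N(1) m] ix by simp
  qed
  have "{x. T x \<noteq> T' x} \<subseteq> {x \<in> {0..<1}. (T x < c) \<noteq> (x < c)} \<union> {x. T x \<noteq> block_perm N \<sigma> x}"
  proof
    fix x assume "x \<in> {x. T x \<noteq> T' x}"
    then have x: "T x \<noteq> T' x" by simp
    then have x01: "x \<in> {0..<1}"
      using full_group_outside[OF T] full_group_outside[OF T'] by metis
    show "x \<in> {x \<in> {0..<1}. (T x < c) \<noteq> (x < c)} \<union> {x. T x \<noteq> block_perm N \<sigma> x}"
    proof (rule ccontr)
      assume "x \<notin> {x \<in> {0..<1}. (T x < c) \<noteq> (x < c)} \<union> {x. T x \<noteq> block_perm N \<sigma> x}"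
      with x01 have *: "T x < c \<longleftrightarrow> x < c" "T x = block_perm N \<sigma> x" by auto
      let ?i = "block_index N x"
      have i: "?i < N"
        using block_index_less[OF N(1) x01] .
      have "\<sigma> ?i < m \<longleftrightarrow> ?i < m"
        using * less_iff[OF \<sigma>(1) x01] less_iff_block_index_less[OF N(1) m x01] by simp
      then have "\<tau> ?i = \<sigma> ?i"
        using \<sigma>1(2) \<sigma>2(2) i by (auto simp: \<tau>_def)
      then have "T' x = T x"
        using * x01 by (simp add: T'_def block_perm_def)
      with x show False by simp
    qed
  qed
  moreover have sets: "{x \<in> {0..<1}. (T x < c) \<noteq> (x < c)} \<in> sets borel" "{x. T x \<noteq> block_perm N \<sigma> x} \<in> sets borel"
  proof -
    have "{x \<in> space borel. x \<in> {0..<1} \<and> (T x < c) \<noteq> (x < c)} \<in> sets borel" "{x \<in> space borel. T x \<noteq> block_perm N \<sigma> x} \<in> sets borel"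
      by measurable
    then show "{x \<in> {0..<1}. (T x < c) \<noteq> (x < c)} \<in> sets borel" "{x. T x \<noteq> block_perm N \<sigma> x} \<in> sets borel"
      by simp_all
  qed
  ultimately have "measure leb {x. T x \<noteq> T' x} \<le> measure leb ({x \<in> {0..<1}. (T x < c) \<noteq> (x < c)} \<union> {x. T x \<noteq> block_perm N \<sigma> x})"
    by (intro leb.finite_measure_mono) auto
  also have "\<dots> \<le> measure leb {x \<in> {0..<1}. (T x < c) \<noteq> (x < c)} + measure leb {x. T x \<noteq> block_perm N \<sigma> x}"
    using sets by (intro measure_Un_le) auto
  finally have "measure leb {x. T x \<noteq> T' x} \<le> measure leb {x \<in> {0..<1}. (T x < c) \<noteq> (x < c)} + \<epsilon>"
    using \<sigma>(2) by linarith
  moreover have "T' x < c \<longleftrightarrow> x < c" if "x \<in> {0..<1}" for x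
    using less_iff[OF \<tau> that] \<tau>m[OF block_index_less[OF N(1) that]] less_iff_block_index_less[OF N(1) m that]
    by (simp add: T'_def)
  ultimately show ?thesis
    using T' by blast
qed

text \<open>Approximation holds for all multiples of some number of blocks, so finitely many elements can be
  approximated with common blocks; along the stages this accommodates a whole sequence.\<close>

lemma common_block_representation:
  assumes \<omega>: "free_ultrafilter \<omega>" and T: "\<And>j k. T j k \<in> full_group"
  obtains n :: "nat \<Rightarrow> nat" and \<sigma> :: "nat \<Rightarrow> nat \<Rightarrow> nat \<Rightarrow> nat"
  where "\<And>k. 0 < n k" "\<And>j k. bij_betw (\<sigma> j k) {..<n k} {..<n k}"
    "\<And>j. alm \<omega> (\<lambda>k x. T j k x = block_perm (n k) (\<sigma> j k) x)"
proof -
  \<comment> \<open>At stage \<open>k\<close> the first \<open>k\<close> sequences are approximated within \<open>1 / Suc k\<close>, with blocks fine enough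
    for all of them; the other ones are given the identity.\<close>
  have "\<exists>N \<sigma>. 0 < N \<and> (\<forall>j. bij_betw (\<sigma> j) {..<N} {..<N}) \<and>
      (\<forall>j<k. measure leb {x. T j k x \<noteq> block_perm N (\<sigma> j) x} < 1 / real (Suc k))" for k
  proof -
    have "\<exists>N0>0. \<forall>N>0. N0 dvd N \<longrightarrow> (\<exists>\<sigma>. bij_betw \<sigma> {..<N} {..<N} \<and>
        measure leb {x. T j k x \<noteq> block_perm N \<sigma> x} < 1 / real (Suc k))" for j
      by (rule full_group_block_approx[OF T]) simp
    then obtain d where d: "\<And>j. d j > 0" "\<And>j N. N > 0 \<Longrightarrow> d j dvd N \<Longrightarrow>
        \<exists>\<sigma>. bij_betw \<sigma> {..<N} {..<N} \<and> measure leb {x. T j k x \<noteq> block_perm N \<sigma> x} < 1 / real (Suc k)"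
      by metis
    define N where "N = (\<Prod>j<k. d j)"
    have N: "0 < N" "\<And>j. j < k \<Longrightarrow> d j dvd N"
      using d(1) by (auto simp: N_def prod_pos intro: dvd_prodI)
    have "\<exists>\<sigma>. bij_betw \<sigma> {..<N} {..<N} \<and>
        (j < k \<longrightarrow> measure leb {x. T j k x \<noteq> block_perm N \<sigma> x} < 1 / real (Suc k))" for j
      using d(2)[OF N(1)] N(2) bij_betw_id[of "{..<N}"] by (cases "j < k") blast+
    then obtain \<sigma> where "\<And>j. bij_betw (\<sigma> j) {..<N} {..<N}"
      "\<And>j. j < k \<Longrightarrow> measure leb {x. T j k x \<noteq> block_perm N (\<sigma> j) x} < 1 / real (Suc k)"
      by metis
    with N show ?thesis
      by (intro exI[of _ N] exI[of _ \<sigma>]) simp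
  qed
  then obtain n \<sigma>' where n: "\<And>k. 0 < n k" "\<And>j k. bij_betw (\<sigma>' k j) {..<n k} {..<n k}"
    "\<And>j k. j < k \<Longrightarrow> measure leb {x. T j k x \<noteq> block_perm (n k) (\<sigma>' k j) x} < 1 / real (Suc k)"
    by metis
  have "alm \<omega> (\<lambda>k x. T j k x = block_perm (n k) (\<sigma>' k j) x)" for j
  proof (rule almI)
    show "{x. T j k x \<noteq> block_perm (n k) (\<sigma>' k j) x} \<in> sets borel" for k
    proof -
      note [measurable] = full_group_borel[OF T]
      have "{x \<in> space borel. T j k x \<noteq> block_perm (n k) (\<sigma>' k j) x} \<in> sets borel"
        by measurable
      then show ?thesis by simp
    qed
    have "(\<lambda>k. measure leb {x. T j k x \<noteq> block_perm (n k) (\<sigma>' k j) x}) \<longlonglongrightarrow> 0"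
    proof (rule tendsto_sandwich[OF _ _ tendsto_const LIMSEQ_inverse_real_of_nat])
      show "eventually (\<lambda>k. measure leb {x. T j k x \<noteq> block_perm (n k) (\<sigma>' k j) x} \<le> inverse (real (Suc k))) sequentially"
        using eventually_gt_at_top[of j] by eventually_elim (use n(3) in \<open>force simp: divide_inverse\<close>)
    qed auto
    then show "((\<lambda>k. measure leb {x. T j k x \<noteq> block_perm (n k) (\<sigma>' k j) x}) \<longlongrightarrow> 0) \<omega>"
      by (rule LIMSEQ_imp_ultralimit[OF \<omega>])
  qed
  with n show ?thesis
    by (intro that[of n "\<lambda>j k. \<sigma>' k j"]) auto
qed

section \<open>Sofic representations as sequences in the full group\<close>

lemma borel_Collect: "Measurable.pred borel P \<Longrightarrow> {x::real. P x} \<in> sets borel"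
  by (simp add: pred_def)

text \<open>Choosing representatives makes a diffuse sofic representation multiplicative and free only
  asymptotically almost everywhere.\<close>

definition sofic_seq :: "nat filter \<Rightarrow> ('g, 'b) monoid_scheme \<Rightarrow> ('g \<Rightarrow> nat \<Rightarrow> real \<Rightarrow> real) \<Rightarrow> bool" where
  "sofic_seq \<omega> G \<theta> \<longleftrightarrow> (\<forall>g k. \<theta> g k \<in> full_group) \<and>
     (\<forall>g\<in>carrier G. \<forall>h\<in>carrier G. alm \<omega> (\<lambda>k x. \<theta> (g \<otimes>\<^bsub>G\<^esub> h) k x = \<theta> g k (\<theta> h k x))) \<and>
     (\<forall>g\<in>carrier G. g \<noteq> \<one>\<^bsub>G\<^esub> \<longrightarrow> alm \<omega> (\<lambda>k x. \<theta> g k x \<noteq> x))"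

text \<open>A sequence \<open>U\<close> that represents a unitary \<open>u\<close> with \<open>u \<Theta> u\<^sup>* = \<Theta>'\<close>. For \<open>\<theta>' = \<theta>\<close> these are the
  elements of \<open>\<Theta>' \<inter> \<E>\<^sup>\<omega>\<close>.\<close>

definition intertwines ::
  "nat filter \<Rightarrow> 'g set \<Rightarrow> (nat \<Rightarrow> real \<Rightarrow> real) \<Rightarrow> ('g \<Rightarrow> nat \<Rightarrow> real \<Rightarrow> real) \<Rightarrow> ('g \<Rightarrow> nat \<Rightarrow> real \<Rightarrow> real) \<Rightarrow> bool"
  where
  "intertwines \<omega> C U \<theta> \<theta>' \<longleftrightarrow> (\<forall>k. U k \<in> full_group) \<and>
     (\<forall>g\<in>C. alm \<omega> (\<lambda>k x. U k (\<theta> g k x) = \<theta>' g k (U k x)))"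

definition conj_seq ::
  "nat filter \<Rightarrow> 'g set \<Rightarrow> ('g \<Rightarrow> nat \<Rightarrow> real \<Rightarrow> real) \<Rightarrow> ('g \<Rightarrow> nat \<Rightarrow> real \<Rightarrow> real) \<Rightarrow> bool" where
  "conj_seq \<omega> C \<theta> \<theta>' \<longleftrightarrow> (\<exists>U. intertwines \<omega> C U \<theta> \<theta>')"

text \<open>The projections of \<open>\<Theta>' \<inter> A\<^sup>\<omega>\<close>.\<close>

definition invariant_sets :: "nat filter \<Rightarrow> 'g set \<Rightarrow> ('g \<Rightarrow> nat \<Rightarrow> real \<Rightarrow> real) \<Rightarrow> (nat \<Rightarrow> real set) set" where
  "invariant_sets \<omega> C \<theta> = {P. (\<forall>k. P k \<in> sets borel) \<and>
     (\<forall>g\<in>C. alm \<omega> (\<lambda>k x. \<theta> g k x \<in> P k \<longleftrightarrow> x \<in> P k))}"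

text \<open>The first two premises on \<open>a\<close> say that it represents an element of \<open>A\<^sup>\<omega>\<close>, the other two that
  this element commutes with the representation and is fixed by the action.\<close>

definition ergodic_seq :: "nat filter \<Rightarrow> 'g set \<Rightarrow> ('g \<Rightarrow> nat \<Rightarrow> real \<Rightarrow> real) \<Rightarrow> bool" where
  "ergodic_seq \<omega> C \<theta> \<longleftrightarrow> (\<forall>a :: nat \<Rightarrow> real \<Rightarrow> complex.
     (\<forall>k. a k \<in> borel_measurable borel) \<longrightarrow> (\<exists>B. \<forall>k x. cmod (a k x) \<le> B) \<longrightarrow>
     (\<forall>g\<in>C. \<forall>e>0. alm \<omega> (\<lambda>k x. cmod (a k (\<theta> g k x) - a k x) < e)) \<longrightarrow>
     (\<forall>U. intertwines \<omega> C U \<theta> \<theta> \<longrightarrow> (\<forall>e>0. alm \<omega> (\<lambda>k x. cmod (a k (U k x) - a k x) < e))) \<longrightarrow>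
     (\<exists>c. \<forall>e>0. alm \<omega> (\<lambda>k x. cmod (a k x - c) < e)))"

lemma intertwines_full_group: "intertwines \<omega> C U \<theta> \<theta>' \<Longrightarrow> U k \<in> full_group"
  by (simp add: intertwines_def)

lemma intertwinesD:
  "intertwines \<omega> C U \<theta> \<theta>' \<Longrightarrow> g \<in> C \<Longrightarrow> alm \<omega> (\<lambda>k x. U k (\<theta> g k x) = \<theta>' g k (U k x))"
  by (simp add: intertwines_def)

lemma alm_intertwines: "alm \<omega> P \<Longrightarrow> intertwines \<omega> C U \<theta> \<theta>' \<Longrightarrow> alm \<omega> (\<lambda>k x. P k (U k x))"
  by (rule alm_vimage[where T = U]) (simp_all add: intertwines_def)

lemma intertwines_id: "intertwines \<omega> C (\<lambda>k x. x) \<theta> \<theta>"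
  by (auto simp: intertwines_def intro!: alm_all)

lemma intertwines_comp:
  assumes U: "intertwines \<omega> C U \<theta> \<theta>'" and V: "intertwines \<omega> C V \<theta>' \<theta>''"
  shows "intertwines \<omega> C (\<lambda>k x. V k (U k x)) \<theta> \<theta>''"
  unfolding intertwines_def
proof (intro conjI allI ballI)
  show "(\<lambda>x. V k (U k x)) \<in> full_group" for k
    by (rule full_group_comp[OF intertwines_full_group[OF V] intertwines_full_group[OF U]])
  fix g assume "g \<in> C"
  show "alm \<omega> (\<lambda>k x. V k (U k (\<theta> g k x)) = \<theta>'' g k (V k (U k x)))"
    by (rule alm_mono2[OF intertwinesD[OF U \<open>g \<in> C\<close>]
      alm_intertwines[OF intertwinesD[OF V \<open>g \<in> C\<close>] U]]) simp
qed

lemma intertwines_inv: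
  assumes U: "intertwines \<omega> C U \<theta> \<theta>'"
  shows "intertwines \<omega> C (\<lambda>k. finv (U k)) \<theta>' \<theta>"
  unfolding intertwines_def
proof (intro conjI allI ballI)
  note fg = intertwines_full_group[OF U]
  show "finv (U k) \<in> full_group" for k
    using full_group_inv[OF fg] .
  fix g assume "g \<in> C"
  show "alm \<omega> (\<lambda>k x. finv (U k) (\<theta>' g k x) = \<theta> g k (finv (U k) x))"
    by (rule alm_mono[OF alm_vimage[OF intertwinesD[OF U \<open>g \<in> C\<close>], where T = "\<lambda>k. finv (U k)"]])
      (simp_all add: inv_full_group_eq fg full_group_inv)
qed

lemma conj_seq_refl: "conj_seq \<omega> C \<theta> \<theta>"
  unfolding conj_seq_def using intertwines_id by blast

lemma conj_seq_sym: "conj_seq \<omega> C \<theta> \<theta>' \<Longrightarrow> conj_seq \<omega> C \<theta>' \<theta>"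
  unfolding conj_seq_def using intertwines_inv by blast

lemma conj_seq_trans: "conj_seq \<omega> C \<theta> \<theta>' \<Longrightarrow> conj_seq \<omega> C \<theta>' \<theta>'' \<Longrightarrow> conj_seq \<omega> C \<theta> \<theta>''"
  unfolding conj_seq_def using intertwines_comp by blast

section \<open>Ergodicity acts transitively on projections of equal trace\<close>

lemma measure_leb_ultralimit:
  assumes "free_ultrafilter \<omega>"
  obtains l where "((\<lambda>k. measure leb (P k)) \<longlongrightarrow> l) \<omega>" "0 \<le> l" "l \<le> 1"
proof -
  obtain l where l: "((\<lambda>k. measure leb (P k)) \<longlongrightarrow> l) \<omega>"
    using bounded_has_ultralimit[OF assms, of "\<lambda>k. measure leb (P k)" 1] measure_leb_le_1 by auto
  moreover have "0 \<le> l"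
    by (rule tendsto_lowerbound[OF l]) (use assms free_ultrafilter_nontrivial in auto)
  moreover have "l \<le> 1"
    by (rule tendsto_upperbound[OF l]) (use assms free_ultrafilter_nontrivial measure_leb_le_1 in auto)
  ultimately show ?thesis
    using that by blast
qed

lemma ultralimit_unique:
  "free_ultrafilter \<omega> \<Longrightarrow> (f \<longlongrightarrow> a) \<omega> \<Longrightarrow> (f \<longlongrightarrow> b) \<omega> \<Longrightarrow> a = (b::'a::t2_space)"
  using tendsto_unique free_ultrafilter_nontrivial by blast

text \<open>An asymptotic statement may be proved up to sets of arbitrarily small measure.\<close>

lemma alm_approx:
  assumes P: "\<And>k. {x. \<not> P k x} \<in> sets borel"
    and ex: "\<And>e. 0 < e \<Longrightarrow> \<exists>D Q. (\<forall>k. D k \<in> sets borel) \<and>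
      eventually (\<lambda>k. measure leb (D k) < e) \<omega> \<and> alm \<omega> Q \<and> (\<forall>k x. Q k x \<longrightarrow> x \<notin> D k \<longrightarrow> P k x)"
  shows "alm \<omega> P"
proof (rule almI[OF P])
  show "((\<lambda>k. measure leb {x. \<not> P k x}) \<longlongrightarrow> 0) \<omega>"
  proof (rule tendstoI)
    fix e :: real assume "0 < e"
    then obtain D Q where D: "\<And>k. D k \<in> sets borel"
      "eventually (\<lambda>k. measure leb (D k) < e / 2) \<omega>" "alm \<omega> Q" "\<And>k x. Q k x \<Longrightarrow> x \<notin> D k \<Longrightarrow> P k x"
      using ex[of "e / 2"] by auto
    obtain B where B: "\<And>k. B k \<in> sets borel" "\<And>k. {x. \<not> Q k x} \<subseteq> B k"
      "((\<lambda>k. measure leb (B k)) \<longlongrightarrow> 0) \<omega>"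
      using D(3) unfolding alm_def by metis
    have "eventually (\<lambda>k. measure leb (B k) < e / 2) \<omega>"
      by (rule order_tendstoD(2)[OF B(3)]) (use \<open>0 < e\<close> in simp)
    with D(2) show "eventually (\<lambda>k. dist (measure leb {x. \<not> P k x}) 0 < e) \<omega>"
    proof eventually_elim
      case (elim k)
      have "{x. \<not> P k x} \<subseteq> D k \<union> B k"
        using D(4) B(2)[of k] by blast
      then have "measure leb {x. \<not> P k x} \<le> measure leb (D k \<union> B k)"
        using D(1) B(1) by (intro leb.finite_measure_mono) auto
      also have "\<dots> \<le> measure leb (D k) + measure leb (B k)"
        using D(1) B(1) by (intro measure_Un_le) auto
      finally show ?case
        using elim by (simp add: dist_real_def)
    qed
  qed
qed

lemma alm_of_equal_limits:
  assumes P: "\<And>k. P k \<in> sets borel" and Q: "\<And>k. Q k \<in> sets borel"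
    and lim: "((\<lambda>k. measure leb (P k)) \<longlongrightarrow> l) \<omega>" "((\<lambda>k. measure leb (Q k)) \<longlongrightarrow> l) \<omega>"
    and sub: "\<And>k. P k \<subseteq> Q k"
  shows "alm \<omega> (\<lambda>k x. x \<in> Q k \<longrightarrow> x \<in> P k)"
proof (rule almI)
  have eq: "{x. \<not> (x \<in> Q k \<longrightarrow> x \<in> P k)} = Q k - P k" for k
    by auto
  show "{x. \<not> (x \<in> Q k \<longrightarrow> x \<in> P k)} \<in> sets borel" for k
    unfolding eq using P Q by auto
  have "measure leb (Q k - P k) = measure leb (Q k) - measure leb (P k)" for k
    using P Q sub by (intro leb.finite_measure_Diff) auto
  then show "((\<lambda>k. measure leb {x. \<not> (x \<in> Q k \<longrightarrow> x \<in> P k)}) \<longlongrightarrow> 0) \<omega>"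
    unfolding eq using tendsto_diff[OF lim(2,1)] by simp
qed

lemma measure_limit_alm_subset:
  assumes \<omega>: "free_ultrafilter \<omega>" and P: "\<And>k. P k \<in> sets borel" and Q: "\<And>k. Q k \<in> sets borel"
    and lim: "((\<lambda>k. measure leb (P k)) \<longlongrightarrow> p) \<omega>" "((\<lambda>k. measure leb (Q k)) \<longlongrightarrow> q) \<omega>"
    and sub: "alm \<omega> (\<lambda>k x. x \<in> P k \<longrightarrow> x \<in> Q k)"
  shows "p \<le> q"
proof -
  have eq: "alm \<omega> (\<lambda>k x. x \<in> P k \<longleftrightarrow> x \<in> P k \<inter> Q k)"
    by (rule alm_mono[OF sub]) auto
  have "((\<lambda>k. measure leb (P k \<inter> Q k)) \<longlongrightarrow> p) \<omega>"
    by (rule tendsto_measure_alm_eq[OF P _ lim(1) eq]) (use P Q in auto)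
  then show ?thesis
    by (rule tendsto_le[OF free_ultrafilter_nontrivial[OF \<omega>] lim(2)])
      (use P Q in \<open>auto intro!: always_eventually leb.finite_measure_mono\<close>)
qed

lemma invariant_sets_borel: "P \<in> invariant_sets \<omega> C \<theta> \<Longrightarrow> P k \<in> sets borel"
  by (simp add: invariant_sets_def)

lemma invariant_setsD:
  "P \<in> invariant_sets \<omega> C \<theta> \<Longrightarrow> g \<in> C \<Longrightarrow> alm \<omega> (\<lambda>k x. \<theta> g k x \<in> P k \<longleftrightarrow> x \<in> P k)"
  by (simp add: invariant_sets_def)

lemma invariant_setsI:
  "(\<And>k. P k \<in> sets borel) \<Longrightarrow> (\<And>g. g \<in> C \<Longrightarrow> alm \<omega> (\<lambda>k x. \<theta> g k x \<in> P k \<longleftrightarrow> x \<in> P k)) \<Longrightarrow>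
    P \<in> invariant_sets \<omega> C \<theta>"
  by (simp add: invariant_sets_def)

lemma invariant_sets_Un:
  assumes "P \<in> invariant_sets \<omega> C \<theta>" "Q \<in> invariant_sets \<omega> C \<theta>"
  shows "(\<lambda>k. P k \<union> Q k) \<in> invariant_sets \<omega> C \<theta>"
proof (rule invariant_setsI)
  show "P k \<union> Q k \<in> sets borel" for k
    using assms[THEN invariant_sets_borel, of k] by auto
  fix g assume g: "g \<in> C"
  show "alm \<omega> (\<lambda>k x. \<theta> g k x \<in> P k \<union> Q k \<longleftrightarrow> x \<in> P k \<union> Q k)"
    by (rule alm_mono2[OF assms(1)[THEN invariant_setsD, OF g] assms(2)[THEN invariant_setsD, OF g]]) auto
qed

lemma invariant_sets_Diff:
  assumes "P \<in> invariant_sets \<omega> C \<theta>" "Q \<in> invariant_sets \<omega> C \<theta>"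
  shows "(\<lambda>k. P k - Q k) \<in> invariant_sets \<omega> C \<theta>"
proof (rule invariant_setsI)
  show "P k - Q k \<in> sets borel" for k
    using assms[THEN invariant_sets_borel, of k] by auto
  fix g assume g: "g \<in> C"
  show "alm \<omega> (\<lambda>k x. \<theta> g k x \<in> P k - Q k \<longleftrightarrow> x \<in> P k - Q k)"
    by (rule alm_mono2[OF assms(1)[THEN invariant_setsD, OF g] assms(2)[THEN invariant_setsD, OF g]]) auto
qed

lemma invariant_sets_vimage:
  assumes P: "P \<in> invariant_sets \<omega> C \<theta>'" and U: "intertwines \<omega> C U \<theta> \<theta>'"
  shows "(\<lambda>k. {x. U k x \<in> P k}) \<in> invariant_sets \<omega> C \<theta>"
proof (rule invariant_setsI)
  note fg = intertwines_full_group[OF U]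
  show "{x. U k x \<in> P k} \<in> sets borel" for k
    by (rule borel_vimage_full_group[OF fg invariant_sets_borel[OF P]])
  fix g assume g: "g \<in> C"
  show "alm \<omega> (\<lambda>k x. \<theta> g k x \<in> {x. U k x \<in> P k} \<longleftrightarrow> x \<in> {x. U k x \<in> P k})"
    by (rule alm_mono2[OF intertwinesD[OF U g] alm_intertwines[OF invariant_setsD[OF P g] U]]) simp
qed

text \<open>On projections ergodicity is the usual zero-one law.\<close>

lemma ergodic_seq_zero_one:
  assumes \<omega>: "free_ultrafilter \<omega>" and erg: "ergodic_seq \<omega> C \<theta>" and P: "P \<in> invariant_sets \<omega> C \<theta>"
    and inv: "\<And>U. intertwines \<omega> C U \<theta> \<theta> \<Longrightarrow> alm \<omega> (\<lambda>k x. U k x \<in> P k \<longleftrightarrow> x \<in> P k)"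
    and l: "((\<lambda>k. measure leb (P k)) \<longlongrightarrow> l) \<omega>"
  shows "l = 0 \<or> l = 1"
proof -
  note [measurable] = invariant_sets_borel[OF P]
  define a :: "nat \<Rightarrow> real \<Rightarrow> complex" where "a k x = (if x \<in> P k then 1 else 0)" for k x
  have "\<exists>c. \<forall>e>0. alm \<omega> (\<lambda>k x. cmod (a k x - c) < e)"
  proof -
    have a1: "a k \<in> borel_measurable borel" for k
      unfolding a_def by measurable
    have a2: "\<exists>B. \<forall>k x. cmod (a k x) \<le> B"
      by (rule exI[of _ 1]) (auto simp: a_def)
    have a3: "alm \<omega> (\<lambda>k x. cmod (a k (\<theta> g k x) - a k x) < e)" if "g \<in> C" "e > 0" for g e
      by (rule alm_mono[OF invariant_setsD[OF P that(1)]]) (use that in \<open>auto simp: a_def\<close>)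
    have a4: "alm \<omega> (\<lambda>k x. cmod (a k (U k x) - a k x) < e)" if "intertwines \<omega> C U \<theta> \<theta>" "e > 0" for U e
      by (rule alm_mono[OF inv[OF that(1)]]) (use that in \<open>auto simp: a_def\<close>)
    show ?thesis
      using erg[unfolded ergodic_seq_def, THEN spec[of _ a]] a1 a2 a3 a4 by simp
  qed
  then obtain c where "\<forall>e>0. alm \<omega> (\<lambda>k x. cmod (a k x - c) < e)" ..
  then have c: "alm \<omega> (\<lambda>k x. cmod (a k x - c) < 1 / 2)"
    by (rule allE[of _ "1 / 2"]) simp
  show ?thesis
  proof (cases "cmod (1 - c) < 1 / 2")
    case True
    then have "\<not> cmod (0 - c) < 1 / 2"
      using norm_triangle_ineq[of "1 - c" c] by simp
    then have "alm \<omega> (\<lambda>k x. x \<in> P k \<longleftrightarrow> x \<in> UNIV)"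
      by (intro alm_mono[OF c]) (auto simp: a_def split: if_splits)
    from tendsto_measure_alm_eq[OF _ _ l this] have "((\<lambda>k. 1) \<longlongrightarrow> l) \<omega>"
      by simp
    then have "l = 1"
      using ultralimit_unique[OF \<omega> tendsto_const] by metis
    then show ?thesis by simp
  next
    case False
    then have "alm \<omega> (\<lambda>k x. x \<in> P k \<longleftrightarrow> x \<in> {})"
      by (intro alm_mono[OF c]) (auto simp: a_def split: if_splits)
    from tendsto_measure_alm_eq[OF _ _ l this] have "((\<lambda>k. 0) \<longlongrightarrow> l) \<omega>"
      by simp
    then have "l = 0"
      using ultralimit_unique[OF \<omega> tendsto_const] by metis
    then show ?thesis by simp
  qed
qed

text \<open>If no commuting element moves a part of \<open>Q\<close> into \<open>P\<close>, take a largest projection \<open>R\<close> that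
  no commuting element moves into \<open>P\<close>; it exists by countable saturation. Maximality makes \<open>R\<close>
  invariant under all commuting elements, hence trivial, although it contains \<open>Q\<close> and avoids
  \<open>P\<close>.\<close>

lemma ergodic_seq_moves:
  assumes \<omega>: "free_ultrafilter \<omega>" and erg: "ergodic_seq \<omega> C \<theta>" and \<theta>: "\<And>g k. \<theta> g k \<in> full_group"
    and Q: "Q \<in> invariant_sets \<omega> C \<theta>" and P: "P \<in> invariant_sets \<omega> C \<theta>"
    and q: "((\<lambda>k. measure leb (Q k)) \<longlongrightarrow> q) \<omega>" "0 < q"
    and p: "((\<lambda>k. measure leb (P k)) \<longlongrightarrow> p) \<omega>" "0 < p"
  shows "\<exists>U. intertwines \<omega> C U \<theta> \<theta> \<and> \<not> alm \<omega> (\<lambda>k x. x \<in> Q k \<longrightarrow> U k x \<notin> P k)"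
proof (rule ccontr)
  assume no: "\<nexists>U. intertwines \<omega> C U \<theta> \<theta> \<and> \<not> alm \<omega> (\<lambda>k x. x \<in> Q k \<longrightarrow> U k x \<notin> P k)"
  define av where "av = {R \<in> invariant_sets \<omega> C \<theta>.
    \<forall>U. intertwines \<omega> C U \<theta> \<theta> \<longrightarrow> alm \<omega> (\<lambda>k x. x \<in> R k \<longrightarrow> U k x \<notin> P k)}"
  have avD: "R \<in> invariant_sets \<omega> C \<theta>"
    "intertwines \<omega> C U \<theta> \<theta> \<Longrightarrow> alm \<omega> (\<lambda>k x. x \<in> R k \<longrightarrow> U k x \<notin> P k)" if "R \<in> av" for R U
    using that by (auto simp: av_def)
  have Q_av: "Q \<in> av"
    using Q no by (auto simp: av_def)
  have av_Un: "(\<lambda>k. R k \<union> R' k) \<in> av" if "R \<in> av" "R' \<in> av" for R R'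
    unfolding av_def
  proof (intro CollectI conjI allI impI)
    show "(\<lambda>k. R k \<union> R' k) \<in> invariant_sets \<omega> C \<theta>"
      by (rule invariant_sets_Un[OF that[THEN avD(1)]])
    show "alm \<omega> (\<lambda>k x. x \<in> R k \<union> R' k \<longrightarrow> U k x \<notin> P k)" if U: "intertwines \<omega> C U \<theta> \<theta>" for U
      by (rule alm_mono2[OF avD(2)[OF \<open>R \<in> av\<close> U] avD(2)[OF \<open>R' \<in> av\<close> U]]) auto
  qed
  \<comment> \<open>The traces of all projections that no commuting element moves into \<open>P\<close>.\<close>
  define V where "V = {t. \<exists>R\<in>av. ((\<lambda>k. measure leb (R k)) \<longlongrightarrow> t) \<omega>}"
  have V_le: "t \<le> 1" if "t \<in> V" for t
    using that tendsto_upperbound[OF _ _ free_ultrafilter_nontrivial[OF \<omega>]] measure_leb_le_1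
    unfolding V_def by fastforce
  then have V_bdd: "bdd_above V"
    by (auto simp: bdd_above_def)
  have qV: "q \<in> V"
    using Q_av q by (auto simp: V_def)
  define s where "s = Sup V"
  have le_s: "t \<le> s" if "t \<in> V" for t
    unfolding s_def by (rule cSup_upper[OF that V_bdd])
  have "\<exists>t\<in>V. s - 1 / real (Suc j) < t" for j
    using less_cSup_iff[of V "s - 1 / real (Suc j)"] qV V_bdd by (auto simp: s_def)
  then have "\<exists>R t. R \<in> av \<and> ((\<lambda>k. measure leb (R k)) \<longlongrightarrow> t) \<omega> \<and> s - 1 / real (Suc j) < t" for j
    unfolding V_def by blast
  then obtain Rs t where Rs: "\<And>j. Rs j \<in> av" "\<And>j. ((\<lambda>k. measure leb (Rs j k)) \<longlongrightarrow> t j) \<omega>"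
    "\<And>j. s - 1 / real (Suc j) < t j"
    by metis
  define W where "W m k = (\<Union>i\<le>m. Rs i k)" for m :: nat and k
  have W: "W m \<in> av" for m
  proof (induction m)
    case 0
    then show ?case using Rs(1) by (simp add: W_def)
  next
    case (Suc m)
    have "W (Suc m) = (\<lambda>k. W m k \<union> Rs (Suc m) k)"
      by (rule ext) (auto simp: W_def atMost_Suc)
    then show ?case using av_Un[OF Suc Rs(1)] by simp
  qed
  note Rs_borel [measurable] = invariant_sets_borel[OF avD(1)[OF Rs(1)]]
  note W_borel [measurable] = invariant_sets_borel[OF avD(1)[OF W]]
  \<comment> \<open>Projections of trace tending to the supremum may be taken increasing. Saturation gives one
    projection of supremal trace that contains them all.\<close>
  obtain R where R: "\<And>k. R k \<in> sets borel"
    "\<And>j. eventually (\<lambda>k. measure leb (W j k - R k) < 1 / real (Suc j) \<and> measure leb (R k) < s + 1 / real (Suc j)) \<omega>"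
  proof (rule ultraproduct_saturation[OF \<omega>, where S = "sets borel" and
        P = "\<lambda>j k y. measure leb (W j k - y) < 1 / real (Suc j) \<and> measure leb y < s + 1 / real (Suc j)"])
    fix m
    obtain w where w: "((\<lambda>k. measure leb (W m k)) \<longlongrightarrow> w) \<omega>"
      by (rule measure_leb_ultralimit[OF \<omega>])
    have "w \<in> V"
      unfolding V_def mem_Collect_eq by (rule bexI[of _ "W m"], rule w, rule W)
    have "w \<le> s"
      by (rule le_s[OF \<open>w \<in> V\<close>])
    moreover have "0 < 1 / real (Suc m)"
      by simp
    ultimately have "w < s + 1 / real (Suc m)"
      by linarith
    from order_tendstoD(2)[OF w this]
    show "eventually (\<lambda>k. \<exists>y\<in>sets borel. \<forall>j<m. measure leb (W j k - y) < 1 / real (Suc j) \<and> measure leb y < s + 1 / real (Suc j)) \<omega>"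
    proof eventually_elim
      case (elim k)
      have "W j k \<subseteq> W m k" if "j < m" for j
        unfolding W_def by (rule UN_mono) (use that in auto)
      then have "W j k - W m k = {}" if "j < m" for j
        using that by blast
      moreover have "1 / real (Suc m) \<le> 1 / real (Suc j)" if "j < m" for j
        using that by (simp add: frac_le)
      ultimately have "\<forall>j<m. measure leb (W j k - W m k) < 1 / real (Suc j) \<and> measure leb (W m k) < s + 1 / real (Suc j)"
        using elim by (metis add_le_cancel_left less_le_trans measure_empty of_nat_0_less_iff zero_less_Suc zero_less_divide_1_iff)
      then show ?case
        using W_borel by blast
    qed
  qed (rule that)
  note [measurable] = R(1)
  obtain r where r: "((\<lambda>k. measure leb (R k)) \<longlongrightarrow> r) \<omega>"
    by (rule measure_leb_ultralimit[OF \<omega>])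
  have small: "\<exists>j. 1 / real (Suc j) < e" if "0 < e" for e :: real
    using that reals_Archimedean by (simp add: divide_inverse)
  have r_le: "r \<le> s + e" if e: "0 < e" for e
  proof -
    obtain j where j: "1 / real (Suc j) < e" using small[OF e] by blast
    have "eventually (\<lambda>k. measure leb (R k) \<le> s + e) \<omega>"
      using R(2)[of j] by eventually_elim (use j in linarith)
    then show ?thesis
      using tendsto_upperbound[OF r] free_ultrafilter_nontrivial[OF \<omega>] by blast
  qed
  have sub: "alm \<omega> (\<lambda>k x. x \<in> Rs j k \<longrightarrow> x \<in> R k)" for j
  proof (rule alm_approx)
    have eq: "{x. \<not> (x \<in> Rs j k \<longrightarrow> x \<in> R k)} = Rs j k - R k" for k by auto
    show "{x. \<not> (x \<in> Rs j k \<longrightarrow> x \<in> R k)} \<in> sets borel" for k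
      unfolding eq by measurable
    fix e :: real assume "0 < e"
    then obtain i where i: "1 / real (Suc i) < e" using small by blast
    show "\<exists>D Q. (\<forall>k. D k \<in> sets borel) \<and> eventually (\<lambda>k. measure leb (D k) < e) \<omega> \<and> alm \<omega> Q \<and>
      (\<forall>k x. Q k x \<longrightarrow> x \<notin> D k \<longrightarrow> x \<in> Rs j k \<longrightarrow> x \<in> R k)"
    proof (intro exI conjI)
      let ?m = "max i j"
      show "\<forall>k. W ?m k - R k \<in> sets borel" by measurable
      have "1 / real (Suc ?m) \<le> 1 / real (Suc i)"
        by (simp add: frac_le)
      with i have "1 / real (Suc ?m) < e" by linarith
      then show "eventually (\<lambda>k. measure leb (W ?m k - R k) < e) \<omega>"
        using R(2)[of ?m] by (auto elim!: eventually_mono)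
      show "alm \<omega> (\<lambda>k x. True)" by (rule alm_all) simp
      show "\<forall>k x. True \<longrightarrow> x \<notin> W ?m k - R k \<longrightarrow> x \<in> Rs j k \<longrightarrow> x \<in> R k"
        by (auto simp: W_def)
    qed
  qed
  have t_le: "t j \<le> r" for j
    by (rule measure_limit_alm_subset[OF \<omega> _ _ Rs(2) r sub]) auto
  have r_s: "r = s"
  proof (rule antisym)
    show "r \<le> s" using r_le by (rule field_le_epsilon)
    show "s \<le> r"
    proof (rule field_le_epsilon)
      fix e :: real assume "0 < e"
      then obtain j where "1 / real (Suc j) < e" using small by blast
      then show "s \<le> r + e" using t_le[of j] Rs(3)[of j] by linarith
    qed
  qed
  have close: "\<exists>j. eventually (\<lambda>k. measure leb (R k - Rs j k) < e) \<omega>" if e: "0 < e" for e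
  proof -
    obtain j where j: "1 / real (Suc j) < e" using small[OF e] by blast
    have "alm \<omega> (\<lambda>k x. x \<in> Rs j k \<longleftrightarrow> x \<in> R k \<inter> Rs j k)"
      by (rule alm_mono[OF sub]) auto
    from tendsto_measure_alm_eq[OF _ _ Rs(2) this]
    have "((\<lambda>k. measure leb (R k \<inter> Rs j k)) \<longlongrightarrow> t j) \<omega>" by auto
    from tendsto_diff[OF r this]
    have "((\<lambda>k. measure leb (R k - Rs j k)) \<longlongrightarrow> r - t j) \<omega>"
      by (simp add: leb.finite_measure_Diff')
    moreover have "r - t j < e"
      using Rs(3)[of j] r_s j by linarith
    ultimately show ?thesis
      using order_tendstoD(2) by blast
  qed
  \<comment> \<open>The class is closed under limits in measure, so \<open>R\<close> belongs to it.\<close>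
  have R_av: "R \<in> av"
    unfolding av_def
  proof (intro CollectI conjI invariant_setsI R(1) allI impI)
    fix g assume g: "g \<in> C"
    note [measurable] = full_group_borel[OF \<theta>]
    show "alm \<omega> (\<lambda>k x. \<theta> g k x \<in> R k \<longleftrightarrow> x \<in> R k)"
    proof (rule alm_approx)
      show "{x. \<not> (\<theta> g k x \<in> R k \<longleftrightarrow> x \<in> R k)} \<in> sets borel" for k
        by (rule borel_Collect) measurable
      fix e :: real assume "0 < e"
      then obtain j where j: "eventually (\<lambda>k. measure leb (R k - Rs j k) < e / 2) \<omega>"
        using close[of "e / 2"] by auto
      show "\<exists>D Q. (\<forall>k. D k \<in> sets borel) \<and> eventually (\<lambda>k. measure leb (D k) < e) \<omega> \<and> alm \<omega> Q \<and>
        (\<forall>k x. Q k x \<longrightarrow> x \<notin> D k \<longrightarrow> (\<theta> g k x \<in> R k \<longleftrightarrow> x \<in> R k))"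
      proof (intro exI conjI)
        let ?D = "\<lambda>k. (R k - Rs j k) \<union> {x. \<theta> g k x \<in> R k - Rs j k}"
        have D: "{x. \<theta> g k x \<in> R k - Rs j k} \<in> sets borel" for k
          by (rule borel_vimage_full_group[OF \<theta>]) measurable
        then show "\<forall>k. ?D k \<in> sets borel" by auto
        have "measure leb (?D k) \<le> measure leb (R k - Rs j k) + measure leb (R k - Rs j k)" for k
          using measure_Un_le[of "R k - Rs j k" leb "{x. \<theta> g k x \<in> R k - Rs j k}"] D
            measure_leb_vimage[OF \<theta>, of "R k - Rs j k"] by auto
        note D_le = this
        show "eventually (\<lambda>k. measure leb (?D k) < e) \<omega>"
        proof (rule eventually_mono[OF j])
          fix k assume "measure leb (R k - Rs j k) < e / 2"
          then show "measure leb (?D k) < e"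
            using D_le[of k] by linarith
        qed
        have "alm \<omega> (\<lambda>k x. \<theta> g k x \<in> Rs j k \<longrightarrow> \<theta> g k x \<in> R k)"
          by (rule alm_vimage[OF sub[of j], where T = "\<theta> g"], rule \<theta>)
        from alm_conj[OF invariant_setsD[OF avD(1)[OF Rs(1)[of j]] g] alm_conj[OF sub[of j] this]]
        show "alm \<omega> (\<lambda>k x. (\<theta> g k x \<in> Rs j k \<longleftrightarrow> x \<in> Rs j k) \<and> (x \<in> Rs j k \<longrightarrow> x \<in> R k) \<and>
          (\<theta> g k x \<in> Rs j k \<longrightarrow> \<theta> g k x \<in> R k))" .
        show "\<forall>k x. (\<theta> g k x \<in> Rs j k \<longleftrightarrow> x \<in> Rs j k) \<and> (x \<in> Rs j k \<longrightarrow> x \<in> R k) \<and>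
          (\<theta> g k x \<in> Rs j k \<longrightarrow> \<theta> g k x \<in> R k) \<longrightarrow> x \<notin> ?D k \<longrightarrow> (\<theta> g k x \<in> R k \<longleftrightarrow> x \<in> R k)"
          by blast
      qed
    qed
  next
    fix U assume U: "intertwines \<omega> C U \<theta> \<theta>"
    note [measurable] = full_group_borel[OF intertwines_full_group[OF U]] invariant_sets_borel[OF P]
    show "alm \<omega> (\<lambda>k x. x \<in> R k \<longrightarrow> U k x \<notin> P k)"
    proof (rule alm_approx)
      show "{x. \<not> (x \<in> R k \<longrightarrow> U k x \<notin> P k)} \<in> sets borel" for k
        by (rule borel_Collect) measurable
      fix e :: real assume "0 < e"
      then obtain j where j: "eventually (\<lambda>k. measure leb (R k - Rs j k) < e) \<omega>"
        using close by blast
      show "\<exists>D Q. (\<forall>k. D k \<in> sets borel) \<and> eventually (\<lambda>k. measure leb (D k) < e) \<omega> \<and> alm \<omega> Q \<and>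
        (\<forall>k x. Q k x \<longrightarrow> x \<notin> D k \<longrightarrow> x \<in> R k \<longrightarrow> U k x \<notin> P k)"
      proof (intro exI conjI)
        show "\<forall>k. R k - Rs j k \<in> sets borel" by measurable
        show "eventually (\<lambda>k. measure leb (R k - Rs j k) < e) \<omega>" by (rule j)
        show "alm \<omega> (\<lambda>k x. x \<in> Rs j k \<longrightarrow> U k x \<notin> P k)" by (rule avD(2)[OF Rs(1) U])
      qed auto
    qed
  qed
  \<comment> \<open>The union of \<open>R\<close> with its preimage under a commuting element is still in the class, hence not
    larger than \<open>R\<close>.\<close>
  have one_side: "alm \<omega> (\<lambda>k x. U k x \<in> R k \<longrightarrow> x \<in> R k)" if U: "intertwines \<omega> C U \<theta> \<theta>" for U
  proof -
    let ?R' = "\<lambda>k. R k \<union> {x. U k x \<in> R k}"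
    note fg = intertwines_full_group[OF U]
    have inv: "(\<lambda>k. {x. U k x \<in> R k}) \<in> invariant_sets \<omega> C \<theta>"
      by (rule invariant_sets_vimage[OF avD(1)[OF R_av] U])
    have "(\<lambda>k. {x. U k x \<in> R k}) \<in> av"
      unfolding av_def
    proof (intro CollectI conjI allI impI inv)
      fix Z assume Z: "intertwines \<omega> C Z \<theta> \<theta>"
      show "alm \<omega> (\<lambda>k x. x \<in> {x. U k x \<in> R k} \<longrightarrow> Z k x \<notin> P k)"
        by (rule alm_mono[OF alm_intertwines[OF avD(2)[OF R_av intertwines_comp[OF intertwines_inv[OF U] Z]] U]])
          (simp add: fg)
    qed
    from av_Un[OF R_av this] have R': "?R' \<in> av" .
    obtain r' where r': "((\<lambda>k. measure leb (?R' k)) \<longlongrightarrow> r') \<omega>"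
      by (rule measure_leb_ultralimit[OF \<omega>])
    have "r' \<in> V"
      unfolding V_def mem_Collect_eq by (rule bexI[of _ ?R'], rule r', rule R')
    have "r' \<le> r"
      unfolding r_s by (rule le_s[OF \<open>r' \<in> V\<close>])
    moreover have "r \<le> r'"
      by (rule measure_limit_alm_subset[OF \<omega> _ _ r r' alm_all])
        (use invariant_sets_borel[OF avD(1)[OF R']] in auto)
    ultimately have "((\<lambda>k. measure leb (?R' k)) \<longlongrightarrow> r) \<omega>"
      using r' by simp
    from alm_of_equal_limits[OF R(1) invariant_sets_borel[OF avD(1)[OF R']] r this]
    show ?thesis
      by (rule alm_mono) auto
  qed
  have "alm \<omega> (\<lambda>k x. U k x \<in> R k \<longleftrightarrow> x \<in> R k)" if U: "intertwines \<omega> C U \<theta> \<theta>" for U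
    by (rule alm_mono2[OF one_side[OF U] alm_intertwines[OF one_side[OF intertwines_inv[OF U]] U]])
      (auto simp: intertwines_full_group[OF U])
  from ergodic_seq_zero_one[OF \<omega> erg avD(1)[OF R_av] this r] have "r = 0 \<or> r = 1" .
  moreover have "0 < r"
    using le_s[OF qV] q(2) r_s by simp
  ultimately have r1: "((\<lambda>k. measure leb (R k)) \<longlongrightarrow> 1) \<omega>"
    using r by auto
  have "alm \<omega> (\<lambda>k x. x \<in> UNIV \<longrightarrow> x \<in> R k)"
    by (rule alm_of_equal_limits[OF R(1) _ r1]) auto
  then have "alm \<omega> (\<lambda>k x. x \<notin> P k)"
    by (rule alm_mono2[OF avD(2)[OF R_av intertwines_id]]) auto
  then have "((\<lambda>k. measure leb (P k)) \<longlongrightarrow> 0) \<omega>"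
    by (subst (asm) alm_notin_iff) (rule invariant_sets_borel[OF P])
  from ultralimit_unique[OF \<omega> p(1) this] have "p = 0" .
  with p(2) show False by simp
qed

text \<open>The involution that exchanges \<open>E\<close> with its image by \<open>U\<close>; it is used for \<open>E\<close> disjoint from
  \<open>U ` E\<close>.\<close>

definition swap_on :: "(real \<Rightarrow> real) \<Rightarrow> real set \<Rightarrow> real \<Rightarrow> real" where
  "swap_on U E x = (if x \<in> E then U x else if finv U x \<in> E then finv U x else x)"

lemma swap_on_full_group:
  assumes U: "U \<in> full_group" and E [measurable]: "E \<in> sets borel" and disj: "\<And>x. x \<in> E \<Longrightarrow> U x \<notin> E"
  shows "swap_on U E \<in> full_group"
proof (rule full_groupI[where S = "swap_on U E"])
  note [measurable] = full_group_borel[OF U] full_group_borel[OF full_group_inv[OF U]]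
  show "swap_on U E \<in> borel_measurable borel"
    unfolding swap_on_def by measurable
  show "swap_on U E (swap_on U E x) = x" "swap_on U E (swap_on U E x) = x" for x
    using disj U by (auto simp: swap_on_def)
  show "swap_on U E x - x \<in> \<rat>" for x
    using full_group_rat[OF U] full_group_rat[OF full_group_inv[OF U]] by (auto simp: swap_on_def)
  show "swap_on U E x = x" if "x \<notin> {0..<1}" for x
    using full_group_outside[OF U that] full_group_outside[OF full_group_inv[OF U] that]
    by (simp add: swap_on_def)
qed

lemma swap_on_intertwines:
  assumes U: "intertwines \<omega> C U \<theta> \<theta>" and E: "E \<in> invariant_sets \<omega> C \<theta>"
    and disj: "\<And>k x. x \<in> E k \<Longrightarrow> U k x \<notin> E k"
  shows "intertwines \<omega> C (\<lambda>k. swap_on (U k) (E k)) \<theta> \<theta>"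
  unfolding intertwines_def
proof (intro conjI allI ballI)
  note fg = intertwines_full_group[OF U]
  show "swap_on (U k) (E k) \<in> full_group" for k
    by (rule swap_on_full_group[OF fg invariant_sets_borel[OF E] disj])
  fix g assume g: "g \<in> C"
  show "alm \<omega> (\<lambda>k x. swap_on (U k) (E k) (\<theta> g k x) = \<theta> g k (swap_on (U k) (E k) x))"
    by (rule alm_mono4[OF invariant_setsD[OF E g] intertwinesD[OF U g] intertwinesD[OF intertwines_inv[OF U] g]
        alm_intertwines[OF invariant_setsD[OF E g] intertwines_inv[OF U]]])
      (simp add: swap_on_def)
qed

text \<open>Among the commuting elements one moves a largest part of \<open>Q\<close> into \<open>P\<close>, again by saturation.
  If something is left over, a further commuting element moves a part of the rest of \<open>Q\<close> into the
  rest of \<open>P\<close>; exchanging these parts first enlarges the overlap.\<close>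

lemma ergodic_seq_transitive:
  assumes \<omega>: "free_ultrafilter \<omega>" and C: "countable C" "C \<noteq> {}"
    and erg: "ergodic_seq \<omega> C \<theta>" and \<theta>: "\<And>g k. \<theta> g k \<in> full_group"
    and Q: "Q \<in> invariant_sets \<omega> C \<theta>" and P: "P \<in> invariant_sets \<omega> C \<theta>"
    and q: "((\<lambda>k. measure leb (Q k)) \<longlongrightarrow> t) \<omega>"
    and p: "((\<lambda>k. measure leb (P k)) \<longlongrightarrow> t) \<omega>"
  shows "\<exists>V. intertwines \<omega> C V \<theta> \<theta> \<and> alm \<omega> (\<lambda>k x. x \<in> Q k \<longleftrightarrow> V k x \<in> P k)"
proof -
  note nontriv = free_ultrafilter_nontrivial[OF \<omega>]
  note [measurable] = invariant_sets_borel[OF Q] invariant_sets_borel[OF P]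
  \<comment> \<open>The part of \<open>Q\<close> at stage \<open>k\<close> that \<open>V\<close> moves into \<open>P\<close>.\<close>
  define ov where "ov V k = {x \<in> Q k. V x \<in> P k}" for V k
  have ov_borel: "ov V k \<in> sets borel" if "V \<in> full_group" for V k
  proof -
    note [measurable] = full_group_borel[OF that]
    have "{x. x \<in> Q k \<and> V x \<in> P k} \<in> sets borel"
      by (rule borel_Collect) measurable
    then show ?thesis by (simp add: ov_def)
  qed
  define T where "T = {s. \<exists>V. intertwines \<omega> C V \<theta> \<theta> \<and> ((\<lambda>k. measure leb (ov (V k) k)) \<longlongrightarrow> s) \<omega>}"
  have T_E: thesis if s: "s \<in> T" and V: "\<And>V. intertwines \<omega> C V \<theta> \<theta> \<Longrightarrow>
      ((\<lambda>k. measure leb (ov (V k) k)) \<longlongrightarrow> s) \<omega> \<Longrightarrow> thesis" for s thesis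
    using s unfolding T_def mem_Collect_eq by (elim exE conjE) (rule V)
  have T_le: "s \<le> 1" if s: "s \<in> T" for s
    using s
  proof (rule T_E)
    fix V assume V: "((\<lambda>k. measure leb (ov (V k) k)) \<longlongrightarrow> s) \<omega>"
    show ?thesis
      by (rule tendsto_upperbound[OF V always_eventually nontriv]) (simp add: measure_leb_le_1)
  qed
  have T_bdd: "bdd_above T"
    using T_le by (auto simp: bdd_above_def)
  obtain s0 where s0: "((\<lambda>k. measure leb (ov (\<lambda>x. x) k)) \<longlongrightarrow> s0) \<omega>"
    by (rule measure_leb_ultralimit[OF \<omega>])
  have s0_T: "s0 \<in> T"
    unfolding T_def mem_Collect_eq by (rule exI[of _ "\<lambda>k x. x"], rule conjI, rule intertwines_id, rule s0)
  define m where "m = Sup T"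
  have le_m: "s \<le> m" if "s \<in> T" for s
    unfolding m_def by (rule cSup_upper[OF that T_bdd])
  have "\<exists>V s. intertwines \<omega> C V \<theta> \<theta> \<and> ((\<lambda>k. measure leb (ov (V k) k)) \<longlongrightarrow> s) \<omega> \<and> m - 1 / real (Suc j) < s" for j
  proof -
    obtain s where s: "s \<in> T" "m - 1 / real (Suc j) < s"
      using less_cSup_iff[of T "m - 1 / real (Suc j)"] s0_T T_bdd by (auto simp: m_def)
    from s(1) show ?thesis
    proof (rule T_E)
      fix V assume V: "intertwines \<omega> C V \<theta> \<theta>" "((\<lambda>k. measure leb (ov (V k) k)) \<longlongrightarrow> s) \<omega>"
      show ?thesis
        by (rule exI[of _ V], rule exI[of _ s], rule conjI, rule V, rule conjI, rule V, rule s)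
    qed
  qed
  then obtain Vs s where Vs: "\<And>j. intertwines \<omega> C (Vs j) \<theta> \<theta>"
    "\<And>j. ((\<lambda>k. measure leb (ov (Vs j k) k)) \<longlongrightarrow> s j) \<omega>" "\<And>j. m - 1 / real (Suc j) < s j"
    by metis
  \<comment> \<open>Commuting with the representation amounts to countably many conditions, which together with
    an almost maximal overlap are met by saturation.\<close>
  define e where "e = from_nat_into C"
  have e_C: "e j \<in> C" for j
    unfolding e_def by (rule from_nat_into[OF C(2)])
  define defect where "defect y i k = {x. y (\<theta> (e i) k x) \<noteq> \<theta> (e i) k (y x)}" for y i k
  have defect_borel: "defect y i k \<in> sets borel" if "y \<in> full_group" for y i k
  proof -
    note [measurable] = full_group_borel[OF that] full_group_borel[OF \<theta>]
    show ?thesis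
      unfolding defect_def by (rule borel_Collect) measurable
  qed
  define cond where "cond j k y \<longleftrightarrow> (\<forall>i\<le>j. measure leb (defect y i k) < 1 / real (Suc j)) \<and>
    m - 1 / real (Suc j) < measure leb (ov y k)" for j k y
  obtain V where V: "\<And>k. V k \<in> full_group" "\<And>j. eventually (\<lambda>k. cond j k (V k)) \<omega>"
  proof (rule ultraproduct_saturation[OF \<omega>, where S = full_group and P = cond])
    fix M
    have 1: "eventually (\<lambda>k. measure leb (defect (Vs M k) i k) < 1 / real (Suc M)) \<omega>" for i
    proof -
      have "((\<lambda>k. measure leb {x. \<not> (Vs M k (\<theta> (e i) k x) = \<theta> (e i) k (Vs M k x))}) \<longlongrightarrow> 0) \<omega>"
        by (rule almD[OF intertwinesD[OF Vs(1) e_C]])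
          (use defect_borel[OF intertwines_full_group[OF Vs(1)]] in \<open>simp add: defect_def\<close>)
      from order_tendstoD(2)[OF this, of "1 / real (Suc M)"] show ?thesis
        by (simp add: defect_def)
    qed
    have "eventually (\<lambda>k. \<forall>i\<in>{..M}. measure leb (defect (Vs M k) i k) < 1 / real (Suc M)) \<omega>"
      by (rule eventually_ball_finite) (use 1 in auto)
    moreover have "eventually (\<lambda>k. m - 1 / real (Suc M) < measure leb (ov (Vs M k) k)) \<omega>"
      by (rule order_tendstoD(1)[OF Vs(2,3)])
    ultimately show "eventually (\<lambda>k. \<exists>y\<in>full_group. \<forall>j<M. cond j k y) \<omega>"
    proof eventually_elim
      case (elim k)
      have "cond j k (Vs M k)" if j: "j < M" for j
      proof -
        have le: "1 / real (Suc M) \<le> 1 / real (Suc j)"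
          using j by (simp add: frac_le)
        show ?thesis
          unfolding cond_def
        proof (intro conjI allI impI)
          fix i assume "i \<le> j"
          then show "measure leb (defect (Vs M k) i k) < 1 / real (Suc j)"
            using elim(1) j le by (meson atMost_iff le_trans less_imp_le less_le_trans)
        qed (use elim(2) le in linarith)
      qed
      then show ?case
        using intertwines_full_group[OF Vs(1)] by blast
    qed
  qed (rule that)
  have small: "\<exists>j\<ge>i. 1 / real (Suc j) < e" if e: "0 < e" for e :: real and i
  proof -
    obtain j where "inverse (real (Suc j)) < e"
      using reals_Archimedean[OF e] by blast
    moreover have "1 / real (Suc (max i j)) \<le> inverse (real (Suc j))"
      by (simp add: divide_inverse)
    ultimately show ?thesis
      by (intro exI[of _ "max i j"]) linarith
  qed
  have VI: "intertwines \<omega> C V \<theta> \<theta>"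
    unfolding intertwines_def
  proof (intro conjI allI ballI V(1))
    fix g assume g: "g \<in> C"
    define i where "i = to_nat_on C g"
    have i: "e i = g"
      unfolding e_def i_def by (rule from_nat_into_to_nat_on[OF C(1) g])
    show "alm \<omega> (\<lambda>k x. V k (\<theta> g k x) = \<theta> g k (V k x))"
    proof (rule almI)
      show "{x. V k (\<theta> g k x) \<noteq> \<theta> g k (V k x)} \<in> sets borel" for k
        using defect_borel[OF V(1), of k i k] by (simp add: defect_def i)
      show "((\<lambda>k. measure leb {x. V k (\<theta> g k x) \<noteq> \<theta> g k (V k x)}) \<longlongrightarrow> 0) \<omega>"
      proof (rule tendstoI)
        fix \<epsilon> :: real assume "0 < \<epsilon>"
        then obtain j where j: "i \<le> j" "1 / real (Suc j) < \<epsilon>"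
          using small by meson
        show "eventually (\<lambda>k. dist (measure leb {x. V k (\<theta> g k x) \<noteq> \<theta> g k (V k x)}) 0 < \<epsilon>) \<omega>"
          using V(2)[of j]
        proof eventually_elim
          case (elim k)
          then have "measure leb (defect (V k) i k) < 1 / real (Suc j)"
            using j(1) unfolding cond_def by blast
          with j(2) show ?case
            by (simp add: defect_def i)
        qed
      qed
    qed
  qed
  obtain v where v: "((\<lambda>k. measure leb (ov (V k) k)) \<longlongrightarrow> v) \<omega>"
    by (rule measure_leb_ultralimit[OF \<omega>])
  have "m \<le> v"
  proof (rule field_le_epsilon)
    fix \<epsilon> :: real assume "0 < \<epsilon>"
    then obtain j where j: "1 / real (Suc j) < \<epsilon>"
      using small by meson
    have "eventually (\<lambda>k. m - \<epsilon> \<le> measure leb (ov (V k) k)) \<omega>"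
      using V(2)[of j] by eventually_elim (use j in \<open>auto simp: cond_def\<close>)
    from tendsto_lowerbound[OF v this nontriv] show "m \<le> v + \<epsilon>" by simp
  qed
  \<comment> \<open>Both leftovers have the same trace \<open>t - v\<close>.\<close>
  define P0 where "P0 k = {x. V k x \<in> P k}" for k
  have P0: "P0 \<in> invariant_sets \<omega> C \<theta>"
    unfolding P0_def by (rule invariant_sets_vimage[OF P VI])
  note [measurable] = invariant_sets_borel[OF P0]
  have p0: "((\<lambda>k. measure leb (P0 k)) \<longlongrightarrow> t) \<omega>"
    unfolding P0_def measure_leb_vimage[OF V(1) invariant_sets_borel[OF P]] by (rule p)
  have ov_eq: "ov (V k) k = Q k \<inter> P0 k" for k
    by (auto simp: ov_def P0_def)
  define Q' where "Q' k = Q k - P0 k" for k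
  define P' where "P' k = P0 k - Q k" for k
  have Q': "Q' \<in> invariant_sets \<omega> C \<theta>" and P': "P' \<in> invariant_sets \<omega> C \<theta>"
    unfolding Q'_def P'_def by (rule invariant_sets_Diff[OF Q P0], rule invariant_sets_Diff[OF P0 Q])
  have q': "((\<lambda>k. measure leb (Q' k)) \<longlongrightarrow> t - v) \<omega>"
    using tendsto_diff[OF q v] unfolding Q'_def ov_eq
    by (subst leb.finite_measure_Diff') auto
  have p': "((\<lambda>k. measure leb (P' k)) \<longlongrightarrow> t - v) \<omega>"
    using tendsto_diff[OF p0 v] unfolding P'_def ov_eq
    by (subst leb.finite_measure_Diff') (auto simp: Int_commute)
  have "t - v \<le> 0"
  proof (rule ccontr)
    assume "\<not> t - v \<le> 0"
    then have pos: "0 < t - v" by simp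
    obtain U where U: "intertwines \<omega> C U \<theta> \<theta>" "\<not> alm \<omega> (\<lambda>k x. x \<in> Q' k \<longrightarrow> U k x \<notin> P' k)"
      using ergodic_seq_moves[OF \<omega> erg \<theta> Q' P' q' pos p' pos] by (elim exE conjE) (rule that)
    \<comment> \<open>The part of the rest of \<open>Q\<close> that \<open>U\<close> moves into the rest of \<open>P\<close>, written with differences to make
      its invariance apparent.\<close>
    define E where "E k = Q' k - (Q' k - {x. U k x \<in> P' k})" for k
    have E_iff: "x \<in> E k \<longleftrightarrow> x \<in> Q' k \<and> U k x \<in> P' k" for k x
      by (auto simp: E_def)
    have UP': "(\<lambda>k. {x. U k x \<in> P' k}) \<in> invariant_sets \<omega> C \<theta>"
      by (rule invariant_sets_vimage[OF P' U(1)])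
    have E: "E \<in> invariant_sets \<omega> C \<theta>"
      unfolding E_def by (rule invariant_sets_Diff[OF Q' invariant_sets_Diff[OF Q' UP']])
    note [measurable] = invariant_sets_borel[OF E]
    obtain \<eta> where \<eta>: "((\<lambda>k. measure leb (E k)) \<longlongrightarrow> \<eta>) \<omega>" "0 \<le> \<eta>"
      by (rule measure_leb_ultralimit[OF \<omega>])
    have "\<eta> \<noteq> 0"
    proof
      assume "\<eta> = 0"
      with \<eta>(1) have "alm \<omega> (\<lambda>k x. x \<notin> E k)"
        by (subst alm_notin_iff) (simp_all add: invariant_sets_borel[OF E])
      then have "alm \<omega> (\<lambda>k x. x \<in> Q' k \<longrightarrow> U k x \<notin> P' k)"
        by (rule alm_mono) (simp add: E_iff)
      with U(2) show False ..
    qed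
    have disj: "U k x \<notin> E k" if "x \<in> E k" for k x
      using that by (auto simp: E_iff Q'_def P'_def)
    define W where "W k = swap_on (U k) (E k)" for k
    have W: "intertwines \<omega> C W \<theta> \<theta>"
      unfolding W_def by (rule swap_on_intertwines[OF U(1) E disj])
    have VW: "intertwines \<omega> C (\<lambda>k x. V k (W k x)) \<theta> \<theta>"
      by (rule intertwines_comp[OF W VI])
    have sub: "ov (V k) k \<union> E k \<subseteq> ov (\<lambda>x. V k (W k x)) k" for k
    proof
      fix x assume "x \<in> ov (V k) k \<union> E k"
      then consider "x \<in> E k" | "x \<in> Q k \<inter> P0 k" by (auto simp: ov_eq)
      then show "x \<in> ov (\<lambda>x. V k (W k x)) k"
      proof cases
        case 1
        then have "W k x \<in> P0 k" "x \<in> Q k"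
          by (auto simp: W_def swap_on_def E_iff P'_def Q'_def)
        then show ?thesis by (simp add: ov_def P0_def)
      next
        case 2
        then have "x \<notin> E k" "finv (U k) x \<notin> E k"
          using intertwines_full_group[OF U(1), of k] by (auto simp: E_iff P'_def Q'_def)
        then have "W k x = x"
          by (simp add: W_def swap_on_def)
        with 2 show ?thesis by (simp add: ov_def P0_def)
      qed
    qed
    have "measure leb (ov (V k) k \<union> E k) = measure leb (ov (V k) k) + measure leb (E k)" for k
      by (rule leb.finite_measure_Union) (auto simp: ov_eq E_iff Q'_def)
    with tendsto_add[OF v \<eta>(1)] have vE: "((\<lambda>k. measure leb (ov (V k) k \<union> E k)) \<longlongrightarrow> v + \<eta>) \<omega>"
      by simp
    obtain w where w: "((\<lambda>k. measure leb (ov (\<lambda>x. V k (W k x)) k)) \<longlongrightarrow> w) \<omega>"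
      by (rule measure_leb_ultralimit[OF \<omega>])
    have "v + \<eta> \<le> w"
      by (rule tendsto_le[OF nontriv w vE])
        (intro always_eventually allI leb.finite_measure_mono sub,
          use ov_borel[OF intertwines_full_group[OF VW]] in simp)
    moreover have "w \<in> T"
      unfolding T_def mem_Collect_eq
      by (rule exI[of _ "\<lambda>k x. V k (W k x)"], rule conjI, rule VW, rule w)
    then have "w \<le> m" by (rule le_m)
    ultimately show False
      using \<open>m \<le> v\<close> \<open>\<eta> \<noteq> 0\<close> \<eta>(2) by linarith
  qed
  moreover have "0 \<le> t - v"
    by (rule tendsto_lowerbound[OF q' always_eventually nontriv]) simp
  ultimately have z: "t - v = 0" by simp
  have "alm \<omega> (\<lambda>k x. x \<notin> Q' k)"
    by (subst alm_notin_iff) (use q' z invariant_sets_borel[OF Q'] in simp_all)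
  moreover have "alm \<omega> (\<lambda>k x. x \<notin> P' k)"
    by (subst alm_notin_iff) (use p' z invariant_sets_borel[OF P'] in simp_all)
  ultimately have "alm \<omega> (\<lambda>k x. x \<in> Q k \<longleftrightarrow> V k x \<in> P k)"
    by (rule alm_mono2) (auto simp: Q'_def P'_def P0_def)
  with VI have "intertwines \<omega> C V \<theta> \<theta> \<and> alm \<omega> (\<lambda>k x. x \<in> Q k \<longleftrightarrow> V k x \<in> P k)" ..
  then show ?thesis
    by (rule exI[of _ V])
qed

section \<open>Sequences of rational cut points\<close>

definition rational_cuts :: "nat filter \<Rightarrow> (nat \<Rightarrow> real) \<Rightarrow> real \<Rightarrow> bool" where
  "rational_cuts \<omega> c l \<longleftrightarrow> 0 < l \<and> l < 1 \<and> (\<forall>k. 0 < c k \<and> c k < 1 \<and> c k \<in> \<rat>) \<and> (c \<longlongrightarrow> l) \<omega>"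

lemma rational_cutsD:
  assumes "rational_cuts \<omega> c l"
  shows "0 < l" "l < 1" "\<And>k. 0 < c k" "\<And>k. c k < 1" "\<And>k. c k \<in> \<rat>" "(c \<longlongrightarrow> l) \<omega>"
  using assms by (auto simp: rational_cuts_def)

abbreviation glue_rep ::
  "(nat \<Rightarrow> real) \<Rightarrow> ('g \<Rightarrow> nat \<Rightarrow> real \<Rightarrow> real) \<Rightarrow> ('g \<Rightarrow> nat \<Rightarrow> real \<Rightarrow> real) \<Rightarrow> 'g \<Rightarrow> nat \<Rightarrow> real \<Rightarrow> real" where
  "glue_rep c \<theta>1 \<theta>2 \<equiv> (\<lambda>g k. glue (c k) (\<theta>1 g k) (\<theta>2 g k))"

lemma inverse_Suc_ultralimit: "free_ultrafilter \<omega> \<Longrightarrow> ((\<lambda>k. 1 / real (Suc k)) \<longlongrightarrow> 0) \<omega>"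
  using LIMSEQ_imp_ultralimit[OF _ LIMSEQ_inverse_real_of_nat] by (simp add: divide_inverse)

text \<open>The cost of moving the initial interval onto a projection is the difference of the measures,
  which tends to 0 if the projection has trace \<open>l\<close>.\<close>

lemma move_interval_seq:
  assumes \<omega>: "free_ultrafilter \<omega>" and c: "rational_cuts \<omega> c l"
    and P: "\<And>k. P k \<in> sets borel" "((\<lambda>k. measure leb (P k)) \<longlongrightarrow> l) \<omega>"
  obtains S where "\<And>k. S k \<in> full_group" "alm \<omega> (\<lambda>k x. x \<in> {0..<1} \<longrightarrow> (S k x \<in> P k \<longleftrightarrow> x < c k))"
proof -
  define good where "good k S \<longleftrightarrow> (\<exists>B\<in>sets borel. {x \<in> {0..<1}. (S x \<in> P k) \<noteq> (x < c k)} \<subseteq> B \<and>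
      measure leb B \<le> \<bar>measure leb (P k) - c k\<bar> + 1 / real (Suc k))" for k S
  have "\<exists>S\<in>full_group. good k S" for k
    unfolding good_def
    by (rule full_group_moves_interval_onto[OF P(1) rational_cutsD(5)[OF c]])
      (rule less_imp_le rational_cutsD[OF c] | simp)+
  then obtain S where S: "\<And>k. S k \<in> full_group" "\<And>k. good k (S k)"
    by metis
  have eq: "{x. \<not> (x \<in> {0..<1} \<longrightarrow> (S k x \<in> P k \<longleftrightarrow> x < c k))} = {x \<in> {0..<1}. (S k x \<in> P k) \<noteq> (x < c k)}" for k
    by auto
  have "((\<lambda>k. \<bar>measure leb (P k) - c k\<bar> + 1 / real (Suc k)) \<longlongrightarrow> \<bar>l - l\<bar> + 0) \<omega>"
    by (intro tendsto_add tendsto_rabs tendsto_diff P(2) rational_cutsD[OF c] inverse_Suc_ultralimit[OF \<omega>])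
  then have "alm \<omega> (\<lambda>k x. x \<in> {0..<1} \<longrightarrow> (S k x \<in> P k \<longleftrightarrow> x < c k))"
    by (intro alm_of_bound[where f = "\<lambda>k. \<bar>measure leb (P k) - c k\<bar> + 1 / real (Suc k)"])
      (unfold eq, rule S(2)[unfolded good_def], simp)
  with S(1) show ?thesis
    by (rule that)
qed

text \<open>The cost of restoring exact preservation of the cut is the measure of the set where it fails,
  which tends to 0.\<close>

lemma unglue_seq:
  assumes \<omega>: "free_ultrafilter \<omega>" and c: "rational_cuts \<omega> c l"
    and T: "\<And>k. T k \<in> full_group" "alm \<omega> (\<lambda>k x. x \<in> {0..<1} \<longrightarrow> (T k x < c k \<longleftrightarrow> x < c k))"
  obtains T1 T2 where "\<And>k. T1 k \<in> full_group" "\<And>k. T2 k \<in> full_group"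
    "alm \<omega> (\<lambda>k x. T k x = glue (c k) (T1 k) (T2 k) x)"
proof -
  define D where "D k = {x \<in> {0..<1}. (T k x < c k) \<noteq> (x < c k)}" for k
  have "\<exists>T1 T2. T1 \<in> full_group \<and> T2 \<in> full_group \<and>
      measure leb {x. T k x \<noteq> glue (c k) T1 T2 x} \<le> measure leb (D k) + 1 / real (Suc k)" for k
  proof -
    obtain T' where T': "T' \<in> full_group" "\<And>x. x \<in> {0..<1} \<Longrightarrow> T' x < c k \<longleftrightarrow> x < c k"
      "measure leb {x. T k x \<noteq> T' x} \<le> measure leb (D k) + 1 / real (Suc k)"
      using full_group_almost_preserving[OF T(1) rational_cutsD(5)[OF c, of k] less_imp_le[OF rational_cutsD(3)[OF c]]
          less_imp_le[OF rational_cutsD(4)[OF c]], of "1 / real (Suc k)" k]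
      unfolding D_def by auto
    obtain T1 T2 where "T1 \<in> full_group" "T2 \<in> full_group" "T' = glue (c k) T1 T2"
      by (rule unglue[OF rational_cutsD(3-5)[OF c] T'(1,2)])
    with T'(3) show ?thesis by blast
  qed
  then obtain T1 T2 where T12: "\<And>k. T1 k \<in> full_group" "\<And>k. T2 k \<in> full_group"
    "\<And>k. measure leb {x. T k x \<noteq> glue (c k) (T1 k) (T2 k) x} \<le> measure leb (D k) + 1 / real (Suc k)"
    by metis
  note g = glue_full_group[OF rational_cutsD(3-5)[OF c] T12(1,2)]
  note [measurable] = full_group_borel[OF T(1)] full_group_borel[OF g]
  have eq: "{x. \<not> (x \<in> {0..<1} \<longrightarrow> (T k x < c k \<longleftrightarrow> x < c k))} = D k" for k
    by (auto simp: D_def)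
  have "{x. \<not> (x \<in> {0..<1} \<longrightarrow> (T k x < c k \<longleftrightarrow> x < c k))} \<in> sets borel" for k
    by (rule borel_Collect) measurable
  from almD[OF T(2) this] have "((\<lambda>k. measure leb (D k)) \<longlongrightarrow> 0) \<omega>"
    by (simp only: eq)
  from tendsto_add[OF this inverse_Suc_ultralimit[OF \<omega>]]
  have lim: "((\<lambda>k. measure leb (D k) + 1 / real (Suc k)) \<longlongrightarrow> 0) \<omega>"
    by simp
  have "alm \<omega> (\<lambda>k x. T k x = glue (c k) (T1 k) (T2 k) x)"
  proof (rule alm_of_bound[OF _ lim])
    fix k
    have "{x. T k x \<noteq> glue (c k) (T1 k) (T2 k) x} \<in> sets borel"
      by (rule borel_Collect) measurable
    then show "\<exists>B\<in>sets borel. {x. T k x \<noteq> glue (c k) (T1 k) (T2 k) x} \<subseteq> B \<and>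
        measure leb B \<le> measure leb (D k) + 1 / real (Suc k)"
      using T12(3) by blast
  qed
  with T12(1,2) show ?thesis
    by (rule that)
qed

lemma block_representation:
  assumes \<omega>: "free_ultrafilter \<omega>" and C: "countable C" and \<theta>: "\<And>g k. \<theta> g k \<in> full_group"
  obtains n :: "nat \<Rightarrow> nat" and \<sigma> :: "'g \<Rightarrow> nat \<Rightarrow> nat \<Rightarrow> nat"
  where "\<And>k. 0 < n k" "\<And>g k. bij_betw (\<sigma> g k) {..<n k} {..<n k}"
    "\<And>g. g \<in> C \<Longrightarrow> alm \<omega> (\<lambda>k x. \<theta> g k x = block_perm (n k) (\<sigma> g k) x)"
proof -
  have fg: "\<theta> (from_nat_into C j) k \<in> full_group" for j k
    by (rule \<theta>)
  obtain n :: "nat \<Rightarrow> nat" and \<sigma> :: "nat \<Rightarrow> nat \<Rightarrow> nat \<Rightarrow> nat"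
    where n: "\<And>k. 0 < n k" "\<And>j k. bij_betw (\<sigma> j k) {..<n k} {..<n k}"
    "\<And>j. alm \<omega> (\<lambda>k x. \<theta> (from_nat_into C j) k x = block_perm (n k) (\<sigma> j k) x)"
    by (rule common_block_representation[where T = "\<lambda>j. \<theta> (from_nat_into C j)", OF \<omega> fg]) blast
  show ?thesis
  proof (rule that[of n "\<lambda>g. \<sigma> (to_nat_on C g)"])
    fix g assume "g \<in> C"
    from n(3)[of "to_nat_on C g"] show "alm \<omega> (\<lambda>k x. \<theta> g k x = block_perm (n k) (\<sigma> (to_nat_on C g) k) x)"
      unfolding from_nat_into_to_nat_on[OF C \<open>g \<in> C\<close>] .
  qed (rule n)+
qed

lemma intertwines_cong:
  assumes U: "intertwines \<omega> C U \<theta> \<theta>'"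
    and eq: "\<And>g. g \<in> C \<Longrightarrow> alm \<omega> (\<lambda>k x. \<theta> g k x = \<rho> g k x)"
    and eq': "\<And>g. g \<in> C \<Longrightarrow> alm \<omega> (\<lambda>k x. \<theta>' g k x = \<rho>' g k x)"
  shows "intertwines \<omega> C U \<rho> \<rho>'"
  unfolding intertwines_def
proof (intro conjI allI ballI)
  show "U k \<in> full_group" for k
    by (rule intertwines_full_group[OF U])
  fix g assume g: "g \<in> C"
  show "alm \<omega> (\<lambda>k x. U k (\<rho> g k x) = \<rho>' g k (U k x))"
    by (rule alm_mono3[OF eq[OF g] alm_intertwines[OF eq'[OF g] U] intertwinesD[OF U g]]) simp
qed

lemma alm_refl: "alm \<omega> (\<lambda>k x. T k x = T k x)"
  by (rule alm_all) simp

lemma intertwines_glue: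
  assumes c: "rational_cuts \<omega> c l" and U: "intertwines \<omega> C U1 \<theta>1 \<theta>1'" "intertwines \<omega> C U2 \<theta>2 \<theta>2'"
    and fg: "\<And>g k. \<theta>1 g k \<in> full_group" "\<And>g k. \<theta>2 g k \<in> full_group"
  shows "intertwines \<omega> C (\<lambda>k. glue (c k) (U1 k) (U2 k)) (glue_rep c \<theta>1 \<theta>2) (glue_rep c \<theta>1' \<theta>2')"
  unfolding intertwines_def
proof (intro conjI allI ballI)
  note c' = rational_cutsD[OF c]
  show "glue (c k) (U1 k) (U2 k) \<in> full_group" for k
    by (rule glue_full_group[OF c'(3-5) intertwines_full_group[OF U(1)] intertwines_full_group[OF U(2)]])
  fix g assume g: "g \<in> C"
  show "alm \<omega> (\<lambda>k x. glue (c k) (U1 k) (U2 k) (glue (c k) (\<theta>1 g k) (\<theta>2 g k) x) =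
      glue (c k) (\<theta>1' g k) (\<theta>2' g k) (glue (c k) (U1 k) (U2 k) x))"
    unfolding glue_comp[OF c'(3,4) fg] glue_comp[OF c'(3,4) intertwines_full_group[OF U(1)] intertwines_full_group[OF U(2)]]
    by (rule alm_glueI[where c = c, OF c'(3,4) intertwinesD[OF U(1) g] intertwinesD[OF U(2) g]])
qed

lemma intertwines_unglue:
  assumes c: "rational_cuts \<omega> c l"
    and U: "intertwines \<omega> C (\<lambda>k. glue (c k) (U1 k) (U2 k)) (glue_rep c \<theta>1 \<theta>2) (glue_rep c \<theta>1' \<theta>2')"
    and fgU: "\<And>k. U1 k \<in> full_group" "\<And>k. U2 k \<in> full_group"
    and fg: "\<And>g k. \<theta>1 g k \<in> full_group" "\<And>g k. \<theta>2 g k \<in> full_group"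
  shows "intertwines \<omega> C U1 \<theta>1 \<theta>1'" "intertwines \<omega> C U2 \<theta>2 \<theta>2'"
proof -
  note c' = rational_cutsD[OF c]
  have "alm \<omega> (\<lambda>k x. glue (c k) (\<lambda>x. U1 k (\<theta>1 g k x)) (\<lambda>x. U2 k (\<theta>2 g k x)) x =
      glue (c k) (\<lambda>x. \<theta>1' g k (U1 k x)) (\<lambda>x. \<theta>2' g k (U2 k x)) x)" if g: "g \<in> C" for g
    using intertwinesD[OF U g] unfolding glue_comp[OF c'(3,4) fg] glue_comp[OF c'(3,4) fgU] .
  note eq = alm_glueD[where c = c, OF c'(3,4,6,1,2) this]
  show "intertwines \<omega> C U1 \<theta>1 \<theta>1'" "intertwines \<omega> C U2 \<theta>2 \<theta>2'"
    unfolding intertwines_def by (intro conjI allI ballI fgU eq, assumption)+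
qed

text \<open>For block permutations collecting gives an exact conjugacy, and \<open>\<theta>\<close> agrees with block permutations
  asymptotically almost everywhere. Thus \<open>\<theta>\<close> absorbs a second copy of itself, whatever the weight.\<close>

lemma collect_intertwines:
  assumes c: "rational_cuts \<omega> c l" and n: "\<And>k. 0 < n k"
    and \<sigma>: "\<And>g k. bij_betw (\<sigma> g k) {..<n k} {..<n k}"
    and eq: "\<And>g. g \<in> C \<Longrightarrow> alm \<omega> (\<lambda>k x. \<theta> g k x = block_perm (n k) (\<sigma> g k) x)"
  shows "intertwines \<omega> C (\<lambda>k. collect (n k) (c k)) \<theta> (glue_rep c \<theta> \<theta>)"
proof -
  note c' = rational_cutsD[OF c]
  let ?\<beta> = "\<lambda>g k. block_perm (n k) (\<sigma> g k)"
  have "intertwines \<omega> C (\<lambda>k. collect (n k) (c k)) ?\<beta> (glue_rep c ?\<beta> ?\<beta>)"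
    unfolding intertwines_def glue_collect[OF n c'(3,4) \<sigma>]
    by (intro conjI allI ballI alm_refl collect_full_group n c')
  moreover have eq': "alm \<omega> (\<lambda>k x. ?\<beta> g k x = \<theta> g k x)" if "g \<in> C" for g
    by (rule alm_mono[OF eq[OF that]]) simp
  ultimately show ?thesis
    by (rule intertwines_cong) (assumption | rule eq' | rule alm_glueI[where c = c, OF c'(3,4)])+
qed

section \<open>Ergodic representations are extreme\<close>

text \<open>Both \<open>\<theta>1 \<oplus> \<theta>2\<close> and \<open>\<theta> \<oplus> \<theta>\<close>, with the same weight, are conjugate to \<open>\<theta>\<close>. The two projections
  onto the first summand are conjugate by an element commuting with \<open>\<theta>\<close>, so some element
  conjugates the one direct sum to the other and respects the summands.\<close>

theorem ergodic_imp_conj_summands: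
  assumes \<omega>: "free_ultrafilter \<omega>" and C: "countable C" "C \<noteq> {}" and c: "rational_cuts \<omega> c l"
    and erg: "ergodic_seq \<omega> C \<theta>" and \<theta>: "\<And>g k. \<theta> g k \<in> full_group"
    and fg: "\<And>g k. \<theta>1 g k \<in> full_group" "\<And>g k. \<theta>2 g k \<in> full_group"
    and conj: "conj_seq \<omega> C \<theta> (glue_rep c \<theta>1 \<theta>2)"
  shows "conj_seq \<omega> C \<theta> \<theta>1" "conj_seq \<omega> C \<theta> \<theta>2"
proof -
  note c' = rational_cutsD[OF c]
  from conj obtain S where S: "intertwines \<omega> C S \<theta> (glue_rep c \<theta>1 \<theta>2)"
    unfolding conj_seq_def by (elim exE) (rule that)
  obtain n \<sigma> where n: "\<And>k. 0 < n k" "\<And>g k. bij_betw (\<sigma> g k) {..<n k} {..<n k}"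
    "\<And>g. g \<in> C \<Longrightarrow> alm \<omega> (\<lambda>k x. \<theta> g k x = block_perm (n k) (\<sigma> g k) x)"
    by (rule block_representation[where \<theta> = \<theta>, OF \<omega> C(1) \<theta>]) blast
  define K where "K k = collect (n k) (c k)" for k
  have K: "intertwines \<omega> C K \<theta> (glue_rep c \<theta> \<theta>)"
    unfolding K_def by (rule collect_intertwines[where n = n and \<sigma> = \<sigma>, OF c n])
  have lo: "(\<lambda>k. {0..<c k}) \<in> invariant_sets \<omega> C (glue_rep c \<rho>1 \<rho>2)"
    if "\<And>g k. \<rho>1 g k \<in> full_group" "\<And>g k. \<rho>2 g k \<in> full_group" for \<rho>1 \<rho>2
  proof (rule invariant_setsI)
    fix g
    show "alm \<omega> (\<lambda>k x. glue (c k) (\<rho>1 g k) (\<rho>2 g k) x \<in> {0..<c k} \<longleftrightarrow> x \<in> {0..<c k})"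
    proof (rule alm_all)
      fix k and x :: real assume x: "x \<in> {0..<1}"
      then have "glue (c k) (\<rho>1 g k) (\<rho>2 g k) x \<in> {0..<1}"
        by (subst full_group_unit_iff[OF glue_full_group[OF c'(3-5) that]])
      then show "glue (c k) (\<rho>1 g k) (\<rho>2 g k) x \<in> {0..<c k} \<longleftrightarrow> x \<in> {0..<c k}"
        using glue_less_iff[OF c'(3,4) that x] x by auto
    qed
  qed simp
  define P where "P k = {x. S k x \<in> {0..<c k}}" for k
  define Q where "Q k = {x. K k x \<in> {0..<c k}}" for k
  have P: "P \<in> invariant_sets \<omega> C \<theta>" and Q: "Q \<in> invariant_sets \<omega> C \<theta>"
    unfolding P_def Q_def by (rule invariant_sets_vimage[OF lo[OF fg] S], rule invariant_sets_vimage[OF lo[OF \<theta> \<theta>] K])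
  have mc: "measure leb {0..<c k} = c k" for k
    using measure_leb_interval[of 0 "c k"] less_imp_le[OF c'(3)[of k]] less_imp_le[OF c'(4)[of k]] by simp
  have "measure leb (P k) = measure leb {0..<c k}" "measure leb (Q k) = measure leb {0..<c k}" for k
    unfolding P_def Q_def
    by (rule measure_leb_vimage[OF intertwines_full_group[OF S]], simp,
      rule measure_leb_vimage[OF intertwines_full_group[OF K]], simp)
  then have lims: "((\<lambda>k. measure leb (P k)) \<longlongrightarrow> l) \<omega>" "((\<lambda>k. measure leb (Q k)) \<longlongrightarrow> l) \<omega>"
    using c'(6) by (simp_all only: mc)
  obtain V where V: "intertwines \<omega> C V \<theta> \<theta>" "alm \<omega> (\<lambda>k x. x \<in> Q k \<longleftrightarrow> V k x \<in> P k)"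
    using ergodic_seq_transitive[OF \<omega> C erg \<theta> Q P lims(2,1)] by (elim exE conjE) (rule that)
  \<comment> \<open>Go back from \<open>\<theta> \<oplus> \<theta>\<close> to \<open>\<theta>\<close>, match the two projections, and pass to \<open>\<theta>1 \<oplus> \<theta>2\<close>.\<close>
  define W where "W k x = S k (V k (finv (K k) x))" for k x
  have W: "intertwines \<omega> C W (glue_rep c \<theta> \<theta>) (glue_rep c \<theta>1 \<theta>2)"
    unfolding W_def by (rule intertwines_comp[OF intertwines_comp[OF intertwines_inv[OF K] V(1)] S])
  note Wfg = intertwines_full_group[OF W]
  have Wc: "alm \<omega> (\<lambda>k x. x \<in> {0..<1} \<longrightarrow> (W k x < c k \<longleftrightarrow> x < c k))"
  proof (rule alm_mono[OF alm_intertwines[OF V(2) intertwines_inv[OF K]]])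
    fix k x assume *: "finv (K k) x \<in> Q k \<longleftrightarrow> V k (finv (K k) x) \<in> P k"
    show "x \<in> {0..<1} \<longrightarrow> (W k x < c k \<longleftrightarrow> x < c k)"
    proof
      assume x: "x \<in> {0..<1}"
      moreover from x have "W k x \<in> {0..<1}"
        by (subst full_group_unit_iff[OF Wfg])
      ultimately show "W k x < c k \<longleftrightarrow> x < c k"
        using * by (simp add: P_def Q_def W_def intertwines_full_group[OF K])
    qed
  qed
  obtain W1 W2 where W12: "\<And>k. W1 k \<in> full_group" "\<And>k. W2 k \<in> full_group"
    "alm \<omega> (\<lambda>k x. W k x = glue (c k) (W1 k) (W2 k) x)"
    by (rule unglue_seq[where T = W, OF \<omega> c Wfg Wc]) blast
  let ?W' = "\<lambda>k. glue (c k) (W1 k) (W2 k)"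
  have W': "intertwines \<omega> C ?W' (glue_rep c \<theta> \<theta>) (glue_rep c \<theta>1 \<theta>2)"
    unfolding intertwines_def
  proof (intro conjI allI ballI)
    show "?W' k \<in> full_group" for k
      by (rule glue_full_group[OF c'(3-5) W12(1,2)])
    fix g assume g: "g \<in> C"
    have "alm \<omega> (\<lambda>k x. W k (glue (c k) (\<theta> g k) (\<theta> g k) x) = ?W' k (glue (c k) (\<theta> g k) (\<theta> g k) x))"
      by (rule alm_vimage[OF W12(3), where T = "\<lambda>k. glue (c k) (\<theta> g k) (\<theta> g k)"])
        (rule glue_full_group[OF c'(3-5) \<theta> \<theta>])
    from alm_mono3[OF this W12(3) intertwinesD[OF W g]]
    show "alm \<omega> (\<lambda>k x. ?W' k (glue (c k) (\<theta> g k) (\<theta> g k) x) = glue (c k) (\<theta>1 g k) (\<theta>2 g k) (?W' k x))"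
      by simp
  qed
  note Wi = intertwines_unglue[OF c W' W12(1,2) \<theta> \<theta>]
  show "conj_seq \<omega> C \<theta> \<theta>1" "conj_seq \<omega> C \<theta> \<theta>2"
    unfolding conj_seq_def by (rule exI[of _ W1], rule Wi(1), rule exI[of _ W2], rule Wi(2))
qed

section \<open>Extreme representations are ergodic\<close>

text \<open>If \<open>c \<le> 1/2\<close>, the half turn carries the part of every block below the cut at \<open>c\<close> above it; if
  \<open>c > 1/2\<close>, it carries the part above the cut below it. In both cases a set of measure
  \<open>min c (1 - c)\<close> changes sides.\<close>

lemma half_turn_moves:
  assumes \<omega>: "free_ultrafilter \<omega>" and c: "rational_cuts \<omega> c l" and n: "\<And>k. 0 < n k"
  shows "\<not> alm \<omega> (\<lambda>k x. x \<in> {0..<1} \<longrightarrow>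
    (half_turn (frac (real (n k) * x)) < c k \<longleftrightarrow> frac (real (n k) * x) < c k))"
proof
  note c' = rational_cutsD[OF c]
  assume *: "alm \<omega> (\<lambda>k x. x \<in> {0..<1} \<longrightarrow>
    (half_turn (frac (real (n k) * x)) < c k \<longleftrightarrow> frac (real (n k) * x) < c k))"
  define J where "J k = (if c k \<le> 1 / 2 then {0..<c k} else {c k..<1})" for k
  \<comment> \<open>\<open>B\<close> is the union over all blocks of the part that changes sides.\<close>
  define B where "B k = {x. collect (n k) (c k) x \<in> J k}" for k
  have J: "J k \<in> sets borel" for k
    by (simp add: J_def)
  note fg = collect_full_group[OF n c'(3-5)]
  have "alm \<omega> (\<lambda>k x. x \<notin> B k)"
  proof (rule alm_mono[OF *], rule notI)
    fix k x
    assume h: "x \<in> {0..<1} \<longrightarrow> (half_turn (frac (real (n k) * x)) < c k \<longleftrightarrow> frac (real (n k) * x) < c k)"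
      and x: "x \<in> B k"
    have "J k \<subseteq> {0..<1}"
      using c'(3,4)[of k] by (auto simp: J_def)
    then have "collect (n k) (c k) x \<in> {0..<1}"
      using x by (auto simp: B_def)
    then have x01: "x \<in> {0..<1}"
      by (simp only: full_group_unit_iff[OF fg])
    have f: "0 \<le> frac (real (n k) * x)" "frac (real (n k) * x) < 1"
      by (simp_all add: frac_lt_1)
    note iff = collect_less_iff[OF n c'(3,4) x01, of k k]
    show False
    proof (cases "c k \<le> 1 / 2")
      case True
      then have "frac (real (n k) * x) < c k"
        using x iff by (simp add: B_def J_def)
      then show ?thesis
        using h x01 half_turn_ge[OF f(1) _ True] by force
    next
      case False
      then have "c k \<le> frac (real (n k) * x)"
        using x iff by (auto simp: B_def J_def)
      then show ?thesis
        using h x01 half_turn_less[OF _ _ f(2), of "c k"] False by force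
    qed
  qed
  then have "((\<lambda>k. measure leb (B k)) \<longlongrightarrow> 0) \<omega>"
    by (subst (asm) alm_notin_iff) (simp_all add: B_def borel_vimage_full_group[OF fg J])
  moreover have "min (c k) (1 - c k) \<le> measure leb (B k)" for k
  proof -
    have "measure leb (B k) = measure leb (J k)"
      unfolding B_def by (rule measure_leb_vimage[OF fg J])
    also have "\<dots> = (if c k \<le> 1 / 2 then c k else 1 - c k)"
      unfolding J_def using c'(3,4)[of k] by (simp add: measure_leb_interval)
    finally show ?thesis by auto
  qed
  ultimately have "min l (1 - l) \<le> 0"
    by (intro tendsto_le[OF free_ultrafilter_nontrivial[OF \<omega>] _ tendsto_min[OF c'(6) tendsto_diff[OF tendsto_const c'(6)]]])
      (auto intro: always_eventually)
  then show False
    using c'(1,2) by auto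
qed

text \<open>An invariant projection \<open>P\<close> of trace \<open>l\<close> splits \<open>\<theta>\<close> into a direct sum with weight \<open>l\<close>. If both
  summands are conjugate to \<open>\<theta>\<close>, this becomes the decomposition of \<open>\<theta>\<close> given by cutting every block
  at \<open>l\<close>, and a commuting element moves its first summand.\<close>

lemma extreme_zero_one:
  fixes G :: "('g, 'b) monoid_scheme"
  assumes \<omega>: "free_ultrafilter \<omega>" and C: "countable (carrier G)" and c: "rational_cuts \<omega> c l"
    and G: "\<And>g h. g \<in> carrier G \<Longrightarrow> h \<in> carrier G \<Longrightarrow> g \<otimes>\<^bsub>G\<^esub> h \<in> carrier G"
    and \<theta>: "sofic_seq \<omega> G \<theta>"
    and ext: "\<And>\<theta>1 \<theta>2. sofic_seq \<omega> G \<theta>1 \<Longrightarrow> sofic_seq \<omega> G \<theta>2 \<Longrightarrow>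
      conj_seq \<omega> (carrier G) \<theta> (glue_rep c \<theta>1 \<theta>2) \<Longrightarrow>
      conj_seq \<omega> (carrier G) \<theta> \<theta>1 \<and> conj_seq \<omega> (carrier G) \<theta> \<theta>2"
    and P: "P \<in> invariant_sets \<omega> (carrier G) \<theta>" "((\<lambda>k. measure leb (P k)) \<longlongrightarrow> l) \<omega>"
    and inv: "\<And>U. intertwines \<omega> (carrier G) U \<theta> \<theta> \<Longrightarrow> alm \<omega> (\<lambda>k x. U k x \<in> P k \<longleftrightarrow> x \<in> P k)"
  shows False
proof -
  let ?C = "carrier G"
  note c' = rational_cutsD[OF c]
  have fg: "\<theta> g k \<in> full_group" for g k
    using \<theta> by (simp add: sofic_seq_def)
  \<comment> \<open>Conjugate so that \<open>P\<close> becomes the initial interval.\<close>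
  obtain S where S: "\<And>k. S k \<in> full_group" "alm \<omega> (\<lambda>k x. x \<in> {0..<1} \<longrightarrow> (S k x \<in> P k \<longleftrightarrow> x < c k))"
    by (rule move_interval_seq[where P = P, OF \<omega> c invariant_sets_borel[OF P(1)] P(2)]) blast
  note Si = full_group_inv[OF S(1)]
  define \<theta>' where "\<theta>' g k x = finv (S k) (\<theta> g k (S k x))" for g k x
  have \<theta>': "\<theta>' g k \<in> full_group" for g k
    unfolding \<theta>'_def by (rule full_group_comp[OF Si full_group_comp[OF fg S(1)]])
  have S\<theta>': "S k (\<theta>' g k x) = \<theta> g k (S k x)" for g k x
    using S(1) by (simp add: \<theta>'_def)
  have pres: "alm \<omega> (\<lambda>k x. x \<in> {0..<1} \<longrightarrow> (\<theta>' g k x < c k \<longleftrightarrow> x < c k))" if g: "g \<in> ?C" for g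
  proof (rule alm_mono3)
    show "alm \<omega> (\<lambda>k x. x \<in> {0..<1} \<longrightarrow> (S k x \<in> P k \<longleftrightarrow> x < c k))"
      by (rule S(2))
    show "alm \<omega> (\<lambda>k x. \<theta>' g k x \<in> {0..<1} \<longrightarrow> (S k (\<theta>' g k x) \<in> P k \<longleftrightarrow> \<theta>' g k x < c k))"
      by (rule alm_vimage[OF S(2), where T = "\<theta>' g"], rule \<theta>')
    show "alm \<omega> (\<lambda>k x. \<theta> g k (S k x) \<in> P k \<longleftrightarrow> S k x \<in> P k)"
      by (rule alm_vimage[OF invariant_setsD[OF P(1) g], where T = S], rule S)
    fix k x
    assume "x \<in> {0..<1} \<longrightarrow> (S k x \<in> P k \<longleftrightarrow> x < c k)"
      and "\<theta>' g k x \<in> {0..<1} \<longrightarrow> (S k (\<theta>' g k x) \<in> P k \<longleftrightarrow> \<theta>' g k x < c k)"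
      and "\<theta> g k (S k x) \<in> P k \<longleftrightarrow> S k x \<in> P k"
    then show "x \<in> {0..<1} \<longrightarrow> (\<theta>' g k x < c k \<longleftrightarrow> x < c k)"
      unfolding S\<theta>' full_group_unit_iff[OF \<theta>'] by blast
  qed
  \<comment> \<open>Off the carrier of the group the summands are given an arbitrary value in the full group.\<close>
  define splits where "splits g p \<longleftrightarrow> (\<forall>k. fst p k \<in> full_group \<and> snd p k \<in> full_group) \<and>
    (g \<in> ?C \<longrightarrow> alm \<omega> (\<lambda>k x. \<theta>' g k x = glue (c k) (fst p k) (snd p k) x))" for g p
  have "\<exists>p. splits g p" for g
  proof (cases "g \<in> ?C")
    case True
    obtain T1 T2 where T: "\<And>k. T1 k \<in> full_group" "\<And>k. T2 k \<in> full_group"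
      "alm \<omega> (\<lambda>k x. \<theta>' g k x = glue (c k) (T1 k) (T2 k) x)"
      by (rule unglue_seq[where T = "\<theta>' g", OF \<omega> c \<theta>' pres[OF True]]) blast
    have "splits g (T1, T2)"
      unfolding splits_def fst_conv snd_conv using T by simp
    then show ?thesis ..
  next
    case False
    then have "splits g (\<lambda>k x. x, \<lambda>k x. x)"
      by (simp add: splits_def)
    then show ?thesis ..
  qed
  then obtain p where p: "\<And>g. splits g (p g)"
    by metis
  define \<theta>1 where "\<theta>1 g = fst (p g)" for g
  define \<theta>2 where "\<theta>2 g = snd (p g)" for g
  have fg12: "\<theta>1 g k \<in> full_group" "\<theta>2 g k \<in> full_group" for g k
    using p[of g] by (simp_all add: splits_def \<theta>1_def \<theta>2_def)
  have split: "alm \<omega> (\<lambda>k x. \<theta>' g k x = glue (c k) (\<theta>1 g k) (\<theta>2 g k) x)" if "g \<in> ?C" for g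
    using p[of g] that by (simp add: splits_def \<theta>1_def \<theta>2_def)
  let ?\<gamma> = "glue_rep c \<theta>1 \<theta>2"
  have \<gamma>: "?\<gamma> g k \<in> full_group" for g k
    by (rule glue_full_group[OF c'(3-5) fg12])
  have S_int: "intertwines \<omega> ?C S ?\<gamma> \<theta>"
    unfolding intertwines_def
  proof (intro conjI allI ballI S(1))
    fix g assume g: "g \<in> ?C"
    show "alm \<omega> (\<lambda>k x. S k (?\<gamma> g k x) = \<theta> g k (S k x))"
      by (rule alm_mono[OF split[OF g]]) (simp flip: S\<theta>')
  qed
  have hom\<gamma>: "alm \<omega> (\<lambda>k x. ?\<gamma> (g \<otimes>\<^bsub>G\<^esub> h) k x = ?\<gamma> g k (?\<gamma> h k x))" if g: "g \<in> ?C" "h \<in> ?C" for g h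
  proof (rule alm_mono4)
    show "alm \<omega> (\<lambda>k x. \<theta> (g \<otimes>\<^bsub>G\<^esub> h) k (S k x) = \<theta> g k (\<theta> h k (S k x)))"
      by (rule alm_vimage[where T = S and P = "\<lambda>k x. \<theta> (g \<otimes>\<^bsub>G\<^esub> h) k x = \<theta> g k (\<theta> h k x)"])
        (use \<theta> g S(1) in \<open>simp_all add: sofic_seq_def\<close>)
    show "alm \<omega> (\<lambda>k x. S k (?\<gamma> (g \<otimes>\<^bsub>G\<^esub> h) k x) = \<theta> (g \<otimes>\<^bsub>G\<^esub> h) k (S k x))"
      by (rule intertwinesD[OF S_int G[OF g]])
    show "alm \<omega> (\<lambda>k x. S k (?\<gamma> h k x) = \<theta> h k (S k x))"
      by (rule intertwinesD[OF S_int g(2)])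
    show "alm \<omega> (\<lambda>k x. S k (?\<gamma> g k (?\<gamma> h k x)) = \<theta> g k (S k (?\<gamma> h k x)))"
      by (rule alm_vimage[OF intertwinesD[OF S_int g(1)], where T = "?\<gamma> h"], rule \<gamma>)
    fix k x
    assume "\<theta> (g \<otimes>\<^bsub>G\<^esub> h) k (S k x) = \<theta> g k (\<theta> h k (S k x))"
      "S k (?\<gamma> (g \<otimes>\<^bsub>G\<^esub> h) k x) = \<theta> (g \<otimes>\<^bsub>G\<^esub> h) k (S k x)"
      "S k (?\<gamma> h k x) = \<theta> h k (S k x)" "S k (?\<gamma> g k (?\<gamma> h k x)) = \<theta> g k (S k (?\<gamma> h k x))"
    then have "S k (?\<gamma> (g \<otimes>\<^bsub>G\<^esub> h) k x) = S k (?\<gamma> g k (?\<gamma> h k x))"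
      by simp
    then show "?\<gamma> (g \<otimes>\<^bsub>G\<^esub> h) k x = ?\<gamma> g k (?\<gamma> h k x)"
      by (simp only: full_group_inj[OF S(1)])
  qed
  have free\<gamma>: "alm \<omega> (\<lambda>k x. ?\<gamma> g k x \<noteq> x)" if g: "g \<in> ?C" "g \<noteq> \<one>\<^bsub>G\<^esub>" for g
  proof (rule alm_mono2)
    show "alm \<omega> (\<lambda>k x. \<theta> g k (S k x) \<noteq> S k x)"
      by (rule alm_vimage[where T = S and P = "\<lambda>k x. \<theta> g k x \<noteq> x"])
        (use \<theta> g S(1) in \<open>simp_all add: sofic_seq_def\<close>)
    show "alm \<omega> (\<lambda>k x. S k (?\<gamma> g k x) = \<theta> g k (S k x))"
      by (rule intertwinesD[OF S_int g(1)])
  qed auto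
  have c1: "\<And>k. 0 < 1 - c k" "\<And>k. 0 \<le> c k" "\<And>k. c k + (1 - c k) \<le> 1" "\<And>k. 0 \<le> (0::real)" "\<And>k. 0 + c k \<le> 1"
    using c'(3,4) less_imp_le by auto
  have zoom1: "alm \<omega> (\<lambda>k t. R k (0 + c k * t))" if "alm \<omega> R" for R
    by (rule alm_zoom[where c = c and a = "\<lambda>k. 0", OF that c'(3) c1(4,5) c'(6,1)])
  have zoom2: "alm \<omega> (\<lambda>k t. R k (c k + (1 - c k) * t))" if "alm \<omega> R" for R
    by (rule alm_zoom[where c = "\<lambda>k. 1 - c k" and a = c, OF that c1(1-3) tendsto_diff[OF tendsto_const c'(6)]])
      (use c'(2) in simp)
  have "sofic_seq \<omega> G \<theta>1 \<and> sofic_seq \<omega> G \<theta>2"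
    unfolding sofic_seq_def
  proof (intro conjI allI ballI impI fg12)
    fix g h assume g: "g \<in> ?C" "h \<in> ?C"
    from hom\<gamma>[OF g] have eq: "alm \<omega> (\<lambda>k x. glue (c k) (\<theta>1 (g \<otimes>\<^bsub>G\<^esub> h) k) (\<theta>2 (g \<otimes>\<^bsub>G\<^esub> h) k) x =
        glue (c k) (\<lambda>x. \<theta>1 g k (\<theta>1 h k x)) (\<lambda>x. \<theta>2 g k (\<theta>2 h k x)) x)"
      unfolding glue_comp[OF c'(3,4) fg12] .
    show "alm \<omega> (\<lambda>k x. \<theta>1 (g \<otimes>\<^bsub>G\<^esub> h) k x = \<theta>1 g k (\<theta>1 h k x))"
      "alm \<omega> (\<lambda>k x. \<theta>2 (g \<otimes>\<^bsub>G\<^esub> h) k x = \<theta>2 g k (\<theta>2 h k x))"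
      by (rule alm_glueD[where c = c, OF c'(3,4,6,1,2) eq])+
  next
    fix g assume g: "g \<in> ?C" "g \<noteq> \<one>\<^bsub>G\<^esub>"
    show "alm \<omega> (\<lambda>k x. \<theta>1 g k x \<noteq> x)"
      by (rule alm_mono2[OF zoom1[OF free\<gamma>[OF g]] alm_unit]) (auto simp: glue_low[OF c'(3)])
    show "alm \<omega> (\<lambda>k x. \<theta>2 g k x \<noteq> x)"
      by (rule alm_mono2[OF zoom2[OF free\<gamma>[OF g]] alm_unit]) (auto simp: glue_high[OF c'(4)])
  qed
  moreover have "conj_seq \<omega> ?C \<theta> ?\<gamma>"
    unfolding conj_seq_def by (rule exI[of _ "\<lambda>k. finv (S k)"], rule intertwines_inv[OF S_int])
  ultimately have conj12: "conj_seq \<omega> ?C \<theta> \<theta>1" "conj_seq \<omega> ?C \<theta> \<theta>2"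
    using ext by auto
  obtain U1 where U1: "intertwines \<omega> ?C U1 \<theta> \<theta>1"
    using conj12(1) unfolding conj_seq_def by (elim exE) (rule that)
  obtain U2 where U2: "intertwines \<omega> ?C U2 \<theta> \<theta>2"
    using conj12(2) unfolding conj_seq_def by (elim exE) (rule that)
  obtain n \<sigma> where n: "\<And>k. 0 < n k" "\<And>g k. bij_betw (\<sigma> g k) {..<n k} {..<n k}"
    "\<And>g. g \<in> ?C \<Longrightarrow> alm \<omega> (\<lambda>k x. \<theta> g k x = block_perm (n k) (\<sigma> g k) x)"
    by (rule block_representation[where \<theta> = \<theta>, OF \<omega> C fg]) blast
  define K where "K k = collect (n k) (c k)" for k
  have K: "intertwines \<omega> ?C K \<theta> (glue_rep c \<theta> \<theta>)"
    unfolding K_def by (rule collect_intertwines[where n = n and \<sigma> = \<sigma>, OF c n])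
  define U where "U k = glue (c k) (U1 k) (U2 k)" for k
  have U: "intertwines \<omega> ?C U (glue_rep c \<theta> \<theta>) ?\<gamma>"
    unfolding U_def by (rule intertwines_glue[OF c U1 U2 fg fg])
  \<comment> \<open>\<open>Z\<close> goes from \<open>\<theta>\<close> over \<open>\<theta> \<oplus> \<theta>\<close> and \<open>\<theta>1 \<oplus> \<theta>2\<close> back to \<open>\<theta>\<close>. It commutes with \<open>\<theta>\<close> and carries the
    projection that cuts every block at \<open>c\<close> to \<open>P\<close>, so invariance identifies the two.\<close>
  define Z where "Z k x = S k (U k (K k x))" for k x
  have Z: "intertwines \<omega> ?C Z \<theta> \<theta>"
    unfolding Z_def by (rule intertwines_comp[OF intertwines_comp[OF K U] S_int])
  have UK: "intertwines \<omega> ?C (\<lambda>k x. U k (K k x)) \<theta> ?\<gamma>"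
    by (rule intertwines_comp[OF K U])
  define W where "W k = inside_blocks (n k) half_turn" for k
  have W: "intertwines \<omega> ?C W \<theta> \<theta>"
  proof (rule intertwines_cong)
    let ?\<beta> = "\<lambda>g k. block_perm (n k) (\<sigma> g k)"
    show "intertwines \<omega> ?C W ?\<beta> ?\<beta>"
      unfolding intertwines_def W_def inside_blocks_commutes[OF n(1) half_turn_full_group n(2)]
      by (intro conjI allI ballI alm_refl inside_blocks_full_group n half_turn_full_group)
    show "alm \<omega> (\<lambda>k x. ?\<beta> g k x = \<theta> g k x)" "alm \<omega> (\<lambda>k x. ?\<beta> g k x = \<theta> g k x)" if "g \<in> ?C" for g
      by (rule alm_mono[OF n(3)[OF that]], simp)+
  qed
  have P_iff: "alm \<omega> (\<lambda>k x. x \<in> {0..<1} \<longrightarrow> (x \<in> P k \<longleftrightarrow> frac (real (n k) * x) < c k))"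
  proof (rule alm_mono2[OF inv[OF Z] alm_intertwines[OF S(2) UK]], rule impI)
    fix k x
    assume a: "Z k x \<in> P k \<longleftrightarrow> x \<in> P k" "U k (K k x) \<in> {0..<1} \<longrightarrow> (S k (U k (K k x)) \<in> P k \<longleftrightarrow> U k (K k x) < c k)"
      and x: "x \<in> {0..<1}"
    have Kx: "K k x \<in> {0..<1}"
      using x by (simp only: full_group_unit_iff[OF intertwines_full_group[OF K]])
    then have "U k (K k x) \<in> {0..<1}"
      by (simp only: full_group_unit_iff[OF intertwines_full_group[OF U]])
    with a have "x \<in> P k \<longleftrightarrow> U k (K k x) < c k"
      by (simp add: Z_def)
    also have "\<dots> \<longleftrightarrow> K k x < c k"
      unfolding U_def by (rule glue_less_iff[OF c'(3,4) intertwines_full_group[OF U1] intertwines_full_group[OF U2] Kx])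
    also have "\<dots> \<longleftrightarrow> frac (real (n k) * x) < c k"
      unfolding K_def by (rule collect_less_iff[OF n(1) c'(3,4) x])
    finally show "x \<in> P k \<longleftrightarrow> frac (real (n k) * x) < c k" .
  qed
  have "alm \<omega> (\<lambda>k x. x \<in> {0..<1} \<longrightarrow>
    (half_turn (frac (real (n k) * x)) < c k \<longleftrightarrow> frac (real (n k) * x) < c k))"
  proof (rule alm_mono3[OF P_iff alm_intertwines[OF P_iff W] inv[OF W]], rule impI)
    fix k x
    assume a: "x \<in> {0..<1} \<longrightarrow> (x \<in> P k \<longleftrightarrow> frac (real (n k) * x) < c k)"
      "W k x \<in> {0..<1} \<longrightarrow> (W k x \<in> P k \<longleftrightarrow> frac (real (n k) * W k x) < c k)" "W k x \<in> P k \<longleftrightarrow> x \<in> P k"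
      and x: "x \<in> {0..<1}"
    have "W k x \<in> {0..<1}"
      using x by (simp only: full_group_unit_iff[OF intertwines_full_group[OF W]])
    with a x show "half_turn (frac (real (n k) * x)) < c k \<longleftrightarrow> frac (real (n k) * x) < c k"
      using frac_inside_blocks[OF n(1) half_turn_full_group x] by (simp add: W_def)
  qed
  with half_turn_moves[OF \<omega> c n(1)] show False ..
qed

text \<open>The distribution function \<open>F t = lim measure {a \<le> t}\<close> is monotone. At a point of continuity few values
  of \<open>a\<close> are close to \<open>t\<close>, so the level set inherits the invariance of \<open>a\<close> and has measure 0 or 1.
  Since \<open>F\<close> has only countably many jumps, it jumps from 0 to 1 at a single point, the constant.\<close>

lemma level_sets_scalar:
  fixes a :: "nat \<Rightarrow> real \<Rightarrow> real"
  assumes \<omega>: "free_ultrafilter \<omega>" and a [measurable]: "\<And>k. a k \<in> borel_measurable borel"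
    and B: "\<And>k x. \<bar>a k x\<bar> \<le> B"
    and fg: "\<And>T k. T \<in> \<T> \<Longrightarrow> T k \<in> full_group"
    and inv: "\<And>T e. T \<in> \<T> \<Longrightarrow> 0 < e \<Longrightarrow> alm \<omega> (\<lambda>k x. \<bar>a k (T k x) - a k x\<bar> < e)"
    and zero_one: "\<And>P l. (\<And>k. P k \<in> sets borel) \<Longrightarrow>
      (\<And>T. T \<in> \<T> \<Longrightarrow> alm \<omega> (\<lambda>k x. T k x \<in> P k \<longleftrightarrow> x \<in> P k)) \<Longrightarrow>
      ((\<lambda>k. measure leb (P k)) \<longlongrightarrow> l) \<omega> \<Longrightarrow> l = 0 \<or> l = 1"
  shows "\<exists>c. \<forall>e>0. alm \<omega> (\<lambda>k x. \<bar>a k x - c\<bar> < e)"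
proof -
  note nontriv = free_ultrafilter_nontrivial[OF \<omega>]
  define L where "L t k = {x. a k x \<le> t}" for t k
  have L [measurable]: "L t k \<in> sets borel" for t k
    unfolding L_def by (rule borel_Collect) measurable
  have "\<exists>l. ((\<lambda>k. measure leb (L t k)) \<longlongrightarrow> l) \<omega>" for t
    by (rule measure_leb_ultralimit[OF \<omega>, of "L t"], rule exI)
  then obtain F where F: "\<And>t. ((\<lambda>k. measure leb (L t k)) \<longlongrightarrow> F t) \<omega>"
    by metis
  have "mono F"
  proof (rule monoI)
    fix s t :: real assume "s \<le> t"
    then show "F s \<le> F t"
      by (intro tendsto_le[OF nontriv F F] always_eventually allI leb.finite_measure_mono) (auto simp: L_def)
  qed
  then have ctble: "countable {t. \<not> isCont F t}"
    by (rule mono_ctble_discont)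
  have cont_point: "\<exists>t. u < t \<and> t < v \<and> isCont F t" if "u < v" for u v
  proof (rule ccontr)
    assume "\<not> ?thesis"
    then have "{u<..<v} \<subseteq> {t. \<not> isCont F t}"
      by auto
    then show False
      using ctble uncountable_open_interval[of u v] that countable_subset by blast
  qed
  have F01: "F t = 0 \<or> F t = 1" if t: "isCont F t" for t
  proof (rule zero_one[OF L _ F])
    fix T assume T: "T \<in> \<T>"
    note [measurable] = full_group_borel[OF fg[OF T]]
    show "alm \<omega> (\<lambda>k x. T k x \<in> L t k \<longleftrightarrow> x \<in> L t k)"
    proof (rule alm_approx)
      show "{x. \<not> (T k x \<in> L t k \<longleftrightarrow> x \<in> L t k)} \<in> sets borel" for k
        by (rule borel_Collect) measurable
      fix e :: real assume e: "0 < e"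
      obtain d where d: "0 < d" "\<And>s. \<bar>s - t\<bar> < d \<Longrightarrow> \<bar>F s - F t\<bar> < e / 2"
        using t[unfolded continuous_at_eps_delta] half_gt_zero[OF e] by (metis dist_real_def)
      define D where "D k = L (t + d / 2) k - L (t - d / 2) k" for k
      have D_eq: "measure leb (D k) = measure leb (L (t + d / 2) k) - measure leb (L (t - d / 2) k)" for k
        unfolding D_def using d(1) by (intro leb.finite_measure_Diff) (auto simp: L_def)
      have lim: "((\<lambda>k. measure leb (D k)) \<longlongrightarrow> F (t + d / 2) - F (t - d / 2)) \<omega>"
        unfolding D_eq by (rule tendsto_diff[OF F F])
      have "F (t + d / 2) - F (t - d / 2) < e"
        using d(2)[of "t + d / 2"] d(2)[of "t - d / 2"] d(1) by (simp add: abs_if split: if_splits)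
      note ev = order_tendstoD(2)[OF lim this]
      show "\<exists>D Q. (\<forall>k. D k \<in> sets borel) \<and> eventually (\<lambda>k. measure leb (D k) < e) \<omega> \<and> alm \<omega> Q \<and>
        (\<forall>k x. Q k x \<longrightarrow> x \<notin> D k \<longrightarrow> (T k x \<in> L t k \<longleftrightarrow> x \<in> L t k))"
      proof (rule exI[of _ D], rule exI[of _ "\<lambda>k x. \<bar>a k (T k x) - a k x\<bar> < d / 2"], intro conjI)
        show "\<forall>k. D k \<in> sets borel"
          unfolding D_def by auto
        show "eventually (\<lambda>k. measure leb (D k) < e) \<omega>"
          by (rule ev)
        show "alm \<omega> (\<lambda>k x. \<bar>a k (T k x) - a k x\<bar> < d / 2)"
          by (rule inv[OF T half_gt_zero[OF d(1)]])
        show "\<forall>k x. \<bar>a k (T k x) - a k x\<bar> < d / 2 \<longrightarrow> x \<notin> D k \<longrightarrow> (T k x \<in> L t k \<longleftrightarrow> x \<in> L t k)"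
        proof (intro allI impI)
          fix k x assume h: "\<bar>a k (T k x) - a k x\<bar> < d / 2" "x \<notin> D k"
          then consider "t + d / 2 < a k x" | "a k x \<le> t - d / 2"
            by (auto simp: D_def L_def not_le)
          then have "a k (T k x) \<le> t \<longleftrightarrow> a k x \<le> t"
          proof cases
            case 1
            then have "t < a k (T k x)" "t < a k x" using h(1) d(1) by linarith+
            then show ?thesis by simp
          next
            case 2
            then have "a k (T k x) \<le> t" "a k x \<le> t" using h(1) d(1) by linarith+
            then show ?thesis by simp
          qed
          then show "T k x \<in> L t k \<longleftrightarrow> x \<in> L t k"
            by (simp add: L_def)
        qed
      qed
    qed
  qed
  have F_low: "F t = 0" if "t < - B" for t
  proof -
    have "\<not> a k x \<le> t" for k x
      using B[of k x] that by linarith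
    then have "L t k = {}" for k
      by (simp add: L_def)
    then have "((\<lambda>k. measure leb (L t k)) \<longlongrightarrow> 0) \<omega>"
      by simp
    from ultralimit_unique[OF \<omega> F this] show ?thesis .
  qed
  have F_high: "F t = 1" if "B \<le> t" for t
  proof -
    have "a k x \<le> t" for k x
      using B[of k x] that by linarith
    then have "L t k = UNIV" for k
      by (simp add: L_def)
    then have "((\<lambda>k. measure leb (L t k)) \<longlongrightarrow> 1) \<omega>"
      by simp
    from ultralimit_unique[OF \<omega> F this] show ?thesis .
  qed
  define V where "V = {t. F t < 1 / 2}"
  have V_bdd: "bdd_above V"
  proof (rule bdd_aboveI[of _ B], rule ccontr)
    fix x assume "x \<in> V" "\<not> x \<le> B"
    then show False
      using F_high[of x] by (simp add: V_def)
  qed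
  have V_ne: "- B - 1 \<in> V"
    using F_low by (simp add: V_def)
  define c where "c = Sup V"
  have below: "F t < 1 / 2" if t: "t < c" for t
  proof -
    obtain s where "s \<in> V" "t < s"
      using t less_cSup_iff[of V t] V_bdd V_ne unfolding c_def by blast
    then show ?thesis
      using monoD[OF \<open>mono F\<close>, of t s] by (simp add: V_def)
  qed
  have above: "1 / 2 \<le> F t" if t: "c < t" for t
    using cSup_upper[OF _ V_bdd, of t] t by (force simp: c_def V_def)
  have "alm \<omega> (\<lambda>k x. \<bar>a k x - c\<bar> < e)" if e: "0 < e" for e
  proof -
    obtain u where u: "c - e < u" "u < c" "isCont F u"
      using cont_point[of "c - e" c] e by auto
    obtain v where v: "c < v" "v < c + e" "isCont F v"
      using cont_point[of c "c + e"] e by auto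
    have "F u = 0" "F v = 1"
      using F01[OF u(3)] below[OF u(2)] F01[OF v(3)] above[OF v(1)] by auto
    then have lim: "((\<lambda>k. measure leb (L u k)) \<longlongrightarrow> 0) \<omega>" "((\<lambda>k. measure leb (L v k)) \<longlongrightarrow> 1) \<omega>"
      using F[of u] F[of v] by simp_all
    have 1: "alm \<omega> (\<lambda>k x. x \<notin> L u k)"
      by (rule alm_notin_iff[THEN iffD2], rule L, rule lim)
    have 2: "alm \<omega> (\<lambda>k x. x \<in> UNIV \<longrightarrow> x \<in> L v k)"
      by (rule alm_of_equal_limits[where l = 1], rule L) (simp_all add: lim)
    show ?thesis
    proof (rule alm_mono2[OF 1 2])
      fix k x assume "x \<notin> L u k" "x \<in> UNIV \<longrightarrow> x \<in> L v k"
      then show "\<bar>a k x - c\<bar> < e"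
        using u v by (simp add: L_def abs_if)
    qed
  qed
  then show ?thesis by blast
qed

text \<open>Real and imaginary part are invariant, and their level sets satisfy the zero-one law.\<close>

theorem extreme_imp_ergodic_seq:
  fixes G :: "('g, 'b) monoid_scheme"
  assumes \<omega>: "free_ultrafilter \<omega>" and C: "countable (carrier G)"
    and c: "\<And>l. 0 < l \<Longrightarrow> l < 1 \<Longrightarrow> rational_cuts \<omega> (c l) l"
    and G: "\<And>g h. g \<in> carrier G \<Longrightarrow> h \<in> carrier G \<Longrightarrow> g \<otimes>\<^bsub>G\<^esub> h \<in> carrier G"
    and \<theta>: "sofic_seq \<omega> G \<theta>"
    and ext: "\<And>l \<theta>1 \<theta>2. 0 < l \<Longrightarrow> l < 1 \<Longrightarrow> sofic_seq \<omega> G \<theta>1 \<Longrightarrow> sofic_seq \<omega> G \<theta>2 \<Longrightarrow>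
      conj_seq \<omega> (carrier G) \<theta> (glue_rep (c l) \<theta>1 \<theta>2) \<Longrightarrow>
      conj_seq \<omega> (carrier G) \<theta> \<theta>1 \<and> conj_seq \<omega> (carrier G) \<theta> \<theta>2"
  shows "ergodic_seq \<omega> (carrier G) \<theta>"
  unfolding ergodic_seq_def
proof (intro allI impI)
  fix a :: "nat \<Rightarrow> real \<Rightarrow> complex"
  assume a: "\<forall>k. a k \<in> borel_measurable borel" and bdd: "\<exists>B. \<forall>k x. cmod (a k x) \<le> B"
    and comm: "\<forall>g\<in>carrier G. \<forall>e>0. alm \<omega> (\<lambda>k x. cmod (a k (\<theta> g k x) - a k x) < e)"
    and inv: "\<forall>U. intertwines \<omega> (carrier G) U \<theta> \<theta> \<longrightarrow> (\<forall>e>0. alm \<omega> (\<lambda>k x. cmod (a k (U k x) - a k x) < e))"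
  obtain B where B: "\<And>k x. cmod (a k x) \<le> B"
    using bdd by blast
  define \<T> where "\<T> = \<theta> ` carrier G \<union> {U. intertwines \<omega> (carrier G) U \<theta> \<theta>}"
  have \<T>_fg: "T k \<in> full_group" if "T \<in> \<T>" for T k
    using that \<theta> intertwines_full_group by (auto simp: \<T>_def sofic_seq_def)
  have \<T>_inv: "alm \<omega> (\<lambda>k x. cmod (a k (T k x) - a k x) < e)" if "T \<in> \<T>" "0 < e" for T e
    using that(1) unfolding \<T>_def
  proof (elim UnE imageE CollectE)
    fix g assume "T = \<theta> g" "g \<in> carrier G"
    then show ?thesis
      using comm that(2) by simp
  next
    assume "intertwines \<omega> (carrier G) T \<theta> \<theta>"
    with inv that(2) show ?thesis
      by simp
  qed
  have zero_one: "l = 0 \<or> l = 1"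
    if P: "\<And>k. P k \<in> sets borel" "\<And>T. T \<in> \<T> \<Longrightarrow> alm \<omega> (\<lambda>k x. T k x \<in> P k \<longleftrightarrow> x \<in> P k)"
      "((\<lambda>k. measure leb (P k)) \<longlongrightarrow> l) \<omega>" for P l
  proof (rule ccontr)
    assume l: "\<not> (l = 0 \<or> l = 1)"
    have "0 \<le> l"
      by (rule tendsto_lowerbound[OF P(3) always_eventually free_ultrafilter_nontrivial[OF \<omega>]]) simp
    moreover have "l \<le> 1"
      by (rule tendsto_upperbound[OF P(3) always_eventually free_ultrafilter_nontrivial[OF \<omega>]])
        (simp add: measure_leb_le_1)
    ultimately have l01: "0 < l" "l < 1"
      using l by auto
    have 1: "P \<in> invariant_sets \<omega> (carrier G) \<theta>"
      by (rule invariant_setsI[OF P(1) P(2)]) (simp add: \<T>_def)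
    have 2: "alm \<omega> (\<lambda>k x. U k x \<in> P k \<longleftrightarrow> x \<in> P k)" if "intertwines \<omega> (carrier G) U \<theta> \<theta>" for U
      by (rule P(2)) (simp add: \<T>_def that)
    show False
      by (rule extreme_zero_one[where \<omega> = \<omega> and G = G and c = "c l" and l = l and \<theta> = \<theta> and P = P])
        (rule \<omega>, rule C, rule c[OF l01], erule (1) G, rule \<theta>, erule (2) ext[OF l01], rule 1, rule P(3), erule 2)
  qed
  have scalar: "\<exists>d. \<forall>e>0. alm \<omega> (\<lambda>k x. \<bar>f (a k x) - d\<bar> < e)"
    if f: "f \<in> borel_measurable borel" "\<And>z w. \<bar>f z - f w\<bar> \<le> cmod (z - w)" "f 0 = 0" for f :: "complex \<Rightarrow> real"
  proof (rule level_sets_scalar[where \<omega> = \<omega> and \<T> = \<T> and B = B])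
    show "free_ultrafilter \<omega>"
      by (rule \<omega>)
    show "T k \<in> full_group" if "T \<in> \<T>" for T k
      by (rule \<T>_fg[OF that])
    show "l = 0 \<or> l = 1" if "\<And>k. P k \<in> sets borel" "\<And>T. T \<in> \<T> \<Longrightarrow> alm \<omega> (\<lambda>k x. T k x \<in> P k \<longleftrightarrow> x \<in> P k)"
      "((\<lambda>k. measure leb (P k)) \<longlongrightarrow> l) \<omega>" for P l
      by (rule zero_one, rule that, erule that, rule that)
    show "(\<lambda>x. f (a k x)) \<in> borel_measurable borel" for k
      using a by (intro measurable_compose[OF _ f(1)]) simp
    show "\<bar>f (a k x)\<bar> \<le> B" for k x
      using f(2)[of "a k x" 0] f(3) B[of k x] by simp
    show "alm \<omega> (\<lambda>k x. \<bar>f (a k (T k x)) - f (a k x)\<bar> < e)" if "T \<in> \<T>" "0 < e" for T e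
      by (rule alm_mono[OF \<T>_inv[OF that]]) (rule le_less_trans[OF f(2)])
  qed
  have "\<exists>d. \<forall>e>0. alm \<omega> (\<lambda>k x. \<bar>Re (a k x) - d\<bar> < e)"
    by (rule scalar) (simp_all add: abs_Re_le_cmod flip: minus_complex.simps(1))
  then obtain d1 where d1: "\<forall>e>0. alm \<omega> (\<lambda>k x. \<bar>Re (a k x) - d1\<bar> < e)" ..
  have "\<exists>d. \<forall>e>0. alm \<omega> (\<lambda>k x. \<bar>Im (a k x) - d\<bar> < e)"
    by (rule scalar) (simp_all add: abs_Im_le_cmod flip: minus_complex.simps(2))
  then obtain d2 where d2: "\<forall>e>0. alm \<omega> (\<lambda>k x. \<bar>Im (a k x) - d2\<bar> < e)" ..
  have "alm \<omega> (\<lambda>k x. cmod (a k x - Complex d1 d2) < e)" if e: "0 < e" for e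
  proof (rule alm_mono2[OF d1[rule_format, OF half_gt_zero[OF e]] d2[rule_format, OF half_gt_zero[OF e]]])
    fix k x assume "\<bar>Re (a k x) - d1\<bar> < e / 2" "\<bar>Im (a k x) - d2\<bar> < e / 2"
    then show "cmod (a k x - Complex d1 d2) < e"
      using cmod_le[of "a k x - Complex d1 d2"] by simp
  qed
  then show "\<exists>c. \<forall>e>0. alm \<omega> (\<lambda>k x. cmod (a k x - c) < e)"
    by blast
qed

section \<open>Square integrable kernels\<close>

text \<open>The inner integral of \<open>L2sq\<close>. It vanishes for \<open>x\<close> outside \<open>[0,1]\<close>, where the orbit is empty.\<close>

definition row_sq :: "kernel \<Rightarrow> real \<Rightarrow> ennreal" where
  "row_sq f x = (\<integral>\<^sup>+y. ennreal ((cmod (f (x, y)))\<^sup>2) \<partial>count_space (orbit x))"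

definition supported :: "kernel \<Rightarrow> bool" where
  "supported f \<longleftrightarrow> (\<forall>p. p \<notin> relE \<longrightarrow> f p = 0)"

lemma orbit_iff: "y \<in> orbit x \<longleftrightarrow> (x, y) \<in> relE"
  by (simp add: orbit_def)

lemma relE_iff: "(x, y) \<in> relE \<longleftrightarrow> x \<in> {0..1} \<and> y \<in> {0..1} \<and> x - y \<in> \<rat>"
  by (simp add: relE_def)

lemma orbit_eq: "(x, y) \<in> relE \<Longrightarrow> orbit x = orbit y"
proof -
  assume xy: "(x, y) \<in> relE"
  then have q: "x - y \<in> \<rat>"
    by (simp add: relE_iff)
  have "x - z \<in> \<rat> \<longleftrightarrow> y - z \<in> \<rat>" for z
    using Rats_diff[OF _ q, of "x - z"] Rats_add[OF _ q, of "y - z"] by auto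
  then show ?thesis
    using xy by (auto simp: orbit_iff relE_iff)
qed

lemma relE_sym: "(x, y) \<in> relE \<Longrightarrow> (y, x) \<in> relE"
  using Rats_minus_iff[of "x - y"] by (auto simp: relE_iff)

lemma supportedD: "supported f \<Longrightarrow> p \<notin> relE \<Longrightarrow> f p = 0"
  unfolding supported_def by blast

lemma kmult_apply: "kmult f g (x, z) = (\<Sum>\<^sub>\<infinity>y\<in>orbit x. f (x, y) * g (y, z))"
  by (simp add: kmult_def)

text \<open>Rows are sums over the rational translates of a point, which makes them measurable in \<open>x\<close>.\<close>

lemma row_sq_eq_rats:
  assumes "supported f"
  shows "row_sq f x = (\<integral>\<^sup>+q. ennreal ((cmod (f (x, x + q)))\<^sup>2) \<partial>count_space \<rat>)"
proof -
  have bij: "bij_betw (\<lambda>q. x + q) \<rat> {y. y - x \<in> \<rat>}"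
    by (rule bij_betw_byWitness[where f' = "\<lambda>y. y - x"]) auto
  have "row_sq f x = (\<integral>\<^sup>+y. ennreal ((cmod (f (x, y)))\<^sup>2) \<partial>count_space {y. y - x \<in> \<rat>})"
    unfolding row_sq_def
  proof (rule nn_integral_count_space_eq)
    fix y assume "y \<in> orbit x - {y. y - x \<in> \<rat>}"
    then have "x - y \<in> \<rat>" "y - x \<notin> \<rat>" by (auto simp: orbit_iff relE_iff)
    then show "ennreal ((cmod (f (x, y)))\<^sup>2) = 0"
      using Rats_minus_iff[of "x - y"] by simp
  next
    fix y assume "y \<in> {y. y - x \<in> \<rat>} - orbit x"
    then show "ennreal ((cmod (f (x, y)))\<^sup>2) = 0"
      using supportedD[OF assms, of "(x, y)"] by (simp add: orbit_iff)
  qed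
  then show ?thesis
    using nn_integral_bij_count_space[OF bij, of "\<lambda>y. ennreal ((cmod (f (x, y)))\<^sup>2)"] by simp
qed

lemma L2sq_eq: "L2sq f = (\<integral>\<^sup>+x. row_sq f x \<partial>lborel)"
proof -
  have "L2sq f = (\<integral>\<^sup>+x. row_sq f x * indicator {0..1} x \<partial>lborel)"
    unfolding L2sq_def row_sq_def
    by (subst nn_integral_restrict_space) (simp_all add: nn_integral_completion)
  also have "\<dots> = (\<integral>\<^sup>+x. row_sq f x \<partial>lborel)"
  proof (rule nn_integral_cong)
    fix x
    have "row_sq f x = 0" if "x \<notin> {0..1}"
    proof -
      have "orbit x = {}" using that by (auto simp: orbit_iff relE_iff)
      then show ?thesis by (simp add: row_sq_def nn_integral_empty)
    qed
    then show "row_sq f x * indicator {0..1} x = row_sq f x"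
      by (cases "x \<in> {0..1}") auto
  qed
  finally show ?thesis .
qed

lemma AE_unit_iff: "(AE x in lebesgue_on {0..1}. P x) \<longleftrightarrow> (AE x in lborel. x \<in> {0..1} \<longrightarrow> P (x::real))"
  by (subst AE_restrict_space_iff) (simp_all add: AE_completion_iff)

lemma kernel_section_borel [measurable]:
  fixes f :: kernel
  assumes "f \<in> borel_measurable borel"
  shows "(\<lambda>x. f (x, x + q)) \<in> borel_measurable borel" "(\<lambda>x. f (x + q, x)) \<in> borel_measurable borel"
    "(\<lambda>x. f (x, x)) \<in> borel_measurable borel"
proof -
  have f: "f \<in> borel_measurable (borel \<Otimes>\<^sub>M borel)"
    using assms by (simp add: borel_prod)
  show "(\<lambda>x. f (x, x + q)) \<in> borel_measurable borel" "(\<lambda>x. f (x + q, x)) \<in> borel_measurable borel"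
    "(\<lambda>x. f (x, x)) \<in> borel_measurable borel"
    by (rule measurable_compose[OF _ f], measurable)+
qed

lemma countable_infinite_rats: "bij_betw (from_nat_into \<rat>) UNIV (\<rat> :: real set)"
  by (rule bij_betw_from_nat_into[OF countable_rat]) (use Rats_infinite in auto)

lemma nn_integral_rats_suminf:
  "(\<integral>\<^sup>+q. h q \<partial>count_space (\<rat>::real set)) = (\<Sum>j. h (from_nat_into \<rat> j))"
  using nn_integral_bij_count_space[OF countable_infinite_rats, of h]
  by (simp add: nn_integral_count_space_nat)

lemma row_sq_measurable:
  assumes "supported f" and [measurable]: "f \<in> borel_measurable borel"
  shows "row_sq f \<in> borel_measurable borel"
proof -
  have "row_sq f = (\<lambda>x. \<Sum>j. ennreal ((cmod (f (x, x + from_nat_into \<rat> j)))\<^sup>2))"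
    by (rule ext) (simp only: row_sq_eq_rats[OF assms(1)] nn_integral_rats_suminf)
  then show ?thesis by simp
qed

lemma L2sq_eq_rats:
  assumes "supported f" and [measurable]: "f \<in> borel_measurable borel"
  shows "L2sq f = (\<integral>\<^sup>+q. (\<integral>\<^sup>+x. ennreal ((cmod (f (x, x + q)))\<^sup>2) \<partial>lborel) \<partial>count_space \<rat>)"
  unfolding L2sq_eq row_sq_eq_rats[OF assms(1)]
  by (rule nn_integral_count_space_nn_integral) (auto simp: countable_rat)

lemma kstar_apply: "kstar f (x, y) = cnj (f (y, x))"
  by (simp add: kstar_def)

lemma kstar_supported: "supported f \<Longrightarrow> supported (kstar f)"
  using relE_sym by (auto simp: supported_def kstar_apply)

lemma kstar_borel: "f \<in> borel_measurable borel \<Longrightarrow> kstar f \<in> borel_measurable borel"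
proof -
  assume "f \<in> borel_measurable borel"
  then have f: "f \<in> borel_measurable (borel \<Otimes>\<^sub>M borel)"
    by (simp add: borel_prod)
  have "(\<lambda>p. f (snd p, fst p)) \<in> borel_measurable (borel \<Otimes>\<^sub>M borel)"
    by (rule measurable_compose[OF _ f]) measurable
  moreover have "cnj \<in> borel_measurable borel"
    by (intro borel_measurable_continuous_onI continuous_intros)
  ultimately have "(\<lambda>p. cnj (f (snd p, fst p))) \<in> borel_measurable (borel \<Otimes>\<^sub>M borel)"
    by (rule measurable_compose)
  moreover have "kstar f = (\<lambda>p. cnj (f (snd p, fst p)))"
    by (auto simp: kstar_def)
  ultimately show ?thesis
    by (simp only: borel_prod)
qed

text \<open>Unimodularity: translations preserve Lebesgue measure, so rows and columns may be
  exchanged.\<close>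

lemma L2sq_kstar:
  assumes f: "supported f" and [measurable]: "f \<in> borel_measurable borel"
  shows "L2sq (kstar f) = L2sq f"
proof -
  have bij: "bij_betw (\<lambda>q::real. - q) \<rat> \<rat>"
    by (rule bij_betw_byWitness[where f' = "\<lambda>q. - q"]) auto
  have "(\<integral>\<^sup>+x. ennreal ((cmod (kstar f (x, x + - q)))\<^sup>2) \<partial>lborel) = (\<integral>\<^sup>+x. ennreal ((cmod (f (x, x + q)))\<^sup>2) \<partial>lborel)" for q
  proof -
    have "(\<integral>\<^sup>+x. ennreal ((cmod (f (x, x + q)))\<^sup>2) \<partial>lborel) =
        ennreal \<bar>1\<bar> * (\<integral>\<^sup>+x. ennreal ((cmod (f (- q + 1 * x, - q + 1 * x + q)))\<^sup>2) \<partial>lborel)"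
      by (rule nn_integral_real_affine) auto
    then show ?thesis
      by (simp add: kstar_apply)
  qed
  then have "L2sq f = (\<integral>\<^sup>+q. (\<integral>\<^sup>+x. ennreal ((cmod (kstar f (x, x + - q)))\<^sup>2) \<partial>lborel) \<partial>count_space \<rat>)"
    using L2sq_eq_rats[OF assms] by simp
  also have "\<dots> = L2sq (kstar f)"
    unfolding L2sq_eq_rats[OF kstar_supported[OF f] kstar_borel[OF assms(2)]]
    by (rule nn_integral_bij_count_space[OF bij, of "\<lambda>q. \<integral>\<^sup>+x. ennreal ((cmod (kstar f (x, x + q)))\<^sup>2) \<partial>lborel"])
  finally show ?thesis by simp
qed

lemma L2E_D:
  assumes "f \<in> L2E"
  shows "f \<in> borel_measurable borel" "supported f" "L2sq f < \<infinity>"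
  using assms by (auto simp: L2E_def supported_def)

lemma L2E_I: "f \<in> borel_measurable borel \<Longrightarrow> supported f \<Longrightarrow> L2sq f < \<infinity> \<Longrightarrow> f \<in> L2E"
  by (auto simp: L2E_def supported_def)

lemma kstar_L2E:
  assumes "f \<in> L2E" shows "kstar f \<in> L2E"
proof -
  note f = L2E_D[OF assms]
  show ?thesis
    by (rule L2E_I[OF kstar_borel[OF f(1)] kstar_supported[OF f(2)]])
      (simp only: L2sq_kstar[OF f(2,1)] f(3))
qed

lemma cmod_add_sq_le: "(cmod (a + b))\<^sup>2 \<le> 2 * (cmod a)\<^sup>2 + 2 * (cmod b)\<^sup>2"
proof -
  have "(cmod (a + b))\<^sup>2 \<le> (cmod a + cmod b)\<^sup>2"
    by (intro power_mono norm_triangle_ineq) simp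
  also have "\<dots> \<le> 2 * (cmod a)\<^sup>2 + 2 * (cmod b)\<^sup>2"
    using sum_squares_bound[of "cmod a" "cmod b"] by (simp add: power2_sum)
  finally show ?thesis .
qed

lemma L2sq_add_le:
  assumes f: "supported f" "f \<in> borel_measurable borel" and g: "supported g" "g \<in> borel_measurable borel"
  shows "L2sq (\<lambda>p. f p + g p) \<le> 2 * L2sq f + 2 * L2sq g"
proof -
  have "row_sq (\<lambda>p. f p + g p) x \<le> 2 * row_sq f x + 2 * row_sq g x" for x
  proof -
    have "ennreal ((cmod (f (x, y) + g (x, y)))\<^sup>2) \<le> 2 * ennreal ((cmod (f (x, y)))\<^sup>2) + 2 * ennreal ((cmod (g (x, y)))\<^sup>2)" for y
      using ennreal_leI[OF cmod_add_sq_le[of "f (x, y)" "g (x, y)"]] by (simp add: ennreal_mult' ennreal_plus)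
    then have "row_sq (\<lambda>p. f p + g p) x \<le> (\<integral>\<^sup>+y. (2 * ennreal ((cmod (f (x, y)))\<^sup>2) + 2 * ennreal ((cmod (g (x, y)))\<^sup>2)) \<partial>count_space (orbit x))"
      unfolding row_sq_def by (intro nn_integral_mono) auto
    also have "\<dots> = 2 * row_sq f x + 2 * row_sq g x"
      unfolding row_sq_def by (subst nn_integral_add) (auto simp: nn_integral_cmult)
    finally show ?thesis .
  qed
  then have "L2sq (\<lambda>p. f p + g p) \<le> (\<integral>\<^sup>+x. (2 * row_sq f x + 2 * row_sq g x) \<partial>lborel)"
    unfolding L2sq_eq by (intro nn_integral_mono) auto
  also have "\<dots> = 2 * L2sq f + 2 * L2sq g"
    unfolding L2sq_eq using row_sq_measurable[OF f] row_sq_measurable[OF g]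
    by (subst nn_integral_add) (auto simp: nn_integral_cmult)
  finally show ?thesis .
qed

lemma L2sq_scale: "L2sq (\<lambda>p. - f p) = L2sq f"
  by (simp add: L2sq_def)

lemma L2E_add: "f \<in> L2E \<Longrightarrow> g \<in> L2E \<Longrightarrow> (\<lambda>p. f p + g p) \<in> L2E"
proof (rule L2E_I)
  assume fg: "f \<in> L2E" "g \<in> L2E"
  note f = L2E_D[OF fg(1)] and g = L2E_D[OF fg(2)]
  show "(\<lambda>p. f p + g p) \<in> borel_measurable borel"
    using f(1) g(1) by (rule borel_measurable_add)
  show "supported (\<lambda>p. f p + g p)"
    using f(2) g(2) by (simp add: supported_def)
  have "2 * L2sq f + 2 * L2sq g < \<infinity>"
    using f(3) g(3) by (simp add: ennreal_mult_less_top)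
  then show "L2sq (\<lambda>p. f p + g p) < \<infinity>"
    using L2sq_add_le[OF f(2,1) g(2,1)] by (rule le_less_trans[rotated])
qed

lemma L2E_uminus: "f \<in> L2E \<Longrightarrow> (\<lambda>p. - f p) \<in> L2E"
  by (auto simp: L2E_def L2sq_scale)

lemma L2E_diff: "f \<in> L2E \<Longrightarrow> g \<in> L2E \<Longrightarrow> (\<lambda>p. f p - g p) \<in> L2E"
  using L2E_add[OF _ L2E_uminus, of f g] by simp

definition sq_norm :: "kernel \<Rightarrow> real" where
  "sq_norm f = enn2real (L2sq f)"

lemma sq_norm_nonneg [simp]: "0 \<le> sq_norm f"
  by (simp add: sq_norm_def)

lemma L2sq_eq_sq_norm: "f \<in> L2E \<Longrightarrow> L2sq f = ennreal (sq_norm f)"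
  using L2E_D(3)[of f] by (simp add: sq_norm_def)

lemma sq_norm_leI: "L2sq f \<le> ennreal c \<Longrightarrow> 0 \<le> c \<Longrightarrow> sq_norm f \<le> c"
  unfolding sq_norm_def by (rule enn2real_leI)

lemma sq_norm_add_le:
  assumes "f \<in> L2E" "g \<in> L2E"
  shows "sq_norm (\<lambda>p. f p + g p) \<le> 2 * sq_norm f + 2 * sq_norm g"
proof (rule sq_norm_leI)
  show "L2sq (\<lambda>p. f p + g p) \<le> ennreal (2 * sq_norm f + 2 * sq_norm g)"
    using L2sq_add_le[OF L2E_D(2,1)[OF assms(1)] L2E_D(2,1)[OF assms(2)]] assms
    by (simp add: L2sq_eq_sq_norm ennreal_mult' ennreal_plus)
qed simp

lemma sq_norm_minus_commute: "sq_norm (\<lambda>p. f p - g p) = sq_norm (\<lambda>p. g p - f p)"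
  using L2sq_scale[of "\<lambda>p. f p - g p"] by (simp add: sq_norm_def)

lemma infsum_complex_of_real:
  fixes h :: "'a \<Rightarrow> real"
  shows "(\<Sum>\<^sub>\<infinity>x\<in>A. complex_of_real (h x)) = complex_of_real (\<Sum>\<^sub>\<infinity>x\<in>A. h x)"
proof (cases "h summable_on A")
  case True
  show ?thesis
    by (rule infsumI[OF has_sum_of_real[OF has_sum_infsum[OF True]]])
next
  case False
  have "\<not> (\<lambda>x. complex_of_real (h x)) summable_on A"
  proof
    assume "(\<lambda>x. complex_of_real (h x)) summable_on A"
    from summable_on_Re[OF this] have "h summable_on A"
      by simp
    with False show False ..
  qed
  with False show ?thesis
    by (simp add: infsum_not_exists)
qed

lemma infsum_nonneg_eq_nn_integral:
  fixes h :: "'a \<Rightarrow> real"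
  assumes "\<And>x. 0 \<le> h x"
  shows "infsum h A = enn2real (\<integral>\<^sup>+x. ennreal (h x) \<partial>count_space A)"
proof (cases "Infinite_Set_Sum.abs_summable_on h A")
  case True
  then have "(\<integral>\<^sup>+x. ennreal (h x) \<partial>count_space A) = ennreal (infsetsum h A)"
    by (rule nn_integral_conv_infsetsum) (use assms in auto)
  then show ?thesis
    using infsetsum_infsum[OF True] assms by (simp add: infsum_nonneg)
next
  case False
  then have "\<not> h summable_on A"
    using abs_summable_equivalent[of h A] assms by simp
  then have "infsum h A = 0"
    by (rule infsum_not_exists)
  moreover have "(\<integral>\<^sup>+x. ennreal (h x) \<partial>count_space A) = \<infinity>"
  proof (rule ccontr)
    assume "(\<integral>\<^sup>+x. ennreal (h x) \<partial>count_space A) \<noteq> \<infinity>"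
    then have "integrable (count_space A) h"
      using assms by (intro integrableI_bounded) (auto simp: less_top)
    with False show False
      by (simp add: Infinite_Set_Sum.abs_summable_on_def)
  qed
  ultimately show ?thesis by simp
qed

text \<open>The diagonal entries of \<open>f\<^sup>*f\<close> are the squared norms of the columns of \<open>f\<close>, and columns may be
  exchanged for rows.\<close>

lemma knorm2_eq:
  assumes f: "f \<in> L2E"
  shows "knorm2 f = sqrt (sq_norm f)"
proof -
  note fD = L2E_D[OF f] and sD = L2E_D[OF kstar_L2E[OF f]]
  have diag: "kmult (kstar f) f (x, x) = complex_of_real (enn2real (row_sq (kstar f) x))" for x
  proof -
    have "kstar f (x, y) * f (y, x) = complex_of_real ((cmod (f (y, x)))\<^sup>2)" for y
      by (simp only: kstar_apply complex_norm_square mult.commute)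
    then have "kmult (kstar f) f (x, x) = (\<Sum>\<^sub>\<infinity>y\<in>orbit x. complex_of_real ((cmod (f (y, x)))\<^sup>2))"
      by (simp only: kmult_apply)
    also have "\<dots> = complex_of_real (\<Sum>\<^sub>\<infinity>y\<in>orbit x. (cmod (f (y, x)))\<^sup>2)"
      by (rule infsum_complex_of_real)
    also have "(\<Sum>\<^sub>\<infinity>y\<in>orbit x. (cmod (f (y, x)))\<^sup>2) = enn2real (row_sq (kstar f) x)"
      by (subst infsum_nonneg_eq_nn_integral) (simp_all add: row_sq_def kstar_apply)
    finally show ?thesis .
  qed
  note meas = row_sq_measurable[OF sD(2,1)]
  have "Re (kTr (kmult (kstar f) f)) = Re (integral\<^sup>L (lebesgue_on {0..1}) (\<lambda>x. complex_of_real (enn2real (row_sq (kstar f) x))))"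
    unfolding kTr_def diag ..
  also have "\<dots> = integral\<^sup>L (lebesgue_on {0..1}) (\<lambda>x. enn2real (row_sq (kstar f) x))"
    by (simp only: integral_complex_of_real Re_complex_of_real)
  also have "\<dots> = enn2real (\<integral>\<^sup>+x. ennreal (enn2real (row_sq (kstar f) x)) \<partial>lebesgue_on {0..1})"
  proof (rule integral_eq_nn_integral)
    have "(\<lambda>x. enn2real (row_sq (kstar f) x)) \<in> borel_measurable borel"
      using meas by measurable
    then show "(\<lambda>x. enn2real (row_sq (kstar f) x)) \<in> borel_measurable (lebesgue_on {0..1})"
      by (intro measurable_restrict_space1 measurable_completion) simp
  qed auto
  also have "(\<integral>\<^sup>+x. ennreal (enn2real (row_sq (kstar f) x)) \<partial>lebesgue_on {0..1}) = L2sq (kstar f)"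
  proof -
    have "AE x in lborel. row_sq (kstar f) x \<noteq> \<infinity>"
    proof (rule nn_integral_PInf_AE)
      show "row_sq (kstar f) \<in> borel_measurable lborel"
        using meas by simp
      show "(\<integral>\<^sup>+x. row_sq (kstar f) x \<partial>lborel) \<noteq> \<infinity>"
        using sD(3) by (metis L2sq_eq less_irrefl)
    qed
    then have "AE x in lebesgue_on {0..1}. row_sq (kstar f) x \<noteq> \<infinity>"
      unfolding AE_unit_iff by eventually_elim simp
    then have "AE x in lebesgue_on {0..1}. ennreal (enn2real (row_sq (kstar f) x)) = row_sq (kstar f) x"
      by eventually_elim (simp add: less_top)
    then have "(\<integral>\<^sup>+x. ennreal (enn2real (row_sq (kstar f) x)) \<partial>lebesgue_on {0..1}) = (\<integral>\<^sup>+x. row_sq (kstar f) x \<partial>lebesgue_on {0..1})"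
      by (rule nn_integral_cong_AE)
    then show ?thesis
      by (simp add: L2sq_def row_sq_def)
  qed
  also have "L2sq (kstar f) = L2sq f"
    by (rule L2sq_kstar[OF fD(2,1)])
  finally show ?thesis
    by (simp add: knorm2_def sq_norm_def)
qed

section \<open>Monomial kernels\<close>

text \<open>All elements of \<open>\<E>\<^sup>\<omega>\<close> and of \<open>A\<^sup>\<omega>\<close>, and all products of these, are represented by kernels with
  at most one entry in every row and column.\<close>

definition monomial :: "(real \<Rightarrow> complex) \<Rightarrow> (real \<Rightarrow> real) \<Rightarrow> kernel" where
  "monomial a T = (\<lambda>(x, y). if y \<in> {0..<1} \<and> x = T y then a x else 0)"

lemma monomial_apply: "monomial a T (x, y) = (if y \<in> {0..<1} \<and> x = T y then a x else 0)"
  by (simp add: monomial_def)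

lemma monomial_apply': "T \<in> full_group \<Longrightarrow> monomial a T (x, y) = (if x \<in> {0..<1} \<and> y = finv T x then a x else 0)"
  using full_group_unit_iff[of T y] by (auto simp: monomial_apply)

lemma full_group_relE: "T \<in> full_group \<Longrightarrow> y \<in> {0..<1} \<Longrightarrow> (T y, y) \<in> relE"
  using full_group_unit_iff[of T y] full_group_rat[of T y] by (auto simp: relE_iff)

lemma monomial_supported: "T \<in> full_group \<Longrightarrow> supported (monomial a T)"
  using full_group_relE by (auto simp: supported_def monomial_def)

lemma monomial_borel:
  assumes T: "T \<in> full_group" and a [measurable]: "a \<in> borel_measurable borel"
  shows "monomial a T \<in> borel_measurable borel"
proof -
  note [measurable] = full_group_borel[OF T]
  have "(\<lambda>p. if snd p \<in> {0..<1} \<and> fst p = T (snd p) then a (fst p) else 0) \<in> borel_measurable (borel \<Otimes>\<^sub>M borel)"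
    by measurable
  then show ?thesis
    by (simp add: monomial_def case_prod_beta borel_prod)
qed

lemma row_sq_monomial_diff:
  assumes T: "T \<in> full_group" and S: "S \<in> full_group"
  shows "row_sq (\<lambda>p. monomial a T p - monomial b S p) x = ennreal (if x \<in> {0..<1} then
    (if finv T x = finv S x then (cmod (a x - b x))\<^sup>2 else (cmod (a x))\<^sup>2 + (cmod (b x))\<^sup>2) else 0)"
proof (cases "x \<in> {0..<1}")
  case False
  then show ?thesis
    using T S by (simp add: row_sq_def monomial_apply' del: atLeastLessThan_iff)
next
  case True
  have orb: "finv R x \<in> orbit x" if "R \<in> full_group" for R
    unfolding orbit_iff using relE_sym[OF full_group_relE[OF full_group_inv[OF that] True]] .
  have "row_sq (\<lambda>p. monomial a T p - monomial b S p) x =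
      (\<Sum>y\<in>{finv T x, finv S x}. ennreal ((cmod (monomial a T (x, y) - monomial b S (x, y)))\<^sup>2))"
    unfolding row_sq_def
    by (rule nn_integral_count_space') (use orb[OF T] orb[OF S] T S in \<open>auto simp: monomial_apply'\<close>)
  also have "\<dots> = ennreal (if finv T x = finv S x then (cmod (a x - b x))\<^sup>2 else (cmod (a x))\<^sup>2 + (cmod (b x))\<^sup>2)"
    using True T S by (auto simp: monomial_apply' ennreal_plus)
  finally show ?thesis
    using True by simp
qed

lemma monomial_zero: "monomial (\<lambda>_. 0) T = (\<lambda>p. 0)"
  by (auto simp: monomial_def)

lemma row_sq_monomial:
  assumes T: "T \<in> full_group"
  shows "row_sq (monomial a T) x = ennreal (if x \<in> {0..<1} then (cmod (a x))\<^sup>2 else 0)"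
  using row_sq_monomial_diff[OF T T, of a "\<lambda>_. 0" x] by (simp add: monomial_zero)

lemma nn_integral_leb: "h \<in> borel_measurable borel \<Longrightarrow> (\<integral>\<^sup>+x. h x \<partial>leb) = (\<integral>\<^sup>+x. h x * indicator {0..<1} x \<partial>lborel)"
  unfolding leb_def by (subst nn_integral_density) (auto simp: mult.commute)

lemma nn_integral_leb_const: "(\<integral>\<^sup>+x. c \<partial>leb) = c"
  by (simp add: emeasure_leb)

lemma monomial_L2E:
  assumes T: "T \<in> full_group" and a: "a \<in> borel_measurable borel" and B: "\<And>x. cmod (a x) \<le> B"
  shows "monomial a T \<in> L2E"
proof (rule L2E_I[OF monomial_borel[OF T a] monomial_supported[OF T]])
  have "L2sq (monomial a T) = (\<integral>\<^sup>+x. ennreal ((cmod (a x))\<^sup>2) * indicator {0..<1} x \<partial>lborel)"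
    unfolding L2sq_eq row_sq_monomial[OF T] by (intro nn_integral_cong) (auto simp: indicator_def)
  also have "\<dots> \<le> (\<integral>\<^sup>+x. ennreal (B\<^sup>2) * indicator {0..<1::real} x \<partial>lborel)"
  proof (rule nn_integral_mono)
    fix x
    have "ennreal ((cmod (a x))\<^sup>2) \<le> ennreal (B\<^sup>2)"
      by (intro ennreal_leI power_mono B) simp
    then show "ennreal ((cmod (a x))\<^sup>2) * indicator {0..<1} x \<le> ennreal (B\<^sup>2) * indicator {0..<1::real} x"
      by (rule mult_right_mono) simp
  qed
  also have "\<dots> < \<infinity>"
    by (simp add: nn_integral_cmult_indicator ennreal_mult_less_top)
  finally show "L2sq (monomial a T) < \<infinity>" .
qed

lemma sq_norm_monomial_diff:
  assumes T: "T \<in> full_group" and S: "S \<in> full_group"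
    and a [measurable]: "a \<in> borel_measurable borel" and b [measurable]: "b \<in> borel_measurable borel"
  shows "sq_norm (\<lambda>p. monomial a T p - monomial b S p) = enn2real (\<integral>\<^sup>+x. ennreal
    (if finv T x = finv S x then (cmod (a x - b x))\<^sup>2 else (cmod (a x))\<^sup>2 + (cmod (b x))\<^sup>2) \<partial>leb)"
proof -
  note [measurable] = full_group_borel[OF full_group_inv[OF T]] full_group_borel[OF full_group_inv[OF S]]
  show ?thesis
    unfolding sq_norm_def L2sq_eq row_sq_monomial_diff[OF T S]
    by (subst nn_integral_leb) (auto intro!: arg_cong[where f = enn2real] nn_integral_cong simp: indicator_def)
qed

lemma infsum_singleton_support:
  fixes h :: "'a \<Rightarrow> complex"
  assumes "\<And>y. y \<in> A \<Longrightarrow> y \<noteq> z \<Longrightarrow> h y = 0" "z \<notin> A \<Longrightarrow> h z = 0"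
  shows "infsum h A = h z"
proof -
  have "infsum h A = infsum h {z}"
    by (rule infsum_cong_neutral) (use assms in auto)
  then show ?thesis by simp
qed

lemma kmult_monomial_left:
  assumes T: "T \<in> full_group"
  shows "kmult (monomial a T) g (x, z) = (if x \<in> {0..<1} then a x * g (finv T x, z) else 0)"
proof -
  have "finv T x \<in> orbit x" if "x \<in> {0..<1}"
    unfolding orbit_iff using relE_sym[OF full_group_relE[OF full_group_inv[OF T] that]] .
  then have "kmult (monomial a T) g (x, z) = monomial a T (x, finv T x) * g (finv T x, z)"
    unfolding kmult_apply by (intro infsum_singleton_support) (use T in \<open>auto simp: monomial_apply'\<close>)
  then show ?thesis
    using T by (simp add: monomial_apply')
qed

lemma kmult_monomial_right:
  assumes S: "S \<in> full_group" and f: "supported f"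
  shows "kmult f (monomial b S) (x, z) = (if z \<in> {0..<1} then f (x, S z) * b (S z) else 0)"
proof -
  have "kmult f (monomial b S) (x, z) = f (x, S z) * monomial b S (S z, z)"
    unfolding kmult_apply
    by (intro infsum_singleton_support) (use supportedD[OF f, of "(x, S z)"] in \<open>auto simp: monomial_apply orbit_iff\<close>)
  then show ?thesis
    by (simp add: monomial_apply)
qed

lemma kmult_monomial:
  assumes "T \<in> full_group" "S \<in> full_group"
  shows "kmult (monomial a T) (monomial b S) = monomial (\<lambda>x. a x * b (finv T x)) (\<lambda>x. T (S x))"
proof
  fix p :: "real \<times> real"
  obtain x z where p: "p = (x, z)" by (cases p)
  have "x \<in> {0..<1} \<longleftrightarrow> finv T x \<in> {0..<1}"
    using full_group_unit_iff[OF full_group_inv[OF assms(1)], of x] by simp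
  then show "kmult (monomial a T) (monomial b S) p = monomial (\<lambda>x. a x * b (finv T x)) (\<lambda>x. T (S x)) p"
    unfolding p kmult_monomial_left[OF assms(1)] monomial_apply
    using assms full_group_unit_iff[OF assms(2), of z] full_group_unit_iff[OF assms(1), of "S z"]
    by (auto simp del: atLeastLessThan_iff simp: inv_full_group_eq)
qed

lemma kstar_monomial:
  assumes "T \<in> full_group"
  shows "kstar (monomial a T) = monomial (\<lambda>x. cnj (a (T x))) (finv T)"
proof
  fix p :: "real \<times> real"
  obtain x y where p: "p = (x, y)" by (cases p)
  show "kstar (monomial a T) p = monomial (\<lambda>x. cnj (a (T x))) (finv T) p"
    unfolding p kstar_apply monomial_apply
    using assms full_group_unit_iff[OF assms, of x] by (auto simp del: atLeastLessThan_iff)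
qed

lemma kstar_kmult_monomial_right:
  assumes S: "S \<in> full_group" and f: "supported f"
  shows "kstar (kmult f (monomial b S)) = kmult (kstar (monomial b S)) (kstar f)"
proof
  fix p :: "real \<times> real"
  obtain x z where p: "p = (x, z)" by (cases p)
  have "finv (finv S) x = S x"
    using inv_inv_eq[OF full_group_bij[OF S]] by simp
  then show "kstar (kmult f (monomial b S)) p = kmult (kstar (monomial b S)) (kstar f) p"
    unfolding p kstar_apply kstar_monomial[OF S] kmult_monomial_left[OF full_group_inv[OF S]] kmult_monomial_right[OF S f]
    by (simp add: mult.commute kstar_apply)
qed

lemma row_sq_kmult_monomial_left:
  assumes T: "T \<in> full_group"
  shows "row_sq (kmult (monomial a T) g) x =
    (if x \<in> {0..<1} then ennreal ((cmod (a x))\<^sup>2) * row_sq g (finv T x) else 0)"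
proof (cases "x \<in> {0..<1}")
  case True
  have "orbit (finv T x) = orbit x"
    by (rule orbit_eq[OF full_group_relE[OF full_group_inv[OF T] True]])
  then show ?thesis
    using True unfolding row_sq_def
    by (simp add: kmult_monomial_left[OF T] norm_mult power_mult_distrib ennreal_mult' nn_integral_cmult)
qed (simp add: row_sq_def kmult_monomial_left[OF T] del: atLeastLessThan_iff)

lemma L2sq_monomial_left:
  assumes T: "T \<in> full_group" and B: "\<And>x. cmod (a x) \<le> B" and g: "supported g" "g \<in> borel_measurable borel"
  shows "L2sq (kmult (monomial a T) g) \<le> ennreal (B\<^sup>2) * L2sq g"
proof -
  note Ti = full_group_inv[OF T]
  note [measurable] = row_sq_measurable[OF g] full_group_borel[OF Ti]
  have "L2sq (kmult (monomial a T) g) \<le> (\<integral>\<^sup>+x. ennreal (B\<^sup>2) * row_sq g (finv T x) * indicator {0..<1} x \<partial>lborel)"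
    unfolding L2sq_eq row_sq_kmult_monomial_left[OF T]
  proof (intro nn_integral_mono)
    fix x
    have "ennreal ((cmod (a x))\<^sup>2) \<le> ennreal (B\<^sup>2)"
      by (intro ennreal_leI power_mono B) simp
    then show "(if x \<in> {0..<1} then ennreal ((cmod (a x))\<^sup>2) * row_sq g (finv T x) else 0) \<le> ennreal (B\<^sup>2) * row_sq g (finv T x) * indicator {0..<1} x"
      by (auto simp: indicator_def intro: mult_right_mono)
  qed
  also have "\<dots> = (\<integral>\<^sup>+x. ennreal (B\<^sup>2) * row_sq g (finv T x) \<partial>leb)"
    by (subst nn_integral_leb) auto
  also have "\<dots> = ennreal (B\<^sup>2) * (\<integral>\<^sup>+x. row_sq g (finv T x) \<partial>leb)"
    by (rule nn_integral_cmult) simp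
  also have "(\<integral>\<^sup>+x. row_sq g (finv T x) \<partial>leb) = (\<integral>\<^sup>+x. row_sq g x \<partial>distr leb leb (finv T))"
    by (rule nn_integral_distr[symmetric]) (simp_all cong: measurable_cong_sets)
  also have "\<dots> = (\<integral>\<^sup>+x. row_sq g x \<partial>leb)"
    by (simp only: full_group_distr[OF Ti])
  also have "\<dots> = (\<integral>\<^sup>+x. row_sq g x * indicator {0..<1} x \<partial>lborel)"
    by (rule nn_integral_leb) simp
  also have "\<dots> \<le> L2sq g"
    unfolding L2sq_eq by (intro nn_integral_mono) (auto simp: indicator_def)
  finally show ?thesis
    by (simp add: mult_left_mono)
qed

lemma supported_kmult_monomial_right:
  assumes S: "S \<in> full_group" and f: "supported f" "f \<in> borel_measurable borel" and b [measurable]: "b \<in> borel_measurable borel"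
  shows "supported (kmult f (monomial b S))" "kmult f (monomial b S) \<in> borel_measurable borel"
proof -
  show "supported (kmult f (monomial b S))"
    unfolding supported_def
  proof (intro allI impI)
    fix p :: "real \<times> real" assume p: "p \<notin> relE"
    obtain x z where xz: "p = (x, z)" by (cases p)
    have "f (x, S z) = 0" if z: "z \<in> {0..<1}"
    proof (rule supportedD[OF f(1)])
      show "(x, S z) \<notin> relE"
      proof
        assume "(x, S z) \<in> relE"
        then have "orbit x = orbit z"
          using orbit_eq[OF full_group_relE[OF S z]] orbit_eq by metis
        moreover have "z \<in> orbit z"
          using z by (simp add: orbit_iff relE_iff)
        ultimately have "z \<in> orbit x"
          by (simp only:)
        then show False
          using p xz by (simp add: orbit_iff)
      qed
    qed
    then show "kmult f (monomial b S) p = 0"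
      unfolding xz kmult_monomial_right[OF S f(1)] by auto
  qed
  note [measurable] = full_group_borel[OF S]
  have f': "f \<in> borel_measurable (borel \<Otimes>\<^sub>M borel)"
    using f(2) by (simp add: borel_prod)
  have [measurable]: "(\<lambda>p. f (fst p, S (snd p))) \<in> borel_measurable (borel \<Otimes>\<^sub>M borel)"
    by (rule measurable_compose[OF _ f']) measurable
  have "(\<lambda>p. if snd p \<in> {0..<1} then f (fst p, S (snd p)) * b (S (snd p)) else 0) \<in> borel_measurable (borel \<Otimes>\<^sub>M borel)"
    by measurable
  moreover have "kmult f (monomial b S) = (\<lambda>p. if snd p \<in> {0..<1} then f (fst p, S (snd p)) * b (S (snd p)) else 0)"
    using kmult_monomial_right[OF S f(1), of b] by (auto simp del: atLeastLessThan_iff)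
  ultimately show "kmult f (monomial b S) \<in> borel_measurable borel"
    by (simp add: borel_prod)
qed

lemma L2sq_monomial_right:
  assumes S: "S \<in> full_group" and B: "\<And>x. cmod (b x) \<le> B" and f: "supported f" "f \<in> borel_measurable borel"
    and b: "b \<in> borel_measurable borel"
  shows "L2sq (kmult f (monomial b S)) \<le> ennreal (B\<^sup>2) * L2sq f"
proof -
  have "L2sq (kmult f (monomial b S)) = L2sq (kmult (kstar (monomial b S)) (kstar f))"
    using L2sq_kstar[OF supported_kmult_monomial_right[OF S f b]] kstar_kmult_monomial_right[OF S f(1)] by simp
  also have "\<dots> \<le> ennreal (B\<^sup>2) * L2sq (kstar f)"
    unfolding kstar_monomial[OF S]
    by (rule L2sq_monomial_left[OF full_group_inv[OF S] _ kstar_supported[OF f(1)] kstar_borel[OF f(2)]])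
      (simp add: B)
  finally show ?thesis
    by (simp add: L2sq_kstar[OF f])
qed

lemma monomial_opnorm:
  assumes "T \<in> full_group" "\<And>x. cmod (a x) \<le> B"
  shows "opnorm_le (monomial a T) B"
proof -
  have "0 \<le> B"
    using assms(2)[of 0] norm_ge_zero[of "a 0"] by linarith
  then show ?thesis
    unfolding opnorm_le_def using L2sq_monomial_left[OF assms] by (auto simp: L2E_def supported_def)
qed

lemma monomial_ME:
  "T \<in> full_group \<Longrightarrow> a \<in> borel_measurable borel \<Longrightarrow> (\<And>x. cmod (a x) \<le> B) \<Longrightarrow> monomial a T \<in> ME"
  using monomial_L2E[of T a B] monomial_opnorm[of T a B] by (auto simp: ME_def)

section \<open>The ultrapower relation\<close>

lemma ME_L2E: "f \<in> ME \<Longrightarrow> f \<in> L2E"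
  by (simp add: ME_def)

lemma bdd_seqs_L2E: "x \<in> bdd_seqs \<Longrightarrow> x k \<in> L2E"
  by (simp add: bdd_seqs_def ME_L2E)

lemma urel_iff:
  "(x, y) \<in> urel \<omega> \<longleftrightarrow> x \<in> bdd_seqs \<and> y \<in> bdd_seqs \<and> ((\<lambda>k. sq_norm (\<lambda>p. x k p - y k p)) \<longlongrightarrow> 0) \<omega>"
proof (cases "x \<in> bdd_seqs \<and> y \<in> bdd_seqs")
  case True
  then have *: "knorm2 (\<lambda>p. x k p - y k p) = sqrt (sq_norm (\<lambda>p. x k p - y k p))" for k
    by (intro knorm2_eq L2E_diff bdd_seqs_L2E) auto
  have "((\<lambda>k. sqrt (sq_norm (\<lambda>p. x k p - y k p))) \<longlongrightarrow> 0) \<omega> \<longleftrightarrow> ((\<lambda>k. sq_norm (\<lambda>p. x k p - y k p)) \<longlongrightarrow> 0) \<omega>"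
  proof
    assume "((\<lambda>k. sqrt (sq_norm (\<lambda>p. x k p - y k p))) \<longlongrightarrow> 0) \<omega>"
    from tendsto_power[OF this, of 2] show "((\<lambda>k. sq_norm (\<lambda>p. x k p - y k p)) \<longlongrightarrow> 0) \<omega>"
      by simp
  next
    assume "((\<lambda>k. sq_norm (\<lambda>p. x k p - y k p)) \<longlongrightarrow> 0) \<omega>"
    from tendsto_real_sqrt[OF this] show "((\<lambda>k. sqrt (sq_norm (\<lambda>p. x k p - y k p))) \<longlongrightarrow> 0) \<omega>"
      by simp
  qed
  with True show ?thesis
    by (simp add: urel_def *)
next
  case False
  then show ?thesis by (auto simp: urel_def)
qed

lemma urel_refl: "x \<in> bdd_seqs \<Longrightarrow> (x, x) \<in> urel \<omega>"
  by (simp add: urel_iff sq_norm_def L2sq_def)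

lemma urel_sym:
  assumes "(x, y) \<in> urel \<omega>" shows "(y, x) \<in> urel \<omega>"
proof -
  have "sq_norm (\<lambda>p. y k p - x k p) = sq_norm (\<lambda>p. x k p - y k p)" for k
    by (rule sq_norm_minus_commute)
  then show ?thesis
    using assms unfolding urel_iff by simp
qed

lemma urel_trans:
  assumes xy: "(x, y) \<in> urel \<omega>" and yz: "(y, z) \<in> urel \<omega>"
  shows "(x, z) \<in> urel \<omega>"
proof -
  have b: "x \<in> bdd_seqs" "y \<in> bdd_seqs" "z \<in> bdd_seqs"
    and l: "((\<lambda>k. sq_norm (\<lambda>p. x k p - y k p)) \<longlongrightarrow> 0) \<omega>" "((\<lambda>k. sq_norm (\<lambda>p. y k p - z k p)) \<longlongrightarrow> 0) \<omega>"
    using xy yz by (simp_all add: urel_iff)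
  have bound: "sq_norm (\<lambda>p. x k p - z k p) \<le> 2 * sq_norm (\<lambda>p. x k p - y k p) + 2 * sq_norm (\<lambda>p. y k p - z k p)" for k
    using sq_norm_add_le[OF L2E_diff[OF b(1,2)[THEN bdd_seqs_L2E, of k]] L2E_diff[OF b(2,3)[THEN bdd_seqs_L2E, of k]]]
    by simp
  have lim: "((\<lambda>k. 2 * sq_norm (\<lambda>p. x k p - y k p) + 2 * sq_norm (\<lambda>p. y k p - z k p)) \<longlongrightarrow> 0) \<omega>"
    using tendsto_add[OF tendsto_mult[OF tendsto_const[of 2] l(1)] tendsto_mult[OF tendsto_const[of 2] l(2)]] by simp
  have "((\<lambda>k. sq_norm (\<lambda>p. x k p - z k p)) \<longlongrightarrow> 0) \<omega>"
    by (rule tendsto_squeeze_0[OF lim sq_norm_nonneg bound])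
  then show ?thesis
    using b by (simp add: urel_iff)
qed

lemma uclass_mem: "z \<in> uclass \<omega> x \<longleftrightarrow> (x, z) \<in> urel \<omega>"
  by (simp add: uclass_def)

lemma uclass_eq_iff:
  assumes "x \<in> bdd_seqs"
  shows "uclass \<omega> x = uclass \<omega> y \<longleftrightarrow> (x, y) \<in> urel \<omega>"
proof
  assume "uclass \<omega> x = uclass \<omega> y"
  then have "x \<in> uclass \<omega> y"
    using urel_refl[OF assms] by (auto simp: uclass_mem)
  then show "(x, y) \<in> urel \<omega>"
    by (simp add: uclass_mem urel_sym)
next
  assume xy: "(x, y) \<in> urel \<omega>"
  have "(x, z) \<in> urel \<omega> \<longleftrightarrow> (y, z) \<in> urel \<omega>" for z
    using urel_trans[OF xy] urel_trans[OF urel_sym[OF xy]] by blast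
  then show "uclass \<omega> x = uclass \<omega> y"
    by (auto simp: uclass_mem)
qed

definition monomial_seq :: "(nat \<Rightarrow> real \<Rightarrow> complex) \<Rightarrow> (nat \<Rightarrow> real \<Rightarrow> real) \<Rightarrow> bool" where
  "monomial_seq a T \<longleftrightarrow> (\<forall>k. T k \<in> full_group) \<and> (\<forall>k. a k \<in> borel_measurable borel) \<and>
     (\<exists>B. \<forall>k x. cmod (a k x) \<le> B)"

text \<open>With \<open>a\<close> in front of the permutation \<open>T\<close>, this is the class of the product of an element of \<open>A\<^sup>\<omega>\<close> and
  an element of \<open>\<E>\<^sup>\<omega>\<close>.\<close>

definition mclass :: "nat filter \<Rightarrow> (nat \<Rightarrow> real \<Rightarrow> complex) \<Rightarrow> (nat \<Rightarrow> real \<Rightarrow> real) \<Rightarrow> uelem" where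
  "mclass \<omega> a T = uclass \<omega> (\<lambda>k. monomial (a k) (T k))"

lemma monomial_seqD:
  assumes "monomial_seq a T"
  shows "T k \<in> full_group" "a k \<in> borel_measurable borel"
  using assms by (simp_all add: monomial_seq_def)

lemma monomial_seq_bdd: "monomial_seq a T \<Longrightarrow> (\<lambda>k. monomial (a k) (T k)) \<in> bdd_seqs"
  using monomial_ME monomial_opnorm unfolding monomial_seq_def bdd_seqs_def by blast

text \<open>Convolution sums are known to converge only for almost every row, where the row and all columns
  in its orbit are square summable; hence additivity holds only
  almost everywhere.\<close>

lemma kmult_add_right_AE:
  assumes x: "x \<in> L2E" and f: "f \<in> L2E" and g: "g \<in> L2E"
  shows "AE s in lborel. \<forall>z\<in>orbit s. kmult x (\<lambda>p. f p + g p) (s, z) = kmult x f (s, z) + kmult x g (s, z)"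
proof -
  have fin_row: "AE s in lborel. row_sq h s \<noteq> \<infinity>" if h: "h \<in> L2E" for h
  proof (rule nn_integral_PInf_AE)
    show "row_sq h \<in> borel_measurable lborel"
      using row_sq_measurable[OF L2E_D(2,1)[OF h]] by simp
    show "(\<integral>\<^sup>+x. row_sq h x \<partial>lborel) \<noteq> \<infinity>"
      using L2E_D(3)[OF h] by (metis L2sq_eq less_irrefl)
  qed
  have fin_col: "AE s in lborel. \<forall>q\<in>\<rat>. row_sq (kstar h) (q + 1 * s) \<noteq> \<infinity>" if h: "h \<in> L2E" for h
  proof (subst AE_ball_countable[OF countable_rat], rule ballI)
    fix q :: real
    note [measurable] = row_sq_measurable[OF L2E_D(2,1)[OF kstar_L2E[OF h]]]
    show "AE s in lborel. row_sq (kstar h) (q + 1 * s) \<noteq> \<infinity>"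
      by (rule AE_borel_affine[OF _ _ fin_row[OF kstar_L2E[OF h]]]) (simp, measurable)
  qed
  have summ: "u summable_on A" if "\<And>w. 0 \<le> u w" "(\<integral>\<^sup>+w. ennreal (u w) \<partial>count_space A) \<noteq> \<infinity>"
    for u :: "real \<Rightarrow> real" and A
  proof -
    have "integrable (count_space A) u"
      using that by (intro integrableI_bounded) (auto simp: less_top)
    then have "Infinite_Set_Sum.abs_summable_on u A"
      by (simp add: Infinite_Set_Sum.abs_summable_on_def)
    then show ?thesis
      using abs_summable_equivalent[of u A] that(1) by simp
  qed
  from fin_row[OF x] fin_col[OF f] fin_col[OF g] show ?thesis
  proof eventually_elim
    case (elim s)
    show ?case
    proof
      fix z assume z: "z \<in> orbit s"
      then have orb: "orbit s = orbit z"
        using orbit_eq by (simp add: orbit_iff)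
      have "z - s \<in> \<rat>"
        using z relE_sym by (simp add: orbit_iff relE_iff)
      then have cols: "row_sq (kstar f) z \<noteq> \<infinity>" "row_sq (kstar g) z \<noteq> \<infinity>"
        using elim(2,3) by (auto dest: bspec[of _ _ "z - s"])
      have prod: "(\<lambda>w. x (s, w) * h (w, z)) summable_on orbit s" if h: "row_sq (kstar h) z \<noteq> \<infinity>" for h
      proof -
        have "(\<lambda>w. (cmod (x (s, w)))\<^sup>2 + (cmod (h (w, z)))\<^sup>2) summable_on orbit s"
          using elim(1) h by (intro summable_on_add summ) (simp_all add: row_sq_def kstar_apply orb)
        then have "(\<lambda>w. cmod (x (s, w) * h (w, z))) summable_on orbit s"
        proof (rule summable_on_comparison_test)
          fix w
          have "2 * (cmod (x (s, w)) * cmod (h (w, z))) \<le> (cmod (x (s, w)))\<^sup>2 + (cmod (h (w, z)))\<^sup>2"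
            using sum_squares_bound[of "cmod (x (s, w))" "cmod (h (w, z))"] by simp
          moreover have "0 \<le> cmod (x (s, w)) * cmod (h (w, z))" by simp
          ultimately show "cmod (x (s, w) * h (w, z)) \<le> (cmod (x (s, w)))\<^sup>2 + (cmod (h (w, z)))\<^sup>2"
            unfolding norm_mult by linarith
        qed simp
        then show ?thesis
          by (rule abs_summable_summable)
      qed
      show "kmult x (\<lambda>p. f p + g p) (s, z) = kmult x f (s, z) + kmult x g (s, z)"
        unfolding kmult_apply distrib_left by (rule infsum_add[OF prod[OF cols(1)] prod[OF cols(2)]])
    qed
  qed
qed

lemma sq_norm_kmult_diff_le:
  assumes x: "x \<in> ME" "opnorm_le x C" and y: "y \<in> L2E" and v: "v \<in> L2E"
  shows "sq_norm (\<lambda>p. kmult x y p - kmult x v p) \<le> C\<^sup>2 * sq_norm (\<lambda>p. y p - v p)"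
proof (rule sq_norm_leI)
  let ?D = "\<lambda>p. y p - v p"
  have D: "?D \<in> L2E"
    by (rule L2E_diff[OF y v])
  have "AE s in lborel. row_sq (\<lambda>p. kmult x y p - kmult x v p) s = row_sq (kmult x ?D) s"
    using kmult_add_right_AE[OF ME_L2E[OF x(1)] D v]
  proof eventually_elim
    case (elim s)
    then show ?case
      unfolding row_sq_def by (intro nn_integral_cong) auto
  qed
  then have "L2sq (\<lambda>p. kmult x y p - kmult x v p) = L2sq (kmult x ?D)"
    unfolding L2sq_eq by (rule nn_integral_cong_AE)
  also have "\<dots> \<le> ennreal (C\<^sup>2) * L2sq ?D"
    using x(2) D by (simp add: opnorm_le_def)
  also have "\<dots> = ennreal (C\<^sup>2 * sq_norm ?D)"
    unfolding L2sq_eq_sq_norm[OF D] by (simp add: ennreal_mult)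
  finally show "L2sq (\<lambda>p. kmult x y p - kmult x v p) \<le> ennreal (C\<^sup>2 * sq_norm ?D)" .
qed simp

section \<open>Products, adjoints and traces of monomial classes\<close>

lemma monomial_seq_mult:
  assumes "monomial_seq a T" "monomial_seq b S"
  shows "monomial_seq (\<lambda>k x. a k x * b k (finv (T k) x)) (\<lambda>k x. T k (S k x))"
proof -
  obtain A B where A: "\<And>k x. cmod (a k x) \<le> A" and B: "\<And>k x. cmod (b k x) \<le> B"
    using assms unfolding monomial_seq_def by metis
  have "0 \<le> A"
    using A[of 0 0] norm_ge_zero[of "a 0 0"] by linarith
  then have "cmod (a k x * b k (finv (T k) x)) \<le> A * B" for k x
    unfolding norm_mult by (intro mult_mono A B) auto
  moreover have "(\<lambda>x. a k x * b k (finv (T k) x)) \<in> borel_measurable borel" for k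
  proof -
    note [measurable] = monomial_seqD(2)[OF assms(1)] monomial_seqD(2)[OF assms(2)]
      full_group_borel[OF full_group_inv[OF monomial_seqD(1)[OF assms(1)]]]
    show ?thesis by measurable
  qed
  ultimately show ?thesis
    unfolding monomial_seq_def using full_group_comp monomial_seqD(1)[OF assms(1)] monomial_seqD(1)[OF assms(2)] by blast
qed

text \<open>The product of two classes is taken over all representatives. The estimate writes
  \<open>xy - uv = x(y - v) + (x - u)v\<close>; the second term is small because \<open>v\<close> is monomial.\<close>

lemma mclass_mult:
  assumes u: "monomial_seq a T" and v: "monomial_seq b S"
  shows "mclass \<omega> a T \<otimes>\<^bsub>MEu \<omega>\<^esub> mclass \<omega> b S = mclass \<omega> (\<lambda>k x. a k x * b k (finv (T k) x)) (\<lambda>k x. T k (S k x))"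
proof -
  let ?u = "\<lambda>k. monomial (a k) (T k)" and ?v = "\<lambda>k. monomial (b k) (S k)"
  let ?uv = "\<lambda>k. kmult (?u k) (?v k)"
  note T = monomial_seqD(1)[OF u] and S = monomial_seqD(1)[OF v]
  have uv: "?uv = (\<lambda>k. monomial (\<lambda>x. a k x * b k (finv (T k) x)) (\<lambda>x. T k (S k x)))"
    by (rule ext) (rule kmult_monomial[OF T S])
  have ub: "?u \<in> bdd_seqs" and vb: "?v \<in> bdd_seqs" and uvb: "?uv \<in> bdd_seqs"
    unfolding uv using monomial_seq_bdd u v monomial_seq_mult[OF u v] by auto
  obtain B where B: "\<And>k x. cmod (b k x) \<le> B"
    using v unfolding monomial_seq_def by metis
  have close: "(?uv, \<lambda>k. kmult (p k) (q k)) \<in> urel \<omega>"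
    if p: "(?u, p) \<in> urel \<omega>" and q: "(?v, q) \<in> urel \<omega>" and pq: "(\<lambda>k. kmult (p k) (q k)) \<in> bdd_seqs" for p q
  proof -
    have pb: "p \<in> bdd_seqs" and qb: "q \<in> bdd_seqs"
      and lp: "((\<lambda>k. sq_norm (\<lambda>z. ?u k z - p k z)) \<longlongrightarrow> 0) \<omega>" and lq: "((\<lambda>k. sq_norm (\<lambda>z. ?v k z - q k z)) \<longlongrightarrow> 0) \<omega>"
      using p q by (simp_all add: urel_iff)
    obtain C where C: "\<And>k. opnorm_le (p k) C"
      using pb unfolding bdd_seqs_def by blast
    have pME: "p k \<in> ME" for k
      using pb by (simp add: bdd_seqs_def)
    have bound: "sq_norm (\<lambda>z. kmult (p k) (q k) z - ?uv k z) \<le>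
        2 * (C\<^sup>2 * sq_norm (\<lambda>z. ?v k z - q k z)) + 2 * (B\<^sup>2 * sq_norm (\<lambda>z. ?u k z - p k z))" for k
    proof -
      note pL = bdd_seqs_L2E[OF pb, of k] and qL = bdd_seqs_L2E[OF qb, of k]
        and uL = bdd_seqs_L2E[OF ub, of k] and vL = bdd_seqs_L2E[OF vb, of k]
      let ?pv = "kmult (p k) (?v k)"
      note bm = monomial_seqD(2)[OF v, of k]
      have pvL: "?pv \<in> L2E"
      proof (rule L2E_I)
        show "?pv \<in> borel_measurable borel" "supported ?pv"
          using supported_kmult_monomial_right[OF S L2E_D(2,1)[OF pL] bm] by auto
        have "L2sq ?pv \<le> ennreal (B\<^sup>2) * L2sq (p k)"
          by (rule L2sq_monomial_right[OF S B L2E_D(2,1)[OF pL] bm])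
        also have "\<dots> < \<infinity>"
          using L2E_D(3)[OF pL] by (simp add: ennreal_mult_less_top)
        finally show "L2sq ?pv < \<infinity>" .
      qed
      have "sq_norm (\<lambda>z. kmult (p k) (q k) z - ?uv k z) =
          sq_norm (\<lambda>z. (kmult (p k) (q k) z - ?pv z) + (?pv z - ?uv k z))"
        by simp
      also have "\<dots> \<le> 2 * sq_norm (\<lambda>z. kmult (p k) (q k) z - ?pv z) + 2 * sq_norm (\<lambda>z. ?pv z - ?uv k z)"
        by (rule sq_norm_add_le[OF L2E_diff[OF bdd_seqs_L2E[OF pq] pvL] L2E_diff[OF pvL bdd_seqs_L2E[OF uvb]]])
      also have "sq_norm (\<lambda>z. kmult (p k) (q k) z - ?pv z) \<le> C\<^sup>2 * sq_norm (\<lambda>z. q k z - ?v k z)"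
        by (rule sq_norm_kmult_diff_le[OF pME C qL vL])
      also have "sq_norm (\<lambda>z. ?pv z - ?uv k z) \<le> B\<^sup>2 * sq_norm (\<lambda>z. p k z - ?u k z)"
      proof (rule sq_norm_leI)
        let ?D = "\<lambda>z. p k z - ?u k z"
        have D: "?D \<in> L2E" by (rule L2E_diff[OF pL uL])
        have "(\<lambda>z. ?pv z - ?uv k z) = kmult ?D (?v k)"
        proof
          fix z :: "real \<times> real"
          obtain s t where z: "z = (s, t)" by (cases z)
          show "?pv z - ?uv k z = kmult ?D (?v k) z"
            unfolding z kmult_monomial_right[OF S L2E_D(2)[OF pL]] kmult_monomial_right[OF S L2E_D(2)[OF uL]]
              kmult_monomial_right[OF S L2E_D(2)[OF D]] by (simp add: left_diff_distrib)
        qed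
        then have "L2sq (\<lambda>z. ?pv z - ?uv k z) \<le> ennreal (B\<^sup>2) * L2sq ?D"
          using L2sq_monomial_right[OF S B L2E_D(2,1)[OF D] bm] by simp
        also have "\<dots> = ennreal (B\<^sup>2 * sq_norm ?D)"
          unfolding L2sq_eq_sq_norm[OF D] by (simp add: ennreal_mult)
        finally show "L2sq (\<lambda>z. ?pv z - ?uv k z) \<le> ennreal (B\<^sup>2 * sq_norm ?D)" .
      qed simp
      finally show ?thesis
        unfolding sq_norm_minus_commute[of "q k" "?v k"] sq_norm_minus_commute[of "p k" "?u k"]
        by simp
    qed
    have lim: "((\<lambda>k. 2 * (C\<^sup>2 * sq_norm (\<lambda>z. ?v k z - q k z)) + 2 * (B\<^sup>2 * sq_norm (\<lambda>z. ?u k z - p k z))) \<longlongrightarrow> 0) \<omega>"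
      using tendsto_add[OF tendsto_mult[OF tendsto_const[of 2] tendsto_mult[OF tendsto_const[of "C\<^sup>2"] lq]]
        tendsto_mult[OF tendsto_const[of 2] tendsto_mult[OF tendsto_const[of "B\<^sup>2"] lp]]] by simp
    have "((\<lambda>k. sq_norm (\<lambda>z. kmult (p k) (q k) z - ?uv k z)) \<longlongrightarrow> 0) \<omega>"
      by (rule tendsto_squeeze_0[OF lim sq_norm_nonneg bound])
    then have "(\<lambda>k. kmult (p k) (q k), ?uv) \<in> urel \<omega>"
      using pq uvb by (simp add: urel_iff)
    then show ?thesis by (rule urel_sym)
  qed
  have "mclass \<omega> a T \<otimes>\<^bsub>MEu \<omega>\<^esub> mclass \<omega> b S =
      (\<Union>x\<in>uclass \<omega> ?u. \<Union>y\<in>uclass \<omega> ?v. uclass \<omega> (\<lambda>k. kmult (x k) (y k)))"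
    by (simp add: MEu_def mclass_def)
  also have "\<dots> = uclass \<omega> ?uv"
  proof (intro equalityI subsetI)
    fix z assume "z \<in> (\<Union>x\<in>uclass \<omega> ?u. \<Union>y\<in>uclass \<omega> ?v. uclass \<omega> (\<lambda>k. kmult (x k) (y k)))"
    then obtain p q where pq: "(?u, p) \<in> urel \<omega>" "(?v, q) \<in> urel \<omega>" "(\<lambda>k. kmult (p k) (q k), z) \<in> urel \<omega>"
      by (auto simp: uclass_mem)
    then have "(\<lambda>k. kmult (p k) (q k)) \<in> bdd_seqs"
      by (simp add: urel_iff)
    from urel_trans[OF close[OF pq(1,2) this] pq(3)] show "z \<in> uclass \<omega> ?uv"
      by (simp add: uclass_mem)
  next
    fix z assume "z \<in> uclass \<omega> ?uv"
    moreover have "?u \<in> uclass \<omega> ?u" "?v \<in> uclass \<omega> ?v"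
      using urel_refl[OF ub] urel_refl[OF vb] by (simp_all add: uclass_mem)
    ultimately show "z \<in> (\<Union>x\<in>uclass \<omega> ?u. \<Union>y\<in>uclass \<omega> ?v. uclass \<omega> (\<lambda>k. kmult (x k) (y k)))"
      by blast
  qed
  finally show ?thesis
    unfolding uv by (simp add: mclass_def)
qed

lemma kstar_diff: "(\<lambda>z. kstar f z - kstar g z) = kstar (\<lambda>z. f z - g z)"
  by (auto simp: kstar_def)

lemma mclass_star:
  assumes u: "monomial_seq a T"
  shows "ustar \<omega> (mclass \<omega> a T) = mclass \<omega> (\<lambda>k x. cnj (a k (T k x))) (\<lambda>k. finv (T k))"
proof -
  let ?u = "\<lambda>k. monomial (a k) (T k)"
  note T = monomial_seqD(1)[OF u]
  have su: "(\<lambda>k. kstar (?u k)) = (\<lambda>k. monomial (\<lambda>x. cnj (a k (T k x))) (finv (T k)))"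
    by (rule ext) (rule kstar_monomial[OF T])
  have ub: "?u \<in> bdd_seqs"
    by (rule monomial_seq_bdd[OF u])
  obtain A where A: "\<And>k x. cmod (a k x) \<le> A"
    using u unfolding monomial_seq_def by metis
  have "monomial_seq (\<lambda>k x. cnj (a k (T k x))) (\<lambda>k. finv (T k))"
    unfolding monomial_seq_def
  proof (intro conjI allI)
    show "finv (T k) \<in> full_group" for k
      by (rule full_group_inv[OF T])
    show "(\<lambda>x. cnj (a k (T k x))) \<in> borel_measurable borel" for k
    proof -
      have "(\<lambda>x. a k (T k x)) \<in> borel_measurable borel"
        by (rule measurable_compose[OF full_group_borel[OF T] monomial_seqD(2)[OF u]])
      moreover have "cnj \<in> borel_measurable borel"
        by (intro borel_measurable_continuous_onI continuous_intros)
      ultimately show ?thesis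
        by (rule measurable_compose)
    qed
    show "\<exists>B. \<forall>k x. cmod (cnj (a k (T k x))) \<le> B"
      using A by (intro exI[of _ A]) simp
  qed
  then have sub: "(\<lambda>k. kstar (?u k)) \<in> bdd_seqs"
    unfolding su by (rule monomial_seq_bdd)
  have "ustar \<omega> (mclass \<omega> a T) = uclass \<omega> (\<lambda>k. kstar (?u k))"
    unfolding ustar_def mclass_def
  proof (intro equalityI subsetI)
    fix z assume "z \<in> (\<Union>x\<in>uclass \<omega> ?u. uclass \<omega> (\<lambda>k. kstar (x k)))"
    then obtain p where p: "(?u, p) \<in> urel \<omega>" "(\<lambda>k. kstar (p k), z) \<in> urel \<omega>"
      by (auto simp: uclass_mem)
    then have pb: "p \<in> bdd_seqs" "(\<lambda>k. kstar (p k)) \<in> bdd_seqs"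
      and lim: "((\<lambda>k. sq_norm (\<lambda>z. ?u k z - p k z)) \<longlongrightarrow> 0) \<omega>"
      by (simp_all add: urel_iff)
    have "sq_norm (\<lambda>z. kstar (?u k) z - kstar (p k) z) = sq_norm (\<lambda>z. ?u k z - p k z)" for k
      using L2sq_kstar[OF L2E_D(2,1)[OF L2E_diff[OF bdd_seqs_L2E[OF ub] bdd_seqs_L2E[OF pb(1)]]], of k k]
      unfolding kstar_diff sq_norm_def by simp
    then have "(\<lambda>k. kstar (?u k), \<lambda>k. kstar (p k)) \<in> urel \<omega>"
      using lim sub pb(2) by (simp add: urel_iff)
    from urel_trans[OF this p(2)] show "z \<in> uclass \<omega> (\<lambda>k. kstar (?u k))"
      by (simp add: uclass_mem)
  next
    fix z assume "z \<in> uclass \<omega> (\<lambda>k. kstar (?u k))"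
    moreover have "?u \<in> uclass \<omega> ?u"
      using urel_refl[OF ub] by (simp add: uclass_mem)
    ultimately show "z \<in> (\<Union>x\<in>uclass \<omega> ?u. uclass \<omega> (\<lambda>k. kstar (x k)))"
      by blast
  qed
  then show ?thesis
    unfolding su by (simp add: mclass_def)
qed

section \<open>Equality of monomial classes\<close>

lemma integral_limit_iff_alm:
  assumes h [measurable]: "\<And>k. h k \<in> borel_measurable borel" and nn: "\<And>k x. 0 \<le> h k x" and M: "\<And>k x. h k x \<le> M"
  shows "((\<lambda>k. enn2real (\<integral>\<^sup>+x. ennreal (h k x) \<partial>leb)) \<longlongrightarrow> 0) \<omega> \<longleftrightarrow> (\<forall>e>0. alm \<omega> (\<lambda>k x. h k x < e))"
proof -
  let ?I = "\<lambda>k. enn2real (\<integral>\<^sup>+x. ennreal (h k x) \<partial>leb)"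
  have M0: "0 \<le> M"
    using nn[of 0 0] M[of 0 0] by linarith
  define D where "D e k = {x. e \<le> h k x}" for e k
  have D [measurable]: "D e k \<in> sets borel" for e k
    unfolding D_def by (rule borel_Collect) measurable
  have Iint: "(\<integral>\<^sup>+x. ennreal (h k x) \<partial>leb) = ennreal (?I k)" for k
  proof -
    have "(\<integral>\<^sup>+x. ennreal (h k x) \<partial>leb) \<le> (\<integral>\<^sup>+x. ennreal M \<partial>leb)"
      by (intro nn_integral_mono ennreal_leI M)
    also have "\<dots> < \<infinity>"
      unfolding nn_integral_leb_const by simp
    finally show ?thesis
      by (simp add: ennreal_enn2real_if)
  qed
  have low: "e * measure leb (D e k) \<le> ?I k" if "0 < e" for e k
  proof -
    have "ennreal (e * measure leb (D e k)) = (\<integral>\<^sup>+x. ennreal e * indicator (D e k) x \<partial>leb)"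
      using that by (simp add: nn_integral_cmult_indicator ennreal_mult leb.emeasure_eq_measure)
    also have "\<dots> \<le> (\<integral>\<^sup>+x. ennreal (h k x) \<partial>leb)"
      by (intro nn_integral_mono) (auto simp: D_def indicator_def intro: ennreal_leI)
    also have "\<dots> = ennreal (?I k)"
      by (rule Iint)
    finally show ?thesis
      by (simp add: ennreal_le_iff)
  qed
  have up: "?I k \<le> e + M * measure leb (D e k)" if "0 < e" for e k
  proof -
    have "ennreal (?I k) = (\<integral>\<^sup>+x. ennreal (h k x) \<partial>leb)"
      by (rule Iint[symmetric])
    also have "\<dots> \<le> (\<integral>\<^sup>+x. (ennreal e + ennreal M * indicator (D e k) x) \<partial>leb)"
    proof (rule nn_integral_mono)
      fix x
      show "ennreal (h k x) \<le> ennreal e + ennreal M * indicator (D e k) x"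
      proof (cases "x \<in> D e k")
        case True
        then show ?thesis
          using ennreal_leI[OF M[of k x]] by (simp add: add_increasing)
      next
        case False
        then show ?thesis
          using that by (simp add: D_def ennreal_leI)
      qed
    qed
    also have "\<dots> = ennreal e + ennreal M * emeasure leb (D e k)"
      by (subst nn_integral_add) (simp_all add: nn_integral_leb_const nn_integral_cmult_indicator del: nn_integral_const)
    also have "\<dots> = ennreal (e + M * measure leb (D e k))"
      using that M0 by (simp add: leb.emeasure_eq_measure ennreal_mult ennreal_plus)
    finally show ?thesis
      by (subst (asm) ennreal_le_iff) (use that M0 in auto)
  qed
  have alm_D: "alm \<omega> (\<lambda>k x. h k x < e) \<longleftrightarrow> ((\<lambda>k. measure leb (D e k)) \<longlongrightarrow> 0) \<omega>" for e
    using alm_notin_iff[of "D e" \<omega>] D by (simp add: D_def not_le)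
  show ?thesis
  proof
    assume lim: "(?I \<longlongrightarrow> 0) \<omega>"
    show "\<forall>e>0. alm \<omega> (\<lambda>k x. h k x < e)"
    proof (intro allI impI)
      fix e :: real assume e: "0 < e"
      have "((\<lambda>k. ?I k / e) \<longlongrightarrow> 0) \<omega>"
        using tendsto_divide[OF lim tendsto_const[of e]] e by simp
      then have "((\<lambda>k. measure leb (D e k)) \<longlongrightarrow> 0) \<omega>"
        by (rule tendsto_squeeze_0) (use low[OF e] e in \<open>simp_all add: field_simps\<close>)
      then show "alm \<omega> (\<lambda>k x. h k x < e)"
        by (simp only: alm_D)
    qed
  next
    assume *: "\<forall>e>0. alm \<omega> (\<lambda>k x. h k x < e)"
    show "(?I \<longlongrightarrow> 0) \<omega>"
    proof (rule tendstoI)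
      fix e :: real assume e: "0 < e"
      have "alm \<omega> (\<lambda>k x. h k x < e / 2)"
        by (rule *[rule_format, OF half_gt_zero[OF e]])
      then have "((\<lambda>k. measure leb (D (e / 2) k)) \<longlongrightarrow> 0) \<omega>"
        by (simp only: alm_D)
      from tendsto_mult[OF tendsto_const[of M] this]
      have "((\<lambda>k. M * measure leb (D (e / 2) k)) \<longlongrightarrow> 0) \<omega>" by simp
      from order_tendstoD(2)[OF this half_gt_zero[OF e]]
      show "eventually (\<lambda>k. dist (?I k) 0 < e) \<omega>"
      proof eventually_elim
        case (elim k)
        then show ?case
          using up[OF half_gt_zero[OF e], of k] by (simp add: dist_real_def)
      qed
    qed
  qed
qed

lemma mclass_eq_iff:
  assumes a: "monomial_seq a T" and b: "monomial_seq b T"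
  shows "mclass \<omega> a T = mclass \<omega> b T \<longleftrightarrow> (\<forall>e>0. alm \<omega> (\<lambda>k x. cmod (a k x - b k x) < e))"
proof -
  note T = monomial_seqD(1)[OF a]
  note [measurable] = monomial_seqD(2)[OF a] monomial_seqD(2)[OF b]
  obtain A B where AB: "\<And>k x. cmod (a k x) \<le> A" "\<And>k x. cmod (b k x) \<le> B"
    using a b unfolding monomial_seq_def by metis
  define h where "h k x = (cmod (a k x - b k x))\<^sup>2" for k x
  have "mclass \<omega> a T = mclass \<omega> b T \<longleftrightarrow>
      ((\<lambda>k. sq_norm (\<lambda>p. monomial (a k) (T k) p - monomial (b k) (T k) p)) \<longlongrightarrow> 0) \<omega>"
    unfolding mclass_def uclass_eq_iff[OF monomial_seq_bdd[OF a]] urel_iff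
    using monomial_seq_bdd[OF a] monomial_seq_bdd[OF b] by simp
  also have "\<dots> \<longleftrightarrow> ((\<lambda>k. enn2real (\<integral>\<^sup>+x. ennreal (h k x) \<partial>leb)) \<longlongrightarrow> 0) \<omega>"
    unfolding sq_norm_monomial_diff[OF T T monomial_seqD(2)[OF a] monomial_seqD(2)[OF b]] h_def by simp
  also have "\<dots> \<longleftrightarrow> (\<forall>e>0. alm \<omega> (\<lambda>k x. h k x < e))"
  proof (rule integral_limit_iff_alm[where M = "(A + B)\<^sup>2"])
    show "h k \<in> borel_measurable borel" for k
      unfolding h_def by measurable
    show "h k x \<le> (A + B)\<^sup>2" for k x
      unfolding h_def
      using norm_triangle_ineq4[of "a k x" "b k x"] AB(1)[of k x] AB(2)[of k x] by (intro power_mono) auto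
  qed (simp add: h_def)
  also have "\<dots> \<longleftrightarrow> (\<forall>e>0. alm \<omega> (\<lambda>k x. cmod (a k x - b k x) < e))"
  proof
    assume *: "\<forall>e>0. alm \<omega> (\<lambda>k x. h k x < e)"
    show "\<forall>e>0. alm \<omega> (\<lambda>k x. cmod (a k x - b k x) < e)"
    proof (intro allI impI)
      fix e :: real assume e: "0 < e"
      then have "alm \<omega> (\<lambda>k x. h k x < e\<^sup>2)"
        by (intro *[rule_format]) simp
      then show "alm \<omega> (\<lambda>k x. cmod (a k x - b k x) < e)"
        by (rule alm_mono) (use e in \<open>auto simp: h_def intro: power_less_imp_less_base\<close>)
    qed
  next
    assume *: "\<forall>e>0. alm \<omega> (\<lambda>k x. cmod (a k x - b k x) < e)"
    show "\<forall>e>0. alm \<omega> (\<lambda>k x. h k x < e)"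
    proof (intro allI impI)
      fix e :: real assume e: "0 < e"
      then have "alm \<omega> (\<lambda>k x. cmod (a k x - b k x) < sqrt e)"
        by (intro *[rule_format]) simp
      then show "alm \<omega> (\<lambda>k x. h k x < e)"
      proof (rule alm_mono)
        fix k x assume "cmod (a k x - b k x) < sqrt e"
        then have "(cmod (a k x - b k x))\<^sup>2 < (sqrt e)\<^sup>2"
          by (rule power_strict_mono) simp_all
        then show "h k x < e"
          using e by (simp add: h_def)
      qed
    qed
  qed
  finally show ?thesis .
qed

definition kclass :: "nat filter \<Rightarrow> (nat \<Rightarrow> real \<Rightarrow> real) \<Rightarrow> uelem" where
  "kclass \<omega> T = mclass \<omega> (\<lambda>k x. 1) T"

lemma monomial_seq_one: "(\<And>k. T k \<in> full_group) \<Longrightarrow> monomial_seq (\<lambda>k x. 1) T"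
  by (auto simp: monomial_seq_def intro!: exI[of _ 1])

lemma kclass_eq_iff:
  assumes T: "\<And>k. T k \<in> full_group" and S: "\<And>k. S k \<in> full_group"
  shows "kclass \<omega> T = kclass \<omega> S \<longleftrightarrow> alm \<omega> (\<lambda>k x. T k x = S k x)"
proof -
  note [measurable] = full_group_borel[OF full_group_inv[OF T]] full_group_borel[OF full_group_inv[OF S]]
  note Tb = monomial_seq_bdd[OF monomial_seq_one[OF T]] and Sb = monomial_seq_bdd[OF monomial_seq_one[OF S]]
  define h where "h k x = (if finv (T k) x = finv (S k) x then 0 else 2::real)" for k x
  have "kclass \<omega> T = kclass \<omega> S \<longleftrightarrow>
      ((\<lambda>k. sq_norm (\<lambda>p. monomial (\<lambda>x. 1) (T k) p - monomial (\<lambda>x. 1) (S k) p)) \<longlongrightarrow> 0) \<omega>"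
    unfolding kclass_def mclass_def uclass_eq_iff[OF Tb] urel_iff using Tb Sb by simp
  also have "\<dots> \<longleftrightarrow> ((\<lambda>k. enn2real (\<integral>\<^sup>+x. ennreal (h k x) \<partial>leb)) \<longlongrightarrow> 0) \<omega>"
  proof -
    have "sq_norm (\<lambda>p. monomial (\<lambda>x. 1) (T k) p - monomial (\<lambda>x. 1) (S k) p) = enn2real (\<integral>\<^sup>+x. ennreal (h k x) \<partial>leb)" for k
      unfolding h_def
      by (subst sq_norm_monomial_diff[OF T S]) (auto intro!: arg_cong[where f = enn2real] nn_integral_cong)
    then show ?thesis by simp
  qed
  also have "\<dots> \<longleftrightarrow> (\<forall>e>0. alm \<omega> (\<lambda>k x. h k x < e))"
  proof (rule integral_limit_iff_alm[where M = 2])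
    show "h k \<in> borel_measurable borel" for k
      unfolding h_def by measurable
  qed (simp_all add: h_def)
  also have "\<dots> \<longleftrightarrow> alm \<omega> (\<lambda>k x. T k x = S k x)"
  proof
    assume "\<forall>e>0. alm \<omega> (\<lambda>k x. h k x < e)"
    then have *: "alm \<omega> (\<lambda>k x. h k x < 1)"
      by (rule allE[of _ 1]) simp
    have "alm \<omega> (\<lambda>k x. h k (T k x) < 1)"
      by (rule alm_vimage[OF *, where T = T], rule T)
    then show "alm \<omega> (\<lambda>k x. T k x = S k x)"
    proof (rule alm_mono)
      fix k x assume "h k (T k x) < 1"
      then have "x = finv (S k) (T k x)"
        using T by (simp add: h_def split: if_splits)
      then show "T k x = S k x"
        using S by (metis full_group_inv_apply(2))
    qed
  next
    assume *: "alm \<omega> (\<lambda>k x. T k x = S k x)"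
    have "alm \<omega> (\<lambda>k x. T k (finv (T k) x) = S k (finv (T k) x))"
      by (rule alm_vimage[OF *, where T = "\<lambda>k. finv (T k)"], rule full_group_inv[OF T])
    show "\<forall>e>0. alm \<omega> (\<lambda>k x. h k x < e)"
    proof (intro allI impI)
      fix e :: real assume e: "0 < e"
      show "alm \<omega> (\<lambda>k x. h k x < e)"
      proof (rule alm_mono[OF \<open>alm \<omega> (\<lambda>k x. T k (finv (T k) x) = S k (finv (T k) x))\<close>])
        fix k x assume "T k (finv (T k) x) = S k (finv (T k) x)"
        then have "x = S k (finv (T k) x)"
          using T by simp
        then have "finv (S k) x = finv (T k) x"
          using S by (simp add: inv_full_group_eq)
        then show "h k x < e"
          using e by (simp add: h_def)
      qed
    qed
  qed
  finally show ?thesis .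
qed

lemma kclass_mult:
  assumes "\<And>k. T k \<in> full_group" "\<And>k. S k \<in> full_group"
  shows "kclass \<omega> T \<otimes>\<^bsub>MEu \<omega>\<^esub> kclass \<omega> S = kclass \<omega> (\<lambda>k x. T k (S k x))"
  unfolding kclass_def using mclass_mult[OF monomial_seq_one[OF assms(1)] monomial_seq_one[OF assms(2)]] by simp

lemma kclass_star: "(\<And>k. T k \<in> full_group) \<Longrightarrow> ustar \<omega> (kclass \<omega> T) = kclass \<omega> (\<lambda>k. finv (T k))"
  unfolding kclass_def using mclass_star[OF monomial_seq_one] by simp

section \<open>Representatives of permutations and diagonal elements\<close>

lemma sq_norm_eq_0I:
  assumes "AE x in lborel. row_sq f x = 0"
  shows "sq_norm f = 0"
proof -
  have "L2sq f = (\<integral>\<^sup>+x. 0 \<partial>(lborel :: real measure))"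
    unfolding L2sq_eq by (rule nn_integral_cong_AE[OF assms])
  then show ?thesis
    by (simp add: sq_norm_def)
qed

lemma AE_unit_null_set:
  assumes "AE x in lebesgue_on {0..1}. P x"
  obtains N where "N \<in> null_sets lborel" "\<And>x::real. x \<in> {0..1} \<Longrightarrow> x \<notin> N \<Longrightarrow> P x"
proof -
  have "AE x in lborel. x \<in> {0..1} \<longrightarrow> P x"
    using assms by (simp add: AE_unit_iff)
  then obtain N where "N \<in> null_sets lborel" "{x \<in> space lborel. \<not> (x \<in> {0..1} \<longrightarrow> P x)} \<subseteq> N"
    unfolding eventually_ae_filter by blast
  then show ?thesis
    by (intro that[of N]) auto
qed

text \<open>After removal of a null set saturated under rational translations, an element of
  \<open>fullE\<close> is the graph of a bijection, which is completed by the identity.\<close>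

lemma fullE_representation:
  assumes u: "u \<in> fullE"
  obtains T where "T \<in> full_group" "sq_norm (\<lambda>p. u p - monomial (\<lambda>x. 1) T p) = 0"
proof -
  have uME: "u \<in> ME" and u01: "range u \<subseteq> {0, 1}"
    and rows: "AE x in lebesgue_on {0..1}. \<exists>!y. u (x, y) = 1"
    and cols: "AE y in lebesgue_on {0..1}. \<exists>!x. u (x, y) = 1"
    using u by (auto simp: fullE_def)
  note uL = L2E_D[OF ME_L2E[OF uME]]
  note [measurable] = uL(1)
  obtain N1 where N1: "N1 \<in> null_sets lborel" "\<And>x. x \<in> {0..1} \<Longrightarrow> x \<notin> N1 \<Longrightarrow> \<exists>!y. u (x, y) = 1"
    using rows by (rule AE_unit_null_set) blast
  obtain N2 where N2: "N2 \<in> null_sets lborel" "\<And>y. y \<in> {0..1} \<Longrightarrow> y \<notin> N2 \<Longrightarrow> \<exists>!x. u (x, y) = 1"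
    using cols by (rule AE_unit_null_set) blast
  define N0 where "N0 = N1 \<union> N2 \<union> {1}"
  have N0: "N0 \<in> null_sets lborel"
    unfolding N0_def using N1(1) N2(1) by (intro null_sets.Un) auto
  \<comment> \<open>The saturation of the exceptional null set under rational translations.\<close>
  define N where "N = (\<Union>q\<in>\<rat>. {z. z - q \<in> N0})"
  have "{z. z - q \<in> N0} \<in> null_sets lborel" for q
  proof (rule null_setsI)
    have N0b: "N0 \<in> sets borel" using N0 by auto
    have "(\<lambda>z. z - q) \<in> borel_measurable borel" by measurable
    from measurable_sets_borel[OF this N0b] show "{z. z - q \<in> N0} \<in> sets lborel"
      by (simp add: vimage_def)
    show "emeasure lborel {z. z - q \<in> N0} = 0"
      using emeasure_lborel_translate[OF N0b, of q] N0 by auto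
  qed
  then have N: "N \<in> null_sets lborel"
    unfolding N_def using countable_rat by (intro null_sets_UN') auto
  have N0_N: "N0 \<subseteq> N"
    by (auto simp: N_def intro!: bexI[of _ 0])
  define X where "X = {0..<1} - N"
  have X_borel [measurable]: "X \<in> sets borel"
    using N by (auto simp: X_def)
  have X_sat: "z \<in> X" if x: "x \<in> X" and xz: "(x, z) \<in> relE" for x z
  proof -
    have "z \<notin> N"
    proof
      assume "z \<in> N"
      then obtain q where q: "q \<in> \<rat>" "z - q \<in> N0" by (auto simp: N_def)
      have "q + (x - z) \<in> \<rat>"
        using q xz by (intro Rats_add) (auto simp: relE_iff)
      moreover have "x - (q + (x - z)) \<in> N0" using q by simp
      ultimately have "x \<in> N" unfolding N_def by blast
      with x show False by (simp add: X_def)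
    qed
    moreover have "z \<noteq> 1"
      using calculation N0_N by (auto simp: N0_def)
    ultimately show ?thesis
      using xz by (auto simp: X_def relE_iff)
  qed
  have X_unit: "x \<in> {0..1}" and X_N1: "x \<notin> N1" and X_N2: "x \<notin> N2" if "x \<in> X" for x
    using that N0_N by (auto simp: X_def N0_def)
  have X_row: "\<exists>!y. u (x, y) = 1" if "x \<in> X" for x
    by (rule N1(2)[OF X_unit[OF that] X_N1[OF that]])
  have X_col: "\<exists>!y. u (y, x) = 1" if "x \<in> X" for x
    by (rule N2(2)[OF X_unit[OF that] X_N2[OF that]])
  have u_relE: "(x, y) \<in> relE" if "u (x, y) = 1" for x y
    using that supportedD[OF uL(2), of "(x, y)"] by auto
  define T where "T y = (if y \<in> X then THE x. u (x, y) = 1 else y)" for y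
  define S where "S x = (if x \<in> X then THE y. u (x, y) = 1 else x)" for x
  have T: "u (T y, y) = 1" if "y \<in> X" for y
    using theI'[OF X_col[OF that]] that by (simp add: T_def)
  have S: "u (x, S x) = 1" if "x \<in> X" for x
    using theI'[OF X_row[OF that]] that by (simp add: S_def)
  have T_unique: "T y = x" if "u (x, y) = 1" "y \<in> X" for x y
    using X_col[OF that(2)] T[OF that(2)] that(1) by auto
  have S_unique: "S x = y" if "u (x, y) = 1" "x \<in> X" for x y
    using X_row[OF that(2)] S[OF that(2)] that(1) by auto
  have TX: "T y \<in> X" if "y \<in> X" for y
    by (rule X_sat[OF that relE_sym[OF u_relE[OF T[OF that]]]])
  have SX: "S y \<in> X" if "y \<in> X" for y
    by (rule X_sat[OF that u_relE[OF S[OF that]]])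
  have fg: "T \<in> full_group"
  proof (rule full_groupI[where S = S])
    show "S (T x) = x" for x
      using S_unique[OF T TX, of x] by (cases "x \<in> X") (simp_all add: T_def S_def)
    show "T (S x) = x" for x
      using T_unique[OF S SX, of x] by (cases "x \<in> X") (simp_all add: T_def S_def)
    show "T x - x \<in> \<rat>" for x
      using u_relE[OF T, of x] by (cases "x \<in> X") (auto simp: relE_iff T_def)
    show "x \<notin> {0..<1} \<Longrightarrow> T x = x" for x
      by (auto simp: T_def X_def)
    show "T \<in> borel_measurable borel"
    proof (rule measurableI)
      fix A :: "real set" assume [measurable]: "A \<in> sets borel"
      have "T -` A \<inter> space borel = (A - X) \<union> (\<Union>q\<in>\<rat>. {y. y \<in> X \<and> u (y + q, y) = 1 \<and> y + q \<in> A})"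
      proof (rule Set.set_eqI, rule iffI)
        fix y assume "y \<in> T -` A \<inter> space borel"
        then have Ty: "T y \<in> A" by simp
        show "y \<in> (A - X) \<union> (\<Union>q\<in>\<rat>. {y. y \<in> X \<and> u (y + q, y) = 1 \<and> y + q \<in> A})"
        proof (cases "y \<in> X")
          case True
          have "T y - y \<in> \<rat>"
            using u_relE[OF T[OF True]] by (simp add: relE_iff)
          then show ?thesis
            using True Ty T[OF True] by (intro UnI2 UN_I[of "T y - y"]) simp_all
        next
          case False
          then show ?thesis using Ty by (simp add: T_def)
        qed
      next
        fix y assume "y \<in> (A - X) \<union> (\<Union>q\<in>\<rat>. {y. y \<in> X \<and> u (y + q, y) = 1 \<and> y + q \<in> A})"
        then show "y \<in> T -` A \<inter> space borel"
          using T_unique by (auto simp: T_def)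
      qed
      moreover have "{y. y \<in> X \<and> u (y + q, y) = 1 \<and> y + q \<in> A} \<in> sets borel" for q
        by (rule borel_Collect) measurable
      then have "(\<Union>q\<in>\<rat>. {y. y \<in> X \<and> u (y + q, y) = 1 \<and> y + q \<in> A}) \<in> sets borel"
        using countable_rat by (intro sets.countable_UN'') blast+
      then have "(A - X) \<union> (\<Union>q\<in>\<rat>. {y. y \<in> X \<and> u (y + q, y) = 1 \<and> y + q \<in> A}) \<in> sets borel"
        by (intro sets.Un sets.Diff) simp_all
      ultimately show "T -` A \<inter> space borel \<in> sets borel"
        by (simp only:)
    qed simp
  qed
  have agree: "u (x, y) = monomial (\<lambda>x. 1) T (x, y)" if x: "x \<in> X" for x y
  proof (cases "u (x, y) = 1")
    case True
    then have y: "y \<in> X"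
      by (rule X_sat[OF x u_relE])
    then have "y \<in> {0..<1}" "T y = x"
      using T_unique[OF True y] by (auto simp: X_def)
    with True show ?thesis
      by (simp add: monomial_apply)
  next
    case False
    then have "u (x, y) = 0"
      using u01 by (auto simp: image_subset_iff)
    moreover have "\<not> (y \<in> {0..<1} \<and> x = T y)"
    proof
      assume "y \<in> {0..<1} \<and> x = T y"
      then show False
        using False T[of y] x by (cases "y \<in> X") (auto simp: T_def)
    qed
    ultimately show ?thesis
      by (auto simp: monomial_apply)
  qed
  have "AE x in lborel. row_sq (\<lambda>p. u p - monomial (\<lambda>x. 1) T p) x = 0"
  proof (rule AE_I'[OF N])
    show "{x \<in> space lborel. row_sq (\<lambda>p. u p - monomial (\<lambda>x. 1) T p) x \<noteq> 0} \<subseteq> N"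
    proof (intro subsetI, rule ccontr)
      fix x assume x: "x \<in> {x \<in> space lborel. row_sq (\<lambda>p. u p - monomial (\<lambda>x. 1) T p) x \<noteq> 0}" "x \<notin> N"
      show False
      proof (cases "x \<in> {0..1}")
        case True
        moreover have "x \<noteq> 1"
          using x(2) N0_N by (auto simp: N0_def)
        ultimately have "x \<in> X"
          using x(2) by (auto simp: X_def)
        then show False
          using x(1) agree by (simp add: row_sq_def)
      next
        case False
        then have "orbit x = {}"
          by (auto simp: orbit_iff relE_iff)
        then show False
          using x(1) by (simp add: row_sq_def nn_integral_empty)
      qed
    qed
  qed
  then have "sq_norm (\<lambda>p. u p - monomial (\<lambda>x. 1) T p) = 0"
    by (rule sq_norm_eq_0I)
  with fg show ?thesis
    by (rule that)
qed

lemma monomial_fullE: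
  assumes T: "T \<in> full_group"
  shows "monomial (\<lambda>x. 1) T \<in> fullE"
proof -
  have "monomial (\<lambda>x. 1) T \<in> ME"
    by (rule monomial_ME[OF T, where B = 1]) auto
  moreover have "monomial (\<lambda>x. 1) T p \<in> {0, 1}" for p
    by (cases p) (simp add: monomial_apply)
  then have "range (monomial (\<lambda>x. 1) T) \<subseteq> {0, 1}"
    by blast
  moreover have "AE x in lebesgue_on {0..1}. \<exists>!y. monomial (\<lambda>x. 1) T (x, y) = 1"
    unfolding AE_unit_iff using AE_lborel_singleton[of "1::real"]
    by eventually_elim (simp add: monomial_apply'[OF T])
  moreover have "AE y in lebesgue_on {0..1}. \<exists>!x. monomial (\<lambda>x. 1) T (x, y) = 1"
    unfolding AE_unit_iff using AE_lborel_singleton[of "1::real"]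
    by eventually_elim (simp add: monomial_apply)
  ultimately show ?thesis
    by (simp add: fullE_def)
qed

lemma carrier_Eu: "carrier (Eu \<omega>) = {kclass \<omega> T |T. \<forall>k. T k \<in> full_group}"
proof (intro equalityI subsetI)
  fix X assume "X \<in> carrier (Eu \<omega>)"
  then obtain x where x: "X = uclass \<omega> x" "x \<in> bdd_seqs" "\<And>k. x k \<in> fullE"
    by (auto simp: Eu_def repr_by_def)
  have "\<exists>T. T \<in> full_group \<and> sq_norm (\<lambda>p. x k p - monomial (\<lambda>x. 1) T p) = 0" for k
    by (rule fullE_representation[OF x(3)]) blast
  then obtain T where T: "\<And>k. T k \<in> full_group" "\<And>k. sq_norm (\<lambda>p. x k p - monomial (\<lambda>x. 1) (T k) p) = 0"
    by metis
  have "(x, \<lambda>k. monomial (\<lambda>x. 1) (T k)) \<in> urel \<omega>"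
    using x(2) monomial_seq_bdd[OF monomial_seq_one[OF T(1)]] by (simp add: urel_iff T(2))
  then have "X = kclass \<omega> T"
    unfolding x(1) kclass_def mclass_def by (simp add: uclass_eq_iff[OF x(2)])
  with T(1) show "X \<in> {kclass \<omega> T |T. \<forall>k. T k \<in> full_group}"
    by (intro CollectI exI[of _ T]) simp
next
  fix X assume "X \<in> {kclass \<omega> T |T. \<forall>k. T k \<in> full_group}"
  then obtain T where T: "X = kclass \<omega> T" "\<And>k. T k \<in> full_group"
    by (elim CollectE exE conjE) (rule that, assumption, erule spec)
  have Tb: "(\<lambda>k. monomial (\<lambda>x. 1) (T k)) \<in> bdd_seqs"
    by (rule monomial_seq_bdd[OF monomial_seq_one[where T = T, OF T(2)]])
  have Eu: "carrier (Eu \<omega>) = repr_by \<omega> fullE"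
    by (simp add: Eu_def)
  show "X \<in> carrier (Eu \<omega>)"
    unfolding Eu T(1) repr_by_def kclass_def mclass_def
    by (intro CollectI exI[of _ "\<lambda>k. monomial (\<lambda>x. 1) (T k)"] conjI refl Tb allI monomial_fullE T(2))
qed

lemma Eu_mult: "x \<otimes>\<^bsub>Eu \<omega>\<^esub> y = x \<otimes>\<^bsub>MEu \<omega>\<^esub> y"
  by (simp add: Eu_def)

lemma row_sq_diagonal:
  assumes h: "supported h" and diag: "\<And>y. x \<noteq> y \<Longrightarrow> h (x, y) = 0"
  shows "row_sq h x = ennreal ((cmod (h (x, x)))\<^sup>2)"
proof (cases "x \<in> {0..1}")
  case True
  then have x: "{x} \<subseteq> orbit x" by (simp add: orbit_iff relE_iff)
  have zero: "ennreal ((cmod (h (x, y)))\<^sup>2) = 0" if "y \<notin> {x}" for y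
    using diag[of y] that by auto
  have "row_sq h x = (\<Sum>y\<in>{x}. ennreal ((cmod (h (x, y)))\<^sup>2))"
    unfolding row_sq_def by (rule nn_integral_count_space'[OF _ zero x]) simp_all
  then show ?thesis by simp
next
  case False
  then have "orbit x = {}" "(x, x) \<notin> relE"
    by (auto simp: orbit_iff relE_iff)
  then show ?thesis
    using supportedD[OF h] by (simp add: row_sq_def nn_integral_empty)
qed

text \<open>The multiplier of a diagonal kernel is bounded by the operator norm, as one sees on the
  indicator of the set where it is larger.\<close>

lemma cartanA_representation:
  assumes f: "f \<in> cartanA" and C: "opnorm_le f C"
  obtains a where "a \<in> borel_measurable borel" "\<And>x. cmod (a x) \<le> C"
    "sq_norm (\<lambda>p. f p - monomial a (\<lambda>x. x) p) = 0"
proof -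
  have fME: "f \<in> ME" and diag: "\<And>x y. x \<noteq> y \<Longrightarrow> f (x, y) = 0"
    using f by (auto simp: cartanA_def)
  have C0: "0 \<le> C"
    using C by (simp add: opnorm_le_def)
  note fL = L2E_D[OF ME_L2E[OF fME]]
  note [measurable] = kernel_section_borel(3)[OF fL(1)]
  define D where "D = {x. x \<in> {0..<1} \<and> C < cmod (f (x, x))}"
  have D [measurable]: "D \<in> sets borel"
    unfolding D_def by (rule borel_Collect) measurable
  define d :: "real \<Rightarrow> complex" where "d x = (if x \<in> D then 1 else 0)" for x
  have d [measurable]: "d \<in> borel_measurable borel"
    unfolding d_def using D by (intro measurable_If_set) simp_all
  have d1: "cmod (d x) \<le> 1" for x
    by (simp add: d_def)
  let ?g = "monomial d (\<lambda>x. x)"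
  have g: "?g \<in> L2E"
    by (rule monomial_L2E[OF full_group_id(2) d d1])
  have inv_id: "finv (\<lambda>x. x) x = x" for x
    by (rule full_group_inv_apply(1)[OF full_group_id(2)])
  have fg: "kmult f ?g (x, y) = (if y \<in> {0..<1} then f (x, y) * d y else 0)" for x y
    by (rule kmult_monomial_right[OF full_group_id(2) fL(2)])
  have L1: "L2sq (kmult f ?g) = (\<integral>\<^sup>+x. ennreal ((cmod (f (x, x)))\<^sup>2) * indicator D x \<partial>lborel)"
    unfolding L2sq_eq
  proof (rule nn_integral_cong)
    fix x
    have "kmult f ?g (x, y) = 0" if "x \<noteq> y" for y
      unfolding fg using diag[OF that] by simp
    then have "row_sq (kmult f ?g) x = ennreal ((cmod (kmult f ?g (x, x)))\<^sup>2)"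
      by (rule row_sq_diagonal[OF supported_kmult_monomial_right(1)[OF full_group_id(2) fL(2,1) d]])
    then show "row_sq (kmult f ?g) x = ennreal ((cmod (f (x, x)))\<^sup>2) * indicator D x"
      unfolding fg by (cases "x \<in> D") (auto simp: d_def, auto simp: D_def)
  qed
  have L2: "L2sq ?g = emeasure lborel D"
  proof -
    have "L2sq ?g = (\<integral>\<^sup>+x. indicator D x \<partial>lborel)"
      unfolding L2sq_eq row_sq_monomial[OF full_group_id(2)]
      by (rule nn_integral_cong) (auto simp: d_def D_def indicator_def)
    then show ?thesis by simp
  qed
  have "emeasure lborel D \<le> emeasure lborel {0..<1::real}"
    by (rule emeasure_mono) (auto simp: D_def)
  then have D_fin: "emeasure lborel D < \<infinity>"
    by (simp add: le_less_trans)
  define e where "e x = ennreal ((cmod (f (x, x)))\<^sup>2 - C\<^sup>2) * indicator D x" for x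
  have [measurable]: "e \<in> borel_measurable borel"
    unfolding e_def by measurable
  have split: "ennreal ((cmod (f (x, x)))\<^sup>2) * indicator D x = e x + ennreal (C\<^sup>2) * indicator D x" for x
  proof (cases "x \<in> D")
    case True
    then have "C\<^sup>2 \<le> (cmod (f (x, x)))\<^sup>2"
      using C0 by (intro power_mono) (auto simp: D_def)
    then show ?thesis
      using True by (simp add: e_def flip: ennreal_plus)
  qed (simp add: e_def)
  have "(\<integral>\<^sup>+x. e x \<partial>lborel) + ennreal (C\<^sup>2) * emeasure lborel D = L2sq (kmult f ?g)"
    unfolding L1 split by (subst nn_integral_add) (simp_all add: nn_integral_cmult_indicator)
  also have "\<dots> \<le> ennreal (C\<^sup>2) * emeasure lborel D"
    using C g unfolding opnorm_le_def L2[symmetric] by blast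
  finally have le: "(\<integral>\<^sup>+x. e x \<partial>lborel) + ennreal (C\<^sup>2) * emeasure lborel D \<le> 0 + ennreal (C\<^sup>2) * emeasure lborel D"
    by simp
  have "ennreal (C\<^sup>2) * emeasure lborel D \<noteq> \<infinity>"
    using D_fin by (simp add: ennreal_mult_eq_top_iff less_top)
  with le have "(\<integral>\<^sup>+x. e x \<partial>lborel) \<le> 0"
    by (subst (asm) ennreal_add_left_cancel_le[symmetric, of "ennreal (C\<^sup>2) * emeasure lborel D"] | simp add: add.commute)+
  then have "(\<integral>\<^sup>+x. e x \<partial>lborel) = 0"
    by simp
  then have "AE x in lborel. e x = 0"
    by (subst (asm) nn_integral_0_iff_AE) simp_all
  then have D_null: "AE x in lborel. x \<notin> D"
  proof eventually_elim
    case (elim x)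
    show ?case
    proof
      assume x: "x \<in> D"
      then have "C\<^sup>2 < (cmod (f (x, x)))\<^sup>2"
        using C0 by (intro power_strict_mono) (auto simp: D_def)
      then show False
        using elim x by (simp add: e_def ennreal_eq_0_iff)
    qed
  qed
  define a where "a x = (if x \<in> {0..<1} \<and> cmod (f (x, x)) \<le> C then f (x, x) else 0)" for x
  have a: "a \<in> borel_measurable borel"
    unfolding a_def by measurable
  have aC: "cmod (a x) \<le> C" for x
    using C0 by (simp add: a_def)
  have "AE x in lborel. row_sq (\<lambda>p. f p - monomial a (\<lambda>x. x) p) x = 0"
    using D_null AE_lborel_singleton[of "1::real"]
  proof eventually_elim
    case (elim x)
    have supp: "supported (\<lambda>p. f p - monomial a (\<lambda>x. x) p)"
      using fL(2) monomial_supported[OF full_group_id(2), of a] by (simp add: supported_def)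
    have "row_sq (\<lambda>p. f p - monomial a (\<lambda>x. x) p) x = ennreal ((cmod (f (x, x) - monomial a (\<lambda>x. x) (x, x)))\<^sup>2)"
      by (rule row_sq_diagonal[OF supp]) (auto simp: diag monomial_apply)
    moreover have "f (x, x) = monomial a (\<lambda>x. x) (x, x)"
    proof (cases "x \<in> {0..<1}")
      case True
      then show ?thesis
        using elim(1) by (auto simp: D_def monomial_apply a_def)
    next
      case False
      then have "(x, x) \<notin> relE"
        using elim(2) by (auto simp: relE_iff)
      then show ?thesis
        using supportedD[OF fL(2)] False by (auto simp: monomial_apply)
    qed
    ultimately show ?case by simp
  qed
  then have "sq_norm (\<lambda>p. f p - monomial a (\<lambda>x. x) p) = 0"
    by (rule sq_norm_eq_0I)
  with a aC show ?thesis
    by (rule that)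
qed

abbreviation dclass :: "nat filter \<Rightarrow> (nat \<Rightarrow> real \<Rightarrow> complex) \<Rightarrow> uelem" where
  "dclass \<omega> a \<equiv> mclass \<omega> a (\<lambda>k x. x)"

abbreviation diag_seq :: "(nat \<Rightarrow> real \<Rightarrow> complex) \<Rightarrow> bool" where
  "diag_seq a \<equiv> monomial_seq a (\<lambda>k x. x)"

lemma diag_seq_iff: "diag_seq a \<longleftrightarrow> (\<forall>k. a k \<in> borel_measurable borel) \<and> (\<exists>B. \<forall>k x. cmod (a k x) \<le> B)"
  by (simp add: monomial_seq_def)

lemma Au_eq: "Au \<omega> = {dclass \<omega> a |a. diag_seq a}"
proof (intro equalityI subsetI)
  fix X assume "X \<in> Au \<omega>"
  then obtain x where x: "X = uclass \<omega> x" "x \<in> bdd_seqs" "\<And>k. x k \<in> cartanA"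
    by (auto simp: Au_def repr_by_def)
  obtain C where C: "\<And>k. opnorm_le (x k) C"
    using x(2) by (auto simp: bdd_seqs_def)
  have "\<exists>a. a \<in> borel_measurable borel \<and> (\<forall>t. cmod (a t) \<le> C) \<and> sq_norm (\<lambda>p. x k p - monomial a (\<lambda>x. x) p) = 0" for k
    by (rule cartanA_representation[OF x(3) C]) blast
  then obtain a where a: "\<And>k. a k \<in> borel_measurable borel" "\<And>k t. cmod (a k t) \<le> C"
    "\<And>k. sq_norm (\<lambda>p. x k p - monomial (a k) (\<lambda>x. x) p) = 0"
    by metis
  have ds: "diag_seq a"
    unfolding diag_seq_iff using a by blast
  have "(x, \<lambda>k. monomial (a k) (\<lambda>x. x)) \<in> urel \<omega>"
    using x(2) monomial_seq_bdd[OF ds] by (simp add: urel_iff a(3))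
  then have "X = dclass \<omega> a"
    unfolding x(1) mclass_def by (simp add: uclass_eq_iff[OF x(2)])
  with ds show "X \<in> {dclass \<omega> a |a. diag_seq a}"
    by (intro CollectI exI[of _ a]) simp
next
  fix X assume "X \<in> {dclass \<omega> a |a. diag_seq a}"
  then obtain a where a: "X = dclass \<omega> a" "diag_seq a"
    by (elim CollectE exE conjE) (rule that)
  have "monomial (a k) (\<lambda>x. x) \<in> cartanA" for k
    using monomial_seq_bdd[OF a(2)] by (auto simp: cartanA_def bdd_seqs_def monomial_apply)
  then show "X \<in> Au \<omega>"
    unfolding a(1) Au_def repr_by_def mclass_def
    using monomial_seq_bdd[OF a(2)] by (intro CollectI exI[of _ "\<lambda>k. monomial (a k) (\<lambda>x. x)"]) simp
qed

lemma uscalar_eq: "uscalar \<omega> c = dclass \<omega> (\<lambda>k x. c)"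
proof -
  let ?k = "\<lambda>p. c * kone p"
  have kone: "?k (x, y) = (if x = y \<and> x \<in> {0..1} then c else 0)" for x y
    by (simp add: kone_def)
  have supp: "supported ?k"
    unfolding supported_def
  proof (intro allI impI)
    fix p :: "real \<times> real" assume "p \<notin> relE"
    then show "?k p = 0"
      by (cases p) (auto simp: kone_def relE_iff)
  qed
  have meas: "?k \<in> borel_measurable borel"
  proof -
    have "(\<lambda>p. if fst p = snd p \<and> fst p \<in> {0..1::real} then c else 0) \<in> borel_measurable (borel \<Otimes>\<^sub>M borel)"
      by measurable
    moreover have "?k = (\<lambda>p. if fst p = snd p \<and> fst p \<in> {0..1} then c else 0)"
      by (auto simp: kone_def)
    ultimately show ?thesis
      by (simp only: borel_prod)
  qed
  have row: "row_sq ?k x = (if x \<in> {0..1} then ennreal ((cmod c)\<^sup>2) else 0)" for x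
  proof (cases "x \<in> {0..1}")
    case True
    then have "x \<in> orbit x" by (simp add: orbit_iff relE_iff)
    then have "row_sq ?k x = (\<Sum>y\<in>{x}. ennreal ((cmod (?k (x, y)))\<^sup>2))"
      unfolding row_sq_def by (intro nn_integral_count_space') (auto simp: kone_def)
    then show ?thesis using True by (simp add: kone_def)
  next
    case False
    then have "orbit x = {}" by (auto simp: orbit_iff relE_iff)
    then show ?thesis using False by (auto simp: row_sq_def nn_integral_empty)
  qed
  have L2: "?k \<in> L2E"
  proof (rule L2E_I[OF meas supp])
    have "L2sq ?k = (\<integral>\<^sup>+x. ennreal ((cmod c)\<^sup>2) * indicator {0..1::real} x \<partial>lborel)"
      unfolding L2sq_eq row by (intro nn_integral_cong) (auto simp: indicator_def)
    then show "L2sq ?k < \<infinity>"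
      by (simp add: nn_integral_cmult_indicator ennreal_mult_less_top)
  qed
  have "opnorm_le ?k (cmod c)"
    unfolding opnorm_le_def
  proof (intro conjI ballI)
    fix g assume g: "g \<in> L2E"
    have "kmult ?k g (x, z) = c * g (x, z)" for x z
    proof (cases "x \<in> {0..1}")
      case True
      then have "x \<in> orbit x" by (simp add: orbit_iff relE_iff)
      then have "kmult ?k g (x, z) = ?k (x, x) * g (x, z)"
        unfolding kmult_apply by (intro infsum_singleton_support) (auto simp: kone_def)
      then show ?thesis using True by (simp add: kone_def)
    next
      case False
      then have "orbit x = {}" "(x, z) \<notin> relE" by (auto simp: orbit_iff relE_iff)
      then show ?thesis
        using supportedD[OF L2E_D(2)[OF g]] by (simp add: kmult_apply)
    qed
    then have "row_sq (kmult ?k g) x = ennreal ((cmod c)\<^sup>2) * row_sq g x" for x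
      unfolding row_sq_def by (simp add: norm_mult power_mult_distrib ennreal_mult nn_integral_cmult)
    then have row: "row_sq (kmult ?k g) = (\<lambda>x. ennreal ((cmod c)\<^sup>2) * row_sq g x)"
      by (rule ext)
    have m: "row_sq g \<in> borel_measurable lborel"
      using row_sq_measurable[OF L2E_D(2,1)[OF g]] by simp
    show "L2sq (kmult ?k g) \<le> ennreal ((cmod c)\<^sup>2) * L2sq g"
      unfolding L2sq_eq row nn_integral_cmult[OF m] by (rule order_refl)
  qed simp
  then have bdd: "(\<lambda>k. ?k) \<in> bdd_seqs"
    using L2 by (auto simp: bdd_seqs_def ME_def)
  have ds: "diag_seq (\<lambda>k x. c)"
    by (auto simp: diag_seq_iff)
  have "AE x in lborel. row_sq (\<lambda>p. ?k p - monomial (\<lambda>x. c) (\<lambda>x. x) p) x = 0"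
    using AE_lborel_singleton[of "1::real"]
  proof eventually_elim
    case (elim x)
    then have "?k (x, y) - monomial (\<lambda>x. c) (\<lambda>x. x) (x, y) = 0" for y
      by (auto simp: kone_def monomial_apply)
    then show ?case by (simp add: row_sq_def)
  qed
  then have "sq_norm (\<lambda>p. ?k p - monomial (\<lambda>x. c) (\<lambda>x. x) p) = 0"
    by (rule sq_norm_eq_0I)
  then have "(\<lambda>k. ?k, \<lambda>k. monomial (\<lambda>x. c) (\<lambda>x. x)) \<in> urel \<omega>"
    using bdd monomial_seq_bdd[OF ds] by (simp add: urel_iff)
  then show ?thesis
    unfolding uscalar_def mclass_def by (simp add: uclass_eq_iff[OF bdd])
qed

section \<open>The trace\<close>

lemma integral_unit_leb:
  fixes f :: "real \<Rightarrow> complex"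
  assumes [measurable]: "f \<in> borel_measurable borel"
  shows "integral\<^sup>L (lebesgue_on {0..1}) f = integral\<^sup>L leb f"
proof -
  have "integral\<^sup>L (lebesgue_on {0..1}) f = integral\<^sup>L lebesgue (\<lambda>x. indicator {0..1} x *\<^sub>R f x)"
    by (rule integral_restrict_space) simp
  also have "\<dots> = integral\<^sup>L lborel (\<lambda>x. indicator {0..1} x *\<^sub>R f x)"
    by (rule integral_completion) simp
  also have "\<dots> = integral\<^sup>L lborel (\<lambda>x. indicator {0..<1} x *\<^sub>R f x)"
  proof (rule integral_cong_AE)
    show "AE x in lborel. indicator {0..1} x *\<^sub>R f x = indicator {0..<1} x *\<^sub>R f x"
      using AE_lborel_singleton[of "1::real"] by eventually_elim (auto simp: indicator_def)
  qed simp_all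
  also have "\<dots> = integral\<^sup>L (density lborel (\<lambda>x. ennreal (indicator {0..<1} x))) f"
    by (rule integral_density[symmetric]) auto
  also have "density lborel (\<lambda>x. ennreal (indicator {0..<1} x)) = leb"
    unfolding leb_def by (intro density_cong) (auto simp: indicator_def)
  finally show ?thesis .
qed

lemma diagonal_le_row_sq:
  assumes "supported f"
  shows "ennreal ((cmod (f (x, x)))\<^sup>2) \<le> row_sq f x"
proof (cases "x \<in> {0..1}")
  case True
  then have "x \<in> orbit x" by (simp add: orbit_iff relE_iff)
  then show ?thesis
    unfolding row_sq_def by (rule nn_integral_ge_point)
next
  case False
  then have "(x, x) \<notin> relE" by (auto simp: relE_iff)
  then show ?thesis
    using supportedD[OF assms] by simp
qed

lemma diagonal_L2:
  assumes f: "f \<in> L2E"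
  shows "(\<integral>\<^sup>+x. ennreal ((cmod (f (x, x)))\<^sup>2) \<partial>leb) \<le> ennreal (sq_norm f)"
    "integrable leb (\<lambda>x. f (x, x))"
proof -
  note fL = L2E_D[OF f]
  note [measurable] = kernel_section_borel(3)[OF fL(1)]
  have "(\<integral>\<^sup>+x. ennreal ((cmod (f (x, x)))\<^sup>2) \<partial>leb) = (\<integral>\<^sup>+x. ennreal ((cmod (f (x, x)))\<^sup>2) * indicator {0..<1} x \<partial>lborel)"
    by (rule nn_integral_leb) measurable
  also have "\<dots> \<le> L2sq f"
    unfolding L2sq_eq by (intro nn_integral_mono) (auto simp: indicator_def diagonal_le_row_sq[OF fL(2)])
  also have "\<dots> = ennreal (sq_norm f)"
    by (rule L2sq_eq_sq_norm[OF f])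
  finally show le: "(\<integral>\<^sup>+x. ennreal ((cmod (f (x, x)))\<^sup>2) \<partial>leb) \<le> ennreal (sq_norm f)" .
  show "integrable leb (\<lambda>x. f (x, x))"
  proof (rule integrableI_bounded)
    have "(\<integral>\<^sup>+x. ennreal (norm (f (x, x))) \<partial>leb) \<le> (\<integral>\<^sup>+x. (1 + ennreal ((cmod (f (x, x)))\<^sup>2)) \<partial>leb)"
    proof (rule nn_integral_mono)
      fix x
      have "2 * cmod (f (x, x)) \<le> 1 + (cmod (f (x, x)))\<^sup>2"
        using sum_squares_bound[of 1 "cmod (f (x, x))"] by simp
      then have "norm (f (x, x)) \<le> 1 + (cmod (f (x, x)))\<^sup>2"
        using norm_ge_zero[of "f (x, x)"] by linarith
      then have "ennreal (norm (f (x, x))) \<le> ennreal (1 + (cmod (f (x, x)))\<^sup>2)"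
        by (rule ennreal_leI)
      also have "\<dots> = 1 + ennreal ((cmod (f (x, x)))\<^sup>2)"
        by (subst ennreal_plus) simp_all
      finally show "ennreal (norm (f (x, x))) \<le> 1 + ennreal ((cmod (f (x, x)))\<^sup>2)" .
    qed
    also have "\<dots> = 1 + (\<integral>\<^sup>+x. ennreal ((cmod (f (x, x)))\<^sup>2) \<partial>leb)"
      by (subst nn_integral_add) (simp_all add: nn_integral_leb_const del: nn_integral_const)
    also have "\<dots> < \<infinity>"
      using le by (simp add: le_less_trans)
    finally show "(\<integral>\<^sup>+x. ennreal (norm (f (x, x))) \<partial>leb) < \<infinity>" .
  qed simp
qed

text \<open>The inequality \<open>\<bar>z\<bar> \<le> e/2 + \<bar>z\<bar>\<^sup>2/(2e)\<close>, integrated over the diagonal, replaces the Cauchy-Schwarz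
  inequality.\<close>

lemma cmod_kTr_diff_le:
  assumes f: "f \<in> L2E" and g: "g \<in> L2E" and e: "0 < e"
  shows "cmod (kTr f - kTr g) \<le> e / 2 + sq_norm (\<lambda>p. f p - g p) / (2 * e)"
proof -
  let ?h = "\<lambda>p. f p - g p"
  note h = L2E_diff[OF f g]
  have "kTr f - kTr g = integral\<^sup>L leb (\<lambda>x. ?h (x, x))"
    unfolding kTr_def integral_unit_leb[OF kernel_section_borel(3)[OF L2E_D(1)[OF f]]]
      integral_unit_leb[OF kernel_section_borel(3)[OF L2E_D(1)[OF g]]]
    by (rule Bochner_Integration.integral_diff[symmetric]) (rule diagonal_L2(2)[OF f], rule diagonal_L2(2)[OF g])
  moreover have "ennreal (cmod (integral\<^sup>L leb (\<lambda>x. ?h (x, x)))) \<le> (\<integral>\<^sup>+x. ennreal (cmod (?h (x, x))) \<partial>leb)"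
    by (rule integral_norm_bound_ennreal[OF diagonal_L2(2)[OF h]])
  also have "\<dots> \<le> (\<integral>\<^sup>+x. (ennreal (e / 2) + ennreal (1 / (2 * e)) * ennreal ((cmod (?h (x, x)))\<^sup>2)) \<partial>leb)"
  proof (rule nn_integral_mono)
    fix x
    have "2 * e * cmod (?h (x, x)) \<le> e\<^sup>2 + (cmod (?h (x, x)))\<^sup>2"
      using sum_squares_bound[of e "cmod (?h (x, x))"] by simp
    then have "cmod (?h (x, x)) \<le> (e\<^sup>2 + (cmod (?h (x, x)))\<^sup>2) / (2 * e)"
      using e by (simp add: pos_le_divide_eq mult.commute)
    also have "\<dots> = e / 2 + 1 / (2 * e) * (cmod (?h (x, x)))\<^sup>2"
      using e by (simp add: add_divide_distrib power2_eq_square)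
    finally have "ennreal (cmod (?h (x, x))) \<le> ennreal (e / 2 + 1 / (2 * e) * (cmod (?h (x, x)))\<^sup>2)"
      by (rule ennreal_leI)
    also have "\<dots> = ennreal (e / 2) + ennreal (1 / (2 * e) * (cmod (?h (x, x)))\<^sup>2)"
      by (rule ennreal_plus) (use e in auto)
    also have "ennreal (1 / (2 * e) * (cmod (?h (x, x)))\<^sup>2) = ennreal (1 / (2 * e)) * ennreal ((cmod (?h (x, x)))\<^sup>2)"
      by (rule ennreal_mult) (use e in auto)
    finally show "ennreal (cmod (?h (x, x))) \<le> ennreal (e / 2) + ennreal (1 / (2 * e)) * ennreal ((cmod (?h (x, x)))\<^sup>2)" .
  qed
  also have "\<dots> = ennreal (e / 2) + ennreal (1 / (2 * e)) * (\<integral>\<^sup>+x. ennreal ((cmod (?h (x, x)))\<^sup>2) \<partial>leb)"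
  proof -
    note [measurable] = kernel_section_borel(3)[OF L2E_D(1)[OF h]]
    have m: "(\<lambda>x. ennreal ((cmod (?h (x, x)))\<^sup>2)) \<in> borel_measurable leb"
      by measurable
    show ?thesis
      using m by (subst nn_integral_add) (simp_all add: nn_integral_leb_const nn_integral_cmult del: nn_integral_const)
  qed
  also have "\<dots> \<le> ennreal (e / 2) + ennreal (1 / (2 * e)) * ennreal (sq_norm ?h)"
    by (intro add_left_mono mult_left_mono diagonal_L2(1)[OF h]) simp
  also have "\<dots> = ennreal (e / 2 + sq_norm ?h / (2 * e))"
  proof -
    have "ennreal (1 / (2 * e)) * ennreal (sq_norm ?h) = ennreal (1 / (2 * e) * sq_norm ?h)"
      by (rule ennreal_mult[symmetric]) (use e in auto)
    moreover have "ennreal (e / 2) + ennreal (1 / (2 * e) * sq_norm ?h) = ennreal (e / 2 + 1 / (2 * e) * sq_norm ?h)"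
      by (rule ennreal_plus[symmetric]) (use e in auto)
    ultimately show ?thesis by simp
  qed
  finally show ?thesis
    using e by (subst (asm) ennreal_le_iff) simp_all
qed

lemma kTr_monomial_one:
  assumes T: "T \<in> full_group"
  shows "kTr (monomial (\<lambda>x. 1) T) = complex_of_real (measure leb {x. x \<in> {0..<1} \<and> T x = x})"
proof -
  note [measurable] = full_group_borel[OF T]
  let ?F = "{x. x \<in> {0..<1} \<and> T x = x}"
  have F: "?F \<in> sets borel"
    by (rule borel_Collect) measurable
  have "kTr (monomial (\<lambda>x. 1) T) = integral\<^sup>L leb (\<lambda>x. monomial (\<lambda>x. 1) T (x, x))"
    unfolding kTr_def by (rule integral_unit_leb[OF kernel_section_borel(3)[OF monomial_borel[OF T]]]) simp
  also have "\<dots> = integral\<^sup>L leb (\<lambda>x. complex_of_real (indicator ?F x))"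
    by (intro Bochner_Integration.integral_cong) (auto simp: monomial_apply indicator_def)
  also have "\<dots> = complex_of_real (integral\<^sup>L leb (indicator ?F))"
    by (rule integral_complex_of_real)
  also have "integral\<^sup>L leb (indicator ?F) = measure leb ?F"
    using F by simp
  finally show ?thesis .
qed

text \<open>The trace of a permutation is the measure of its set of fixed points, and the trace is continuous
  in the 2-norm.\<close>

lemma uTr_kclass_eq_0_iff:
  assumes \<omega>: "free_ultrafilter \<omega>" and T: "\<And>k. T k \<in> full_group"
  shows "uTr \<omega> (kclass \<omega> T) = 0 \<longleftrightarrow> alm \<omega> (\<lambda>k x. T k x \<noteq> x)"
proof -
  let ?u = "\<lambda>k. monomial (\<lambda>x. 1) (T k)"
  define F where "F k = {x. x \<in> {0..<1} \<and> T k x = x}" for k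
  have F: "F k \<in> sets borel" for k
  proof -
    note [measurable] = full_group_borel[OF T]
    show ?thesis unfolding F_def by (rule borel_Collect) measurable
  qed
  note ub = monomial_seq_bdd[OF monomial_seq_one[where T = T, OF T]]
  obtain l where l: "((\<lambda>k. measure leb (F k)) \<longlongrightarrow> l) \<omega>"
    by (rule measure_leb_ultralimit[OF \<omega>])
  have Tr_u: "((\<lambda>k. kTr (?u k)) \<longlongrightarrow> complex_of_real l) \<omega>"
    unfolding kTr_monomial_one[OF T] F_def[symmetric] by (rule tendsto_of_real[OF l])
  have Tr_p: "((\<lambda>k. kTr (p k)) \<longlongrightarrow> complex_of_real l) \<omega>" if p: "(?u, p) \<in> urel \<omega>" for p
  proof -
    have pb: "p \<in> bdd_seqs" and lim: "((\<lambda>k. sq_norm (\<lambda>z. ?u k z - p k z)) \<longlongrightarrow> 0) \<omega>"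
      using p by (simp_all add: urel_iff)
    have "((\<lambda>k. kTr (?u k) - kTr (p k)) \<longlongrightarrow> 0) \<omega>"
    proof (rule tendstoI)
      fix e :: real assume e: "0 < e"
      have "0 < e\<^sup>2" using e by simp
      from order_tendstoD(2)[OF lim this]
      show "eventually (\<lambda>k. dist (kTr (?u k) - kTr (p k)) 0 < e) \<omega>"
      proof eventually_elim
        case (elim k)
        have "sq_norm (\<lambda>z. ?u k z - p k z) / (2 * e) < e\<^sup>2 / (2 * e)"
          using elim e by (intro divide_strict_right_mono) auto
        also have "e\<^sup>2 / (2 * e) = e / 2"
          using e by (simp add: power2_eq_square)
        finally have "cmod (kTr (?u k) - kTr (p k)) < e"
          using cmod_kTr_diff_le[OF bdd_seqs_L2E[OF ub, of k] bdd_seqs_L2E[OF pb, of k] e] by linarith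
        then show ?case
          by (simp add: dist_norm)
      qed
    qed
    from tendsto_diff[OF Tr_u this] show ?thesis by simp
  qed
  have "uTr \<omega> (kclass \<omega> T) = complex_of_real l"
    unfolding uTr_def
  proof (rule the_equality)
    show "\<exists>x\<in>kclass \<omega> T. ((\<lambda>k. kTr (x k)) \<longlongrightarrow> complex_of_real l) \<omega>"
      unfolding kclass_def mclass_def
      by (rule bexI[of _ ?u]) (rule Tr_u, simp add: uclass_mem urel_refl[OF ub])
    fix t assume "\<exists>x\<in>kclass \<omega> T. ((\<lambda>k. kTr (x k)) \<longlongrightarrow> t) \<omega>"
    then obtain p where p: "(?u, p) \<in> urel \<omega>" "((\<lambda>k. kTr (p k)) \<longlongrightarrow> t) \<omega>"
      unfolding kclass_def mclass_def Bex_def uclass_mem by (elim exE conjE) (rule that)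
    show "t = complex_of_real l"
      by (rule ultralimit_unique[OF \<omega> p(2) Tr_p[OF p(1)]])
  qed
  then have "uTr \<omega> (kclass \<omega> T) = 0 \<longleftrightarrow> l = 0"
    by simp
  also have "\<dots> \<longleftrightarrow> ((\<lambda>k. measure leb (F k)) \<longlongrightarrow> 0) \<omega>"
    using l ultralimit_unique[OF \<omega> l, of 0] by auto
  also have "\<dots> \<longleftrightarrow> alm \<omega> (\<lambda>k x. x \<notin> F k)"
    by (rule alm_notin_iff[symmetric, OF F])
  also have "\<dots> \<longleftrightarrow> alm \<omega> (\<lambda>k x. T k x \<noteq> x)"
  proof
    assume "alm \<omega> (\<lambda>k x. x \<notin> F k)"
    then show "alm \<omega> (\<lambda>k x. T k x \<noteq> x)"
      by (rule alm_mono2[OF _ alm_unit]) (simp add: F_def)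
  next
    assume "alm \<omega> (\<lambda>k x. T k x \<noteq> x)"
    then show "alm \<omega> (\<lambda>k x. x \<notin> F k)"
      by (rule alm_mono) (simp add: F_def)
  qed
  finally show ?thesis .
qed

section \<open>Block-diagonal sums of permutation matrices\<close>

abbreviation perm_mat :: "nat \<Rightarrow> (nat \<Rightarrow> nat) \<Rightarrow> complex mat" where
  "perm_mat n \<sigma> \<equiv> mat n n (\<lambda>(i, j). if i = \<sigma> j then 1 else 0)"

lemma Psi_n_perm_mat:
  assumes n: "0 < n" and \<sigma>: "\<And>j. j < n \<Longrightarrow> \<sigma> j < n"
  shows "Psi_n n (perm_mat n \<sigma>) = monomial (\<lambda>x. 1) (block_perm n \<sigma>)"
proof
  fix p :: "real \<times> real"
  obtain x y where p: "p = (x, y)" by (cases p)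
  show "Psi_n n (perm_mat n \<sigma>) p = monomial (\<lambda>x. 1) (block_perm n \<sigma>) p"
  proof (cases "y \<in> {0..<1}")
    case False
    then show ?thesis
      by (auto simp: p Psi_n_def monomial_apply)
  next
    case y: True
    define j where "j = block_index n y"
    define t where "t = frac (real n * y)"
    have j: "j < n" and t: "0 \<le> t" "t < 1"
      using block_index_less[OF n y] frac_ge_0 frac_lt_1 by (auto simp: j_def t_def)
    have T: "block_perm n \<sigma> y = (real (\<sigma> j) + t) / real n"
      using y by (simp add: block_perm_def j_def t_def)
    show ?thesis
    proof (cases "x = block_perm n \<sigma> y")
      case True
      have x: "x \<in> {0..<1}" "block_index n x = \<sigma> j" "frac (real n * x) = t"
        using block_point[OF \<sigma>[OF j] t] unfolding True T by blast+
      then have "Psi_n n (perm_mat n \<sigma>) p = 1"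
        using y j \<sigma>[OF j] by (simp add: p Psi_n_def t_def j_def flip: block_index_def)
      with True y show ?thesis
        by (simp add: p monomial_apply)
    next
      case False
      have "Psi_n n (perm_mat n \<sigma>) p = 0"
      proof (cases "x \<in> {0..<1} \<and> frac (real n * x) = t")
        case True
        then have "block_index n x \<noteq> \<sigma> j"
          using block_decomp[OF n, of x] False T by auto
        then show ?thesis
          using True y j block_index_less[OF n, of x]
          by (simp add: p Psi_n_def t_def j_def flip: block_index_def)
      next
        case False
        then show ?thesis
          by (auto simp: p Psi_n_def t_def)
      qed
      with False show ?thesis
        by (simp add: p monomial_apply)
    qed
  qed
qed

text \<open>The permutation of \<open>{..<(r + s) * n}\<close> behind \<open>(\<sigma> \<otimes> 1\<^sub>r) \<oplus> (\<tau> \<otimes> 1\<^sub>s)\<close>.\<close>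

definition amplified_perm :: "nat \<Rightarrow> nat \<Rightarrow> nat \<Rightarrow> (nat \<Rightarrow> nat) \<Rightarrow> (nat \<Rightarrow> nat) \<Rightarrow> nat \<Rightarrow> nat" where
  "amplified_perm n r s \<sigma> \<tau> j =
     (if j < n * r then \<sigma> (j div r) * r + j mod r
      else n * r + (\<tau> ((j - n * r) div s) * s + (j - n * r) mod s))"

lemma digit_less:
  fixes q n r m :: nat
  assumes "q < n" "m < r"
  shows "q * r + m < n * r"
proof -
  have "q * r + m < Suc q * r" using assms by simp
  also have "\<dots> \<le> n * r" using assms by (intro mult_right_mono) auto
  finally show ?thesis .
qed

lemma digit_eq_iff:
  fixes i q r m :: nat
  assumes "m < r"
  shows "i = q * r + m \<longleftrightarrow> i div r = q \<and> i mod r = m"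
proof
  assume "i = q * r + m"
  then show "i div r = q \<and> i mod r = m" using assms by simp
next
  assume "i div r = q \<and> i mod r = m"
  then show "i = q * r + m" using div_mult_mod_eq[of i r] by simp
qed

lemma block_sum_perm_mat:
  assumes r: "0 < r" and s: "0 < s" and \<sigma>: "\<And>j. j < n \<Longrightarrow> \<sigma> j < n"
  shows "block_sum (tensor_one (perm_mat n \<sigma>) r) (tensor_one (perm_mat n \<tau>) s) =
    perm_mat ((r + s) * n) (amplified_perm n r s \<sigma> \<tau>)"
proof (rule eq_matI)
  have N: "(r + s) * n = n * r + n * s"
    by (simp add: algebra_simps)
  let ?A = "block_sum (tensor_one (perm_mat n \<sigma>) r) (tensor_one (perm_mat n \<tau>) s)"
  let ?B = "perm_mat ((r + s) * n) (amplified_perm n r s \<sigma> \<tau>)"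
  show "dim_row ?A = dim_row ?B" "dim_col ?A = dim_col ?B"
    by (simp_all add: block_sum_def tensor_one_def N)
  fix i j assume "i < dim_row ?B" "j < dim_col ?B"
  then have ij: "i < n * r + n * s" "j < n * r + n * s"
    by (simp_all add: N)
  have div_n: "q div m < n" if "q < n * m" for q m :: nat
    using that by (simp add: less_mult_imp_div_less)
  show "?A $$ (i, j) = ?B $$ (i, j)"
  proof (cases "j < n * r")
    case j: True
    show ?thesis
    proof (cases "i < n * r")
      case True
      then show ?thesis
        using ij j r div_n[OF True] div_n[OF j] digit_eq_iff[of "j mod r" r i "\<sigma> (j div r)"]
        by (auto simp: block_sum_def tensor_one_def N amplified_perm_def)
    next
      case False
      have "\<sigma> (j div r) * r + j mod r < n * r"
        by (rule digit_less[OF \<sigma>[OF div_n[OF j]]]) (use r in simp)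
      with False have "i \<noteq> \<sigma> (j div r) * r + j mod r" by simp
      then show ?thesis
        using False ij j by (auto simp: block_sum_def tensor_one_def N amplified_perm_def)
    qed
  next
    case j: False
    then have j': "j - n * r < n * s"
      using ij by linarith
    show ?thesis
    proof (cases "i < n * r")
      case True
      then show ?thesis
        using ij j by (auto simp: block_sum_def tensor_one_def N amplified_perm_def)
    next
      case False
      then have i': "i - n * r < n * s"
        using ij by linarith
      define q m where "q = \<tau> ((j - n * r) div s)" and "m = (j - n * r) mod s"
      have "m < s" using s by (simp add: m_def)
      have "i = n * r + (q * s + m) \<longleftrightarrow> i - n * r = q * s + m"
        using False by linarith
      also have "\<dots> \<longleftrightarrow> (i - n * r) div s = q \<and> (i - n * r) mod s = m"
        by (rule digit_eq_iff[OF \<open>m < s\<close>])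
      finally show ?thesis
        using False ij j div_n[OF i'] div_n[OF j'] i' j'
        by (auto simp: block_sum_def tensor_one_def N amplified_perm_def q_def m_def)
    qed
  qed
qed

text \<open>Cutting each of \<open>n\<close> blocks into \<open>r\<close> parts does not change a block permutation, so the first
  \<open>n * r\<close> of the \<open>(r + s) * n\<close> blocks carry a copy of \<open>\<sigma>\<close> scaled by \<open>r / (r + s)\<close>.\<close>

lemma block_perm_amplified:
  assumes n: "0 < n" and r: "0 < r" and s: "0 < s"
    and \<sigma>: "\<And>j. j < n \<Longrightarrow> \<sigma> j < n" and \<tau>: "\<And>j. j < n \<Longrightarrow> \<tau> j < n"
  shows "block_perm ((r + s) * n) (amplified_perm n r s \<sigma> \<tau>) =
    glue (real r / real (r + s)) (block_perm n \<sigma>) (block_perm n \<tau>)"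
proof
  fix x
  define c where "c = real r / real (r + s)"
  let ?N = "(r + s) * n" and ?\<pi> = "amplified_perm n r s \<sigma> \<tau>"
  have c: "0 < c" "c < 1" and c1: "1 - c = real s / real (r + s)"
    using r s by (auto simp: c_def field_simps)
  have N: "real ?N = real n * real r + real n * real s" "0 < real ?N"
    using n r by (simp_all add: algebra_simps add_pos_nonneg)
  have point: "block_perm ?N ?\<pi> ((real j + w) / real ?N) = (real (?\<pi> j) + w) / real ?N"
    if "j < ?N" "0 \<le> w" "w < 1" for j w
    by (rule block_perm_point[OF that])
  have split: "\<exists>v w. v < m \<and> 0 \<le> w \<and> w < 1 \<and> real m * u = real v + w" if u: "0 \<le> u" "u < 1" and m: "0 < m" for u m
  proof (intro exI conjI)
    have "u \<in> {0..<1}" using u by simp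
    from block_index_less[OF m this] block_index_frac[OF m this]
    show "block_index m u < m" "real m * u = real (block_index m u) + frac (real m * u)" by auto
  qed (auto simp: frac_lt_1)
  have affine: "a / d + b / d * (y / m) = (m * a + b * y) / (d * m)" if "0 < d" "0 < m" for a b d m y :: real
    using that by (simp add: field_simps)
  have high_value: "c + (1 - c) * ((real i + u) / real n) = (real (n * r + (i * s + v)) + w) / real ?N"
    if "real s * u = real v + w" for i v u w
  proof -
    have "real s * (real i + u) = real (i * s + v) + w"
      using that by (simp add: distrib_left mult.commute)
    moreover have "0 < real (r + s)" "0 < real n"
      using n r by simp_all
    ultimately show ?thesis
      unfolding c1 unfolding c_def by (subst affine) (simp_all add: mult.commute)
  qed
  show "block_perm ?N ?\<pi> x = glue (real r / real (r + s)) (block_perm n \<sigma>) (block_perm n \<tau>) x"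
    unfolding c_def[symmetric]
  proof (cases "x \<in> {0..<1}")
    case True
    from c True show "block_perm ?N ?\<pi> x = glue c (block_perm n \<sigma>) (block_perm n \<tau>) x"
    proof (cases rule: unit_glue_cases)
      case (low t)
      obtain i u where iu: "i < n" "0 \<le> u" "u < 1" "t = (real i + u) / real n"
        using unit_blockE[OF n low(1)] by blast
      obtain v w where vw: "v < r" "0 \<le> w" "w < 1" "real r * u = real v + w"
        using split[OF iu(2,3) r] by blast
      have j: "i * r + v < n * r"
        by (rule digit_less[OF iu(1) vw(1)])
      then have jN: "i * r + v < ?N"
        by (simp add: algebra_simps)
      have \<pi>: "?\<pi> (i * r + v) = \<sigma> i * r + v"
        using j vw(1) by (simp add: amplified_perm_def)
      have x: "x = (real (i * r + v) + w) / real ?N"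
        unfolding low(2) iu(4) c_def using n r vw(4) by (simp add: field_simps)
      have "block_perm ?N ?\<pi> x = (real (\<sigma> i * r + v) + w) / real ?N"
        unfolding x point[OF jN vw(2,3)] \<pi> by simp
      also have "\<dots> = c * ((real (\<sigma> i) + u) / real n)"
        unfolding c_def using n r vw(4) by (simp add: field_simps)
      also have "\<dots> = glue c (block_perm n \<sigma>) (block_perm n \<tau>) x"
        unfolding low(2) glue_low[OF c(1) low(1)] unfolding iu(4) block_perm_point[OF iu(1-3)] by simp
      finally show ?thesis .
    next
      case (high t)
      obtain i u where iu: "i < n" "0 \<le> u" "u < 1" "t = (real i + u) / real n"
        using unit_blockE[OF n high(1)] by blast
      obtain v w where vw: "v < s" "0 \<le> w" "w < 1" "real s * u = real v + w"
        using split[OF iu(2,3) s] by blast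
      have j: "i * s + v < n * s"
        by (rule digit_less[OF iu(1) vw(1)])
      then have jN: "n * r + (i * s + v) < ?N"
        by (simp add: algebra_simps)
      have \<pi>: "?\<pi> (n * r + (i * s + v)) = n * r + (\<tau> i * s + v)"
        using vw(1) by (simp add: amplified_perm_def)
      have x: "x = (real (n * r + (i * s + v)) + w) / real ?N"
        unfolding high(2) iu(4) by (rule high_value[OF vw(4)])
      have "block_perm ?N ?\<pi> x = (real (n * r + (\<tau> i * s + v)) + w) / real ?N"
        unfolding x point[OF jN vw(2,3)] \<pi> by simp
      also have "\<dots> = c + (1 - c) * ((real (\<tau> i) + u) / real n)"
        by (rule high_value[OF vw(4), symmetric])
      also have "\<dots> = glue c (block_perm n \<sigma>) (block_perm n \<tau>) x"
        unfolding high(2) glue_high[OF c(2) high(1)] unfolding iu(4) block_perm_point[OF iu(1-3)] by simp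
      finally show ?thesis .
    qed
  next
    case False
    then show "block_perm ?N ?\<pi> x = glue c (block_perm n \<sigma>) (block_perm n \<tau>) x"
      using glue_outside[OF c False] unfolding block_perm_def by (simp only: if_False)
  qed
qed

lemma Psi_perm_mat:
  assumes "\<And>k. 0 < n k" "\<And>k j. j < n k \<Longrightarrow> \<sigma> k j < n k"
  shows "Psi \<omega> n (\<lambda>k. perm_mat (n k) (\<sigma> k)) = kclass \<omega> (\<lambda>k. block_perm (n k) (\<sigma> k))"
  using Psi_n_perm_mat[OF assms] by (simp add: Psi_def kclass_def mclass_def)

lemma Psi_block_sum:
  assumes n: "\<And>k. 0 < n k" and r: "\<And>k. 0 < r k" and s: "\<And>k. 0 < s k"
    and \<sigma>: "\<And>k j. j < n k \<Longrightarrow> \<sigma> k j < n k" and \<tau>: "\<And>k j. j < n k \<Longrightarrow> \<tau> k j < n k"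
  shows "Psi \<omega> (\<lambda>k. (r k + s k) * n k)
      (\<lambda>k. block_sum (tensor_one (perm_mat (n k) (\<sigma> k)) (r k)) (tensor_one (perm_mat (n k) (\<tau> k)) (s k))) =
    kclass \<omega> (\<lambda>k. glue (real (r k) / real (r k + s k)) (block_perm (n k) (\<sigma> k)) (block_perm (n k) (\<tau> k)))"
proof -
  let ?N = "\<lambda>k. (r k + s k) * n k" and ?\<pi> = "\<lambda>k. amplified_perm (n k) (r k) (s k) (\<sigma> k) (\<tau> k)"
  have N: "0 < ?N k" for k
    using n[of k] r[of k] by simp
  have \<pi>: "?\<pi> k j < ?N k" if "j < ?N k" for k j
  proof (cases "j < n k * r k")
    case True
    then have "j div r k < n k" by (simp add: less_mult_imp_div_less)
    from digit_less[OF \<sigma>[OF this], of "j mod r k" "r k"] show ?thesis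
      using True r[of k] by (simp add: amplified_perm_def algebra_simps)
  next
    case False
    have "j - n k * r k < n k * s k"
      using that False by (simp add: algebra_simps)
    then have "(j - n k * r k) div s k < n k" by (simp add: less_mult_imp_div_less)
    from digit_less[OF \<tau>[OF this], of "(j - n k * r k) mod s k" "s k"] show ?thesis
      using False s[of k] by (simp add: amplified_perm_def algebra_simps)
  qed
  have "block_sum (tensor_one (perm_mat (n k) (\<sigma> k)) (r k)) (tensor_one (perm_mat (n k) (\<tau> k)) (s k)) =
      perm_mat (?N k) (?\<pi> k)" for k
    by (rule block_sum_perm_mat[OF r s \<sigma>])
  then have "Psi \<omega> ?N (\<lambda>k. block_sum (tensor_one (perm_mat (n k) (\<sigma> k)) (r k)) (tensor_one (perm_mat (n k) (\<tau> k)) (s k))) =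
      Psi \<omega> ?N (\<lambda>k. perm_mat (?N k) (?\<pi> k))"
    by (rule arg_cong[OF ext])
  also have "\<dots> = kclass \<omega> (\<lambda>k. block_perm (?N k) (?\<pi> k))"
    by (rule Psi_perm_mat[where n = ?N and \<sigma> = ?\<pi>, OF N \<pi>])
  also have "(\<lambda>k. block_perm (?N k) (?\<pi> k)) =
      (\<lambda>k. glue (real (r k) / real (r k + s k)) (block_perm (n k) (\<sigma> k)) (block_perm (n k) (\<tau> k)))"
    by (rule ext) (rule block_perm_amplified[OF n r s \<sigma> \<tau>])
  finally show ?thesis .
qed

text \<open>The value does not depend on the chosen matrices, since a direct sum of sequences in the
  full group is determined up to asymptotically null sets by its summands.\<close>

lemma Phi_kclass:
  assumes \<omega>: "free_ultrafilter \<omega>" and r: "\<And>k. 0 < r l k" and s: "\<And>k. 0 < s l k"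
    and T: "\<And>k. T k \<in> full_group" and S: "\<And>k. S k \<in> full_group"
  shows "Phi \<omega> r s l (kclass \<omega> T) (kclass \<omega> S) =
    kclass \<omega> (\<lambda>k. glue (real (r l k) / real (r l k + s l k)) (T k) (S k))"
proof -
  define c where "c k = real (r l k) / real (r l k + s l k)" for k
  have c: "0 < c k" "c k < 1" "c k \<in> \<rat>" for k
    using r[of k] s[of k] by (auto simp: c_def field_simps)
  define W where "W = kclass \<omega> (\<lambda>k. glue (c k) (T k) (S k))"
  let ?P = "\<lambda>w. \<exists>n x y.
     (\<forall>k. 0 < n k \<and> x k \<in> perm_matrices (n k) \<and> y k \<in> perm_matrices (n k)) \<and>
     Psi \<omega> n x = kclass \<omega> T \<and> Psi \<omega> n y = kclass \<omega> S \<and>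
     w = Psi \<omega> (\<lambda>k. (r l k + s l k) * n k)
               (\<lambda>k. block_sum (tensor_one (x k) (r l k)) (tensor_one (y k) (s l k)))"
  have val_eq: "Psi \<omega> (\<lambda>k. (r l k + s l k) * n k)
      (\<lambda>k. block_sum (tensor_one (perm_mat (n k) (\<sigma> k)) (r l k)) (tensor_one (perm_mat (n k) (\<tau> k)) (s l k))) = W"
    if n: "\<And>k. 0 < n k" and \<sigma>: "\<And>k. bij_betw (\<sigma> k) {..<n k} {..<n k}" and \<tau>: "\<And>k. bij_betw (\<tau> k) {..<n k} {..<n k}"
      and eq: "kclass \<omega> (\<lambda>k. block_perm (n k) (\<sigma> k)) = kclass \<omega> T"
        "kclass \<omega> (\<lambda>k. block_perm (n k) (\<tau> k)) = kclass \<omega> S" for n \<sigma> \<tau>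
  proof -
    have maps: "j < n k \<Longrightarrow> \<sigma> k j < n k" "j < n k \<Longrightarrow> \<tau> k j < n k" for k j
      using bij_betw_apply[OF \<sigma>, of j k] bij_betw_apply[OF \<tau>, of j k] by auto
    have fg: "block_perm (n k) (\<sigma> k) \<in> full_group" "block_perm (n k) (\<tau> k) \<in> full_group" for k
      by (rule block_perm_full_group[OF n \<sigma>], rule block_perm_full_group[OF n \<tau>])
    have 1: "alm \<omega> (\<lambda>k x. block_perm (n k) (\<sigma> k) x = T k x)"
      using eq(1) unfolding kclass_eq_iff[where T = "\<lambda>k. block_perm (n k) (\<sigma> k)" and S = T, OF fg(1) T] .
    have 2: "alm \<omega> (\<lambda>k x. block_perm (n k) (\<tau> k) x = S k x)"
      using eq(2) unfolding kclass_eq_iff[where T = "\<lambda>k. block_perm (n k) (\<tau> k)" and S = S, OF fg(2) S] .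
    have "alm \<omega> (\<lambda>k x. glue (c k) (block_perm (n k) (\<sigma> k)) (block_perm (n k) (\<tau> k)) x = glue (c k) (T k) (S k) x)"
      by (rule alm_glueI[where c = c, OF c(1,2) 1 2])
    then have "kclass \<omega> (\<lambda>k. glue (c k) (block_perm (n k) (\<sigma> k)) (block_perm (n k) (\<tau> k))) = W"
      unfolding W_def
      by (subst kclass_eq_iff[where T = "\<lambda>k. glue (c k) (block_perm (n k) (\<sigma> k)) (block_perm (n k) (\<tau> k))"
            and S = "\<lambda>k. glue (c k) (T k) (S k)", OF glue_full_group[OF c fg] glue_full_group[OF c T S]])
    moreover have "Psi \<omega> (\<lambda>k. (r l k + s l k) * n k)
        (\<lambda>k. block_sum (tensor_one (perm_mat (n k) (\<sigma> k)) (r l k)) (tensor_one (perm_mat (n k) (\<tau> k)) (s l k))) =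
      kclass \<omega> (\<lambda>k. glue (c k) (block_perm (n k) (\<sigma> k)) (block_perm (n k) (\<tau> k)))"
      unfolding c_def by (rule Psi_block_sum) (erule maps | rule n r s)+
    ultimately show ?thesis
      by (rule trans[rotated])
  qed
  have "?P W"
  proof -
    have fg: "(if j = 0 then T k else S k) \<in> full_group" for j :: nat and k
      using T S by simp
    obtain n :: "nat \<Rightarrow> nat" and \<sigma> :: "nat \<Rightarrow> nat \<Rightarrow> nat \<Rightarrow> nat"
      where n: "\<And>k. 0 < n k" "\<And>j k. bij_betw (\<sigma> j k) {..<n k} {..<n k}"
      "\<And>j. alm \<omega> (\<lambda>k x. (if j = 0 then T k else S k) x = block_perm (n k) (\<sigma> j k) x)"
      by (rule common_block_representation[where T = "\<lambda>j k. if j = 0 then T k else S k", OF \<omega> fg]) blast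
    have fg': "block_perm (n k) (\<sigma> j k) \<in> full_group" for j k
      by (rule block_perm_full_group[OF n(1,2)])
    have maps: "i < n k \<Longrightarrow> \<sigma> j k i < n k" for i j k
      using bij_betw_apply[OF n(2), of i k j] by auto
    have "alm \<omega> (\<lambda>k x. block_perm (n k) (\<sigma> 0 k) x = T k x)"
      using n(3)[of 0] by (simp add: eq_commute)
    then have 1: "kclass \<omega> (\<lambda>k. block_perm (n k) (\<sigma> 0 k)) = kclass \<omega> T"
      by (subst kclass_eq_iff[where T = "\<lambda>k. block_perm (n k) (\<sigma> 0 k)" and S = T, OF fg' T])
    have "alm \<omega> (\<lambda>k x. block_perm (n k) (\<sigma> 1 k) x = S k x)"
      using n(3)[of 1] by (simp add: eq_commute)
    then have 2: "kclass \<omega> (\<lambda>k. block_perm (n k) (\<sigma> 1 k)) = kclass \<omega> S"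
      by (subst kclass_eq_iff[where T = "\<lambda>k. block_perm (n k) (\<sigma> 1 k)" and S = S, OF fg' S])
    let ?x = "\<lambda>j k. perm_mat (n k) (\<sigma> j k)"
    have "?x j k \<in> perm_matrices (n k)" for j k
      unfolding perm_matrices_def using n(2) by blast
    moreover have "Psi \<omega> n (?x 0) = kclass \<omega> T"
      by (rule trans[OF Psi_perm_mat[where n = n and \<sigma> = "\<sigma> 0", OF n(1) maps] 1])
    moreover have "Psi \<omega> n (?x 1) = kclass \<omega> S"
      by (rule trans[OF Psi_perm_mat[where n = n and \<sigma> = "\<sigma> 1", OF n(1) maps] 2])
    moreover have "W = Psi \<omega> (\<lambda>k. (r l k + s l k) * n k)
        (\<lambda>k. block_sum (tensor_one (?x 0 k) (r l k)) (tensor_one (?x 1 k) (s l k)))"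
      by (rule val_eq[where n = n and \<sigma> = "\<sigma> 0" and \<tau> = "\<sigma> 1", OF n(1) n(2) n(2) 1 2, symmetric])
    ultimately show ?thesis
      by (intro exI[of _ n] exI[of _ "?x 0"] exI[of _ "?x 1"]) (simp only: n(1) simp_thms)
  qed
  moreover have "w = W" if w: "?P w" for w
  proof -
    from w obtain n x y where nxy: "\<And>k. 0 < n k \<and> x k \<in> perm_matrices (n k) \<and> y k \<in> perm_matrices (n k)"
      and eq: "Psi \<omega> n x = kclass \<omega> T" "Psi \<omega> n y = kclass \<omega> S"
      and wv: "w = Psi \<omega> (\<lambda>k. (r l k + s l k) * n k)
               (\<lambda>k. block_sum (tensor_one (x k) (r l k)) (tensor_one (y k) (s l k)))"
      by (elim exE conjE) (rule that, erule spec, assumption+)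
    have n: "0 < n k" for k
      using nxy by blast
    have "\<exists>\<pi>. x k = perm_mat (n k) \<pi> \<and> bij_betw \<pi> {..<n k} {..<n k}"
      "\<exists>\<pi>. y k = perm_mat (n k) \<pi> \<and> bij_betw \<pi> {..<n k} {..<n k}" for k
      using nxy[of k] unfolding perm_matrices_def by blast+
    then obtain \<sigma> \<tau> where x: "\<And>k. x k = perm_mat (n k) (\<sigma> k)" and \<sigma>: "\<And>k. bij_betw (\<sigma> k) {..<n k} {..<n k}"
      and y: "\<And>k. y k = perm_mat (n k) (\<tau> k)" and \<tau>: "\<And>k. bij_betw (\<tau> k) {..<n k} {..<n k}"
      by metis
    have maps: "j < n k \<Longrightarrow> \<sigma> k j < n k" "j < n k \<Longrightarrow> \<tau> k j < n k" for k j
      using bij_betw_apply[OF \<sigma>, of j k] bij_betw_apply[OF \<tau>, of j k] by auto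
    have x': "x = (\<lambda>k. perm_mat (n k) (\<sigma> k))" and y': "y = (\<lambda>k. perm_mat (n k) (\<tau> k))"
      by (rule ext, rule x, rule ext, rule y)
    have e1: "kclass \<omega> (\<lambda>k. block_perm (n k) (\<sigma> k)) = kclass \<omega> T"
      by (rule trans[OF Psi_perm_mat[where n = n and \<sigma> = \<sigma>, OF n maps(1), symmetric] eq(1)[unfolded x']])
    have e2: "kclass \<omega> (\<lambda>k. block_perm (n k) (\<tau> k)) = kclass \<omega> S"
      by (rule trans[OF Psi_perm_mat[where n = n and \<sigma> = \<tau>, OF n maps(2), symmetric] eq(2)[unfolded y']])
    show ?thesis
      unfolding wv x' y' by (rule val_eq[where n = n and \<sigma> = \<sigma> and \<tau> = \<tau>, OF n \<sigma> \<tau> e1 e2])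
  qed
  ultimately have "Phi \<omega> r s l (kclass \<omega> T) (kclass \<omega> S) = W"
    unfolding Phi_def by (rule some_equality)
  then show ?thesis
    by (simp add: W_def c_def)
qed

section \<open>Diffuse sofic representations as sequences\<close>

text \<open>Membership in the full group is required for all \<open>g\<close>, also off the carrier, so that it can be used
  without side conditions.\<close>

definition represents ::
  "nat filter \<Rightarrow> ('g, 'b) monoid_scheme \<Rightarrow> ('g \<Rightarrow> uelem) \<Rightarrow> ('g \<Rightarrow> nat \<Rightarrow> real \<Rightarrow> real) \<Rightarrow> bool" where
  "represents \<omega> G \<Theta> \<theta> \<longleftrightarrow>
     (\<forall>g k. \<theta> g k \<in> full_group) \<and> (\<forall>g\<in>carrier G. \<Theta> g = kclass \<omega> (\<theta> g))"

lemma representsD: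
  assumes "represents \<omega> G \<Theta> \<theta>"
  shows "\<theta> g k \<in> full_group" "g \<in> carrier G \<Longrightarrow> \<Theta> g = kclass \<omega> (\<theta> g)"
  using assms by (simp_all add: represents_def)

lemma carrier_EuD:
  assumes "u \<in> carrier (Eu \<omega>)"
  shows "\<exists>T. (\<forall>k. T k \<in> full_group) \<and> u = kclass \<omega> T"
  using assms unfolding carrier_Eu by (elim CollectE exE conjE) (intro exI conjI)

lemma kclass_Eu:
  assumes "\<And>k. T k \<in> full_group"
  shows "kclass \<omega> T \<in> carrier (Eu \<omega>)"
  unfolding carrier_Eu by (intro CollectI exI[of _ T] conjI refl allI assms)

lemma diffuse_sofic_represented:
  assumes \<Theta>: "\<Theta> \<in> diffuse_sofic \<omega> G"
  obtains \<theta> where "represents \<omega> G \<Theta> \<theta>"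
proof -
  have "\<exists>T. (\<forall>k. T k \<in> full_group) \<and> (g \<in> carrier G \<longrightarrow> \<Theta> g = kclass \<omega> T)" for g
  proof (cases "g \<in> carrier G")
    case True
    then have "\<Theta> g \<in> carrier (Eu \<omega>)"
      using \<Theta> by (auto simp: diffuse_sofic_def hom_def)
    from carrier_EuD[OF this] True show ?thesis
      by simp
  next
    case False
    then show ?thesis
      by (intro exI[of _ "\<lambda>k x. x"]) simp
  qed
  then have "\<exists>\<theta>. \<forall>g. (\<forall>k. \<theta> g k \<in> full_group) \<and> (g \<in> carrier G \<longrightarrow> \<Theta> g = kclass \<omega> (\<theta> g))"
    by (rule choice[OF allI])
  then obtain \<theta> where "\<forall>g. (\<forall>k. \<theta> g k \<in> full_group) \<and> (g \<in> carrier G \<longrightarrow> \<Theta> g = kclass \<omega> (\<theta> g))"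
    by (elim exE) (rule that)
  then have "represents \<omega> G \<Theta> \<theta>"
    unfolding represents_def by simp
  then show ?thesis
    by (rule that)
qed

lemma represents_kclass:
  "(\<And>g k. \<theta> g k \<in> full_group) \<Longrightarrow> represents \<omega> G (\<lambda>g. kclass \<omega> (\<theta> g)) \<theta>"
  by (simp add: represents_def)

lemma diffuse_sofic_iff:
  assumes \<omega>: "free_ultrafilter \<omega>" and G: "group G" and rep: "represents \<omega> G \<Theta> \<theta>"
  shows "\<Theta> \<in> diffuse_sofic \<omega> G \<longleftrightarrow> sofic_seq \<omega> G \<theta>"
proof -
  note fg = representsD(1)[OF rep] and \<Theta> = representsD(2)[OF rep]
  interpret group G by (rule G)
  have "\<Theta> g \<in> carrier (Eu \<omega>)" if "g \<in> carrier G" for g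
    unfolding \<Theta>[OF that] by (rule kclass_Eu[where T = "\<theta> g", OF fg])
  moreover have "\<Theta> (g \<otimes>\<^bsub>G\<^esub> h) = \<Theta> g \<otimes>\<^bsub>Eu \<omega>\<^esub> \<Theta> h \<longleftrightarrow>
      alm \<omega> (\<lambda>k x. \<theta> (g \<otimes>\<^bsub>G\<^esub> h) k x = \<theta> g k (\<theta> h k x))"
    if g: "g \<in> carrier G" and h: "h \<in> carrier G" for g h
    unfolding \<Theta>[OF g] \<Theta>[OF h] \<Theta>[OF m_closed[OF g h]] Eu_mult
      kclass_mult[where T = "\<theta> g" and S = "\<theta> h", OF fg fg]
    by (rule kclass_eq_iff[where T = "\<theta> (g \<otimes>\<^bsub>G\<^esub> h)" and S = "\<lambda>k x. \<theta> g k (\<theta> h k x)",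
        OF fg full_group_comp[OF fg fg]])
  moreover have "uTr \<omega> (\<Theta> g) = 0 \<longleftrightarrow> alm \<omega> (\<lambda>k x. \<theta> g k x \<noteq> x)" if "g \<in> carrier G" for g
    unfolding \<Theta>[OF that] by (rule uTr_kclass_eq_0_iff[where T = "\<theta> g", OF \<omega> fg])
  ultimately show ?thesis
    using fg by (simp add: diffuse_sofic_def hom_def Pi_iff sofic_seq_def)
qed

section \<open>Conjugacy classes\<close>

lemma conj_seqI: "intertwines \<omega> C U \<theta> \<theta>' \<Longrightarrow> conj_seq \<omega> C \<theta> \<theta>'"
  by (auto simp: conj_seq_def)

lemma ad_kclass:
  assumes U: "\<And>k. U k \<in> full_group" and T: "\<And>k. T k \<in> full_group"
  shows "ad \<omega> (kclass \<omega> U) (kclass \<omega> T) = kclass \<omega> (\<lambda>k x. U k (T k (finv (U k) x)))"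
  unfolding ad_def kclass_mult[where T = U and S = T, OF U T] kclass_star[where T = U, OF U]
  by (rule kclass_mult[where T = "\<lambda>k x. U k (T k x)" and S = "\<lambda>k. finv (U k)",
      OF full_group_comp[OF U T] full_group_inv[OF U]])

lemma conj_rel_iff:
  assumes \<Theta>: "\<Theta> \<in> diffuse_sofic \<omega> G" "represents \<omega> G \<Theta> \<theta>"
    and \<Theta>': "\<Theta>' \<in> diffuse_sofic \<omega> G" "represents \<omega> G \<Theta>' \<theta>'"
  shows "(\<Theta>, \<Theta>') \<in> conj_rel \<omega> G \<longleftrightarrow> conj_seq \<omega> (carrier G) \<theta> \<theta>'"
proof -
  note fg = representsD(1)[OF \<Theta>(2)] and fg' = representsD(1)[OF \<Theta>'(2)]
  have ad_iff: "\<Theta>' g = ad \<omega> (kclass \<omega> U) (\<Theta> g) \<longleftrightarrow> alm \<omega> (\<lambda>k x. U k (\<theta> g k x) = \<theta>' g k (U k x))"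
    if g: "g \<in> carrier G" and U: "\<And>k. U k \<in> full_group" for g U
  proof -
    note Ui = full_group_inv[OF U]
    have "\<Theta>' g = ad \<omega> (kclass \<omega> U) (\<Theta> g) \<longleftrightarrow> alm \<omega> (\<lambda>k x. \<theta>' g k x = U k (\<theta> g k (finv (U k) x)))"
      unfolding representsD(2)[OF \<Theta>(2) g] representsD(2)[OF \<Theta>'(2) g] ad_kclass[where U = U and T = "\<theta> g", OF U fg]
      by (rule kclass_eq_iff[where T = "\<theta>' g" and S = "\<lambda>k x. U k (\<theta> g k (finv (U k) x))",
          OF fg' full_group_comp[OF U full_group_comp[OF fg Ui]]])
    also have "\<dots> \<longleftrightarrow> alm \<omega> (\<lambda>k x. U k (\<theta> g k x) = \<theta>' g k (U k x))"
    proof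
      assume "alm \<omega> (\<lambda>k x. \<theta>' g k x = U k (\<theta> g k (finv (U k) x)))"
      from alm_vimage[where T = U, OF this U]
      show "alm \<omega> (\<lambda>k x. U k (\<theta> g k x) = \<theta>' g k (U k x))"
        by (rule alm_mono) (simp add: U)
    next
      assume "alm \<omega> (\<lambda>k x. U k (\<theta> g k x) = \<theta>' g k (U k x))"
      from alm_vimage[where T = "\<lambda>k. finv (U k)", OF this Ui]
      show "alm \<omega> (\<lambda>k x. \<theta>' g k x = U k (\<theta> g k (finv (U k) x)))"
        by (rule alm_mono) (simp add: U)
    qed
    finally show ?thesis .
  qed
  show ?thesis
  proof
    assume "(\<Theta>, \<Theta>') \<in> conj_rel \<omega> G"
    then obtain u where u: "u \<in> carrier (Eu \<omega>)" "\<And>g. g \<in> carrier G \<Longrightarrow> \<Theta>' g = ad \<omega> u (\<Theta> g)"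
      by (auto simp: conj_rel_def)
    obtain U where U: "\<And>k. U k \<in> full_group" "u = kclass \<omega> U"
      using carrier_EuD[OF u(1)] by (elim exE conjE) (rule that, erule spec)
    have "intertwines \<omega> (carrier G) U \<theta> \<theta>'"
      unfolding intertwines_def
    proof (intro conjI allI ballI U(1))
      fix g assume g: "g \<in> carrier G"
      show "alm \<omega> (\<lambda>k x. U k (\<theta> g k x) = \<theta>' g k (U k x))"
        by (rule iffD1[OF ad_iff[where U = U, OF g U(1)] u(2)[OF g, unfolded U(2)]])
    qed
    then show "conj_seq \<omega> (carrier G) \<theta> \<theta>'"
      by (rule conj_seqI)
  next
    assume "conj_seq \<omega> (carrier G) \<theta> \<theta>'"
    then obtain U where U: "intertwines \<omega> (carrier G) U \<theta> \<theta>'"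
      unfolding conj_seq_def by (elim exE) (rule that)
    note Ufg = intertwines_full_group[OF U]
    have "\<Theta>' g = ad \<omega> (kclass \<omega> U) (\<Theta> g)" if g: "g \<in> carrier G" for g
      by (rule iffD2[OF ad_iff[where U = U, OF g Ufg] intertwinesD[OF U g]])
    then have "\<exists>u\<in>carrier (Eu \<omega>). \<forall>g\<in>carrier G. \<Theta>' g = ad \<omega> u (\<Theta> g)"
      by (intro bexI[of _ "kclass \<omega> U"] ballI kclass_Eu Ufg)
    then show "(\<Theta>, \<Theta>') \<in> conj_rel \<omega> G"
      using \<Theta>(1) \<Theta>'(1) by (simp add: conj_rel_def)
  qed
qed

lemma conj_rel_equiv: "equiv (diffuse_sofic \<omega> G) (conj_rel \<omega> G)"
proof (rule equivI)
  show "conj_rel \<omega> G \<subseteq> diffuse_sofic \<omega> G \<times> diffuse_sofic \<omega> G"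
    by (auto simp: conj_rel_def)
  show "refl_on (diffuse_sofic \<omega> G) (conj_rel \<omega> G)"
  proof (rule refl_onI)
    fix \<Theta> assume \<Theta>: "\<Theta> \<in> diffuse_sofic \<omega> G"
    obtain \<theta> where \<theta>: "represents \<omega> G \<Theta> \<theta>"
      using \<Theta> by (rule diffuse_sofic_represented)
    show "(\<Theta>, \<Theta>) \<in> conj_rel \<omega> G"
      by (rule iffD2[OF conj_rel_iff[OF \<Theta> \<theta> \<Theta> \<theta>] conj_seq_refl])
  qed
  have rep: "\<exists>\<theta> \<theta>'. \<Theta> \<in> diffuse_sofic \<omega> G \<and> \<Theta>' \<in> diffuse_sofic \<omega> G \<and> represents \<omega> G \<Theta> \<theta> \<and> represents \<omega> G \<Theta>' \<theta>' \<and>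
      conj_seq \<omega> (carrier G) \<theta> \<theta>'" if "(\<Theta>, \<Theta>') \<in> conj_rel \<omega> G" for \<Theta> \<Theta>'
  proof -
    have d: "\<Theta> \<in> diffuse_sofic \<omega> G" "\<Theta>' \<in> diffuse_sofic \<omega> G"
      using that by (auto simp: conj_rel_def)
    obtain \<theta> where \<theta>: "represents \<omega> G \<Theta> \<theta>" using d(1) by (rule diffuse_sofic_represented)
    obtain \<theta>' where \<theta>': "represents \<omega> G \<Theta>' \<theta>'" using d(2) by (rule diffuse_sofic_represented)
    show ?thesis
      using d \<theta> \<theta>' conj_rel_iff[OF d(1) \<theta> d(2) \<theta>'] that by blast
  qed
  show "sym (conj_rel \<omega> G)"
  proof (rule symI)
    fix \<Theta> \<Theta>' assume "(\<Theta>, \<Theta>') \<in> conj_rel \<omega> G"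
    from rep[OF this] obtain \<theta> \<theta>' where d: "\<Theta> \<in> diffuse_sofic \<omega> G" "\<Theta>' \<in> diffuse_sofic \<omega> G"
      "represents \<omega> G \<Theta> \<theta>" "represents \<omega> G \<Theta>' \<theta>'" "conj_seq \<omega> (carrier G) \<theta> \<theta>'" by blast
    show "(\<Theta>', \<Theta>) \<in> conj_rel \<omega> G"
      by (rule iffD2[OF conj_rel_iff[OF d(2,4,1,3)] conj_seq_sym[OF d(5)]])
  qed
  show "trans (conj_rel \<omega> G)"
  proof (rule transI)
    fix \<Theta> \<Theta>' \<Theta>'' assume 1: "(\<Theta>, \<Theta>') \<in> conj_rel \<omega> G" and 2: "(\<Theta>', \<Theta>'') \<in> conj_rel \<omega> G"
    from rep[OF 1] obtain \<theta> \<theta>' where d: "\<Theta> \<in> diffuse_sofic \<omega> G" "\<Theta>' \<in> diffuse_sofic \<omega> G"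
      "represents \<omega> G \<Theta> \<theta>" "represents \<omega> G \<Theta>' \<theta>'" "conj_seq \<omega> (carrier G) \<theta> \<theta>'" by blast
    have d2: "\<Theta>'' \<in> diffuse_sofic \<omega> G" using 2 by (auto simp: conj_rel_def)
    obtain \<theta>'' where \<theta>'': "represents \<omega> G \<Theta>'' \<theta>''" using d2 by (rule diffuse_sofic_represented)
    have "conj_seq \<omega> (carrier G) \<theta>' \<theta>''"
      by (rule iffD1[OF conj_rel_iff[OF d(2,4) d2 \<theta>''] 2])
    from conj_seq_trans[OF d(5) this] show "(\<Theta>, \<Theta>'') \<in> conj_rel \<omega> G"
      by (rule iffD2[OF conj_rel_iff[OF d(1,3) d2 \<theta>'']])
  qed
qed

lemma sof_class_eq_iff:
  assumes "\<Theta> \<in> diffuse_sofic \<omega> G" "\<Theta>' \<in> diffuse_sofic \<omega> G"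
  shows "sof_class \<omega> G \<Theta> = sof_class \<omega> G \<Theta>' \<longleftrightarrow> (\<Theta>, \<Theta>') \<in> conj_rel \<omega> G"
  unfolding sof_class_def by (rule eq_equiv_class_iff[OF conj_rel_equiv assms])

lemma Sof_eq: "Sof \<omega> G = sof_class \<omega> G ` diffuse_sofic \<omega> G"
  by (auto simp: Sof_def quotient_def sof_class_def)

section \<open>Convex combinations\<close>

lemma sofic_seq_glue_rep:
  assumes c: "rational_cuts \<omega> c l" and 1: "sofic_seq \<omega> G \<theta>1" and 2: "sofic_seq \<omega> G \<theta>2"
  shows "sofic_seq \<omega> G (glue_rep c \<theta>1 \<theta>2)"
  unfolding sofic_seq_def
proof (intro conjI allI ballI impI)
  note c' = rational_cutsD[OF c]
  have fg: "\<theta>1 g k \<in> full_group" "\<theta>2 g k \<in> full_group" for g k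
    using 1 2 by (simp_all add: sofic_seq_def)
  show "glue (c k) (\<theta>1 g k) (\<theta>2 g k) \<in> full_group" for g k
    by (rule glue_full_group[OF c'(3-5) fg])
  fix g assume g: "g \<in> carrier G"
  {
    fix h assume h: "h \<in> carrier G"
    have m: "alm \<omega> (\<lambda>k x. \<theta>1 (g \<otimes>\<^bsub>G\<^esub> h) k x = \<theta>1 g k (\<theta>1 h k x))"
      "alm \<omega> (\<lambda>k x. \<theta>2 (g \<otimes>\<^bsub>G\<^esub> h) k x = \<theta>2 g k (\<theta>2 h k x))"
      using 1 2 g h by (simp_all add: sofic_seq_def)
    show "alm \<omega> (\<lambda>k x. glue (c k) (\<theta>1 (g \<otimes>\<^bsub>G\<^esub> h) k) (\<theta>2 (g \<otimes>\<^bsub>G\<^esub> h) k) x =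
        glue (c k) (\<theta>1 g k) (\<theta>2 g k) (glue (c k) (\<theta>1 h k) (\<theta>2 h k) x))"
      unfolding glue_comp[OF c'(3,4) fg] by (rule alm_glueI[where c = c, OF c'(3,4) m])
  }
  assume "g \<noteq> \<one>\<^bsub>G\<^esub>"
  then have free: "alm \<omega> (\<lambda>k x. \<theta>1 g k x \<noteq> x)" "alm \<omega> (\<lambda>k x. \<theta>2 g k x \<noteq> x)"
    using 1 2 g by (simp_all add: sofic_seq_def)
  have nn: "0 \<le> c k" "0 \<le> 1 - c k" "0 < 1 - c k" "0 + c k \<le> 1" "c k + (1 - c k) \<le> 1" for k
    using c'(3,4)[of k] by auto
  have low: "alm \<omega> (\<lambda>k x. x \<in> {0..<0 + c k} \<longrightarrow> \<theta>1 g k ((x - 0) / c k) \<noteq> (x - 0) / c k)"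
    by (rule alm_unzoom[where c = c and a = "\<lambda>_. 0", OF free(1) c'(3) order_refl nn(4)])
  have high: "alm \<omega> (\<lambda>k x. x \<in> {c k..<c k + (1 - c k)} \<longrightarrow> \<theta>2 g k ((x - c k) / (1 - c k)) \<noteq> (x - c k) / (1 - c k))"
    by (rule alm_unzoom[where c = "\<lambda>k. 1 - c k" and a = c, OF free(2) nn(3) nn(1) nn(5)])
  show "alm \<omega> (\<lambda>k x. glue (c k) (\<theta>1 g k) (\<theta>2 g k) x \<noteq> x)"
  proof (rule alm_mono3[OF alm_unit low high])
    fix k x assume x: "x \<in> {0..<1::real}"
      and lo: "x \<in> {0..<0 + c k} \<longrightarrow> \<theta>1 g k ((x - 0) / c k) \<noteq> (x - 0) / c k"
      and hi: "x \<in> {c k..<c k + (1 - c k)} \<longrightarrow> \<theta>2 g k ((x - c k) / (1 - c k)) \<noteq> (x - c k) / (1 - c k)"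
    show "glue (c k) (\<theta>1 g k) (\<theta>2 g k) x \<noteq> x"
    proof (cases "x < c k")
      case True
      then have "\<theta>1 g k (x / c k) \<noteq> x / c k" using x lo by simp
      then show ?thesis
        using True x c'(3)[of k] by (simp add: glue_def field_simps)
    next
      case False
      then have "\<theta>2 g k ((x - c k) / (1 - c k)) \<noteq> (x - c k) / (1 - c k)" using x hi by simp
      moreover have "c k + (1 - c k) * y = x \<longleftrightarrow> y = (x - c k) / (1 - c k)" for y
        using nn(3)[of k] by (auto simp: field_simps)
      ultimately show ?thesis
        using False x by (simp add: glue_def)
    qed
  qed
qed

definition weight_cut :: "(real \<Rightarrow> nat \<Rightarrow> nat) \<Rightarrow> (real \<Rightarrow> nat \<Rightarrow> nat) \<Rightarrow> real \<Rightarrow> nat \<Rightarrow> real" where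
  "weight_cut r s l k = real (r l k) / real (r l k + s l k)"

lemma rational_cuts_weight_cut:
  assumes w: "weight_seqs \<omega> r s" and l: "0 < l" "l < 1"
  shows "rational_cuts \<omega> (weight_cut r s l) l"
proof -
  have "0 < r l k" "0 < s l k" for k
    using w l by (auto simp: weight_seqs_def)
  then have "0 < weight_cut r s l k" "weight_cut r s l k < 1" "weight_cut r s l k \<in> \<rat>" for k
    by (simp_all add: weight_cut_def add_pos_pos)
  moreover have "(weight_cut r s l \<longlongrightarrow> l) \<omega>"
    using w l unfolding weight_seqs_def weight_cut_def[abs_def] by simp
  ultimately show ?thesis
    using l by (simp add: rational_cuts_def)
qed

lemma represents_Phi:
  assumes \<omega>: "free_ultrafilter \<omega>" and w: "weight_seqs \<omega> r s" and l: "0 < l" "l < 1"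
    and 1: "represents \<omega> G \<Theta>1 \<theta>1" and 2: "represents \<omega> G \<Theta>2 \<theta>2"
  shows "represents \<omega> G (\<lambda>g. Phi \<omega> r s l (\<Theta>1 g) (\<Theta>2 g)) (glue_rep (weight_cut r s l) \<theta>1 \<theta>2)"
  unfolding represents_def
proof (intro conjI allI ballI)
  note c' = rational_cutsD[OF rational_cuts_weight_cut[OF w l]]
  show "glue (weight_cut r s l k) (\<theta>1 g k) (\<theta>2 g k) \<in> full_group" for g k
    by (rule glue_full_group[OF c'(3-5) representsD(1)[OF 1] representsD(1)[OF 2]])
  have rs: "0 < r l k" "0 < s l k" for k
    using w l by (auto simp: weight_seqs_def)
  fix g assume g: "g \<in> carrier G"
  show "Phi \<omega> r s l (\<Theta>1 g) (\<Theta>2 g) = kclass \<omega> (\<lambda>k. glue (weight_cut r s l k) (\<theta>1 g k) (\<theta>2 g k))"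
    unfolding representsD(2)[OF 1 g] representsD(2)[OF 2 g] weight_cut_def
    by (rule Phi_kclass[where r = r and s = s and l = l and T = "\<theta>1 g" and S = "\<theta>2 g", OF \<omega> rs representsD(1)[OF 1] representsD(1)[OF 2]])
qed

text \<open>The union over all representatives of the two classes is a single class, because conjugating
  elements of the summands can be glued.\<close>

lemma convex_comb_sof_class:
  assumes \<omega>: "free_ultrafilter \<omega>" and w: "weight_seqs \<omega> r s" and G: "group G" and l: "0 < l" "l < 1"
    and \<Theta>1: "\<Theta>1 \<in> diffuse_sofic \<omega> G" and \<Theta>2: "\<Theta>2 \<in> diffuse_sofic \<omega> G"
  shows "(\<lambda>g. Phi \<omega> r s l (\<Theta>1 g) (\<Theta>2 g)) \<in> diffuse_sofic \<omega> G"
    "convex_comb \<omega> G r s l (sof_class \<omega> G \<Theta>1) (sof_class \<omega> G \<Theta>2) =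
      sof_class \<omega> G (\<lambda>g. Phi \<omega> r s l (\<Theta>1 g) (\<Theta>2 g))"
proof -
  note c = rational_cuts_weight_cut[OF w l]
  let ?\<Phi> = "\<lambda>\<Theta>1 \<Theta>2 g. Phi \<omega> r s l (\<Theta>1 g) (\<Theta>2 g)"
  obtain \<theta>1 where 1: "represents \<omega> G \<Theta>1 \<theta>1" using \<Theta>1 by (rule diffuse_sofic_represented)
  obtain \<theta>2 where 2: "represents \<omega> G \<Theta>2 \<theta>2" using \<Theta>2 by (rule diffuse_sofic_represented)
  have diffuse: "?\<Phi> \<Xi>1 \<Xi>2 \<in> diffuse_sofic \<omega> G"
    if \<Xi>: "\<Xi>1 \<in> diffuse_sofic \<omega> G" "\<Xi>2 \<in> diffuse_sofic \<omega> G" and rep: "represents \<omega> G \<Xi>1 \<xi>1" "represents \<omega> G \<Xi>2 \<xi>2"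
    for \<Xi>1 \<Xi>2 \<xi>1 \<xi>2
    by (rule iffD2[OF diffuse_sofic_iff[OF \<omega> G represents_Phi[OF \<omega> w l rep]]
          sofic_seq_glue_rep[OF c iffD1[OF diffuse_sofic_iff[OF \<omega> G rep(1)] \<Xi>(1)]
            iffD1[OF diffuse_sofic_iff[OF \<omega> G rep(2)] \<Xi>(2)]]])
  note d = diffuse[OF \<Theta>1 \<Theta>2 1 2]
  show "?\<Phi> \<Theta>1 \<Theta>2 \<in> diffuse_sofic \<omega> G" by (rule d)
  have same: "sof_class \<omega> G (?\<Phi> \<Xi>1 \<Xi>2) = sof_class \<omega> G (?\<Phi> \<Theta>1 \<Theta>2)"
    if \<Xi>: "\<Xi>1 \<in> sof_class \<omega> G \<Theta>1" "\<Xi>2 \<in> sof_class \<omega> G \<Theta>2" for \<Xi>1 \<Xi>2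
  proof -
    have rel: "(\<Theta>1, \<Xi>1) \<in> conj_rel \<omega> G" "(\<Theta>2, \<Xi>2) \<in> conj_rel \<omega> G"
      using \<Xi> by (simp_all add: sof_class_def)
    then have \<Xi>d: "\<Xi>1 \<in> diffuse_sofic \<omega> G" "\<Xi>2 \<in> diffuse_sofic \<omega> G"
      by (simp_all add: conj_rel_def)
    obtain \<xi>1 where x1: "represents \<omega> G \<Xi>1 \<xi>1" using \<Xi>d(1) by (rule diffuse_sofic_represented)
    obtain \<xi>2 where x2: "represents \<omega> G \<Xi>2 \<xi>2" using \<Xi>d(2) by (rule diffuse_sofic_represented)
    from rel(1) have "conj_seq \<omega> (carrier G) \<theta>1 \<xi>1" unfolding conj_rel_iff[OF \<Theta>1 1 \<Xi>d(1) x1] .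
    then obtain U1 where U1: "intertwines \<omega> (carrier G) U1 \<theta>1 \<xi>1"
      unfolding conj_seq_def by (elim exE) (rule that)
    from rel(2) have "conj_seq \<omega> (carrier G) \<theta>2 \<xi>2" unfolding conj_rel_iff[OF \<Theta>2 2 \<Xi>d(2) x2] .
    then obtain U2 where U2: "intertwines \<omega> (carrier G) U2 \<theta>2 \<xi>2"
      unfolding conj_seq_def by (elim exE) (rule that)
    from intertwines_glue[OF c U1 U2 representsD(1)[OF 1] representsD(1)[OF 2]]
    have "conj_seq \<omega> (carrier G) (glue_rep (weight_cut r s l) \<theta>1 \<theta>2) (glue_rep (weight_cut r s l) \<xi>1 \<xi>2)"
      by (rule conj_seqI)
    then have "(?\<Phi> \<Theta>1 \<Theta>2, ?\<Phi> \<Xi>1 \<Xi>2) \<in> conj_rel \<omega> G"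
      by (rule iffD2[OF conj_rel_iff[OF d represents_Phi[OF \<omega> w l 1 2] diffuse[OF \<Xi>d x1 x2] represents_Phi[OF \<omega> w l x1 x2]]])
    then show ?thesis
      by (rule iffD2[OF sof_class_eq_iff[OF d diffuse[OF \<Xi>d x1 x2]], symmetric])
  qed
  have self: "\<Xi> \<in> sof_class \<omega> G \<Xi>" if "\<Xi> \<in> diffuse_sofic \<omega> G" for \<Xi>
    unfolding sof_class_def by (rule equiv_class_self[OF conj_rel_equiv that])
  have "convex_comb \<omega> G r s l (sof_class \<omega> G \<Theta>1) (sof_class \<omega> G \<Theta>2) =
      (\<Union>\<Xi>1\<in>sof_class \<omega> G \<Theta>1. \<Union>\<Xi>2\<in>sof_class \<omega> G \<Theta>2. sof_class \<omega> G (?\<Phi> \<Theta>1 \<Theta>2))"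
    unfolding convex_comb_def by (intro SUP_cong refl same)
  also have "\<dots> = sof_class \<omega> G (?\<Phi> \<Theta>1 \<Theta>2)"
    using self[OF \<Theta>1] self[OF \<Theta>2] by auto
  finally show "convex_comb \<omega> G r s l (sof_class \<omega> G \<Theta>1) (sof_class \<omega> G \<Theta>2) = sof_class \<omega> G (?\<Phi> \<Theta>1 \<Theta>2)" .
qed

lemma extreme_pt_iff:
  assumes \<omega>: "free_ultrafilter \<omega>" and w: "weight_seqs \<omega> r s" and G: "group G"
    and \<Theta>: "\<Theta> \<in> diffuse_sofic \<omega> G" and rep: "represents \<omega> G \<Theta> \<theta>"
  shows "extreme_pt \<omega> G r s (sof_class \<omega> G \<Theta>) \<longleftrightarrow>
    (\<forall>l \<theta>1 \<theta>2. 0 < l \<longrightarrow> l < 1 \<longrightarrow> sofic_seq \<omega> G \<theta>1 \<longrightarrow> sofic_seq \<omega> G \<theta>2 \<longrightarrow>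
      conj_seq \<omega> (carrier G) \<theta> (glue_rep (weight_cut r s l) \<theta>1 \<theta>2) \<longrightarrow>
      conj_seq \<omega> (carrier G) \<theta> \<theta>1 \<and> conj_seq \<omega> (carrier G) \<theta> \<theta>2)"
proof -
  have class_iff: "sof_class \<omega> G \<Theta> = sof_class \<omega> G \<Xi> \<longleftrightarrow> conj_seq \<omega> (carrier G) \<theta> \<xi>"
    if \<Xi>: "\<Xi> \<in> diffuse_sofic \<omega> G" "represents \<omega> G \<Xi> \<xi>" for \<Xi> \<xi>
    unfolding sof_class_eq_iff[OF \<Theta> \<Xi>(1)] by (rule conj_rel_iff[OF \<Theta> rep \<Xi>])
  have comb_iff: "sof_class \<omega> G \<Theta> = convex_comb \<omega> G r s l (sof_class \<omega> G \<Theta>1) (sof_class \<omega> G \<Theta>2) \<longleftrightarrow>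
      conj_seq \<omega> (carrier G) \<theta> (glue_rep (weight_cut r s l) \<theta>1 \<theta>2)"
    if l: "0 < l" "l < 1" and 1: "\<Theta>1 \<in> diffuse_sofic \<omega> G" "represents \<omega> G \<Theta>1 \<theta>1"
      and 2: "\<Theta>2 \<in> diffuse_sofic \<omega> G" "represents \<omega> G \<Theta>2 \<theta>2" for l \<Theta>1 \<Theta>2 \<theta>1 \<theta>2
    unfolding convex_comb_sof_class(2)[OF \<omega> w G l 1(1) 2(1)]
    by (rule class_iff[OF convex_comb_sof_class(1)[OF \<omega> w G l 1(1) 2(1)] represents_Phi[OF \<omega> w l 1(2) 2(2)]])
  show ?thesis
  proof
    assume ext: "extreme_pt \<omega> G r s (sof_class \<omega> G \<Theta>)"
    show "\<forall>l \<theta>1 \<theta>2. 0 < l \<longrightarrow> l < 1 \<longrightarrow> sofic_seq \<omega> G \<theta>1 \<longrightarrow> sofic_seq \<omega> G \<theta>2 \<longrightarrow>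
      conj_seq \<omega> (carrier G) \<theta> (glue_rep (weight_cut r s l) \<theta>1 \<theta>2) \<longrightarrow>
      conj_seq \<omega> (carrier G) \<theta> \<theta>1 \<and> conj_seq \<omega> (carrier G) \<theta> \<theta>2"
    proof (intro allI impI)
      fix l \<theta>1 \<theta>2
      assume l: "0 < l" "l < 1" and s: "sofic_seq \<omega> G \<theta>1" "sofic_seq \<omega> G \<theta>2"
        and conj: "conj_seq \<omega> (carrier G) \<theta> (glue_rep (weight_cut r s l) \<theta>1 \<theta>2)"
      let ?\<Theta>1 = "\<lambda>g. kclass \<omega> (\<theta>1 g)" and ?\<Theta>2 = "\<lambda>g. kclass \<omega> (\<theta>2 g)"
      have fg: "\<theta>1 g k \<in> full_group" "\<theta>2 g k \<in> full_group" for g k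
        using s by (simp_all add: sofic_seq_def)
      have r1: "represents \<omega> G ?\<Theta>1 \<theta>1" and r2: "represents \<omega> G ?\<Theta>2 \<theta>2"
        by (rule represents_kclass[where \<theta> = \<theta>1, OF fg(1)], rule represents_kclass[where \<theta> = \<theta>2, OF fg(2)])
      have d1: "?\<Theta>1 \<in> diffuse_sofic \<omega> G" and d2: "?\<Theta>2 \<in> diffuse_sofic \<omega> G"
        by (rule iffD2[OF diffuse_sofic_iff[OF \<omega> G r1] s(1)], rule iffD2[OF diffuse_sofic_iff[OF \<omega> G r2] s(2)])
      have comb: "sof_class \<omega> G \<Theta> = convex_comb \<omega> G r s l (sof_class \<omega> G ?\<Theta>1) (sof_class \<omega> G ?\<Theta>2)"
        by (rule iffD2[OF comb_iff[OF l d1 r1 d2 r2] conj])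
      have "sof_class \<omega> G ?\<Theta>1 \<in> Sof \<omega> G" "sof_class \<omega> G ?\<Theta>2 \<in> Sof \<omega> G"
        unfolding Sof_eq using d1 d2 by simp_all
      moreover have "l \<in> {0<..<1}" using l by simp
      ultimately have "sof_class \<omega> G ?\<Theta>1 = sof_class \<omega> G \<Theta> \<and> sof_class \<omega> G ?\<Theta>2 = sof_class \<omega> G \<Theta>"
        using ext comb unfolding extreme_pt_def by blast
      then show "conj_seq \<omega> (carrier G) \<theta> \<theta>1 \<and> conj_seq \<omega> (carrier G) \<theta> \<theta>2"
        using class_iff[OF d1 r1] class_iff[OF d2 r2] by simp
    qed
  next
    assume *: "\<forall>l \<theta>1 \<theta>2. 0 < l \<longrightarrow> l < 1 \<longrightarrow> sofic_seq \<omega> G \<theta>1 \<longrightarrow> sofic_seq \<omega> G \<theta>2 \<longrightarrow>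
      conj_seq \<omega> (carrier G) \<theta> (glue_rep (weight_cut r s l) \<theta>1 \<theta>2) \<longrightarrow>
      conj_seq \<omega> (carrier G) \<theta> \<theta>1 \<and> conj_seq \<omega> (carrier G) \<theta> \<theta>2"
    show "extreme_pt \<omega> G r s (sof_class \<omega> G \<Theta>)"
      unfolding extreme_pt_def
    proof (intro conjI ballI impI)
      show "sof_class \<omega> G \<Theta> \<in> Sof \<omega> G"
        unfolding Sof_eq using \<Theta> by simp
      fix l C1 C2
      assume "l \<in> {0<..<1::real}" and C: "C1 \<in> Sof \<omega> G" "C2 \<in> Sof \<omega> G"
        and comb: "sof_class \<omega> G \<Theta> = convex_comb \<omega> G r s l C1 C2"
      then have l: "0 < l" "l < 1" by simp_all
      obtain \<Theta>1 where 1: "\<Theta>1 \<in> diffuse_sofic \<omega> G" "C1 = sof_class \<omega> G \<Theta>1"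
        using C(1) unfolding Sof_eq by blast
      obtain \<Theta>2 where 2: "\<Theta>2 \<in> diffuse_sofic \<omega> G" "C2 = sof_class \<omega> G \<Theta>2"
        using C(2) unfolding Sof_eq by blast
      obtain \<theta>1 where r1: "represents \<omega> G \<Theta>1 \<theta>1" using 1(1) by (rule diffuse_sofic_represented)
      obtain \<theta>2 where r2: "represents \<omega> G \<Theta>2 \<theta>2" using 2(1) by (rule diffuse_sofic_represented)
      have "conj_seq \<omega> (carrier G) \<theta> (glue_rep (weight_cut r s l) \<theta>1 \<theta>2)"
        by (rule iffD1[OF comb_iff[OF l 1(1) r1 2(1) r2] comb[unfolded 1(2) 2(2)]])
      from *[rule_format, OF l iffD1[OF diffuse_sofic_iff[OF \<omega> G r1] 1(1)] iffD1[OF diffuse_sofic_iff[OF \<omega> G r2] 2(1)] this]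
      have "sof_class \<omega> G \<Theta> = sof_class \<omega> G \<Theta>1" "sof_class \<omega> G \<Theta> = sof_class \<omega> G \<Theta>2"
        unfolding class_iff[OF 1(1) r1] class_iff[OF 2(1) r2] by simp_all
      then show "C1 = sof_class \<omega> G \<Theta>" "C2 = sof_class \<omega> G \<Theta>"
        unfolding 1(2) 2(2) by simp_all
    qed
  qed
qed

section \<open>Ergodicity of the commutant action\<close>

lemma dclass_kclass_commute_iff:
  assumes a: "diag_seq a" and T: "\<And>k. T k \<in> full_group"
  shows "dclass \<omega> a \<otimes>\<^bsub>MEu \<omega>\<^esub> kclass \<omega> T = kclass \<omega> T \<otimes>\<^bsub>MEu \<omega>\<^esub> dclass \<omega> a \<longleftrightarrow>
    (\<forall>e>0. alm \<omega> (\<lambda>k x. cmod (a k (T k x) - a k x) < e))"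
proof -
  note one = monomial_seq_one[where T = T, OF T]
  note Ti = full_group_inv[OF T]
  have id: "finv (\<lambda>x. x) x = x" for x
    by (rule full_group_inv_apply(1)[OF full_group_id(2)])
  have 1: "dclass \<omega> a \<otimes>\<^bsub>MEu \<omega>\<^esub> kclass \<omega> T = mclass \<omega> (\<lambda>k x. a k x * 1) T"
    unfolding kclass_def by (rule mclass_mult[OF a one])
  have 2: "kclass \<omega> T \<otimes>\<^bsub>MEu \<omega>\<^esub> dclass \<omega> a = mclass \<omega> (\<lambda>k x. 1 * a k (finv (T k) x)) T"
    unfolding kclass_def by (rule mclass_mult[OF one a])
  have m1: "monomial_seq (\<lambda>k x. a k x * 1) T"
    using monomial_seq_mult[OF a one] by simp
  have m2: "monomial_seq (\<lambda>k x. 1 * a k (finv (T k) x)) T"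
    using monomial_seq_mult[OF one a] by simp
  have "dclass \<omega> a \<otimes>\<^bsub>MEu \<omega>\<^esub> kclass \<omega> T = kclass \<omega> T \<otimes>\<^bsub>MEu \<omega>\<^esub> dclass \<omega> a \<longleftrightarrow>
      (\<forall>e>0. alm \<omega> (\<lambda>k x. cmod (a k x * 1 - 1 * a k (finv (T k) x)) < e))"
    unfolding 1 2 by (rule mclass_eq_iff[OF m1 m2])
  also have "\<dots> \<longleftrightarrow> (\<forall>e>0. alm \<omega> (\<lambda>k x. cmod (a k (T k x) - a k x) < e))"
  proof (intro iffI allI impI)
    fix e :: real
    assume *: "\<forall>e>0. alm \<omega> (\<lambda>k x. cmod (a k x * 1 - 1 * a k (finv (T k) x)) < e)" and e: "0 < e"
    from alm_vimage[where T = T, OF *[rule_format, OF e] T]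
    show "alm \<omega> (\<lambda>k x. cmod (a k (T k x) - a k x) < e)"
      by (rule alm_mono) (simp add: T)
  next
    fix e :: real
    assume *: "\<forall>e>0. alm \<omega> (\<lambda>k x. cmod (a k (T k x) - a k x) < e)" and e: "0 < e"
    from alm_vimage[where T = "\<lambda>k. finv (T k)", OF *[rule_format, OF e] Ti]
    show "alm \<omega> (\<lambda>k x. cmod (a k x * 1 - 1 * a k (finv (T k) x)) < e)"
      by (rule alm_mono) (simp add: T)
  qed
  finally show ?thesis .
qed

text \<open>An element is fixed by conjugation with a unitary exactly if it commutes with it.\<close>

lemma ad_dclass_eq_iff:
  assumes a: "diag_seq a" and U: "\<And>k. U k \<in> full_group"
  shows "ad \<omega> (kclass \<omega> U) (dclass \<omega> a) = dclass \<omega> a \<longleftrightarrow>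
    (\<forall>e>0. alm \<omega> (\<lambda>k x. cmod (a k (U k x) - a k x) < e))"
proof -
  note one = monomial_seq_one[where T = U, OF U]
  note Ui = full_group_inv[OF U]
  note onei = monomial_seq_one[where T = "\<lambda>k. finv (U k)", OF Ui]
  have m: "monomial_seq (\<lambda>k x. 1 * a k (finv (U k) x)) U"
    using monomial_seq_mult[OF one a] by simp
  have fold: "(\<lambda>k x. U k (finv (U k) x)) = (\<lambda>k x. x)"
    by (intro ext) (simp add: U)
  let ?b = "\<lambda>k x. 1 * a k (finv (U k) x) * 1"
  have "ad \<omega> (kclass \<omega> U) (dclass \<omega> a) = mclass \<omega> ?b (\<lambda>k x. U k (finv (U k) x))"
    unfolding ad_def kclass_star[where T = U, OF U] unfolding kclass_def mclass_mult[OF one a]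
    by (rule mclass_mult[OF m onei])
  then have ad: "ad \<omega> (kclass \<omega> U) (dclass \<omega> a) = dclass \<omega> ?b"
    unfolding fold .
  have b: "diag_seq ?b"
    using monomial_seq_mult[OF m onei] unfolding fold .
  have "ad \<omega> (kclass \<omega> U) (dclass \<omega> a) = dclass \<omega> a \<longleftrightarrow> (\<forall>e>0. alm \<omega> (\<lambda>k x. cmod (?b k x - a k x) < e))"
    unfolding ad by (rule mclass_eq_iff[OF b a])
  also have "\<dots> \<longleftrightarrow> (\<forall>e>0. alm \<omega> (\<lambda>k x. cmod (a k (U k x) - a k x) < e))"
  proof (intro iffI allI impI)
    fix e :: real
    assume *: "\<forall>e>0. alm \<omega> (\<lambda>k x. cmod (?b k x - a k x) < e)" and e: "0 < e"
    from alm_vimage[where T = U, OF *[rule_format, OF e] U]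
    show "alm \<omega> (\<lambda>k x. cmod (a k (U k x) - a k x) < e)"
      by (rule alm_mono) (simp add: U norm_minus_commute)
  next
    fix e :: real
    assume *: "\<forall>e>0. alm \<omega> (\<lambda>k x. cmod (a k (U k x) - a k x) < e)" and e: "0 < e"
    from alm_vimage[where T = "\<lambda>k. finv (U k)", OF *[rule_format, OF e] Ui]
    show "alm \<omega> (\<lambda>k x. cmod (?b k x - a k x) < e)"
      by (rule alm_mono) (simp add: U norm_minus_commute)
  qed
  finally show ?thesis .
qed

lemma gamma_ergodic_iff:
  assumes rep: "represents \<omega> G \<Theta> \<theta>"
  shows "gamma_ergodic \<omega> G \<Theta> \<longleftrightarrow> ergodic_seq \<omega> (carrier G) \<theta>"
proof -
  note fg = representsD(1)[OF rep] and \<Theta> = representsD(2)[OF rep]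
  have commute: "kclass \<omega> U \<otimes>\<^bsub>MEu \<omega>\<^esub> \<Theta> g = \<Theta> g \<otimes>\<^bsub>MEu \<omega>\<^esub> kclass \<omega> U \<longleftrightarrow>
      alm \<omega> (\<lambda>k x. U k (\<theta> g k x) = \<theta> g k (U k x))"
    if g: "g \<in> carrier G" and U: "\<And>k. U k \<in> full_group" for g U
    unfolding \<Theta>[OF g] kclass_mult[where T = U and S = "\<theta> g", OF U fg] kclass_mult[where T = "\<theta> g" and S = U, OF fg U]
    by (rule kclass_eq_iff[where T = "\<lambda>k x. U k (\<theta> g k x)" and S = "\<lambda>k x. \<theta> g k (U k x)",
        OF full_group_comp[OF U fg] full_group_comp[OF fg U]])
  have comm_E: "kclass \<omega> U \<in> commutant_in \<omega> G \<Theta> (carrier (Eu \<omega>)) \<longleftrightarrow> intertwines \<omega> (carrier G) U \<theta> \<theta>"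
    if U: "\<And>k. U k \<in> full_group" for U
  proof -
    have "kclass \<omega> U \<in> carrier (Eu \<omega>)"
      by (rule kclass_Eu[where T = U, OF U])
    then show ?thesis
      using U commute[where U = U, OF _ U] by (simp add: commutant_in_def intertwines_def)
  qed
  have comm_A: "dclass \<omega> a \<in> commutant_in \<omega> G \<Theta> (Au \<omega>) \<longleftrightarrow>
      (\<forall>g\<in>carrier G. \<forall>e>0. alm \<omega> (\<lambda>k x. cmod (a k (\<theta> g k x) - a k x) < e))"
    if a: "diag_seq a" for a
  proof -
    have "dclass \<omega> a \<in> Au \<omega>"
      unfolding Au_eq by (intro CollectI exI[of _ a] conjI refl a)
    moreover have "dclass \<omega> a \<otimes>\<^bsub>MEu \<omega>\<^esub> \<Theta> g = \<Theta> g \<otimes>\<^bsub>MEu \<omega>\<^esub> dclass \<omega> a \<longleftrightarrow>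
        (\<forall>e>0. alm \<omega> (\<lambda>k x. cmod (a k (\<theta> g k x) - a k x) < e))" if g: "g \<in> carrier G" for g
      unfolding \<Theta>[OF g] by (rule dclass_kclass_commute_iff[where T = "\<theta> g", OF a fg])
    ultimately show ?thesis
      by (simp add: commutant_in_def)
  qed
  have scalar: "dclass \<omega> a = uscalar \<omega> c \<longleftrightarrow> (\<forall>e>0. alm \<omega> (\<lambda>k x. cmod (a k x - c) < e))"
    if a: "diag_seq a" for a c
  proof -
    have c: "diag_seq (\<lambda>k x. c)"
      by (auto simp: diag_seq_iff)
    show ?thesis
      unfolding uscalar_eq by (rule mclass_eq_iff[OF a c])
  qed
  show ?thesis
  proof
    assume erg: "gamma_ergodic \<omega> G \<Theta>"
    show "ergodic_seq \<omega> (carrier G) \<theta>"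
      unfolding ergodic_seq_def
    proof (intro allI impI)
      fix a :: "nat \<Rightarrow> real \<Rightarrow> complex"
      assume a: "\<forall>k. a k \<in> borel_measurable borel" "\<exists>B. \<forall>k x. cmod (a k x) \<le> B"
        and comm: "\<forall>g\<in>carrier G. \<forall>e>0. alm \<omega> (\<lambda>k x. cmod (a k (\<theta> g k x) - a k x) < e)"
        and inv_U: "\<forall>U. intertwines \<omega> (carrier G) U \<theta> \<theta> \<longrightarrow> (\<forall>e>0. alm \<omega> (\<lambda>k x. cmod (a k (U k x) - a k x) < e))"
      have ds: "diag_seq a"
        unfolding diag_seq_iff by (rule conjI[OF a])
      have mem: "dclass \<omega> a \<in> commutant_in \<omega> G \<Theta> (Au \<omega>)"
        by (rule iffD2[OF comm_A[OF ds] comm])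
      have fixed: "ad \<omega> u (dclass \<omega> a) = dclass \<omega> a" if u: "u \<in> commutant_in \<omega> G \<Theta> (carrier (Eu \<omega>))" for u
      proof -
        have "u \<in> carrier (Eu \<omega>)"
          using u by (simp add: commutant_in_def)
        from carrier_EuD[OF this] obtain U where U: "\<And>k. U k \<in> full_group" "u = kclass \<omega> U"
          by (elim exE conjE) (rule that, erule spec)
        have tw: "intertwines \<omega> (carrier G) U \<theta> \<theta>"
          by (rule iffD1[OF comm_E[where U = U, OF U(1)] u[unfolded U(2)]])
        show ?thesis
          unfolding U(2)
          by (rule iffD2[OF ad_dclass_eq_iff[where U = U, OF ds U(1)] inv_U[THEN spec, THEN mp, OF tw]])
      qed
      have "\<exists>c. dclass \<omega> a = uscalar \<omega> c"
        by (rule erg[unfolded gamma_ergodic_def ergodic_action_def, THEN bspec, THEN mp,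
            OF mem ballI[OF fixed]])
      then show "\<exists>c. \<forall>e>0. alm \<omega> (\<lambda>k x. cmod (a k x - c) < e)"
        unfolding scalar[OF ds] .
    qed
  next
    assume erg: "ergodic_seq \<omega> (carrier G) \<theta>"
    show "gamma_ergodic \<omega> G \<Theta>"
      unfolding gamma_ergodic_def ergodic_action_def
    proof (intro ballI impI)
      fix A assume A: "A \<in> commutant_in \<omega> G \<Theta> (Au \<omega>)"
        and fixed: "\<forall>u\<in>commutant_in \<omega> G \<Theta> (carrier (Eu \<omega>)). ad \<omega> u A = A"
      have "A \<in> Au \<omega>"
        using A by (simp add: commutant_in_def)
      then obtain a where a: "A = dclass \<omega> a" "diag_seq a"
        unfolding Au_eq by (elim CollectE exE conjE) (rule that)
      have bnd: "\<forall>k. a k \<in> borel_measurable borel" "\<exists>B. \<forall>k x. cmod (a k x) \<le> B"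
        by (rule conjunct1[OF a(2)[unfolded diag_seq_iff]], rule conjunct2[OF a(2)[unfolded diag_seq_iff]])
      have comm: "\<forall>g\<in>carrier G. \<forall>e>0. alm \<omega> (\<lambda>k x. cmod (a k (\<theta> g k x) - a k x) < e)"
        by (rule iffD1[OF comm_A[OF a(2)] A[unfolded a(1)]])
      have inv_U: "\<forall>U. intertwines \<omega> (carrier G) U \<theta> \<theta> \<longrightarrow> (\<forall>e>0. alm \<omega> (\<lambda>k x. cmod (a k (U k x) - a k x) < e))"
      proof (rule allI, rule impI)
        fix U assume U: "intertwines \<omega> (carrier G) U \<theta> \<theta>"
        note Ufg = intertwines_full_group[OF U]
        have "kclass \<omega> U \<in> commutant_in \<omega> G \<Theta> (carrier (Eu \<omega>))"
          by (rule iffD2[OF comm_E[where U = U, OF Ufg] U])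
        then have "ad \<omega> (kclass \<omega> U) (dclass \<omega> a) = dclass \<omega> a"
          by (rule fixed[unfolded a(1), rule_format])
        then show "\<forall>e>0. alm \<omega> (\<lambda>k x. cmod (a k (U k x) - a k x) < e)"
          unfolding ad_dclass_eq_iff[where U = U, OF a(2) Ufg] .
      qed
      from erg[unfolded ergodic_seq_def, THEN spec, THEN mp, THEN mp, THEN mp, THEN mp, OF bnd comm inv_U]
      show "\<exists>c. A = uscalar \<omega> c"
        unfolding a(1) scalar[OF a(2)] .
    qed
  qed
qed

section \<open>Extreme points and ergodicity\<close>

theorem theorem4p8:
  fixes \<omega> :: "nat filter"
    and r s :: "real \<Rightarrow> nat \<Rightarrow> nat"
    and G :: "('g, 'b) monoid_scheme"
    and \<Theta> :: "'g \<Rightarrow> uelem"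
  assumes "free_ultrafilter \<omega>"
    and "weight_seqs \<omega> r s"
    and "group G"
    and "countable (carrier G)"
    and "\<Theta> \<in> diffuse_sofic \<omega> G"
  shows "extreme_pt \<omega> G r s (sof_class \<omega> G \<Theta>) \<longleftrightarrow> gamma_ergodic \<omega> G \<Theta>"
proof -
  interpret group G by (rule assms(3))
  obtain \<theta> where rep: "represents \<omega> G \<Theta> \<theta>"
    using assms(5) by (rule diffuse_sofic_represented)
  note cuts = rational_cuts_weight_cut[OF assms(2)]
  have \<theta>: "sofic_seq \<omega> G \<theta>"
    by (rule iffD1[OF diffuse_sofic_iff[OF assms(1,3) rep] assms(5)])
  show ?thesis
    unfolding extreme_pt_iff[OF assms(1,2,3,5) rep] gamma_ergodic_iff[OF rep]
  proof
    assume ext: "\<forall>l \<theta>1 \<theta>2. 0 < l \<longrightarrow> l < 1 \<longrightarrow> sofic_seq \<omega> G \<theta>1 \<longrightarrow> sofic_seq \<omega> G \<theta>2 \<longrightarrow>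
      conj_seq \<omega> (carrier G) \<theta> (glue_rep (weight_cut r s l) \<theta>1 \<theta>2) \<longrightarrow>
      conj_seq \<omega> (carrier G) \<theta> \<theta>1 \<and> conj_seq \<omega> (carrier G) \<theta> \<theta>2"
    show "ergodic_seq \<omega> (carrier G) \<theta>"
      by (rule extreme_imp_ergodic_seq[where c = "weight_cut r s", OF assms(1,4) cuts m_closed \<theta> ext[rule_format]])
  next
    assume erg: "ergodic_seq \<omega> (carrier G) \<theta>"
    show "\<forall>l \<theta>1 \<theta>2. 0 < l \<longrightarrow> l < 1 \<longrightarrow> sofic_seq \<omega> G \<theta>1 \<longrightarrow> sofic_seq \<omega> G \<theta>2 \<longrightarrow>
      conj_seq \<omega> (carrier G) \<theta> (glue_rep (weight_cut r s l) \<theta>1 \<theta>2) \<longrightarrow>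
      conj_seq \<omega> (carrier G) \<theta> \<theta>1 \<and> conj_seq \<omega> (carrier G) \<theta> \<theta>2"
    proof (intro allI impI)
      fix l \<theta>1 \<theta>2
      assume l: "0 < l" "l < 1" and s: "sofic_seq \<omega> G \<theta>1" "sofic_seq \<omega> G \<theta>2"
        and conj: "conj_seq \<omega> (carrier G) \<theta> (glue_rep (weight_cut r s l) \<theta>1 \<theta>2)"
      have fg: "\<theta>1 g k \<in> full_group" "\<theta>2 g k \<in> full_group" for g k
        using s by (simp_all add: sofic_seq_def)
      have "carrier G \<noteq> {}"
        using one_closed by blast
      note summands = ergodic_imp_conj_summands[where \<theta> = \<theta> and ?\<theta>1.0 = \<theta>1 and ?\<theta>2.0 = \<theta>2,
          OF assms(1,4) this cuts[OF l] erg representsD(1)[OF rep] fg conj]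
      show "conj_seq \<omega> (carrier G) \<theta> \<theta>1 \<and> conj_seq \<omega> (carrier G) \<theta> \<theta>2"
        by (rule conjI[OF summands])
    qed
  qed
qed

end
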